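(* Let $K$ be an algebraically closed field of characteristic zero and let $a,b\ge 0$ be integers, not both zero. If $a$ and $b$ are even and $\mathrm{ind}\,\bar{\mathfrak q}(a,b)=\mathrm{ind}\,\bar{\mathfrak r}(a,b)=1$, then $\bar{\mathfrak q}(a,b)$ and $\bar{\mathfrak r}(a,b)$ are strongly quasi-reductive and hence contact.
   Context: The index of a finite-dimensional Lie algebra $\mathfrak h$ is $\mathrm{ind}\,\mathfrak h=\min_{\gamma\in\mathfrak h^*}\dim\mathfrak h_\gamma$, where $\mathfrak h_\gamma=\{\xi\in\mathfrak h\mid\gamma([\xi,\mathfrak h])=0\}$. $\mathfrak h$ is contact if $\dim\mathfrak h=2n+1$ is odd and there is $\alpha\in\mathfrak h^*$ with $(d_{\mathfrak h}\alpha)^{\wedge n}\wedge\alpha\neq 0$, where $d_{\mathfrak h}\alpha\in\wedge^2\mathfrak h^*$, $d_{\mathfrak h}\alpha(\xi,\eta)=-\alpha([\xi,\eta])$ (up to an irrelevant sign convention). For an affine algebraic group $H$, $\mathfrak h=\mathrm{Lie}\,H$ is strongly quasi-reductive (with respect to $H$) if there is $\beta\in\mathfrak h^*$ whose stabiliser $H_\beta$ for the coadjoint action is reductive; equivalently, if the centre $Z\subset H$ consists of semisimple elements and $H_\beta/Z$ is reductive for some $\beta\in\mathfrak h^*$. $\bar{\mathfrak q}(a,b)=\mathrm{Lie}\,\bar Q(a,b)$, where $\bar Q(a,b)=\mathrm S(\mathrm{GL}_a\times\mathrm{GL}_b)\ltimes\exp(\mathfrak n\oplus\mathfrak n)$;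 here $\mathrm S(\mathrm{GL}_a\times\mathrm{GL}_b)=(\mathrm{GL}_a\times\mathrm{GL}_b)\cap\mathrm{SL}_{a+b}$ is the block-diagonal Levi subgroup, $\mathfrak n\cong K^a\otimes(K^b)^*$ is the Abelian nilpotent radical of the corresponding maximal parabolic subalgebra of $\mathfrak{sl}_{a+b}$, and $\mathfrak n\oplus\mathfrak n$ (two copies) is an Abelian ideal. Equivalently (up to the twist of the $\mathrm{GL}_b$-action by an outer automorphism), $\bar{\mathfrak q}(a,b)$ is the quotient of $\mathfrak q(a,b)=(\mathfrak{gl}_a\oplus\mathfrak{gl}_b)\ltimes 2(K^a\otimes K^b)$ by its $1$-dimensional central toral subalgebra $K(I_a,-I_b)$. $\bar{\mathfrak r}(a,b)=\mathrm{Lie}\,\bar R(a,b)$, where $\bar R(a,b)$ is the quotient of $R(a,b)=(\mathrm{GL}_a\times\mathrm{GL}_b)\ltimes\exp((\mathfrak{gl}_a^{\mathsf{ab}}\oplus W)\oplus V)$ by its $1$-dimensional central torus $\{(cI_a,c^{-1}I_b)\mid c\in K^\times\}$. Here $\mathfrak{gl}_a^{\mathsf{ab}}$ is a copy of the vector space $\mathfrak{gl}_a$ on which $\mathrm{GL}_a$ acts via the adjoint representation and $\mathrm{GL}_b$ acts trivially; $W\cong V\cong K^a\otimes K^b$ with the natural action of $\mathrm{GL}_a\times\mathrm{GL}_b$; in the nilpotent ideal $(\mathfrak{gl}_a^{\mathsf{ab}}\oplus W)\oplus V$ one has $[\mathfrak{gl}_a^{\mathsf{ab}},\mathfrak{gl}_a^{\mathsf{ab}}]=[W,W]=0$,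 $V$ is central in this ideal, and $[A,w]=(A\otimes\mathrm{id})w\in V$ for $A\in\mathfrak{gl}_a^{\mathsf{ab}}$, $w\in W$ (identifying $W\cong V$). *)

theory Defs
  imports
    "HOL-Library.Function_Algebras"
    "HOL-Combinatorics.Permutations"
    "HOL-Algebra.Coset"
    "Jordan_Normal_Form.Determinant"
begin

section \<open>Lie algebras: index and contact forms\<close>

record ('k, 'v) lie_algebra =
  lie_carrier :: "'v set"
  lie_scale :: "'k \<Rightarrow> 'v \<Rightarrow> 'v"
  lie_bracket :: "'v \<Rightarrow> 'v \<Rightarrow> 'v"

abbreviation lie_dim :: "('k::field, 'v::ab_group_add) lie_algebra \<Rightarrow> 'v set \<Rightarrow> nat" where
  "lie_dim L \<equiv> vector_space.dim (lie_scale L)"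

text \<open>The dual space; the values of a linear form outside the carrier are irrelevant.\<close>

definition lie_dual :: "('k::field, 'v::ab_group_add) lie_algebra \<Rightarrow> ('v \<Rightarrow> 'k) set" where
  "lie_dual L = {\<gamma>.
     (\<forall>x \<in> lie_carrier L. \<forall>y \<in> lie_carrier L. \<gamma> (x + y) = \<gamma> x + \<gamma> y) \<and>
     (\<forall>c. \<forall>x \<in> lie_carrier L. \<gamma> (lie_scale L c x) = c * \<gamma> x)}"

definition lie_stabiliser ::
  "('k::field, 'v::ab_group_add) lie_algebra \<Rightarrow> ('v \<Rightarrow> 'k) \<Rightarrow> 'v set" where
  "lie_stabiliser L \<gamma> =
     {\<xi> \<in> lie_carrier L. \<forall>\<eta> \<in> lie_carrier L. \<gamma> (lie_bracket L \<xi> \<eta>) = 0}"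

definition lie_index :: "('k::field, 'v::ab_group_add) lie_algebra \<Rightarrow> nat" where
  "lie_index L = (INF \<gamma> \<in> lie_dual L. lie_dim L (lie_stabiliser L \<gamma>))"

text \<open>
  An exterior form of degree \<open>p\<close> is a function of sequences of vectors that only depends
  on the entries with index less than \<open>p\<close>.
\<close>

definition wedge ::
  "nat \<Rightarrow> nat \<Rightarrow> ((nat \<Rightarrow> 'v) \<Rightarrow> 'k::field_char_0) \<Rightarrow> ((nat \<Rightarrow> 'v) \<Rightarrow> 'k) \<Rightarrow> (nat \<Rightarrow> 'v) \<Rightarrow> 'k" where
  "wedge p q \<omega> \<eta> = (\<lambda>v.
     (\<Sum>\<sigma> | \<sigma> permutes {..<p + q}.
        of_int (sign \<sigma>) * \<omega> (\<lambda>i. v (\<sigma> i)) * \<eta> (\<lambda>i. v (\<sigma> (p + i))))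
     / (fact p * fact q))"

primrec wedge_power ::
  "nat \<Rightarrow> ((nat \<Rightarrow> 'v) \<Rightarrow> 'k::field_char_0) \<Rightarrow> nat \<Rightarrow> (nat \<Rightarrow> 'v) \<Rightarrow> 'k" where
  "wedge_power p \<omega> 0 = (\<lambda>v. 1)"
| "wedge_power p \<omega> (Suc n) = wedge p (p * n) \<omega> (wedge_power p \<omega> n)"

definition lie_d :: "('k::field, 'v::ab_group_add) lie_algebra \<Rightarrow> ('v \<Rightarrow> 'k) \<Rightarrow> (nat \<Rightarrow> 'v) \<Rightarrow> 'k" where
  "lie_d L \<alpha> = (\<lambda>v. - \<alpha> (lie_bracket L (v 0) (v 1)))"

definition contact :: "('k::field_char_0, 'v::ab_group_add) lie_algebra \<Rightarrow> bool" where
  "contact L \<longleftrightarrow> (\<exists>n. lie_dim L (lie_carrier L) = 2 * n + 1 \<and>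
     (\<exists>\<alpha> \<in> lie_dual L. \<exists>v. (\<forall>i. v i \<in> lie_carrier L) \<and>
        wedge (2 * n) 1 (wedge_power 2 (lie_d L \<alpha>) n) (\<lambda>u. \<alpha> (u 0)) v \<noteq> 0))"

section \<open>Affine algebraic groups\<close>

text \<open>
  An affine algebraic group over an algebraically closed field is represented by its group of
  points together with its coordinate ring, an algebra of functions on the points.
  By convention, regular functions are extended by zero outside the carrier.
\<close>

record ('g, 'k) alg_group = "'g monoid" +
  coord_ring :: "('g \<Rightarrow> 'k) set"

definition zero_outside :: "'g set \<Rightarrow> ('g \<Rightarrow> 'k::zero) \<Rightarrow> 'g \<Rightarrow> 'k" where
  "zero_outside S f = (\<lambda>x. if x \<in> S then f x else 0)"

inductive_set generated_algebra :: "'g set \<Rightarrow> ('g \<Rightarrow> 'k::field) set \<Rightarrow> ('g \<Rightarrow> 'k) set"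
  for S :: "'g set" and F :: "('g \<Rightarrow> 'k) set" where
  const: "zero_outside S (\<lambda>x. c) \<in> generated_algebra S F"
| gen: "f \<in> F \<Longrightarrow> zero_outside S f \<in> generated_algebra S F"
| add: "f \<in> generated_algebra S F \<Longrightarrow> g \<in> generated_algebra S F \<Longrightarrow> f + g \<in> generated_algebra S F"
| mult: "f \<in> generated_algebra S F \<Longrightarrow> g \<in> generated_algebra S F \<Longrightarrow> f * g \<in> generated_algebra S F"

text \<open>
  The structure induced on a closed subgroup, and the quotient by a closed normal subgroup:
  a function on the quotient is regular iff its pullback is, i.e. the coordinate ring of the
  quotient is the ring of invariants.
\<close>

definition alg_subgroup :: "('g, 'k::field) alg_group \<Rightarrow> 'g set \<Rightarrow> ('g, 'k) alg_group" where
  "alg_subgroup G S = G\<lparr>carrier := S, coord_ring := zero_outside S ` coord_ring G\<rparr>"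

definition alg_quotient :: "('g, 'k::field) alg_group \<Rightarrow> 'g set \<Rightarrow> ('g set, 'k) alg_group" where
  "alg_quotient G N =
     \<lparr>carrier = carrier (G Mod N), monoid.mult = monoid.mult (G Mod N), one = one (G Mod N),
      coord_ring = {f. (\<forall>C. C \<notin> carrier (G Mod N) \<longrightarrow> f C = 0) \<and>
        zero_outside (carrier G) (\<lambda>x. f (N #>\<^bsub>G\<^esub> x)) \<in> coord_ring G}\<rparr>"

text \<open>
  \<open>Lie G\<close> is the tangent space at the identity: point derivations of the coordinate ring,
  extended by zero. The bracket is the one of the left invariant vector fields
  \<open>f \<mapsto> (x \<mapsto> \<delta> (y \<mapsto> f (x y)))\<close>, evaluated at the identity.
\<close>

definition right_slice :: "('g, 'k::field) alg_group \<Rightarrow> ('g \<Rightarrow> 'k) \<Rightarrow> 'g \<Rightarrow> 'g \<Rightarrow> 'k" where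
  "right_slice G f x = zero_outside (carrier G) (\<lambda>y. f (x \<otimes>\<^bsub>G\<^esub> y))"

definition left_invariant_field ::
  "('g, 'k::field) alg_group \<Rightarrow> (('g \<Rightarrow> 'k) \<Rightarrow> 'k) \<Rightarrow> ('g \<Rightarrow> 'k) \<Rightarrow> 'g \<Rightarrow> 'k" where
  "left_invariant_field G \<delta> f = zero_outside (carrier G) (\<lambda>x. \<delta> (right_slice G f x))"

definition point_derivations :: "('g, 'k::field) alg_group \<Rightarrow> (('g \<Rightarrow> 'k) \<Rightarrow> 'k) set" where
  "point_derivations G = {\<delta>.
     (\<forall>f. f \<notin> coord_ring G \<longrightarrow> \<delta> f = 0) \<and>
     (\<forall>f \<in> coord_ring G. \<forall>g \<in> coord_ring G. \<delta> (f + g) = \<delta> f + \<delta> g) \<and>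
     (\<forall>c. \<forall>f \<in> coord_ring G. \<delta> (\<lambda>x. c * f x) = c * \<delta> f) \<and>
     (\<forall>f \<in> coord_ring G. \<forall>g \<in> coord_ring G.
        \<delta> (f * g) = f \<one>\<^bsub>G\<^esub> * \<delta> g + \<delta> f * g \<one>\<^bsub>G\<^esub>)}"

definition Lie :: "('g, 'k::field) alg_group \<Rightarrow> ('k, ('g \<Rightarrow> 'k) \<Rightarrow> 'k) lie_algebra" where
  "Lie G =
     \<lparr>lie_carrier = point_derivations G,
      lie_scale = (\<lambda>c \<delta> f. c * \<delta> f),
      lie_bracket = (\<lambda>\<delta> \<epsilon>. zero_outside (coord_ring G)
        (\<lambda>f. \<delta> (left_invariant_field G \<epsilon> f) - \<epsilon> (left_invariant_field G \<delta> f)))\<rparr>"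

definition Ad ::
  "('g, 'k::field) alg_group \<Rightarrow> 'g \<Rightarrow> (('g \<Rightarrow> 'k) \<Rightarrow> 'k) \<Rightarrow> ('g \<Rightarrow> 'k) \<Rightarrow> 'k" where
  "Ad G x \<delta> = zero_outside (coord_ring G)
     (\<lambda>f. \<delta> (zero_outside (carrier G) (\<lambda>y. f (x \<otimes>\<^bsub>G\<^esub> y \<otimes>\<^bsub>G\<^esub> inv\<^bsub>G\<^esub> x))))"

text \<open>
  The coadjoint action is \<open>(x \<cdot> \<beta>) (\<delta>) = \<beta> (Ad x\<inverse> \<delta>)\<close>; the stabiliser does not change
  when \<open>x\<inverse>\<close> is replaced by \<open>x\<close>.
\<close>

definition coadjoint_stabiliser ::
  "('g, 'k::field) alg_group \<Rightarrow> ((('g \<Rightarrow> 'k) \<Rightarrow> 'k) \<Rightarrow> 'k) \<Rightarrow> 'g set" where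
  "coadjoint_stabiliser G \<beta> =
     {x \<in> carrier G. \<forall>\<delta> \<in> lie_carrier (Lie G). \<beta> (Ad G x \<delta>) = \<beta> \<delta>}"

definition zariski_closed :: "('g, 'k::field) alg_group \<Rightarrow> 'g set \<Rightarrow> bool" where
  "zariski_closed G S \<longleftrightarrow>
     (\<exists>F \<subseteq> coord_ring G. S = {x \<in> carrier G. \<forall>f \<in> F. f x = 0})"

definition zariski_connected :: "('g, 'k::field) alg_group \<Rightarrow> 'g set \<Rightarrow> bool" where
  "zariski_connected G S \<longleftrightarrow>
     \<not> (\<exists>C D. zariski_closed G C \<and> zariski_closed G D \<and> S \<subseteq> C \<union> D \<and>
          S \<inter> C \<inter> D = {} \<and> S \<inter> C \<noteq> {} \<and> S \<inter> D \<noteq> {})"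

text \<open>
  An element is unipotent iff right translation by it acts locally unipotently on the
  coordinate ring.
\<close>

definition unipotent :: "('g, 'k::field) alg_group \<Rightarrow> 'g \<Rightarrow> bool" where
  "unipotent G u \<longleftrightarrow> u \<in> carrier G \<and>
     (\<forall>f \<in> coord_ring G. \<exists>n.
        ((\<lambda>h. zero_outside (carrier G) (\<lambda>x. h (x \<otimes>\<^bsub>G\<^esub> u)) - h) ^^ n) f = 0)"

text \<open>
  Reductive means that the unipotent radical, i.e. the largest closed connected normal
  unipotent subgroup, is trivial. Reductive groups need not be connected.
\<close>

definition reductive :: "('g, 'k::field) alg_group \<Rightarrow> bool" where
  "reductive G \<longleftrightarrow>
     (\<forall>U. U \<lhd> G \<and> zariski_closed G U \<and> zariski_connected G U \<and> (\<forall>u \<in> U. unipotent G u)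
        \<longrightarrow> U = {\<one>\<^bsub>G\<^esub>})"

definition strongly_quasi_reductive :: "('g, 'k::field) alg_group \<Rightarrow> bool" where
  "strongly_quasi_reductive G \<longleftrightarrow>
     (\<exists>\<beta> \<in> lie_dual (Lie G). reductive (alg_subgroup G (coadjoint_stabiliser G \<beta>)))"

section \<open>The groups\<close>

definition entries :: "('g \<Rightarrow> 'k mat) \<Rightarrow> nat \<Rightarrow> nat \<Rightarrow> ('g \<Rightarrow> 'k) set" where
  "entries M m n = {(\<lambda>x. M x $$ (i, j)) | i j. i < m \<and> j < n}"

definition mat_inv :: "'k::field mat \<Rightarrow> 'k mat" where
  "mat_inv M = inverse (det M) \<cdot>\<^sub>m adj_mat M"

text \<open>
  An element \<open>(g, h, X, Y)\<close> stands for \<open>exp (X, Y) \<cdot> (g, h)\<close>. The nilradical \<open>K\<^sup>a \<otimes> (K\<^sup>b)\<^sup>*\<close> of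
  the maximal parabolic is the space of \<open>a\<close> by \<open>b\<close> matrices with \<open>(g, h) \<cdot> X = g X h\<inverse>\<close>.
\<close>

type_synonym 'k Qbar_group = "('k mat \<times> 'k mat \<times> 'k mat \<times> 'k mat, 'k) alg_group"

definition Qbar :: "nat \<Rightarrow> nat \<Rightarrow> 'k::field Qbar_group" where
  "Qbar a b = (let S = {(g, h, X, Y). g \<in> carrier_mat a a \<and> h \<in> carrier_mat b b \<and>
         det g * det h = 1 \<and> X \<in> carrier_mat a b \<and> Y \<in> carrier_mat a b} in
     \<lparr>carrier = S,
      monoid.mult = (\<lambda>(g, h, X, Y) (g', h', X', Y').
        (g * g', h * h', X + g * X' * mat_inv h, Y + g * Y' * mat_inv h)),
      one = (1\<^sub>m a, 1\<^sub>m b, 0\<^sub>m a b, 0\<^sub>m a b),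
      coord_ring = generated_algebra S
        (entries (\<lambda>(g, h, X, Y). g) a a \<union> entries (\<lambda>(g, h, X, Y). h) b b \<union>
         entries (\<lambda>(g, h, X, Y). X) a b \<union> entries (\<lambda>(g, h, X, Y). Y) a b)\<rparr>)"

text \<open>
  An element \<open>(g, h, A, w, v)\<close> stands for \<open>exp (A + w + v) \<cdot> (g, h)\<close>. The space \<open>K\<^sup>a \<otimes> K\<^sup>b\<close> is
  that of \<open>a\<close> by \<open>b\<close> matrices with \<open>(g, h) \<cdot> w = g w h\<^sup>T\<close>. The nilpotent ideal is 2-step
  nilpotent, whence \<open>exp x \<cdot> exp y = exp (x + y + [x, y] / 2)\<close>, and
  \<open>[A + w + v, A' + w' + v'] = A w' - A' w\<close>.
\<close>

definition R_group :: "nat \<Rightarrow> nat \<Rightarrow>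
    ('k mat \<times> 'k mat \<times> 'k mat \<times> 'k mat \<times> 'k mat, 'k::field) alg_group" where
  "R_group a b = (let S = {(g, h, A, w, v). g \<in> carrier_mat a a \<and> h \<in> carrier_mat b b \<and>
         det g \<noteq> 0 \<and> det h \<noteq> 0 \<and>
         A \<in> carrier_mat a a \<and> w \<in> carrier_mat a b \<and> v \<in> carrier_mat a b} in
     \<lparr>carrier = S,
      monoid.mult = (\<lambda>(g, h, A, w, v) (g', h', A', w', v').
        let A'' = g * A' * mat_inv g;
            w'' = g * w' * transpose_mat h;
            v'' = g * v' * transpose_mat h
        in (g * g', h * h', A + A'', w + w'', v + v'' + inverse 2 \<cdot>\<^sub>m (A * w'' - A'' * w))),
      one = (1\<^sub>m a, 1\<^sub>m b, 0\<^sub>m a a, 0\<^sub>m a b, 0\<^sub>m a b),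
      coord_ring = generated_algebra S
        (entries (\<lambda>(g, h, A, w, v). g) a a \<union> entries (\<lambda>(g, h, A, w, v). h) b b \<union>
         {\<lambda>(g, h, A, w, v). inverse (det g), \<lambda>(g, h, A, w, v). inverse (det h)} \<union>
         entries (\<lambda>(g, h, A, w, v). A) a a \<union>
         entries (\<lambda>(g, h, A, w, v). w) a b \<union> entries (\<lambda>(g, h, A, w, v). v) a b)\<rparr>)"

definition R_central_torus :: "nat \<Rightarrow> nat \<Rightarrow>
    ('k::field mat \<times> 'k mat \<times> 'k mat \<times> 'k mat \<times> 'k mat) set" where
  "R_central_torus a b =
     {(c \<cdot>\<^sub>m 1\<^sub>m a, inverse c \<cdot>\<^sub>m 1\<^sub>m b, 0\<^sub>m a a, 0\<^sub>m a b, 0\<^sub>m a b) | c. c \<noteq> 0}"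

type_synonym 'k Rbar_group =
  "(('k mat \<times> 'k mat \<times> 'k mat \<times> 'k mat \<times> 'k mat) set, 'k) alg_group"

definition Rbar :: "nat \<Rightarrow> nat \<Rightarrow> 'k::field Rbar_group" where
  "Rbar a b = alg_quotient (R_group a b) (R_central_torus a b)"

type_synonym 'k qbar_algebra =
  "('k, (('k mat \<times> 'k mat \<times> 'k mat \<times> 'k mat) \<Rightarrow> 'k) \<Rightarrow> 'k) lie_algebra"

type_synonym 'k rbar_algebra =
  "('k, (('k mat \<times> 'k mat \<times> 'k mat \<times> 'k mat \<times> 'k mat) set \<Rightarrow> 'k) \<Rightarrow> 'k) lie_algebra"

definition qbar :: "nat \<Rightarrow> nat \<Rightarrow> 'k::field qbar_algebra" where
  "qbar a b = Lie (Qbar a b)"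

definition rbar :: "nat \<Rightarrow> nat \<Rightarrow> 'k::field rbar_algebra" where
  "rbar a b = Lie (Rbar a b)"

end

theory Submission
  imports Defs "HOL-Library.Product_Plus"
begin

section \<open>Finitely supported matrices\<close>

text \<open>Elements of both Lie algebras are written as block matrices
  \<open>[A0, A1, V; 0, A0, W; 0, 0, B]\<close> of size \<open>2 * a + b\<close>, with
  \<open>A1 = 0\<close> in the case of q(a, b). These matrices form an associative algebra E with
  unit. Its commutator algebra is r(a, b) or q(a, b), after a twist of the second factor, and the
  barred algebras arise by dividing out the scalars. Every linear form on E is a trace form with
  parameters \<open>(C0, C1, D, S, T)\<close>, and its stabiliser is cut out by matrix equations
  (\<open>rsol\<close>, \<open>qsol\<close>). Since the unit always stabilises, index one of the
  barred algebra provides a form whose stabiliser in E is spanned by 1 and one further element. The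
  aim is to find a form whose stabiliser is the span of 1 and an idempotent w different from 0 and
  1.

  Such a form comes from a Euclidean algorithm on (a, b). A generic parameter contains an injective
  or surjective matrix, and eliminating with it identifies the stabiliser with one for smaller
  sizes: q(a, b) leads to r(a, b - a), and r(a, b) leads to q(a, b - a) or to r(a - b, b) (locale
  \<open>splitting\<close>, lemmas \<open>f1_sol\<close> to \<open>g3_sol\<close>). Transposition
  exchanges a and b in q. Small stabilisers persist for generic parameters
  (\<open>stab_generic\<close>), so regularity goes down the recursion. Every parameter of a smaller
  algebra comes from a larger one without losing eigenvalues, so a stabiliser spanned by 1 and an
  element with two distinct eigenvalues can be lifted back up (\<open>split1\<close>,
  \<open>split2\<close>, \<open>split3\<close>). The sizes stay even. The recursion ends at gl(c)
  with c even, where a stabiliser of dimension at most two forces c = 2 and diag(0, 1) is a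
  solution, or at r(a, 0) with a at least 2, whose stabilisers are too large
  (\<open>split_forms\<close>). A stabiliser is closed under multiplication, so its second generator
  satisfies a quadratic equation with two distinct roots, and a spectral idempotent w can be
  extracted (\<open>split_idempotent\<close>).

  Modulo scalars, the coadjoint stabiliser in the group then lies in the units s + t w. A unipotent
  element acts trivially through the characters s and s + t, or through their ratio in the quotient
  group, so it is trivial and the stabiliser is reductive. For the contact property, the form is
  moved in a direction that still annihilates commutators with w, until it is nonzero on w and zero
  on 1 (\<open>contact_form_exists\<close>). A form that does not vanish on its one-dimensional
  stabiliser is contact: in a symplectic basis of its kernel the top exterior power is a Pfaffian,
  which counts permutations and is nonzero in characteristic zero (\<open>symplectic_basis\<close>,
  \<open>contactI\<close>).

  It remains to match the coordinate-ring definitions with this picture. In a faithful matrix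
  representation, point derivations become matrices, brackets become commutators and Ad becomes
  conjugation (locale \<open>lin_group\<close>). Tangent vectors are realised by rational curves.
  For R(a, b) the group is the full unit group of E, and derivations of the scalar-invariant
  functions are shown to be E modulo scalars (locale \<open>lin_group_scalars\<close>). For the
  group of q the tangent space is a complement of the scalars in E.
  \<open>quasi_reductive_contact\<close> combines these facts in both cases.\<close>

typedef (overloaded) 'a::zero fm =
  "{f :: nat \<Rightarrow> nat \<Rightarrow> 'a. \<exists>n. \<forall>i j. f i j \<noteq> 0 \<longrightarrow> i < n \<and> j < n}"
  morphisms ent Fm
  by (rule exI[of _ "\<lambda>i j. 0"]) simp

text \<open>All sizes live in one ring, with \<open>M m n\<close> as subspaces and
  \<open>idm n\<close> as local units. This lets a and b vary in the recursion without changing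
  types.\<close>

definition M :: "nat \<Rightarrow> nat \<Rightarrow> 'a::zero fm set" where
  "M m n = {x. \<forall>i j. ent x i j \<noteq> 0 \<longrightarrow> i < m \<and> j < n}"

lemma M_I: "(\<And>i j. ent x i j \<noteq> 0 \<Longrightarrow> i < m \<and> j < n) \<Longrightarrow> x \<in> M m n"
  by (auto simp: M_def)

lemma M_D: "x \<in> M m n \<Longrightarrow> \<not> (i < m \<and> j < n) \<Longrightarrow> ent x i j = 0"
  by (auto simp: M_def)

lemma M_nz: "x \<in> M m n \<Longrightarrow> ent x i j \<noteq> 0 \<Longrightarrow> i < m \<and> j < n"
  by (auto simp: M_def)

lemma M_mono: "x \<in> M m n \<Longrightarrow> m \<le> m' \<Longrightarrow> n \<le> n' \<Longrightarrow> x \<in> M m' n'"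
  by (fastforce simp: M_def)

lemma ex_M: "\<exists>n. x \<in> M n n"
  using ent[of x] by (auto simp: M_def)

lemma fm_eqI: "(\<And>i j. ent x i j = ent y i j) \<Longrightarrow> x = y"
  by (metis ent_inject ext)

lemma ent_Fm: "(\<And>i j. f i j \<noteq> 0 \<Longrightarrow> i < m \<and> j < n) \<Longrightarrow> ent (Fm f) = f"
  by (rule Fm_inverse) (auto intro!: exI[of _ "max m n"] simp: less_max_iff_disj)

lemma Fm_M: "(\<And>i j. f i j \<noteq> 0 \<Longrightarrow> i < m \<and> j < n) \<Longrightarrow> Fm f \<in> M m n"
proof -
  assume *: "\<And>i j. f i j \<noteq> 0 \<Longrightarrow> i < m \<and> j < n"
  have "ent (Fm f) = f" by (rule ent_Fm[of f m n]) (use * in blast)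
  then show ?thesis using * by (simp add: M_def)
qed

instantiation fm :: (field) ring
begin
definition "0 = Fm (\<lambda>i j. 0)"
definition "x + y = Fm (\<lambda>i j. ent x i j + ent y i j)"
definition "- x = Fm (\<lambda>i j. - ent x i j)"
definition "x - y = Fm (\<lambda>i j. ent x i j - ent y i j)"
text \<open>Each row has finite support, so the product makes sense with no size attached to the
  factors.\<close>

definition "x * y = Fm (\<lambda>i j. \<Sum>k | ent x i k \<noteq> 0. ent x i k * ent y k j)"

lemma ent_zero [simp]: "ent 0 i j = 0"
  unfolding zero_fm_def by (subst ent_Fm) auto

lemma ent_add [simp]: "ent (x + y) i j = ent x i j + ent y i j"
proof -
  obtain m n where "x \<in> M m m" "y \<in> M n n" using ex_M by metis
  then show ?thesis unfolding plus_fm_def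
    by (subst ent_Fm[of _ "max m n" "max m n"]) (auto simp: less_max_iff_disj, (metis M_nz add.right_neutral diff_self)+)
qed

lemma ent_uminus [simp]: "ent (- x) i j = - ent x i j"
proof -
  obtain m where "x \<in> M m m" using ex_M by metis
  then show ?thesis unfolding uminus_fm_def
    by (subst ent_Fm[of _ m m]) (auto dest: M_nz)
qed

lemma ent_diff [simp]: "ent (x - y) i j = ent x i j - ent y i j"
proof -
  obtain m n where "x \<in> M m m" "y \<in> M n n" using ex_M by metis
  then show ?thesis unfolding minus_fm_def
    by (subst ent_Fm[of _ "max m n" "max m n"]) (auto simp: less_max_iff_disj, (metis M_nz add.right_neutral diff_self)+)
qed

lemma ent_times_aux: "(x :: 'a fm) \<in> M m n \<Longrightarrow> (\<Sum>k | ent x i k \<noteq> 0. ent x i k * ent y k j) = (\<Sum>k<n. ent x i k * ent y k j)"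
  by (rule sum.mono_neutral_left) (auto dest: M_nz[of x m n])

lemma ent_times: 
  assumes "x \<in> M m n"
  shows "ent (x * y) i j = (\<Sum>k<n. ent x i k * ent y k j)"
proof -
  obtain p where p: "y \<in> M p p" using ex_M by metis
  have "ent (x * y) i j = (\<Sum>k | ent x i k \<noteq> 0. ent x i k * ent y k j)"
    unfolding times_fm_def
  proof (subst ent_Fm[of _ m p])
    fix i j assume "(\<Sum>k | ent x i k \<noteq> 0. ent x i k * ent y k j) \<noteq> 0"
    then obtain k where "ent x i k * ent y k j \<noteq> 0" by (meson sum.neutral)
    then show "i < m \<and> j < p" using M_D[OF assms] M_D[OF p] by fastforce
  qed simp
  then show ?thesis using ent_times_aux[OF assms] by simp
qed

lemma M_times: 
  assumes "x \<in> M m n" "y \<in> M n' p" shows "x * y \<in> M m p"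
proof (rule M_I)
  fix i j assume "ent (x * y) i j \<noteq> 0"
  then have "(\<Sum>k<n. ent x i k * ent y k j) \<noteq> 0" by (simp add: ent_times[OF assms(1)])
  then obtain k where "ent x i k * ent y k j \<noteq> 0" by (meson sum.neutral)
  then show "i < m \<and> j < p" using M_D[OF assms(1)] M_D[OF assms(2)] by fastforce
qed

instance
proof
  fix a b c :: "'a fm"
  show "a + b + c = a + (b + c)" by (rule fm_eqI) simp
  show "a + b = b + a" by (rule fm_eqI) simp
  show "0 + a = a" by (rule fm_eqI) simp
  show "- a + a = 0" by (rule fm_eqI) simp
  show "a - b = a + - b" by (rule fm_eqI) simp
  obtain m where m: "a \<in> M m m" using ex_M by metis
  obtain p where p: "b \<in> M p p" using ex_M by metis
  have ab: "a * b \<in> M m p" using M_times[OF m p] .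
  show "a * b * c = a * (b * c)"
  proof (rule fm_eqI)
    fix i j
    have "ent (a * b * c) i j = (\<Sum>l<p. (\<Sum>k<m. ent a i k * ent b k l) * ent c l j)"
      by (simp add: ent_times[OF ab] ent_times[OF m])
    also have "\<dots> = (\<Sum>l<p. \<Sum>k<m. ent a i k * (ent b k l * ent c l j))"
      by (simp add: sum_distrib_right mult.assoc)
    also have "\<dots> = (\<Sum>k<m. \<Sum>l<p. ent a i k * (ent b k l * ent c l j))"
      by (rule sum.swap)
    also have "\<dots> = ent (a * (b * c)) i j"
      by (simp add: ent_times[OF m] ent_times[OF p] sum_distrib_left)
    finally show "ent (a * b * c) i j = ent (a * (b * c)) i j" .
  qed
  show "a * (b + c) = a * b + a * c"
    by (rule fm_eqI) (simp add: ent_times[OF m] algebra_simps sum.distrib)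
  define q where "q = max m p"
  have q: "a \<in> M q q" "b \<in> M q q" using M_mono[OF m] M_mono[OF p] by (auto simp: q_def)
  have "a + b \<in> M q q" by (rule M_I) (metis M_nz[OF q(1)] M_nz[OF q(2)] add.right_neutral ent_add)
  then show "(a + b) * c = a * c + b * c"
    by (intro fm_eqI) (simp add: ent_times[OF q(1)] ent_times[OF q(2)] ent_times algebra_simps sum.distrib)
qed
end

lemma M_zero [simp]: "(0 :: 'a::field fm) \<in> M m n" by (simp add: M_def)

lemma M_add: "x \<in> M m n \<Longrightarrow> y \<in> M m n \<Longrightarrow> (x :: 'a::field fm) + y \<in> M m n"
  by (rule M_I) (metis M_D add.right_neutral ent_add)

lemma M_uminus: "x \<in> M m n \<Longrightarrow> - (x :: 'a::field fm) \<in> M m n"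
  by (auto simp: M_def)

lemma M_diff: "x \<in> M m n \<Longrightarrow> y \<in> M m n \<Longrightarrow> (x :: 'a::field fm) - y \<in> M m n"
  using M_add[of x m n "- y"] M_uminus[of y m n] by simp

definition sm :: "'a::field \<Rightarrow> 'a fm \<Rightarrow> 'a fm" where
  "sm c x = Fm (\<lambda>i j. c * ent x i j)"

lemma ent_sm [simp]: "ent (sm c x) i j = c * ent x i j"
proof -
  obtain m where "x \<in> M m m" using ex_M by metis
  then show ?thesis unfolding sm_def
    by (subst ent_Fm[of _ m m]) (auto dest: M_nz)
qed

lemma M_sm: "x \<in> M m n \<Longrightarrow> sm c x \<in> M m n"
  by (auto simp: M_def)

lemma ent_sum: "ent (sum f A) i j = (\<Sum>a\<in>A. ent (f a) i j)"
  by (induction A rule: infinite_finite_induct) auto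

lemma M_sum: "(\<And>a. a \<in> A \<Longrightarrow> f a \<in> M m n) \<Longrightarrow> (sum f A :: 'a::field fm) \<in> M m n"
  by (induction A rule: infinite_finite_induct) (auto intro: M_add)

interpretation fm: vector_space "sm :: 'a::field \<Rightarrow> 'a fm \<Rightarrow> 'a fm"
  by unfold_locales (auto intro!: fm_eqI simp: algebra_simps)

lemma sm_times [simp]: "sm c x * y = sm c (x * y)"
proof -
  obtain m where m: "x \<in> M m m" using ex_M by metis
  show ?thesis
    by (rule fm_eqI) (simp add: ent_times[OF M_sm[OF m]] ent_times[OF m] sum_distrib_left mult.assoc)
qed

lemma times_sm [simp]: "x * sm c y = sm c (x * y)"
proof -
  obtain m where m: "x \<in> M m m" using ex_M by metis
  show ?thesis
    by (rule fm_eqI) (simp add: ent_times[OF m] sum_distrib_left mult_ac)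
qed

definition idm :: "nat \<Rightarrow> 'a::field fm" where
  "idm n = Fm (\<lambda>i j. if i = j \<and> i < n then 1 else 0)"

lemma ent_idm: "ent (idm n) i j = (if i = j \<and> i < n then 1 else 0)"
  unfolding idm_def by (subst ent_Fm[of _ n n]) (auto split: if_splits)

lemma M_idm: "n \<le> m \<Longrightarrow> n \<le> p \<Longrightarrow> idm n \<in> M m p"
  by (auto simp: M_def ent_idm)

lemma idm_times: assumes "x \<in> M m n" "m \<le> p" shows "idm p * x = x"
proof (rule fm_eqI)
  fix i j
  have "ent (idm p * x) i j = (\<Sum>k<p. if k = i then ent x i j else 0)"
    unfolding ent_times[OF M_idm[OF le_refl le_refl]] by (rule sum.cong) (auto simp: ent_idm)
  then show "ent (idm p * x) i j = ent x i j"
    using M_D[OF assms(1), of i j] assms(2) by (auto simp: not_less)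
qed

lemma times_idm: assumes "x \<in> M m n" "n \<le> p" shows "x * idm p = x"
proof (rule fm_eqI)
  fix i j
  have "ent (x * idm p) i j = (\<Sum>k<n. if k = j then ent x i j else 0)"
    unfolding ent_times[OF assms(1)] using assms(2) by (intro sum.cong) (auto simp: ent_idm)
  then show "ent (x * idm p) i j = ent x i j"
    using M_D[OF assms(1), of i j] assms(2) by (auto simp: not_less)
qed

text \<open>Turns size information into equations with the local units, the form in which the
  simplifier can use it.\<close>

lemma M_iff: "x \<in> M m n \<longleftrightarrow> idm m * x = x \<and> x * idm n = x"
proof
  assume *: "idm m * x = x \<and> x * idm n = x"
  obtain k where k: "x \<in> M k k" using ex_M by metis
  have "idm m * x \<in> M m k" using M_times[OF M_idm k] by blast
  then have "x \<in> M m k" using * by simp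
  then have "x * idm n \<in> M m n" using M_times[OF _ M_idm] by blast
  then show "x \<in> M m n" using * by simp
qed (auto simp: idm_times times_idm)

definition tpose :: "'a::zero fm \<Rightarrow> 'a fm" where
  "tpose x = Fm (\<lambda>i j. ent x j i)"

lemma ent_tpose [simp]: "ent (tpose x) i j = ent x j i"
proof -
  obtain m where "x \<in> M m m" using ex_M by metis
  then show ?thesis unfolding tpose_def
    by (subst ent_Fm[of _ m m]) (auto dest: M_nz)
qed

lemma tpose_tpose [simp]: "tpose (tpose x) = x" by (rule fm_eqI) simp
lemma tpose_add: "tpose (x + y) = tpose x + tpose (y :: 'a::field fm)" by (rule fm_eqI) simp
lemma tpose_diff: "tpose (x - y) = tpose x - tpose (y :: 'a::field fm)" by (rule fm_eqI) simp
lemma tpose_zero [simp]: "tpose (0 :: 'a::field fm) = 0" by (rule fm_eqI) simp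
lemma tpose_sm: "tpose (sm c x) = sm c (tpose x)" by (rule fm_eqI) simp
lemma tpose_idm [simp]: "tpose (idm n) = idm n" by (rule fm_eqI) (auto simp: ent_idm)
lemma M_tpose: "tpose x \<in> M m n \<longleftrightarrow> x \<in> M n m" by (auto simp: M_def)

lemma tpose_times: "tpose (x * y) = tpose y * tpose (x :: 'a::field fm)"
proof -
  obtain m n where mn: "x \<in> M m m" "y \<in> M n n" using ex_M by metis
  define q where "q = max m n"
  have q: "x \<in> M q q" "tpose y \<in> M q q" using mn by (auto intro: M_mono simp: M_tpose q_def)
  show ?thesis
    by (rule fm_eqI) (simp add: ent_times[OF q(1)] ent_times[OF q(2)] mult.commute)
qed

definition el :: "nat \<Rightarrow> nat \<Rightarrow> 'a::field fm" where
  "el p q = Fm (\<lambda>i j. if i = p \<and> j = q then 1 else 0)"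

lemma ent_el: "ent (el p q) i j = (if i = p \<and> j = q then 1 else 0)"
  unfolding el_def by (subst ent_Fm[of _ "Suc p" "Suc q"]) (auto split: if_splits)

lemma M_el: "p < m \<Longrightarrow> q < n \<Longrightarrow> el p q \<in> M m n"
  by (auto simp: M_def ent_el)

lemma fm_expand:
  assumes "x \<in> M m n"
  shows "x = (\<Sum>i<m. \<Sum>j<n. sm (ent x i j) (el i j))"
proof (rule fm_eqI)
  fix p q
  have "ent (\<Sum>i<m. \<Sum>j<n. sm (ent x i j) (el i j)) p q
      = (\<Sum>i<m. \<Sum>j<n. if i = p then if j = q then ent x i j else 0 else 0)"
    unfolding ent_sum by (intro sum.cong) (auto simp: ent_el)
  also have "\<dots> = (\<Sum>i<m. if i = p then (\<Sum>j<n. if j = q then ent x i j else 0) else 0)"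
    by (intro sum.cong) auto
  also have "\<dots> = ent x p q"
    using M_D[OF assms, of p q] by (auto)
  finally show "ent x p q = ent (\<Sum>i<m. \<Sum>j<n. sm (ent x i j) (el i j)) p q" by simp
qed

lemma M_span: "M m n \<subseteq> fm.span ((\<lambda>(i, j). el i j) ` ({..<m} \<times> {..<n}))"
proof
  fix x :: "'a fm" assume "x \<in> M m n"
  then have "x = (\<Sum>i<m. \<Sum>j<n. sm (ent x i j) (el i j))" by (rule fm_expand)
  moreover have "(\<Sum>i<m. \<Sum>j<n. sm (ent x i j) (el i j)) \<in> fm.span ((\<lambda>(i, j). el i j) ` ({..<m} \<times> {..<n}))"
    by (intro fm.span_sum fm.span_scale fm.span_base) auto
  ultimately show "x \<in> fm.span ((\<lambda>(i, j). el i j) ` ({..<m} \<times> {..<n}))" by simp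
qed

definition tr :: "'a::field fm \<Rightarrow> 'a" where
  "tr x = (\<Sum>i | ent x i i \<noteq> 0. ent x i i)"

lemma tr_M: assumes "x \<in> M m n" shows "tr x = (\<Sum>i<m. ent x i i)"
  unfolding tr_def by (rule sum.mono_neutral_left) (auto dest: M_nz[OF assms])

lemma tr_zero [simp]: "tr 0 = 0" by (simp add: tr_def)

lemma tr_add: "tr (x + y) = tr x + tr y"
proof -
  obtain m n where mn: "x \<in> M m m" "y \<in> M n n" using ex_M by metis
  define q where "q = max m n"
  have q: "x \<in> M q q" "y \<in> M q q" using mn by (auto intro: M_mono simp: q_def)
  show ?thesis using q M_add[OF q] by (simp add: tr_M sum.distrib)
qed

lemma tr_sm: "tr (sm c x) = c * tr x"
proof -
  obtain m where m: "x \<in> M m m" using ex_M by metis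
  show ?thesis by (simp add: tr_M[OF M_sm[OF m]] tr_M[OF m] sum_distrib_left)
qed

lemma tr_diff: "tr (x - y) = tr x - tr y"
  using tr_add[of "x - y" y] by simp

lemma tr_comm: "tr (x * y) = tr (y * x)"
proof -
  obtain m n where mn: "x \<in> M m m" "y \<in> M n n" using ex_M by metis
  define q where "q = max m n"
  have q: "x \<in> M q q" "y \<in> M q q" using mn by (auto intro: M_mono simp: q_def)
  have "tr (x * y) = (\<Sum>i<q. \<Sum>k<q. ent x i k * ent y k i)"
    using M_times[OF q] by (simp add: tr_M ent_times[OF q(1)])
  also have "\<dots> = (\<Sum>k<q. \<Sum>i<q. ent y k i * ent x i k)"
    by (subst sum.swap) (simp add: mult.commute)
  also have "\<dots> = tr (y * x)"
    using M_times[OF q(2,1)] by (simp add: tr_M ent_times[OF q(2)])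
  finally show ?thesis .
qed

lemma tr_el: assumes "x \<in> M m n" shows "tr (x * el p q) = ent x q p"
proof -
  have "tr (x * el p q) = (\<Sum>i<m. \<Sum>k<n. ent x i k * ent (el p q) k i)"
    by (simp add: tr_M[OF M_times[OF assms M_el[OF lessI lessI]]] ent_times[OF assms])
  also have "\<dots> = (\<Sum>i<m. \<Sum>k<n. if i = q then if k = p then ent x i k else 0 else 0)"
    by (intro sum.cong) (auto simp: ent_el)
  also have "\<dots> = (\<Sum>i<m. if i = q then (\<Sum>k<n. if k = p then ent x i k else 0) else 0)"
    by (intro sum.cong) auto
  also have "\<dots> = ent x q p" using M_D[OF assms, of q p] by auto
  finally show ?thesis .
qed

text \<open>Testing against elementary matrices reads off the entries. This is what turns the
  stabiliser of a trace form into matrix equations.\<close>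

lemma tr_nondeg:
  assumes x: "x \<in> M m n" and 0: "\<And>y. y \<in> M n m \<Longrightarrow> tr (x * y) = 0"
  shows "x = 0"
proof (rule fm_eqI)
  fix i j
  show "ent x i j = ent 0 i j"
  proof (cases "i < m \<and> j < n")
    case True
    then show ?thesis using 0[OF M_el[of j n i m]] tr_el[OF x, of j i] by simp
  qed (use M_D[OF x] in auto)
qed

definition of_mat :: "'a::field mat \<Rightarrow> 'a fm" where
  "of_mat A = Fm (\<lambda>i j. if i < dim_row A \<and> j < dim_col A then A $$ (i, j) else 0)"

definition to_mat :: "nat \<Rightarrow> nat \<Rightarrow> 'a::field fm \<Rightarrow> 'a mat" where
  "to_mat m n x = mat m n (\<lambda>(i, j). ent x i j)"

lemma ent_of_mat: "ent (of_mat A) i j = (if i < dim_row A \<and> j < dim_col A then A $$ (i, j) else 0)"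
  unfolding of_mat_def by (subst ent_Fm[of _ "dim_row A" "dim_col A"]) (auto split: if_splits)

lemma M_of_mat: "A \<in> carrier_mat m n \<Longrightarrow> of_mat A \<in> M m n"
  by (auto simp: M_def ent_of_mat split: if_splits)

lemma to_mat_carrier [simp]: "to_mat m n x \<in> carrier_mat m n" by (simp add: to_mat_def)
lemma to_mat_dim [simp]: "dim_row (to_mat m n x) = m" "dim_col (to_mat m n x) = n" by (simp_all add: to_mat_def)
lemma to_mat_idx [simp]: "i < m \<Longrightarrow> j < n \<Longrightarrow> to_mat m n x $$ (i, j) = ent x i j" by (simp add: to_mat_def)

lemma of_mat_to_mat: "x \<in> M m n \<Longrightarrow> of_mat (to_mat m n x) = x"
  by (rule fm_eqI) (auto simp: ent_of_mat dest: M_D)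

lemma to_mat_of_mat: "A \<in> carrier_mat m n \<Longrightarrow> to_mat m n (of_mat A) = A"
  by (rule eq_matI) (auto simp: ent_of_mat)

lemma of_mat_inj: "A \<in> carrier_mat m n \<Longrightarrow> B \<in> carrier_mat m n \<Longrightarrow> of_mat A = of_mat B \<Longrightarrow> A = B"
  by (metis to_mat_of_mat)

lemma of_mat_times:
  assumes "A \<in> carrier_mat m n" "B \<in> carrier_mat n p"
  shows "of_mat (A * B) = of_mat A * of_mat B"
proof (rule fm_eqI)
  fix i j
  show "ent (of_mat (A * B)) i j = ent (of_mat A * of_mat B) i j"
    using assms by (auto simp: ent_times[OF M_of_mat[OF assms(1)]] ent_of_mat scalar_prod_def
        lessThan_atLeast0 intro!: sum.cong)
qed

lemma of_mat_add: "A \<in> carrier_mat m n \<Longrightarrow> B \<in> carrier_mat m n \<Longrightarrow> of_mat (A + B) = of_mat A + of_mat B"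
  by (rule fm_eqI) (auto simp: ent_of_mat)
lemma of_mat_minus: "A \<in> carrier_mat m n \<Longrightarrow> B \<in> carrier_mat m n \<Longrightarrow> of_mat (A - B) = of_mat A - of_mat B"
  by (rule fm_eqI) (auto simp: ent_of_mat)
lemma of_mat_smult: "of_mat (c \<cdot>\<^sub>m A) = sm c (of_mat A)"
  by (rule fm_eqI) (auto simp: ent_of_mat)
lemma of_mat_one: "of_mat (1\<^sub>m n) = idm n"
  by (rule fm_eqI) (auto simp: ent_of_mat ent_idm)
lemma of_mat_zero: "of_mat (0\<^sub>m m n) = 0"
  by (rule fm_eqI) (auto simp: ent_of_mat)
lemma of_mat_tpose: "of_mat (transpose_mat A) = tpose (of_mat A)"
  by (rule fm_eqI) (auto simp: ent_of_mat)

lemma mat_inv_carrier: "A \<in> carrier_mat n n \<Longrightarrow> mat_inv A \<in> carrier_mat n n"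
  by (auto simp: mat_inv_def adj_mat)

lemma mat_inv:
  assumes "A \<in> carrier_mat n n" "det A \<noteq> 0"
  shows "of_mat A * of_mat (mat_inv A) = idm n" "of_mat (mat_inv A) * of_mat A = idm n"
proof -
  note a = adj_mat[OF assms(1)]
  have "of_mat A * of_mat (mat_inv A) = sm (inverse (det A)) (of_mat (A * adj_mat A))"
    by (simp add: mat_inv_def of_mat_smult of_mat_times[OF assms(1) a(1)])
  also have "\<dots> = idm n" using assms(2) by (simp add: a(2) of_mat_smult of_mat_one)
  finally show "of_mat A * of_mat (mat_inv A) = idm n" .
  have "of_mat (mat_inv A) * of_mat A = sm (inverse (det A)) (of_mat (adj_mat A * A))"
    by (simp add: mat_inv_def of_mat_smult of_mat_times[OF a(1) assms(1)])
  also have "\<dots> = idm n" using assms(2) by (simp add: a(3) of_mat_smult of_mat_one)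
  finally show "of_mat (mat_inv A) * of_mat A = idm n" .
qed

lemma fm_inv_unique:
  assumes "z \<in> M n n" "w \<in> M n n" "z * y = idm n" "y * w = idm n"
  shows "z = w"
  by (metis assms M_iff mult.assoc)

section \<open>Kernels of linear forms on the block algebras\<close>

type_synonym 'a t5 = "'a fm \<times> 'a fm \<times> 'a fm \<times> 'a fm \<times> 'a fm"

text \<open>The stabiliser of the form \<open>tr (C0 * A0) + tr (C1 * A1) + tr (D * B) + tr (S * W)
  + tr (T * V)\<close> on block matrices \<open>[A0, A1, V; 0, A0, W; 0, 0, B]\<close>. Each
  equation is the coefficient of one block of the test element.\<close>

definition rsol :: "nat \<Rightarrow> nat \<Rightarrow> 'a::field t5 \<Rightarrow> 'a t5 set" where
  "rsol a b = (\<lambda>(C0, C1, D, S, T). {(A0, A1, B, W, V).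
     A0 \<in> M a a \<and> A1 \<in> M a a \<and> B \<in> M b b \<and> W \<in> M a b \<and> V \<in> M a b \<and>
     T * A0 = B * T \<and> S * A0 + T * A1 = B * S \<and> C1 * A0 - A0 * C1 = W * T \<and>
     C0 * A0 - A0 * C0 + (C1 * A1 - A1 * C1) = W * S + V * T \<and> B * D - D * B = S * W + T * V})"

text \<open>The analogue for \<open>A1 = 0\<close>, with X and Y in the places of W and V. It is
  kept in quintuples so that the maps between the two families have a single type.\<close>

definition qsol :: "nat \<Rightarrow> nat \<Rightarrow> 'a::field t5 \<Rightarrow> 'a t5 set" where
  "qsol a b = (\<lambda>(C, C1, D, P, Q). {(A, A1, B, X, Y).
     A \<in> M a a \<and> A1 = 0 \<and> B \<in> M b b \<and> X \<in> M a b \<and> Y \<in> M a b \<and>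
     P * A = B * P \<and> Q * A = B * Q \<and> C * A - A * C = X * P + Y * Q \<and>
     B * D - D * B = P * X + Q * Y})"

definition params :: "nat \<Rightarrow> nat \<Rightarrow> 'a::field t5 set" where
  "params a b = {(C0, C1, D, S, T). C0 \<in> M a a \<and> C1 \<in> M a a \<and> D \<in> M b b \<and> S \<in> M b a \<and> T \<in> M b a}"

definition smt :: "'a::field \<Rightarrow> 'a t5 \<Rightarrow> 'a t5" where
  "smt s = (\<lambda>(A0, A1, B, W, V). (sm s A0, sm s A1, sm s B, sm s W, sm s V))"

definition one5 :: "nat \<Rightarrow> nat \<Rightarrow> 'a::field t5" where
  "one5 a b = (idm a, 0, idm b, 0, 0)"

definition lin5 :: "('a::field t5 \<Rightarrow> 'a t5) \<Rightarrow> bool" where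
  "lin5 f \<longleftrightarrow> (\<forall>s t x y. f (smt s x + smt t y) = smt s (f x) + smt t (f y))"

definition spanned_by :: "'a::field t5 \<Rightarrow> 'a t5 \<Rightarrow> 'a t5 set \<Rightarrow> bool" where
  "spanned_by e u X \<longleftrightarrow> (\<forall>x \<in> X. \<exists>s t. x = smt s e + smt t u)"

text \<open>Eigenvalues of the block matrix, seen on a column vector for the sub-block A0 or on a
  row vector for the quotient block B. These are the sides on which eigenvectors extend through the
  triangular reductions below.\<close>

definition ev :: "nat \<Rightarrow> nat \<Rightarrow> 'a::field t5 \<Rightarrow> 'a \<Rightarrow> bool" where
  "ev a b x c = (case x of (A0, A1, B, W, V) \<Rightarrow>
     (\<exists>v. v \<noteq> 0 \<and> idm a * v = v \<and> A0 * v = sm c v) \<or>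
     (\<exists>v. v \<noteq> 0 \<and> v * idm b = v \<and> v * B = sm c v))"

definition split :: "nat \<Rightarrow> nat \<Rightarrow> 'a::field t5 set \<Rightarrow> bool" where
  "split a b X \<longleftrightarrow> (\<exists>u \<in> X. spanned_by (one5 a b) u X \<and> (\<exists>c d. c \<noteq> d \<and> ev a b u c \<and> ev a b u d))"

text \<open>The unit \<open>one5\<close> always stabilises, so this bounds the stabiliser modulo
  scalars by dimension one.\<close>

definition rank_le_2 :: "nat \<Rightarrow> nat \<Rightarrow> 'a::field t5 set \<Rightarrow> bool" where
  "rank_le_2 a b X \<longleftrightarrow> (\<exists>u. spanned_by (one5 a b) u X)"

lemma spanned_by_image:
  assumes "lin5 f" "f e = e'" "spanned_by e u X" "Y \<subseteq> f ` X"
  shows "spanned_by e' (f u) Y"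
  unfolding spanned_by_def
proof
  fix y assume "y \<in> Y"
  then obtain x where "x \<in> X" "y = f x" using assms(4) by auto
  moreover from this obtain s t where "x = smt s e + smt t u"
    using assms(3) unfolding spanned_by_def by blast
  ultimately have "y = smt s e' + smt t (f u)"
    using assms(1,2) unfolding lin5_def by simp
  then show "\<exists>s t. y = smt s e' + smt t (f u)" by blast
qed

lemma rank_le_2_image:
  assumes "lin5 f" "f (one5 a b) = one5 c d" "rank_le_2 a b X" "Y \<subseteq> f ` X"
  shows "rank_le_2 c d Y"
  using assms spanned_by_image unfolding rank_le_2_def by blast

text \<open>An isomorphism of kernels pulls back a splitting if it does not create eigenvalues.\<close>

lemma split_pullback:
  assumes "lin5 g" "g (one5 c d) = one5 a b" "split c d Y" "X = g ` Y"
    and "\<And>y k. y \<in> Y \<Longrightarrow> ev c d y k \<Longrightarrow> ev a b (g y) k"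
  shows "split a b X"
  using assms spanned_by_image[OF assms(1,2)] unfolding split_def by blast

lemma asc: "(x :: 'a::semigroup_mult) * y = z \<Longrightarrow> x * (y * w) = z * w"
  by (simp add: mult.assoc[symmetric])

lemma asc2: "(x :: 'a::semigroup_mult) * y = z * z' \<Longrightarrow> x * (y * w) = z * (z' * w)"
  by (metis mult.assoc)

lemma M_closed:
  "A \<in> M m n \<Longrightarrow> B \<in> M n p \<Longrightarrow> A * B \<in> M m p"
  "A \<in> M m n \<Longrightarrow> A' \<in> M m n \<Longrightarrow> A + A' \<in> M m n"
  "A \<in> M m n \<Longrightarrow> A' \<in> M m n \<Longrightarrow> A - A' \<in> M m n"
  for A :: "'a::field fm"
  by (simp_all add: M_times M_add M_diff)

text \<open>A decomposition of K^b into the images of P and N, with P' and N' as the dual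
  projections. In the applications P is a generic injective parameter, or P' a generic surjective
  one.\<close>

locale splitting =
  fixes b a c :: nat and P P' N N' :: "'a::field fm"
  assumes M: "P \<in> M b a" "P' \<in> M a b" "N \<in> M b c" "N' \<in> M c b"
    and PP: "P' * P = idm a" and NN: "N' * N = idm c"
    and PN: "P' * N = 0" and NP: "N' * P = 0"
    and one: "P * P' + N * N' = idm b"
begin

lemma id_simps [simp]:
  "idm b * P = P" "P * idm a = P" "idm a * P' = P'" "P' * idm b = P'"
  "idm b * N = N" "N * idm c = N" "idm c * N' = N'" "N' * idm b = N'"
  using M by (auto simp: M_iff)

lemmas cancel = PP NN PN NP PP[THEN asc] NN[THEN asc] PN[THEN asc] NP[THEN asc]

lemma decomp_l: "x \<in> M b n \<Longrightarrow> P * (P' * x) + N * (N' * x) = x"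
  by (metis distrib_right idm_times mult.assoc le_refl one)

lemma decomp_r: "x \<in> M n b \<Longrightarrow> x * P * P' + x * N * N' = x"
  by (metis distrib_left times_idm mult.assoc le_refl one)

lemma eq_l: "x \<in> M b n \<Longrightarrow> y \<in> M b n \<Longrightarrow> P' * x = P' * y \<Longrightarrow> N' * x = N' * y \<Longrightarrow> x = y"
  by (metis decomp_l)

lemma eq_r: "x \<in> M n b \<Longrightarrow> y \<in> M n b \<Longrightarrow> x * P = y * P \<Longrightarrow> x * N = y * N \<Longrightarrow> x = y"
  by (metis decomp_r)

text \<open>The rewrite rules expressing that \<open>B\<close> is block triangular with diagonal blocks \<open>A\<close>, \<open>B'\<close>.\<close>

lemma triangular:
  assumes B: "B \<in> M b b" and A: "A \<in> M a a" and BP: "P * A = B * P"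
  shows "P' * B = A * P' + P' * B * N * N'" "N' * B = N' * B * N * N'"
    "B * N = P * (P' * B * N) + N * (N' * B * N)" "P' * B * P = A" "N' * B * P = 0"
proof -
  show 1: "P' * B * P = A" using A by (simp add: mult.assoc BP[symmetric] cancel idm_times)
  show 2: "N' * B * P = 0" by (simp add: mult.assoc BP[symmetric] cancel)
  show "P' * B = A * P' + P' * B * N * N'"
    using decomp_r[of "P' * B" a] M B 1 by (simp add: M_closed)
  show "N' * B = N' * B * N * N'"
    using decomp_r[of "N' * B" c] M B 2 by (simp add: M_closed)
  show "B * N = P * (P' * B * N) + N * (N' * B * N)"
    using decomp_l[of "B * N" c] M B by (simp add: M_closed mult.assoc)
qed

text \<open>Reduction of q(a, b) to r(a, b - a). The relation \<open>P * A = B * P\<close> makes B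
  block triangular with blocks A, W, B2. The free matrix Y splits into \<open>Y * P\<close> and
  \<open>Y * N\<close>, which become the new A1 and V, and X is recovered from the last equation by
  \<open>g1\<close>.\<close>

definition f1 :: "'a t5 \<Rightarrow> 'a t5" where
  "f1 = (\<lambda>(A, A1, B, X, Y). (A, Y * P, N' * B * N, P' * B * N, Y * N))"

definition g1 :: "'a fm \<Rightarrow> 'a fm \<Rightarrow> 'a t5 \<Rightarrow> 'a t5" where
  "g1 D Q = (\<lambda>(A, A1, B, W, V).
     let B' = P * A * P' + P * W * N' + N * B * N'; Y = A1 * P' + V * N'
     in (A, 0, B', P' * (B' * D - D * B' - Q * Y), Y))"

lemma f1_sol:
  assumes par: "C \<in> M a a" "D \<in> M b b" "Q \<in> M b a"
    and x: "x \<in> qsol a b (C, C1, D, P, Q)"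
  shows "f1 x \<in> rsol a c (C + P' * D * P, P' * Q, N' * D * N, N' * D * P, N' * Q)" "g1 D Q (f1 x) = x"
proof -
  obtain A B X Y where xe: "x = (A, 0, B, X, Y)" and m: "A \<in> M a a" "B \<in> M b b" "X \<in> M a b" "Y \<in> M a b"
    and e1: "P * A = B * P" and e2: "Q * A = B * Q" and e3: "C * A - A * C = X * P + Y * Q"
    and e4: "B * D - D * B = P * X + Q * Y"
    using x by (auto simp: qsol_def)
  define W where "W = P' * B * N"
  define B2 where "B2 = N' * B * N"
  note t = triangular[OF m(2,1) e1, folded W_def B2_def]
  have r: "P' * B = A * P' + W * N'" "N' * B = B2 * N'" "B * N = P * W + N * B2" "B * P = P * A" "B * Q = Q * A"
    using t e1 e2 by auto
  have r': "P' * (B * z) = A * (P' * z) + W * (N' * z)" "N' * (B * z) = B2 * (N' * z)"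
    "B * (N * z) = P * (W * z) + N * (B2 * z)" "B * (P * z) = P * (A * z)" "B * (Q * z) = Q * (A * z)" for z
    by (simp_all only: mult.assoc[symmetric] distrib_right[symmetric] r)
  \<comment> \<open>Applying P' to the last equation solves it for X. Inserting the result into the
    third equation eliminates X altogether.\<close>
  have XP: "P' * (B * D - D * B - Q * Y) = X"
    using m by (simp add: e4 algebra_simps cancel idm_times[OF m(3)])
  have "P' * (B * D - D * B - Q * Y) * P = X * P" using XP by simp
  then have k1: "A * (P' * (D * P)) + W * (N' * (D * P)) - P' * (D * (P * A)) - P' * (Q * (Y * P)) = C * A - A * C - Y * Q"
    using e3 by (simp add: algebra_simps r r')
  have k2: "Y * Q = Y * P * (P' * Q) + Y * N * (N' * Q)"
    using arg_cong[OF decomp_r[OF m(4)], of "\<lambda>z. z * Q"] by (simp add: algebra_simps)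
  have k3: "N' * (B * D - D * B) * P = N' * (P * X + Q * Y) * P" using e4 by simp
  have k4: "N' * (B * D - D * B) * N = N' * (P * X + Q * Y) * N" using e4 by simp
  have "P' * Q * A - A * (P' * Q) = W * (N' * Q)" 
    by (simp add: mult.assoc e2 r(1) r'(1) distrib_right)
  moreover have "N' * Q * A = B2 * (N' * Q)" 
    by (simp add: mult.assoc e2 r(2) r'(2))
  moreover have "N' * D * P * A + N' * Q * (Y * P) = B2 * (N' * D * P)"
    using k3 by (simp add: algebra_simps r r' cancel)
  moreover have "B2 * (N' * D * N) - N' * D * N * B2 = N' * D * P * W + N' * Q * (Y * N)"
    using k4 by (simp add: algebra_simps r r' cancel)
  moreover have "(C + P' * D * P) * A - A * (C + P' * D * P) + (P' * Q * (Y * P) - Y * P * (P' * Q))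
      = W * (N' * D * P) + Y * N * (N' * Q)"
    using k1 unfolding k2 by (simp add: algebra_simps)
  moreover have "W \<in> M a c" "B2 \<in> M c c" "Y * P \<in> M a a" "Y * N \<in> M a c"
    unfolding W_def B2_def using m M by - (assumption | rule M_closed)+
  ultimately show "f1 x \<in> rsol a c (C + P' * D * P, P' * Q, N' * D * N, N' * D * P, N' * Q)"
    using m unfolding xe f1_def rsol_def by (simp add: W_def B2_def)
  have Y: "Y * P * P' + Y * N * N' = Y" by (rule decomp_r[OF m(4)])
  have B: "P * A * P' + P * W * N' + N * B2 * N' = B"
    using decomp_r[OF m(2)] r by (simp add: algebra_simps)
  show "g1 D Q (f1 x) = x"
    unfolding xe f1_def g1_def by (simp add: Let_def B[unfolded W_def B2_def] Y XP)
qed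

lemma g1_sol:
  assumes par: "C \<in> M a a" "D \<in> M b b" "Q \<in> M b a"
    and y: "y \<in> rsol a c (C + P' * D * P, P' * Q, N' * D * N, N' * D * P, N' * Q)"
  shows "g1 D Q y \<in> qsol a b (C, C1, D, P, Q)" "f1 (g1 D Q y) = y"
proof -
  obtain A A1 B2 W V where ye: "y = (A, A1, B2, W, V)"
    and m: "A \<in> M a a" "A1 \<in> M a a" "B2 \<in> M c c" "W \<in> M a c" "V \<in> M a c"
    and e1: "N' * Q * A = B2 * (N' * Q)" and e2: "N' * D * P * A + N' * Q * A1 = B2 * (N' * D * P)"
    and e3: "P' * Q * A - A * (P' * Q) = W * (N' * Q)"
    and e4: "(C + P' * D * P) * A - A * (C + P' * D * P) + (P' * Q * A1 - A1 * (P' * Q)) = W * (N' * D * P) + V * (N' * Q)"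
    and e5: "B2 * (N' * D * N) - N' * D * N * B2 = N' * D * P * W + N' * Q * V"
    using y by (auto simp: rsol_def)
  define B where "B = P * A * P' + P * W * N' + N * B2 * N'"
  define Y where "Y = A1 * P' + V * N'"
  define X where "X = P' * (B * D - D * B - Q * Y)"
  have mm: "B \<in> M b b" "Y \<in> M a b" "X \<in> M a b"
    unfolding B_def Y_def X_def using m M par by - (assumption | rule M_closed)+
  have g: "g1 D Q y = (A, 0, B, X, Y)" unfolding ye g1_def X_def Y_def B_def by (simp add: Let_def)
  have i: "idm a * (A * z) = A * z" "idm c * (B2 * z) = B2 * z" "idm a * (W * z) = W * z"
     "A * idm a = A" "W * idm c = W" "B2 * idm c = B2" "A1 * idm a = A1" "V * idm c = V"
     "idm a * A = A" "idm a * W = W" "idm c * B2 = B2" for z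
    using m by (simp_all add: M_iff mult.assoc[symmetric])
  have r: "P' * B = A * P' + W * N'" "N' * B = B2 * N'" "B * N = P * W + N * B2" "B * P = P * A"
     "Y * P = A1" "Y * N = V"
    unfolding B_def Y_def using m by (simp_all add: algebra_simps cancel i)
  have r': "P' * (B * z) = A * (P' * z) + W * (N' * z)" "N' * (B * z) = B2 * (N' * z)"
    "B * (N * z) = P * (W * z) + N * (B2 * z)" "B * (P * z) = P * (A * z)"
    "Y * (P * z) = A1 * z" "Y * (N * z) = V * z" for z
    by (simp_all only: mult.assoc[symmetric] distrib_right[symmetric] r)
  have q2: "Q * A = B * Q"
    by (rule eq_l[of _ a]) (use m mm par e1 e3 in \<open>simp_all add: M_closed algebra_simps r r'\<close>)
  have YQ: "Y * Q = A1 * (P' * Q) + V * (N' * Q)" by (simp add: Y_def algebra_simps)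
  have q3: "C * A - A * C = X * P + Y * Q"
    using e4 unfolding YQ by (simp add: X_def algebra_simps r r')
  have q4: "B * D - D * B = P * X + Q * Y"
  proof (rule eq_l[of _ b])
    show "P' * (B * D - D * B) = P' * (P * X + Q * Y)"
      using mm(3) by (simp add: distrib_left cancel idm_times) (simp add: X_def algebra_simps)
    show "N' * (B * D - D * B) = N' * (P * X + Q * Y)"
    proof (rule eq_r[of _ c])
      show "N' * (B * D - D * B) * P = N' * (P * X + Q * Y) * P"
        using e2 by (simp add: algebra_simps r r' cancel)
      show "N' * (B * D - D * B) * N = N' * (P * X + Q * Y) * N"
        using e5 by (simp add: algebra_simps r r' cancel)
    qed (use m mm par M in \<open>simp_all add: M_closed\<close>)
  qed (use m mm par M in \<open>simp_all add: M_closed\<close>)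
  show "g1 D Q y \<in> qsol a b (C, C1, D, P, Q)"
    unfolding g qsol_def using m mm q2 q3 q4 r by simp
  show "f1 (g1 D Q y) = y"
    unfolding g unfolding f1_def ye using r by (simp add: r r' cancel algebra_simps i)
qed

text \<open>Column eigenvectors of A are kept. A row eigenvector v of the small block extends to
  \<open>v * N'\<close>, because \<open>N' * B\<close> is the small block times N'.\<close>

lemma ev1: "ev a c y k \<Longrightarrow> ev a b (g1 D Q y) k"
proof -
  assume *: "ev a c y k"
  obtain A A1 B2 W V where ye: "y = (A, A1, B2, W, V)" by (cases y)
  from * consider v where "v \<noteq> 0" "idm a * v = v" "A * v = sm k v" | v where "v \<noteq> 0" "v * idm c = v" "v * B2 = sm k v"
    unfolding ev_def ye by auto
  then show ?thesis
  proof cases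
    case 1 then show ?thesis unfolding ev_def ye g1_def by (auto simp: Let_def)
  next
    case 2
    have "v * N' \<noteq> 0"
    proof
      assume "v * N' = 0"
      then have "v * N' * N = 0" by simp
      then show False using 2 by (simp add: mult.assoc NN)
    qed
    moreover have "v * N' * (P * A * P' + P * W * N' + N * B2 * N') = sm k (v * N')"
      using 2 by (simp add: algebra_simps cancel 2(2)[THEN asc] 2(3)[THEN asc])
    moreover have "v * N' * idm b = v * N'" by (simp add: mult.assoc)
    ultimately show ?thesis unfolding ev_def ye g1_def Let_def by auto
  qed
qed

text \<open>Reduction of r(a, b) to q(a, b - a) with T = P injective. B is triangular as before, A1
  and V are solved from the equations, and \<open>W * P\<close> is the commutator of C1 and A. Only
  \<open>W * N\<close> remains free, and the shift by C1 brings the remaining equations into the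
  shape of \<open>qsol\<close>.\<close>

definition f2 :: "'a fm \<Rightarrow> 'a t5 \<Rightarrow> 'a t5" where
  "f2 C1 = (\<lambda>(A, A1, B, W, V). (A, 0, N' * B * N, P' * B * N, W * N - C1 * (P' * B * N)))"

definition g2 :: "'a fm \<Rightarrow> 'a fm \<Rightarrow> 'a fm \<Rightarrow> 'a t5 \<Rightarrow> 'a t5" where
  "g2 C1 D S = (\<lambda>(A, A1, B, X, Y).
     let B' = P * A * P' + P * X * N' + N * B * N';
         W = (C1 * A - A * C1) * P' + (Y + C1 * X) * N'
     in (A, P' * (B' * S - S * A), B', W, P' * (B' * D - D * B' - S * W)))"

lemma f2_sol:
  assumes par: "C0 \<in> M a a" "C1 \<in> M a a" "D \<in> M b b" "S \<in> M b a"
    and x: "x \<in> rsol a b (C0, C1, D, S, P)"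
  shows "f2 C1 x \<in> qsol a c (P' * D * P + C0 + (P' * S * C1 - C1 * (P' * S)), C', N' * D * N,
       N' * D * P + N' * S * C1, N' * S)" "g2 C1 D S (f2 C1 x) = x"
proof -
  obtain A A1 B W V where xe: "x = (A, A1, B, W, V)"
    and m: "A \<in> M a a" "A1 \<in> M a a" "B \<in> M b b" "W \<in> M a b" "V \<in> M a b"
    and e1: "P * A = B * P" and e2: "S * A + P * A1 = B * S" and e3: "C1 * A - A * C1 = W * P"
    and e4: "C0 * A - A * C0 + (C1 * A1 - A1 * C1) = W * S + V * P"
    and e5: "B * D - D * B = S * W + P * V"
    using x by (auto simp: rsol_def)
  define X where "X = P' * B * N"
  define B2 where "B2 = N' * B * N"
  note t = triangular[OF m(3,1) e1, folded X_def B2_def]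
  have r: "P' * B = A * P' + X * N'" "N' * B = B2 * N'" "B * N = P * X + N * B2" "B * P = P * A"
    "W * P = C1 * A - A * C1"
    using t e1 e3 by auto
  have r': "P' * (B * z) = A * (P' * z) + X * (N' * z)" "N' * (B * z) = B2 * (N' * z)"
    "B * (N * z) = P * (X * z) + N * (B2 * z)" "B * (P * z) = P * (A * z)"
    "W * (P * z) = (C1 * A - A * C1) * z" for z
    by (simp_all only: mult.assoc[symmetric] distrib_right[symmetric] r)
  have i: "idm a * A1 = A1" "idm a * V = V" "idm a * (V * z) = V * z" for z
    using m by (simp_all add: M_iff mult.assoc[symmetric])
  \<comment> \<open>The P' component of the second equation solves for A1. Its N' component is the
    second equation of the smaller system.\<close>
  have A1: "A1 = A * (P' * S) + X * (N' * S) - P' * S * A"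
  proof -
    have "P' * (S * A + P * A1) = P' * (B * S)" by (simp add: e2)
    then show ?thesis by (simp add: algebra_simps cancel r' i)
  qed
  have k2: "N' * S * A = B2 * (N' * S)"
  proof -
    have "N' * (S * A + P * A1) = N' * (B * S)" by (simp add: e2)
    then show ?thesis by (simp add: algebra_simps cancel r')
  qed
  have "N' * (B * D - D * B) * P = N' * (S * W + P * V) * P" by (simp add: e5)
  then have k3: "B2 * (N' * (D * P)) - N' * (D * (P * A)) = N' * (S * (C1 * A)) - N' * (S * (A * C1))"
    by (simp add: algebra_simps cancel r r')
  have "N' * (B * D - D * B) * N = N' * (S * W + P * V) * N" by (simp add: e5)
  then have k4: "B2 * (N' * (D * N)) - N' * (D * (P * X)) - N' * (D * (N * B2)) = N' * (S * (W * N))"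
    by (simp add: algebra_simps cancel r r')
  have "P' * (B * D - D * B) * P = P' * (S * W + P * V) * P" by (simp add: e5)
  then have VP: "V * P = A * (P' * (D * P)) + X * (N' * (D * P)) - P' * (D * (P * A))
      - (P' * (S * (C1 * A)) - P' * (S * (A * C1)))"
    by (simp add: algebra_simps cancel r r' i)
  have WS: "W * S = (C1 * A - A * C1) * (P' * S) + W * N * (N' * S)"
    using arg_cong[OF decomp_r[OF m(4)], of "\<lambda>z. z * S"] by (simp add: algebra_simps r r')
  \<comment> \<open>Adding \<open>N' * S * C1\<close> to \<open>N' * D * P\<close> absorbs the
    commutator of C1 and A on the right of \<open>k3\<close>, since \<open>N' * S\<close> already
    intertwines A and B2.\<close>
  have q1: "(N' * D * P + N' * S * C1) * A = B2 * (N' * D * P + N' * S * C1)"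
  proof -
    have "(N' * D * P + N' * S * C1) * A - B2 * (N' * D * P + N' * S * C1)
      = (N' * S * A - B2 * (N' * S)) * C1 - (B2 * (N' * (D * P)) - N' * (D * (P * A)) - (N' * (S * (C1 * A)) - N' * (S * (A * C1))))"
      by (simp add: algebra_simps)
    then show ?thesis by (simp add: k2 k3)
  qed
  have q3: "(P' * D * P + C0 + (P' * S * C1 - C1 * (P' * S))) * A - A * (P' * D * P + C0 + (P' * S * C1 - C1 * (P' * S)))
     = X * (N' * D * P + N' * S * C1) + (W * N - C1 * X) * (N' * S)" (is "?l = ?r")
  proof -
    have "?l - ?r = (C0 * A - A * C0 + (C1 * A1 - A1 * C1)) - (W * S + V * P)"
      unfolding VP WS A1 by (simp add: algebra_simps)
    then show ?thesis by (simp add: e4)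
  qed
  have q4: "B2 * (N' * D * N) - N' * D * N * B2 = (N' * D * P + N' * S * C1) * X + N' * S * (W * N - C1 * X)"
    (is "?l = ?r")
  proof -
    have "?l - ?r = B2 * (N' * (D * N)) - N' * (D * (P * X)) - N' * (D * (N * B2)) - N' * (S * (W * N))"
      by (simp add: algebra_simps)
    then show ?thesis by (simp add: k4)
  qed
  have "X \<in> M a c" "B2 \<in> M c c" "W * N - C1 * X \<in> M a c"
    unfolding X_def B2_def using m M par by - (assumption | rule M_closed)+
  then show "f2 C1 x \<in> qsol a c (P' * D * P + C0 + (P' * S * C1 - C1 * (P' * S)), C', N' * D * N,
       N' * D * P + N' * S * C1, N' * S)"
    using m q1 k2 q3 q4 unfolding xe f2_def qsol_def by (simp add: X_def B2_def)
  have B: "P * A * P' + P * X * N' + N * B2 * N' = B"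
    using decomp_r[OF m(3)] r by (simp add: algebra_simps)
  have W: "(C1 * A - A * C1) * P' + W * N * N' = W"
    using decomp_r[OF m(4)] r by simp
  have "P' * (B * S - S * A) = A1"
    using e2 by (simp add: diff_eq_eq[symmetric] algebra_simps cancel i flip: e2)
  moreover have "P' * (B * D - D * B - S * W) = V"
    by (simp add: e5 algebra_simps cancel i)
  ultimately show "g2 C1 D S (f2 C1 x) = x"
    unfolding xe f2_def g2_def by (simp add: Let_def B[unfolded X_def B2_def] W)
qed

lemma g2_sol:
  assumes par: "C0 \<in> M a a" "C1 \<in> M a a" "D \<in> M b b" "S \<in> M b a"
    and y: "y \<in> qsol a c (P' * D * P + C0 + (P' * S * C1 - C1 * (P' * S)), C', N' * D * N,
       N' * D * P + N' * S * C1, N' * S)"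
  shows "g2 C1 D S y \<in> rsol a b (C0, C1, D, S, P)" "f2 C1 (g2 C1 D S y) = y"
proof -
  obtain A B2 X Y where ye: "y = (A, 0, B2, X, Y)"
    and m: "A \<in> M a a" "B2 \<in> M c c" "X \<in> M a c" "Y \<in> M a c"
    and e1: "(N' * D * P + N' * S * C1) * A = B2 * (N' * D * P + N' * S * C1)"
    and e2: "N' * S * A = B2 * (N' * S)"
    and e3: "(P' * D * P + C0 + (P' * S * C1 - C1 * (P' * S))) * A - A * (P' * D * P + C0 + (P' * S * C1 - C1 * (P' * S)))
     = X * (N' * D * P + N' * S * C1) + Y * (N' * S)"
    and e4: "B2 * (N' * D * N) - N' * D * N * B2 = (N' * D * P + N' * S * C1) * X + N' * S * Y"
    using y by (auto simp: qsol_def)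
  define B where "B = P * A * P' + P * X * N' + N * B2 * N'"
  define W where "W = (C1 * A - A * C1) * P' + (Y + C1 * X) * N'"
  define A1 where "A1 = P' * (B * S - S * A)"
  define V where "V = P' * (B * D - D * B - S * W)"
  have mm: "B \<in> M b b" "W \<in> M a b"
    unfolding B_def W_def using m M par by - (assumption | rule M_closed)+
  have mm': "A1 \<in> M a a" "V \<in> M a b"
    unfolding A1_def V_def using mm m M par by - (assumption | rule M_closed)+
  have g: "g2 C1 D S y = (A, A1, B, W, V)"
    unfolding ye g2_def A1_def V_def W_def B_def by (simp add: Let_def)
  have i: "idm a * (A * z) = A * z" "idm c * (B2 * z) = B2 * z" "idm a * (X * z) = X * z"
     "A * idm a = A" "X * idm c = X" "B2 * idm c = B2" "C1 * idm a = C1" "Y * idm c = Y"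
     "idm a * A = A" "idm a * X = X" "idm c * B2 = B2" for z
    using m par by (simp_all add: M_iff mult.assoc[symmetric])
  have r: "P' * B = A * P' + X * N'" "N' * B = B2 * N'" "B * N = P * X + N * B2" "B * P = P * A"
     "W * P = C1 * A - A * C1" "W * N = Y + C1 * X"
    unfolding B_def W_def using m by (simp_all add: algebra_simps cancel i)
  have r': "P' * (B * z) = A * (P' * z) + X * (N' * z)" "N' * (B * z) = B2 * (N' * z)"
    "B * (N * z) = P * (X * z) + N * (B2 * z)" "B * (P * z) = P * (A * z)"
    "W * (P * z) = (C1 * A - A * C1) * z" "W * (N * z) = (Y + C1 * X) * z" for z
    by (simp_all only: mult.assoc[symmetric] distrib_right[symmetric] r)
  have e2': "N' * (S * A) = B2 * (N' * S)" "N' * (S * (A * z)) = B2 * (N' * (S * z))" for z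
    using e2 by (simp_all only: mult.assoc[symmetric])
  have A1: "A1 = A * (P' * S) + X * (N' * S) - P' * S * A"
    unfolding A1_def by (simp add: algebra_simps r r')
  have q2: "S * A + P * A1 = B * S"
  proof (rule eq_l[of _ a])
    show "P' * (S * A + P * A1) = P' * (B * S)"
      using mm'(1) by (simp add: distrib_left cancel idm_times) (simp add: A1_def algebra_simps)
    show "N' * (S * A + P * A1) = N' * (B * S)"
      by (simp add: algebra_simps cancel r' e2')
  qed (use m mm mm' par M in \<open>simp_all add: M_closed\<close>)
  have q5: "B * D - D * B = S * W + P * V"
  proof (rule eq_l[of _ b])
    show "P' * (B * D - D * B) = P' * (S * W + P * V)"
      using mm'(2) by (simp add: distrib_left cancel idm_times) (simp add: V_def algebra_simps)
    show "N' * (B * D - D * B) = N' * (S * W + P * V)"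
    proof (rule eq_r[of _ c])
      have "N' * (B * D - D * B) * P - N' * (S * W + P * V) * P
        = (N' * S * A - B2 * (N' * S)) * C1 + B2 * (N' * D * P + N' * S * C1) - (N' * D * P + N' * S * C1) * A"
        by (simp add: algebra_simps cancel r r')
      then show "N' * (B * D - D * B) * P = N' * (S * W + P * V) * P"
        by (simp add: e1 e2)
      have "N' * (B * D - D * B) * N - N' * (S * W + P * V) * N
        = (B2 * (N' * D * N) - N' * D * N * B2) - ((N' * D * P + N' * S * C1) * X + N' * S * Y)"
        by (simp add: algebra_simps cancel r r')
      then show "N' * (B * D - D * B) * N = N' * (S * W + P * V) * N"
        by (simp add: e4)
    qed (insert m mm mm' par M, (assumption | rule M_closed)+)
  qed (insert m mm mm' par M, (assumption | rule M_closed)+)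
  have VP: "V * P = A * (P' * (D * P)) + X * (N' * (D * P)) - P' * (D * (P * A))
      - (P' * (S * (C1 * A)) - P' * (S * (A * C1)))"
    unfolding V_def by (simp add: algebra_simps r r')
  have WS: "W * S = (C1 * A - A * C1) * (P' * S) + (Y + C1 * X) * (N' * S)"
    unfolding W_def by (simp add: algebra_simps)
  have q4: "C0 * A - A * C0 + (C1 * A1 - A1 * C1) = W * S + V * P" (is "?l = ?r")
  proof -
    have "?l - ?r = ((P' * D * P + C0 + (P' * S * C1 - C1 * (P' * S))) * A - A * (P' * D * P + C0 + (P' * S * C1 - C1 * (P' * S))))
      - (X * (N' * D * P + N' * S * C1) + Y * (N' * S))"
      unfolding VP WS A1 by (simp add: algebra_simps)
    then show ?thesis by (simp add: e3)
  qed
  show "g2 C1 D S y \<in> rsol a b (C0, C1, D, S, P)"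
    unfolding g rsol_def using m mm mm' q2 q4 q5 r by simp
  show "f2 C1 (g2 C1 D S y) = y"
    unfolding g unfolding f2_def ye using r by (simp add: r r' cancel algebra_simps i)
qed

text \<open>Only the diagonal components enter \<open>ev\<close>, and in those \<open>g2\<close>
  coincides with \<open>g1\<close>.\<close>

lemma ev2: "ev a c y k \<Longrightarrow> ev a b (g2 C1 D S y) k"
  using ev1[of y k 0 0] by (cases y) (simp add: ev_def g1_def g2_def Let_def)

text \<open>Reduction of r(b, a) to r(b - a, a) when T = P' is surjective and the parameters are
  normalised to S = 0 and \<open>C1 * P = 0\<close>. The relation \<open>P' * A0 = B * P'\<close>
  makes A0 triangular with quotient B, \<open>P' * A1 = 0\<close> puts A1 into the image of N, and W
  and V are determined by the rest.\<close>

definition f3 :: "'a t5 \<Rightarrow> 'a t5" where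
  "f3 = (\<lambda>(A0, A1, B, W, V). (N' * A0 * N, N' * A1 * N, B, N' * A0 * P, N' * A1 * P))"

definition g3 :: "'a fm \<Rightarrow> 'a fm \<Rightarrow> 'a t5 \<Rightarrow> 'a t5" where
  "g3 C0 C1 = (\<lambda>(A2, A3, B, W, V).
     let A0 = P * B * P' + N * W * P' + N * A2 * N'; A1 = N * V * P' + N * A3 * N'
     in (A0, A1, B, C1 * A0 * P, (C0 * A0 - A0 * C0 + (C1 * A1 - A1 * C1)) * P))"

lemma f3_sol:
  assumes par: "C0 \<in> M b b" "C1 \<in> M b b" "C1 * P = 0" "D \<in> M a a"
    and x: "x \<in> rsol b a (C0, C1, D, 0, P')"
  shows "f3 x \<in> rsol c a (N' * C0 * N, N' * C1 * N, D + P' * C0 * P, P' * C0 * N, P' * C1 * N)"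
    "g3 C0 C1 (f3 x) = x"
proof -
  obtain A0 A1 B W V where xe: "x = (A0, A1, B, W, V)"
    and m: "A0 \<in> M b b" "A1 \<in> M b b" "B \<in> M a a" "W \<in> M b a" "V \<in> M b a"
    and e1: "P' * A0 = B * P'" and e2: "P' * A1 = 0" and e3: "C1 * A0 - A0 * C1 = W * P'"
    and e4: "C0 * A0 - A0 * C0 + (C1 * A1 - A1 * C1) = V * P'"
    and e5: "B * D - D * B = P' * V"
    using x by (auto simp: rsol_def)
  define A2 where "A2 = N' * A0 * N"
  define A3 where "A3 = N' * A1 * N"
  define W' where "W' = N' * A0 * P"
  define V' where "V' = N' * A1 * P"
  have i: "B * idm a = B" "W * idm a = W" "V * idm a = V" using m by (simp_all add: M_iff)
  have z: "P' * A0 * N = 0" "P' * A0 * P = B" by (simp_all add: e1 mult.assoc cancel i)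
  have r: "A0 * N = N * A2" "A0 * P = P * B + N * W'" "N' * A0 = W' * P' + A2 * N'"
    "A1 * N = N * A3" "A1 * P = N * V'" "N' * A1 = V' * P' + A3 * N'"
    unfolding A2_def A3_def W'_def V'_def
    using decomp_l[of "A0 * N" c] decomp_l[of "A0 * P" a] decomp_r[of "N' * A0" c]
      decomp_l[of "A1 * N" c] decomp_l[of "A1 * P" a] decomp_r[of "N' * A1" c] m M z e2
    by (simp_all add: M_closed mult.assoc[symmetric])
  note r = r e1 e2 par(3)
  have r': "A0 * (N * z) = N * (A2 * z)" "A0 * (P * z) = P * (B * z) + N * (W' * z)"
    "N' * (A0 * z) = W' * (P' * z) + A2 * (N' * z)" "A1 * (N * z) = N * (A3 * z)"
    "A1 * (P * z) = N * (V' * z)" "N' * (A1 * z) = V' * (P' * z) + A3 * (N' * z)"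
    "P' * (A0 * z) = B * (P' * z)" "P' * (A1 * z) = 0" "C1 * (P * z) = 0" for z
    by (simp_all only: mult.assoc[symmetric] distrib_right[symmetric] r mult_zero_left)
  \<comment> \<open>The third and fourth equations are cut into blocks. Right multiplication by N
    kills the terms ending in P', which contain W and V, and leaves the first four equations of the
    smaller system.\<close>
  have "P' * (C1 * A0 - A0 * C1) * N = P' * (W * P') * N" by (simp add: e3)
  then have q1: "P' * C1 * N * A2 = B * (P' * C1 * N)"
    by (simp add: algebra_simps cancel r r')
  have "P' * (C0 * A0 - A0 * C0 + (C1 * A1 - A1 * C1)) * N = P' * (V * P') * N" by (simp add: e4)
  then have q2: "P' * C0 * N * A2 + P' * C1 * N * A3 = B * (P' * C0 * N)"
    by (simp add: algebra_simps cancel r r')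
  have "N' * (C1 * A0 - A0 * C1) * N = N' * (W * P') * N" by (simp add: e3)
  then have q3: "N' * C1 * N * A2 - A2 * (N' * C1 * N) = W' * (P' * C1 * N)"
    by (simp add: algebra_simps cancel r r')
  have "N' * (C0 * A0 - A0 * C0 + (C1 * A1 - A1 * C1)) * N = N' * (V * P') * N" by (simp add: e4)
  then have q4: "N' * C0 * N * A2 - A2 * (N' * C0 * N) + (N' * C1 * N * A3 - A3 * (N' * C1 * N))
      = W' * (P' * C0 * N) + V' * (P' * C1 * N)"
    by (simp add: algebra_simps cancel r r')
  \<comment> \<open>In the remaining corner the fifth equation replaces \<open>P' * V\<close> by the
    commutator of B and D.\<close>
  have "P' * (C0 * A0 - A0 * C0 + (C1 * A1 - A1 * C1)) * P = P' * (V * P') * P" by (simp add: e4)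
  then have "P' * (C0 * A0 - A0 * C0 + (C1 * A1 - A1 * C1)) * P = B * D - D * B" 
    unfolding e5 by (simp add: mult.assoc cancel i)
  then have q5: "B * (D + P' * C0 * P) - (D + P' * C0 * P) * B = P' * C0 * N * W' + P' * C1 * N * V'"
    by (simp add: algebra_simps cancel r r')
  have "A2 \<in> M c c" "A3 \<in> M c c" "W' \<in> M c a" "V' \<in> M c a"
    unfolding A2_def A3_def W'_def V'_def using m M par by - (assumption | rule M_closed)+
  then show "f3 x \<in> rsol c a (N' * C0 * N, N' * C1 * N, D + P' * C0 * P, P' * C0 * N, P' * C1 * N)"
    using m q1 q2 q3 q4 q5 unfolding xe f3_def rsol_def by (simp add: A2_def A3_def W'_def V'_def)
  have A0: "P * B * P' + N * W' * P' + N * A2 * N' = A0"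
    using decomp_r[OF m(1)] r by (simp add: algebra_simps)
  have A1: "N * V' * P' + N * A3 * N' = A1"
    using decomp_r[OF m(2)] r by (simp add: algebra_simps)
  have "C1 * A0 * P = (C1 * A0 - A0 * C1) * P" by (simp add: algebra_simps r)
  then have W: "C1 * A0 * P = W" by (simp add: e3 mult.assoc cancel i)
  have V: "(C0 * A0 - A0 * C0 + (C1 * A1 - A1 * C1)) * P = V" by (simp add: e4 mult.assoc cancel i)
  show "g3 C0 C1 (f3 x) = x"
    unfolding xe f3_def g3_def
    using A0 A1 W V unfolding A2_def A3_def W'_def V'_def by (simp add: Let_def)
qed

lemma g3_sol:
  assumes par: "C0 \<in> M b b" "C1 \<in> M b b" "C1 * P = 0" "D \<in> M a a"
    and y: "y \<in> rsol c a (N' * C0 * N, N' * C1 * N, D + P' * C0 * P, P' * C0 * N, P' * C1 * N)"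
  shows "g3 C0 C1 y \<in> rsol b a (C0, C1, D, 0, P')" "f3 (g3 C0 C1 y) = y"
proof -
  obtain A2 A3 B W' V' where ye: "y = (A2, A3, B, W', V')"
    and m: "A2 \<in> M c c" "A3 \<in> M c c" "B \<in> M a a" "W' \<in> M c a" "V' \<in> M c a"
    and e1: "P' * C1 * N * A2 = B * (P' * C1 * N)"
    and e2: "P' * C0 * N * A2 + P' * C1 * N * A3 = B * (P' * C0 * N)"
    and e3: "N' * C1 * N * A2 - A2 * (N' * C1 * N) = W' * (P' * C1 * N)"
    and e4: "N' * C0 * N * A2 - A2 * (N' * C0 * N) + (N' * C1 * N * A3 - A3 * (N' * C1 * N))
      = W' * (P' * C0 * N) + V' * (P' * C1 * N)"
    and e5: "B * (D + P' * C0 * P) - (D + P' * C0 * P) * B = P' * C0 * N * W' + P' * C1 * N * V'"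
    using y by (auto simp: rsol_def)
  define A0 where "A0 = P * B * P' + N * W' * P' + N * A2 * N'"
  define A1 where "A1 = N * V' * P' + N * A3 * N'"
  define W where "W = C1 * A0 * P"
  define V where "V = (C0 * A0 - A0 * C0 + (C1 * A1 - A1 * C1)) * P"
  have mm: "A0 \<in> M b b" "A1 \<in> M b b"
    unfolding A0_def A1_def using m M par by - (assumption | rule M_closed)+
  have mm': "W \<in> M b a" "V \<in> M b a"
    unfolding W_def V_def using mm m M par by - (assumption | rule M_closed)+
  have g: "g3 C0 C1 y = (A0, A1, B, W, V)"
    unfolding ye g3_def W_def V_def A0_def A1_def by (simp add: Let_def)
  have i: "idm c * (A2 * z) = A2 * z" "idm c * (A3 * z) = A3 * z" "idm c * (W' * z) = W' * z"
     "idm c * (V' * z) = V' * z" "idm a * (B * z) = B * z"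
     "A2 * idm c = A2" "A3 * idm c = A3" "W' * idm a = W'" "V' * idm a = V'" "B * idm a = B"
     "idm c * A2 = A2" "idm c * A3 = A3" "idm c * W' = W'" "idm c * V' = V'" "idm a * B = B" for z
    using m par by (simp_all add: M_iff mult.assoc[symmetric])
  have r: "A0 * N = N * A2" "A0 * P = P * B + N * W'" "N' * A0 = W' * P' + A2 * N'"
    "A1 * N = N * A3" "A1 * P = N * V'" "N' * A1 = V' * P' + A3 * N'" "P' * A0 = B * P'" "P' * A1 = 0"
    unfolding A0_def A1_def using m by (simp_all add: algebra_simps cancel i)
  note r = r par(3)
  have r': "A0 * (N * z) = N * (A2 * z)" "A0 * (P * z) = P * (B * z) + N * (W' * z)"
    "N' * (A0 * z) = W' * (P' * z) + A2 * (N' * z)" "A1 * (N * z) = N * (A3 * z)"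
    "A1 * (P * z) = N * (V' * z)" "N' * (A1 * z) = V' * (P' * z) + A3 * (N' * z)"
    "P' * (A0 * z) = B * (P' * z)" "P' * (A1 * z) = 0" "C1 * (P * z) = 0" for z
    by (simp_all only: mult.assoc[symmetric] distrib_right[symmetric] r mult_zero_left)
  have q3: "C1 * A0 - A0 * C1 = W * P'"
  proof (rule eq_r[of _ b])
    show "(C1 * A0 - A0 * C1) * P = W * P' * P"
      using mm'(1) by (simp add: mult.assoc cancel times_idm) (simp add: W_def algebra_simps r)
    show "(C1 * A0 - A0 * C1) * N = W * P' * N"
    proof (rule eq_l[of _ c])
      show "P' * ((C1 * A0 - A0 * C1) * N) = P' * (W * P' * N)"
        using e1 by (simp add: algebra_simps cancel r r')
      show "N' * ((C1 * A0 - A0 * C1) * N) = N' * (W * P' * N)"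
        using e3 by (simp add: algebra_simps cancel r r')
    qed (insert m mm mm' par M, (assumption | rule M_closed)+)
  qed (insert m mm mm' par M, (assumption | rule M_closed)+)
  have q4: "C0 * A0 - A0 * C0 + (C1 * A1 - A1 * C1) = V * P'"
  proof (rule eq_r[of _ b])
    show "(C0 * A0 - A0 * C0 + (C1 * A1 - A1 * C1)) * P = V * P' * P"
      using mm'(2) by (simp add: mult.assoc cancel times_idm) (simp add: V_def algebra_simps r)
    show "(C0 * A0 - A0 * C0 + (C1 * A1 - A1 * C1)) * N = V * P' * N"
    proof (rule eq_l[of _ c])
      show "P' * ((C0 * A0 - A0 * C0 + (C1 * A1 - A1 * C1)) * N) = P' * (V * P' * N)"
        using e2 by (simp add: algebra_simps cancel r r')
      show "N' * ((C0 * A0 - A0 * C0 + (C1 * A1 - A1 * C1)) * N) = N' * (V * P' * N)"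
        using e4 by (simp add: algebra_simps cancel r r')
    qed (insert m mm mm' par M, (assumption | rule M_closed)+)
  qed (insert m mm mm' par M, (assumption | rule M_closed)+)
  have q5: "B * D - D * B = P' * V"
    using e5 by (simp add: V_def algebra_simps cancel r r')
  show "g3 C0 C1 y \<in> rsol b a (C0, C1, D, 0, P')"
    unfolding g rsol_def using m mm mm' q3 q4 q5 r by simp
  show "f3 (g3 C0 C1 y) = y"
    unfolding g unfolding f3_def ye by (simp add: r r' cancel algebra_simps i)
qed

text \<open>Now B is kept, and a column eigenvector v of the small block is carried to
  \<open>N * v\<close>, because A0 preserves the image of N.\<close>

lemma ev3: "ev c a y k \<Longrightarrow> ev b a (g3 C0 C1 y) k"
proof -
  assume *: "ev c a y k"
  obtain A2 A3 B W V where ye: "y = (A2, A3, B, W, V)" by (cases y)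
  from * consider v where "v \<noteq> 0" "idm c * v = v" "A2 * v = sm k v" | v where "v \<noteq> 0" "v * idm a = v" "v * B = sm k v"
    unfolding ev_def ye by auto
  then show ?thesis
  proof cases
    case 2 then show ?thesis unfolding ev_def ye g3_def by (auto simp: Let_def)
  next
    case 1
    have "N * v \<noteq> 0"
    proof
      assume "N * v = 0"
      then have "N' * (N * v) = 0" by simp
      then show False using 1 by (simp add: cancel)
    qed
    moreover have "(P * B * P' + N * W * P' + N * A2 * N') * (N * v) = sm k (N * v)"
      using 1 by (simp add: algebra_simps cancel)
    moreover have "idm b * (N * v) = N * v" by (simp add: mult.assoc[symmetric])
    ultimately show ?thesis unfolding ev_def ye g3_def Let_def by auto
  qed
qed

lemma lin5_maps: "lin5 f1" "lin5 (g1 D Q)" "lin5 (f2 C1)" "lin5 (g2 C1 D S)" "lin5 f3" "lin5 (g3 C0 C1)"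
  unfolding lin5_def smt_def f1_def g1_def f2_def g2_def f3_def g3_def Let_def
  by (simp_all add: algebra_simps fm.scale_right_distrib fm.scale_right_diff_distrib split: prod.splits)

lemma one_maps:
  "f1 (one5 a b) = one5 a c" "f2 C1 (one5 a b) = one5 a c" "f3 (one5 b a) = one5 c a"
  "D \<in> M b b \<Longrightarrow> g1 D Q (one5 a c) = one5 a b"
  "C1 \<in> M a a \<Longrightarrow> D \<in> M b b \<Longrightarrow> S \<in> M b a \<Longrightarrow> g2 C1 D S (one5 a c) = one5 a b"
  "C0 \<in> M b b \<Longrightarrow> C1 \<in> M b b \<Longrightarrow> C1 * P = 0 \<Longrightarrow> g3 C0 C1 (one5 c a) = one5 b a"
  unfolding f1_def f2_def f3_def g1_def g2_def g3_def one5_def Let_def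
  by (simp_all add: cancel mult.assoc one M_iff)

end

text \<open>Conjugation by the unipotent element with Z in the A1 block. On forms it shifts S by
  \<open>T * Z\<close>, so S can be cleared when T is surjective.\<close>

definition gauge1 :: "'a::field fm \<Rightarrow> 'a t5 \<Rightarrow> 'a t5" where
  "gauge1 Z = (\<lambda>(A0, A1, B, W, V). (A0, A1 + (A0 * Z - Z * A0), B, W, V - Z * W))"

lemma gauge1_sol:
  assumes "Z \<in> M a a" "x \<in> rsol a b (C0, C1, D, S, T)"
  shows "gauge1 Z x \<in> rsol a b (C0 + (C1 * Z - Z * C1), C1, D, S + T * Z, T)"
proof -
  obtain A0 A1 B W V where xe: "x = (A0, A1, B, W, V)"
    and m: "A0 \<in> M a a" "A1 \<in> M a a" "B \<in> M b b" "W \<in> M a b" "V \<in> M a b"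
    and e1: "T * A0 = B * T" and e2: "S * A0 + T * A1 = B * S" and e3: "C1 * A0 - A0 * C1 = W * T"
    and e4: "C0 * A0 - A0 * C0 + (C1 * A1 - A1 * C1) = W * S + V * T"
    and e5: "B * D - D * B = S * W + T * V"
    using assms(2) by (auto simp: rsol_def)
  have "(S + T * Z) * A0 + T * (A1 + (A0 * Z - Z * A0)) - B * (S + T * Z) 
      = (S * A0 + T * A1 - B * S) + (T * A0 - B * T) * Z" by (simp add: algebra_simps)
  then have q2: "(S + T * Z) * A0 + T * (A1 + (A0 * Z - Z * A0)) = B * (S + T * Z)"
    by (simp add: e1 e2)
  have "(C0 + (C1 * Z - Z * C1)) * A0 - A0 * (C0 + (C1 * Z - Z * C1)) +
      (C1 * (A1 + (A0 * Z - Z * A0)) - (A1 + (A0 * Z - Z * A0)) * C1) - (W * (S + T * Z) + (V - Z * W) * T)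
    = (C0 * A0 - A0 * C0 + (C1 * A1 - A1 * C1) - (W * S + V * T)) + (C1 * A0 - A0 * C1 - W * T) * Z
      - Z * (C1 * A0 - A0 * C1 - W * T)" by (simp add: algebra_simps)
  then have q4: "(C0 + (C1 * Z - Z * C1)) * A0 - A0 * (C0 + (C1 * Z - Z * C1)) +
      (C1 * (A1 + (A0 * Z - Z * A0)) - (A1 + (A0 * Z - Z * A0)) * C1) = W * (S + T * Z) + (V - Z * W) * T"
    by (simp add: e3 e4)
  have q5: "B * D - D * B = (S + T * Z) * W + T * (V - Z * W)" by (simp add: e5 algebra_simps)
  have "A1 + (A0 * Z - Z * A0) \<in> M a a" "V - Z * W \<in> M a b"
    using m assms(1) by - (assumption | rule M_closed)+
  then show ?thesis unfolding xe gauge1_def rsol_def using m e1 e3 q2 q4 q5 by simp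
qed

text \<open>Conjugation by the unipotent element with z in the W block. Once S = 0 it replaces C1 by
  \<open>C1 - z * T\<close>.\<close>

definition gauge2 :: "'a::field fm \<Rightarrow> 'a t5 \<Rightarrow> 'a t5" where
  "gauge2 z = (\<lambda>(A0, A1, B, W, V). (A0, A1, B, W + (A0 * z - z * B), V + A1 * z))"

lemma gauge2_sol:
  assumes "z \<in> M a b" "x \<in> rsol a b (C0, C1, D, 0, T)"
  shows "gauge2 z x \<in> rsol a b (C0, C1 - z * T, D, 0, T)"
proof -
  obtain A0 A1 B W V where xe: "x = (A0, A1, B, W, V)"
    and m: "A0 \<in> M a a" "A1 \<in> M a a" "B \<in> M b b" "W \<in> M a b" "V \<in> M a b"
    and e1: "T * A0 = B * T" and e2: "T * A1 = 0" and e3: "C1 * A0 - A0 * C1 = W * T"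
    and e4: "C0 * A0 - A0 * C0 + (C1 * A1 - A1 * C1) = V * T"
    and e5: "B * D - D * B = T * V"
    using assms(2) by (auto simp: rsol_def)
  have "(C1 - z * T) * A0 - A0 * (C1 - z * T) - (W + (A0 * z - z * B)) * T
     = (C1 * A0 - A0 * C1 - W * T) - z * (T * A0 - B * T)" by (simp add: algebra_simps)
  then have q3: "(C1 - z * T) * A0 - A0 * (C1 - z * T) = (W + (A0 * z - z * B)) * T"
    by (simp add: e1 e3)
  have "C0 * A0 - A0 * C0 + ((C1 - z * T) * A1 - A1 * (C1 - z * T)) - (V + A1 * z) * T
    = (C0 * A0 - A0 * C0 + (C1 * A1 - A1 * C1) - V * T) - z * (T * A1)" by (simp add: algebra_simps)
  then have q4: "C0 * A0 - A0 * C0 + ((C1 - z * T) * A1 - A1 * (C1 - z * T)) = (V + A1 * z) * T"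
    by (simp add: e2 e4)
  have q5: "B * D - D * B = T * (V + A1 * z)" by (simp add: e5 distrib_left mult.assoc[symmetric] e2)
  have "W + (A0 * z - z * B) \<in> M a b" "V + A1 * z \<in> M a b"
    using m assms(1) by - (assumption | rule M_closed)+
  then show ?thesis unfolding xe gauge2_def rsol_def using m e1 e2 q3 q4 q5 by simp
qed

lemma gauge_inv: "gauge1 Z (gauge1 (- Z) x) = x" "gauge2 z (gauge2 (- z) x) = x"
  by (auto simp: gauge1_def gauge2_def algebra_simps split: prod.splits)

lemma gauge_lin: "lin5 (gauge1 Z)" "lin5 (gauge2 z)"
  unfolding lin5_def smt_def gauge1_def gauge2_def
  by (simp_all add: algebra_simps fm.scale_right_distrib fm.scale_right_diff_distrib split: prod.splits)

lemma gauge_one: "Z \<in> M a a \<Longrightarrow> gauge1 Z (one5 a b) = one5 a b" "z \<in> M a b \<Longrightarrow> gauge2 z (one5 a b) = one5 a b"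
  by (auto simp: gauge1_def gauge2_def one5_def M_iff)

text \<open>Transposition identifies q(a, b) with q(b, a), so for q only the case of a at most b
  needs a reduction.\<close>

definition swap5 :: "'a::field t5 \<Rightarrow> 'a t5" where
  "swap5 = (\<lambda>(A, A1, B, X, Y). (tpose B, 0, tpose A, tpose X, tpose Y))"

lemma swap5_sol:
  assumes "x \<in> qsol a b (C, C1, D, P, Q)"
  shows "swap5 x \<in> qsol b a (tpose D, C1', tpose C, tpose P, tpose Q)"
proof -
  obtain A B X Y where xe: "x = (A, 0, B, X, Y)"
    and m: "A \<in> M a a" "B \<in> M b b" "X \<in> M a b" "Y \<in> M a b"
    and e: "P * A = B * P" "Q * A = B * Q" "C * A - A * C = X * P + Y * Q" "B * D - D * B = P * X + Q * Y"
    using assms by (auto simp: qsol_def)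
  note e' = e[THEN arg_cong[of _ _ tpose], unfolded tpose_times tpose_add tpose_diff]
  show ?thesis unfolding xe swap5_def qsol_def
    using m e'(1,2)[symmetric] e'(3,4) by (simp only: M_tpose split_conv mem_Collect_eq simp_thms)
qed

lemma swap5_swap5: "x \<in> qsol a b G \<Longrightarrow> swap5 (swap5 x) = x"
  by (auto simp: swap5_def qsol_def split: prod.splits)

lemma swap5_lin: "lin5 swap5"
  unfolding lin5_def smt_def swap5_def by (auto simp: tpose_add tpose_sm split: prod.splits)

lemma swap5_one: "swap5 (one5 a b) = one5 b a"
  by (simp add: swap5_def one5_def)

lemma tpose_eq_0 [simp]: "tpose v = 0 \<longleftrightarrow> v = (0 :: 'a::field fm)"
  by (metis tpose_tpose tpose_zero)

lemma swap5_ev: "ev a b x k \<Longrightarrow> ev b a (swap5 x) k"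
proof -
  assume *: "ev a b x k"
  obtain A A1 B X Y where xe: "x = (A, A1, B, X, Y)" by (cases x)
  from * consider v where "v \<noteq> 0" "idm a * v = v" "A * v = sm k v" | v where "v \<noteq> 0" "v * idm b = v" "v * B = sm k v"
    unfolding ev_def xe by auto
  then have "\<exists>v. v \<noteq> 0 \<and> ((v * idm a = v \<and> v * tpose A = sm k v) \<or> (idm b * v = v \<and> tpose B * v = sm k v))"
  proof cases
    case 1
    show ?thesis using 1(1) 1(2,3)[THEN arg_cong[of _ _ tpose]]
      by (intro exI[of _ "tpose v"]) (simp add: tpose_times tpose_sm)
  next
    case 2
    show ?thesis using 2(1) 2(2,3)[THEN arg_cong[of _ _ tpose]]
      by (intro exI[of _ "tpose v"]) (simp add: tpose_times tpose_sm)
  qed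
  then show ?thesis unfolding ev_def xe swap5_def by auto
qed

section \<open>Genericity\<close>

definition polyfun :: "('a::comm_ring_1 \<Rightarrow> 'a) \<Rightarrow> bool" where
  "polyfun f \<longleftrightarrow> (\<exists>p. \<forall>t. f t = poly p t)"

lemma polyfun_const: "polyfun (\<lambda>t. c)"
  unfolding polyfun_def by (rule exI[of _ "[:c:]"]) simp

lemma polyfun_id: "polyfun (\<lambda>t. t)"
  unfolding polyfun_def by (rule exI[of _ "[:0, 1:]"]) simp

lemma polyfun_add: "polyfun f \<Longrightarrow> polyfun g \<Longrightarrow> polyfun (\<lambda>t. f t + g t)"
  unfolding polyfun_def by (metis poly_add)

lemma polyfun_diff: "polyfun f \<Longrightarrow> polyfun g \<Longrightarrow> polyfun (\<lambda>t. f t - g t)"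
  unfolding polyfun_def by (metis poly_diff)

lemma polyfun_mult: "polyfun f \<Longrightarrow> polyfun g \<Longrightarrow> polyfun (\<lambda>t. f t * g t)"
  unfolding polyfun_def by (metis poly_mult)

lemma polyfun_sum: "(\<And>a. a \<in> A \<Longrightarrow> polyfun (f a)) \<Longrightarrow> polyfun (\<lambda>t. \<Sum>a\<in>A. f a t)"
  by (induction A rule: infinite_finite_induct) (auto intro: polyfun_const polyfun_add)

lemma polyfun_prod: "(\<And>a. a \<in> A \<Longrightarrow> polyfun (f a)) \<Longrightarrow> polyfun (\<lambda>t. \<Prod>a\<in>A. f a t)"
  by (induction A rule: infinite_finite_induct) (auto intro: polyfun_const polyfun_mult)

lemma polyfun_det:
  assumes "\<And>i j. i < n \<Longrightarrow> j < n \<Longrightarrow> polyfun (\<lambda>t. A t i j)"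
  shows "polyfun (\<lambda>t. det (mat n n (\<lambda>(i, j). A t i j)))"
proof -
  have e: "det (mat n n (\<lambda>(i, j). A t i j)) =
      (\<Sum>p | p permutes {0..<n}. signof p * (\<Prod>i = 0..<n. A t i (p i)))" for t
    unfolding det_def'[OF mat_carrier] by (intro sum.cong arg_cong2[of _ _ _ _ "(*)"] prod.cong refl) auto
  have "polyfun (\<lambda>t. A t i (p i))" if "p permutes {0..<n}" "i \<in> {0..<n}" for p i
    using that assms by auto
  then show ?thesis unfolding e by (intro polyfun_sum polyfun_mult polyfun_const polyfun_prod) auto
qed

lemma polyfun_finite:
  fixes f :: "'a::idom \<Rightarrow> 'a"
  assumes "polyfun f" "f t0 \<noteq> 0"
  shows "finite {t. f t = 0}"
proof -
  obtain p where p: "\<And>t. f t = poly p t" using assms(1) unfolding polyfun_def by auto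
  then have "p \<noteq> 0" using assms(2) by auto
  then show ?thesis unfolding p by (rule poly_roots_finite)
qed

text \<open>For t nonzero the matrix is t times 1 + s P with s = 1/t. The determinant of 1 + s P is
  a polynomial in s with value 1 at s = 0.\<close>

lemma invertible_generic:
  fixes P :: "'a::field fm"
  assumes P: "P \<in> M n n"
  shows "finite {t. \<not> (\<exists>h \<in> M n n. (P + sm t (idm n)) * h = idm n \<and> h * (P + sm t (idm n)) = idm n)}"
    (is "finite ?bad")
proof -
  define A where "A = (\<lambda>s i j. s * ent P i j + (if i = j then 1 else 0))"
  define d where "d = (\<lambda>s. det (mat n n (\<lambda>(i, j). A s i j)))"
  have "mat n n (\<lambda>(i, j). A 0 i j) = 1\<^sub>m n" by (rule eq_matI) (auto simp: A_def)
  then have "d 0 \<noteq> 0" by (simp add: d_def)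
  moreover have "polyfun d" unfolding d_def A_def
    by (intro polyfun_det polyfun_add polyfun_mult polyfun_id polyfun_const)
  ultimately have fin: "finite {s. d s = 0}" by (rule polyfun_finite[rotated])
  have "?bad \<subseteq> insert 0 (inverse ` {s. d s = 0})"
  proof
    fix t assume t: "t \<in> ?bad"
    show "t \<in> insert 0 (inverse ` {s. d s = 0})"
    proof (rule ccontr)
      assume "\<not> ?thesis"
      then have t0: "t \<noteq> 0" and "d (inverse t) \<noteq> 0" by (auto simp: image_iff)
      let ?m = "mat n n (\<lambda>(i, j). A (inverse t) i j)"
      have m: "?m \<in> carrier_mat n n" "det ?m \<noteq> 0" using \<open>d (inverse t) \<noteq> 0\<close> by (auto simp: d_def)
      have "of_mat ?m = sm (inverse t) (P + sm t (idm n))"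
        using t0 M_D[OF P] by (intro fm_eqI) (auto simp: ent_of_mat A_def ent_idm field_simps)
      then have "(P + sm t (idm n)) * sm (inverse t) (of_mat (mat_inv ?m)) = idm n"
          "sm (inverse t) (of_mat (mat_inv ?m)) * (P + sm t (idm n)) = idm n"
        using mat_inv[OF m] by simp_all
      moreover have "sm (inverse t) (of_mat (mat_inv ?m)) \<in> M n n"
        by (intro M_sm M_of_mat mat_inv_carrier m)
      ultimately show False using t by blast
    qed
  qed
  then show ?thesis using fin by (meson finite_imageI finite_insert finite_subset)
qed

definition lf :: "('a::field fm \<Rightarrow> 'a) \<Rightarrow> bool" where
  "lf \<beta> \<longleftrightarrow> (\<forall>x y. \<beta> (x + y) = \<beta> x + \<beta> y) \<and> (\<forall>c x. \<beta> (sm c x) = c * \<beta> x)"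

lemma lf_add: "lf \<beta> \<Longrightarrow> \<beta> (x + y) = \<beta> x + \<beta> y" by (simp add: lf_def)
lemma lf_sm: "lf \<beta> \<Longrightarrow> \<beta> (sm c x) = c * \<beta> x" by (simp add: lf_def)
lemma lf_zero: "lf \<beta> \<Longrightarrow> \<beta> 0 = 0" using lf_sm[of \<beta> 0 0] by simp
lemma lf_diff: "lf \<beta> \<Longrightarrow> \<beta> (x - y) = \<beta> x - \<beta> y" using lf_add[of \<beta> "x - y" y] by simp
lemma lf_sum: "lf \<beta> \<Longrightarrow> \<beta> (sum f A) = (\<Sum>a\<in>A. \<beta> (f a))"
  by (induction A rule: infinite_finite_induct) (auto simp: lf_zero lf_add)
lemma lf_comb: "lf \<beta> \<Longrightarrow> lf \<gamma> \<Longrightarrow> lf (\<lambda>x. \<beta> x + t * \<gamma> x)"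
  by (simp add: lf_def algebra_simps)

text \<open>The stabiliser of \<beta> in the commutator Lie algebra of E, written with products. In
  this form it is visibly a subalgebra.\<close>

definition stab :: "'a::field fm set \<Rightarrow> ('a fm \<Rightarrow> 'a) \<Rightarrow> 'a fm set" where
  "stab E \<beta> = {x \<in> E. \<forall>y \<in> E. \<beta> (x * y) = \<beta> (y * x)}"

definition spans :: "'a::field fm \<Rightarrow> 'a fm \<Rightarrow> 'a fm set \<Rightarrow> bool" where
  "spans e u X \<longleftrightarrow> (\<forall>x \<in> X. \<exists>s t. x = sm s e + sm t u)"

lemma stab_lin:
  assumes "fm.subspace E" "lf \<beta>" "x \<in> stab E \<beta>" "y \<in> stab E \<beta>"
  shows "sm s x + sm t y \<in> stab E \<beta>"
proof -
  have "sm s x + sm t y \<in> E" using assms by (auto simp: stab_def intro!: fm.subspace_add fm.subspace_scale)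
  then show ?thesis using assms(2-4) by (auto simp: stab_def algebra_simps lf_add lf_sm)
qed

lemma fm_indep_list:
  assumes "fm.independent (set bs)" "distinct bs" "(\<Sum>i<length bs. sm (c i) (bs ! i)) = (0 :: 'a::field fm)" "i < length bs"
  shows "c i = 0"
proof -
  define idx where "idx = (\<lambda>x. THE i. i < length bs \<and> bs ! i = x)"
  have idx: "idx (bs ! i) = i" if "i < length bs" for i
    unfolding idx_def using that assms(2) by (auto simp: nth_eq_iff_index_eq intro!: the_equality)
  have "(\<Sum>x\<in>set bs. sm (c (idx x)) x) = (\<Sum>i<length bs. sm (c (idx (bs ! i))) (bs ! i))"
    using sum.reindex_bij_betw[OF bij_betw_nth[OF assms(2) refl refl], of "\<lambda>x. sm (c (idx x)) x"] by simp
  also have "\<dots> = 0" using assms(3) idx by simp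
  finally have "c (idx (bs ! i)) = 0"
    using fm.independentD[OF assms(1) _ subset_refl, of "\<lambda>x. c (idx x)" "bs ! i"] assms(4) by simp
  then show ?thesis using idx[OF assms(4)] by simp
qed

lemma fm_span_list:
  assumes "distinct bs" "x \<in> fm.span (set bs)"
  shows "\<exists>c. x = (\<Sum>i<length bs. sm (c i) (bs ! i))"
proof -
  obtain u where "x = (\<Sum>v\<in>set bs. sm (u v) v)"
    using assms(2) fm.span_finite[of "set bs"] by auto
  then have "x = (\<Sum>i<length bs. sm (u (bs ! i)) (bs ! i))"
    using sum.reindex_bij_betw[OF bij_betw_nth[OF assms(1) refl refl], of "\<lambda>x. sm (u x) x"] by simp
  then show ?thesis by (rule exI[of _ "\<lambda>i. u (bs ! i)"])
qed

text \<open>The unit is extended first to a basis of the stabiliser and then to a basis of E. Here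
  k, which is 1 or 2, is the dimension of the stabiliser.\<close>

lemma adapted_basis:
  assumes E: "fm.subspace E" "E \<subseteq> M n n" and e: "e \<in> stab E \<beta>" "e \<noteq> 0"
    and \<beta>: "lf \<beta>" and u: "spans e u (stab E \<beta>)"
  shows "\<exists>bs k. fm.independent (set bs) \<and> distinct bs \<and> set bs \<subseteq> E \<and> E \<subseteq> fm.span (set bs) \<and>
     0 < k \<and> k \<le> 2 \<and> k \<le> length bs \<and> bs ! 0 = e \<and> (\<forall>i<k. bs ! i \<in> stab E \<beta>) \<and>
     (\<forall>x \<in> stab E \<beta>. \<exists>w. x = (\<Sum>i<k. sm (w i) (bs ! i)))"
proof -
  have ext: "\<exists>bs. fm.independent (set bs) \<and> distinct bs \<and> set bs \<subseteq> E \<and> E \<subseteq> fm.span (set bs) \<and> take (length l) bs = l"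
    if l: "set l \<subseteq> E" "fm.independent (set l)" "distinct l" for l
  proof -
    obtain B where B: "set l \<subseteq> B" "B \<subseteq> E" "fm.independent B" "E \<subseteq> fm.span B"
      using fm.maximal_independent_subset_extend[OF l(1,2)] by metis
    have "B \<subseteq> fm.span ((\<lambda>(i, j). el i j) ` ({..<n} \<times> {..<n}))" using B(2) E(2) M_span by blast
    then have "finite B" using fm.independent_span_bound[OF _ B(3)] by (metis finite_SigmaI finite_imageI finite_lessThan)
    then obtain r where r: "set r = B - set l" "distinct r" using finite_distinct_list by (metis finite_Diff)
    have "set (l @ r) = B" using r B(1) by auto
    then show ?thesis using B l(3) r by (intro exI[of _ "l @ r"]) auto
  qed
  have eE: "e \<in> E" using e by (simp add: stab_def)
  show ?thesis
  proof (cases "\<forall>x \<in> stab E \<beta>. \<exists>s. x = sm s e")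
    case True
    have "fm.independent (set [e])" using e by (simp add: fm.dependent_single)
    from ext[OF _ this] eE obtain bs where bs: "fm.independent (set bs)" "distinct bs" "set bs \<subseteq> E"
      "E \<subseteq> fm.span (set bs)" "take 1 bs = [e]" by auto
    then have "bs ! 0 = e" "1 \<le> length bs" by (cases bs; auto)+
    moreover have "\<forall>x\<in>stab E \<beta>. \<exists>w. x = (\<Sum>i<1. sm (w i) (bs ! i))"
    proof
      fix x assume "x \<in> stab E \<beta>"
      then obtain s where "x = sm s e" using True by auto
      then show "\<exists>w. x = (\<Sum>i<1. sm (w i) (bs ! i))" using \<open>bs ! 0 = e\<close> by (intro exI[of _ "\<lambda>i. s"]) simp
    qed
    ultimately show ?thesis using bs e by (intro exI[of _ bs] exI[of _ 1]) auto
  next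
    case False
    then obtain z where z: "z \<in> stab E \<beta>" "\<And>s. z \<noteq> sm s e" by auto
    then obtain s t where st: "z = sm s e + sm t u" using u unfolding spans_def by blast
    with z(2)[of s] have t: "t \<noteq> 0" by auto
    have u': "u = sm (1 / t) z - sm (s / t) e" unfolding st using t by (simp add: fm.scale_right_distrib)
    have "z \<notin> fm.span {e}" using z(2) by (auto simp: fm.span_singleton)
    then have "fm.independent {z, e}" by (rule fm.independent_insertI) (use e in \<open>simp add: fm.dependent_single\<close>)
    then have ind: "fm.independent (set [e, z])" by (simp add: insert_commute)
    have "z \<noteq> e" using z(2)[of 1] by simp
    from ext[OF _ ind] eE z(1) this obtain bs where bs: "fm.independent (set bs)" "distinct bs" "set bs \<subseteq> E"
      "E \<subseteq> fm.span (set bs)" "take 2 bs = [e, z]" by (auto simp: stab_def numeral_2_eq_2)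
    then have b: "bs ! 0 = e" "bs ! 1 = z" "2 \<le> length bs"
      by (cases bs; cases "tl bs"; auto)+
    have "\<forall>x\<in>stab E \<beta>. \<exists>w. x = (\<Sum>i<2. sm (w i) (bs ! i))"
    proof
      fix x assume "x \<in> stab E \<beta>"
      then obtain p q where "x = sm p e + sm q u" using u unfolding spans_def by blast
      then have "x = sm (p - q * s / t) e + sm (q / t) z"
        unfolding u' by (simp add: algebra_simps fm.scale_right_diff_distrib fm.scale_left_diff_distrib)
      then show "\<exists>w. x = (\<Sum>i<2. sm (w i) (bs ! i))" using b
        by (intro exI[of _ "\<lambda>i. if i = 0 then p - q * s / t else q / t"]) (simp add: numeral_2_eq_2)
    qed
    then show ?thesis using bs b e z(1)
      by (intro exI[of _ bs] exI[of _ 2]) (auto simp: numeral_2_eq_2 less_Suc_eq)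
  qed
qed

text \<open>Adding the projection onto the kernel makes the Gram matrix of \<open>x, y \<mapsto> \<beta> (x y - y x)\<close> invertible
  at \<open>t = 0\<close>, hence for almost all \<open>t\<close>; then the kernel embeds into the span of at most two vectors.\<close>

lemma stab_generic:
  fixes \<beta> \<gamma> :: "'a::field fm \<Rightarrow> 'a"
  assumes E: "fm.subspace E" "E \<subseteq> M n n" and e: "e \<in> E" "\<And>x. x \<in> E \<Longrightarrow> e * x = x \<and> x * e = x" "e \<noteq> 0"
    and lf: "lf \<beta>" "lf \<gamma>" and u: "spans e u (stab E \<beta>)"
  shows "finite {t. \<not> (\<exists>u. spans e u (stab E (\<lambda>x. \<beta> x + t * \<gamma> x)))}"
proof -
  have e_stab: "e \<in> stab E \<delta>" for \<delta> using e by (auto simp: stab_def)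
  obtain bs k where bs: "fm.independent (set bs)" "distinct bs" "set bs \<subseteq> E" "E \<subseteq> fm.span (set bs)"
    and k: "0 < k" "k \<le> 2" "k \<le> length bs" and b0: "bs ! 0 = e" and bk: "\<And>i. i < k \<Longrightarrow> bs ! i \<in> stab E \<beta>"
    and sp: "\<And>x. x \<in> stab E \<beta> \<Longrightarrow> \<exists>w. x = (\<Sum>i<k. sm (w i) (bs ! i))"
    using adapted_basis[OF E e_stab e(3) lf(1) u] by auto
  define m where "m = length bs"
  have bE: "bs ! i \<in> E" if "i < m" for i using that bs(3) by (auto simp: m_def)
  define \<beta>t where "\<beta>t = (\<lambda>t x. \<beta> x + t * \<gamma> x)"
  have lft: "lf (\<beta>t t)" for t unfolding \<beta>t_def by (rule lf_comb[OF lf])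
  define w where "w = (\<lambda>t x y. \<beta>t t (x * y) - \<beta>t t (y * x))"
  define G where "G = (\<lambda>t i j. w t (bs ! i) (bs ! j) + (if i = j \<and> i < k then 1 else 0))"
  define comb where "comb = (\<lambda>c. \<Sum>i<m. sm (c i) (bs ! i))"
  have comb_E: "comb c \<in> E" for c unfolding comb_def
    by (intro fm.subspace_sum[OF E(1)] fm.subspace_scale[OF E(1)] bE) auto
  have w_comb: "w t x (comb c) = (\<Sum>j<m. w t x (bs ! j) * c j)" for t x c
    unfolding w_def comb_def
    by (simp add: sum_distrib_left sum_distrib_right lf_sum[OF lft] lf_sm[OF lft] sum_subtractf algebra_simps)
  have w_comb': "w t (comb c) y = (\<Sum>j<m. c j * w t (bs ! j) y)" for t y c
    unfolding w_def comb_def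
    by (simp add: sum_distrib_left sum_distrib_right lf_sum[OF lft] lf_sm[OF lft] sum_subtractf algebra_simps)
  have w_anti: "w t x y = - w t y x" for t x y by (simp add: w_def)
  have stab_w: "x \<in> stab E (\<beta>t t) \<longleftrightarrow> x \<in> E \<and> (\<forall>y\<in>E. w t y x = 0)" for t x
    by (auto simp: stab_def w_def)
  have b_t0: "\<beta>t 0 = \<beta>" by (simp add: \<beta>t_def)
  have ex_comb: "\<exists>c. x = comb c" if "x \<in> E" for x
    unfolding comb_def m_def by (rule fm_span_list[OF bs(2)]) (use that bs(4) in auto)
  have comb0: "c i = 0" if "comb c = 0" "i < m" for c i
    using fm_indep_list[OF bs(1,2)] that unfolding comb_def m_def by auto
  define d where "d = (\<lambda>t. det (mat m m (\<lambda>(i, j). G t i j)))"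
  have Gv: "(mat m m (\<lambda>(i, j). G t i j) *\<^sub>v v) $ i = w t (bs ! i) (comb (($) v)) + (if i < k then v $ i else 0)"
    if "v \<in> carrier_vec m" "i < m" for t v i
  proof -
    have "(mat m m (\<lambda>(i, j). G t i j) *\<^sub>v v) $ i = (\<Sum>j<m. G t i j * v $ j)"
      using that by (simp add: scalar_prod_def lessThan_atLeast0)
    also have "\<dots> = (\<Sum>j<m. w t (bs ! i) (bs ! j) * v $ j) + (\<Sum>j<m. if j = i then (if i < k then v $ i else 0) else 0)"
      unfolding G_def sum.distrib[symmetric] by (intro sum.cong) (auto simp: algebra_simps)
    finally show ?thesis using that by (simp add: w_comb)
  qed
  \<comment> \<open>For a kernel vector v the rows below k have no Gram part, because their basis
    vectors stabilise; hence the first k coordinates of v vanish. The other rows then put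
    \<open>comb v\<close> into the stabiliser, which is spanned by the first k basis vectors, so v =
    0.\<close>
  have "d 0 \<noteq> 0"
  proof
    assume "d 0 = 0"
    then obtain v where v: "v \<in> carrier_vec m" "v \<noteq> 0\<^sub>v m" "mat m m (\<lambda>(i, j). G 0 i j) *\<^sub>v v = 0\<^sub>v m"
      unfolding d_def det_0_iff_vec_prod_zero[OF mat_carrier] by auto
    have row: "w 0 (bs ! i) (comb (($) v)) + (if i < k then v $ i else 0) = 0" if "i < m" for i
      using Gv[OF v(1) that, of 0] v(3) that by simp
    have vk: "v $ i = 0" if "i < k" for i
    proof -
      have "w 0 (bs ! i) (comb (($) v)) = 0"
        using bk[OF that] comb_E[of "($) v"] unfolding stab_def w_def b_t0 by auto
      then show ?thesis using row[of i] that k by (simp add: m_def)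
    qed
    have "comb (($) v) \<in> stab E \<beta>"
    proof -
      have "w 0 y (comb (($) v)) = 0" if y: "y \<in> E" for y
      proof -
        obtain c where "y = comb c" using ex_comb[OF y] by auto
        have "w 0 (bs ! i) (comb (($) v)) = 0" if "i < m" for i
          using row[OF that] vk[of i] by (cases "i < k") simp_all
        then show ?thesis by (simp add: \<open>y = comb c\<close> w_comb')
      qed
      then show ?thesis using stab_w[of _ 0] comb_E by (auto simp: b_t0)
    qed
    from sp[OF this] obtain c where c: "comb (($) v) = (\<Sum>i<k. sm (c i) (bs ! i))" by auto
    also have "\<dots> = comb (\<lambda>i. if i < k then c i else 0)"
      unfolding comb_def using k by (intro sum.mono_neutral_cong_left) (auto simp: m_def)
    finally have "comb (\<lambda>i. v $ i - (if i < k then c i else 0)) = 0"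
      by (simp add: comb_def fm.scale_left_diff_distrib sum_subtractf)
    from comb0[OF this] have "v $ i = (if i < k then c i else 0)" if "i < m" for i using that by auto
    then have "v $ i = 0" if "i < m" for i using that vk[of i] by (cases "i < k") simp_all
    then show False using v(1,2) by auto
  qed
  moreover have "polyfun d"
  proof -
    have "G = (\<lambda>t i j. (\<beta> (bs ! i * bs ! j) + t * \<gamma> (bs ! i * bs ! j)) -
       (\<beta> (bs ! j * bs ! i) + t * \<gamma> (bs ! j * bs ! i)) + (if i = j \<and> i < k then 1 else 0))"
      by (simp add: G_def w_def \<beta>t_def)
    then show ?thesis unfolding d_def
      by (simp only:) (intro polyfun_det polyfun_add polyfun_diff polyfun_mult polyfun_id polyfun_const)
  qed
  ultimately have fin: "finite {t. d t = 0}" by (rule polyfun_finite[rotated])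
  have "\<exists>u. spans e u (stab E (\<beta>t t))" if dt: "d t \<noteq> 0" for t
  proof -
    \<comment> \<open>When the perturbed Gram matrix is invertible, an element of the stabiliser is
      determined by its first k coordinates.\<close>
    have inj: "x = 0" if x: "x \<in> stab E (\<beta>t t)" "x = comb c" "\<And>i. i < k \<Longrightarrow> c i = 0" for x c
    proof -
      have "mat m m (\<lambda>(i, j). G t i j) *\<^sub>v vec m c = 0\<^sub>v m"
      proof (rule eq_vecI)
        fix i assume "i < dim_vec (0\<^sub>v m)"
        then have i: "i < m" by simp
        have cc: "comb (($) (vec m c)) = comb c" by (simp add: comb_def)
        have "w t (bs ! i) x = 0" using x(1) bE[OF i] by (simp add: stab_w)
        then show "(mat m m (\<lambda>(i, j). G t i j) *\<^sub>v vec m c) $ i = 0\<^sub>v m $ i"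
          using Gv[of "vec m c" i t] i x(2,3) cc by auto
      qed simp
      moreover have "\<not> (\<exists>v. v \<in> carrier_vec m \<and> v \<noteq> 0\<^sub>v m \<and> mat m m (\<lambda>(i, j). G t i j) *\<^sub>v v = 0\<^sub>v m)"
        using dt unfolding d_def det_0_iff_vec_prod_zero[OF mat_carrier] .
      ultimately have "vec m c = 0\<^sub>v m" using vec_carrier by blast
      then have "c i = 0" if "i < m" for i using that by (metis index_vec index_zero_vec(1))
      then show "x = 0" by (simp add: x(2) comb_def)
    qed
    have e_comb: "e = comb (\<lambda>i. if i = 0 then 1 else 0)"
    proof -
      have "comb (\<lambda>i. if i = 0 then 1 else 0) = (\<Sum>i<m. if i = 0 then e else 0)"
        unfolding comb_def by (intro sum.cong) (auto simp: b0)
      then show ?thesis using k by (cases bs) (auto simp: m_def)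
    qed
    have comb_lin: "sm p (comb c) + sm q (comb c') = comb (\<lambda>i. p * c i + q * c' i)" for p q c c'
      by (simp add: comb_def fm.scale_sum_right sum.distrib[symmetric] fm.scale_left_distrib)
    show ?thesis
    proof (cases "\<forall>x \<in> stab E (\<beta>t t). \<exists>s. x = sm s e")
      case True
      have "spans e e (stab E (\<beta>t t))" unfolding spans_def
      proof
        fix x assume "x \<in> stab E (\<beta>t t)"
        then obtain s where "x = sm s e" using True by auto
        then have "x = sm s e + sm 0 e" by simp
        then show "\<exists>s t. x = sm s e + sm t e" by blast
      qed
      then show ?thesis by blast
    next
      case False
      then obtain z where z: "z \<in> stab E (\<beta>t t)" "\<And>s. z \<noteq> sm s e" by auto
      then obtain c where c: "z = comb c" using ex_comb[of z] by (auto simp: stab_def)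
      \<comment> \<open>Otherwise \<open>z - c 0 * e\<close> would have vanishing first k
        coordinates, making z a multiple of e.\<close>
      have k2: "k = 2 \<and> c 1 \<noteq> 0"
      proof (rule ccontr)
        assume *: "\<not> ?thesis"
        have "sm 1 z + sm (- c 0) e = 0"
        proof (rule inj)
          show "sm 1 z + sm (- c 0) e \<in> stab E (\<beta>t t)" by (rule stab_lin[OF E(1) lft z(1) e_stab])
          show "sm 1 z + sm (- c 0) e = comb (\<lambda>i. 1 * c i + - c 0 * (if i = 0 then 1 else 0))"
            unfolding c by (subst e_comb) (rule comb_lin)
          fix i assume "i < k"
          then have "i = 0 \<or> i = 1 \<and> k = 2" using k by auto
          then show "1 * c i + - c 0 * (if i = 0 then 1 else 0) = 0" using * by auto
        qed
        then have "z = sm (c 0) e" by simp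
        then show False using z(2) by blast
      qed
      have "spans e z (stab E (\<beta>t t))" unfolding spans_def
      proof
        fix x assume x: "x \<in> stab E (\<beta>t t)"
        then obtain c' where c': "x = comb c'" using ex_comb[of x] by (auto simp: stab_def)
        \<comment> \<open>Chosen to kill the coordinates 0 and 1 of
          \<open>x + q z + p e\<close>.\<close>
        define q where "q = - c' 1 / c 1"
        define p where "p = - (c' 0 + q * c 0)"
        have "sm 1 (sm 1 x + sm q z) + sm p e = 0"
        proof (rule inj)
          show "sm 1 (sm 1 x + sm q z) + sm p e \<in> stab E (\<beta>t t)" 
            by (intro stab_lin[OF E(1) lft] z(1) x e_stab)
          show "sm 1 (sm 1 x + sm q z) + sm p e = comb (\<lambda>i. 1 * (1 * c' i + q * c i) + p * (if i = 0 then 1 else 0))"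
            unfolding c c' by (subst e_comb) (simp only: comb_lin)
          fix i assume "i < k"
          then have "i = 0 \<or> i = 1" using k by auto
          then show "1 * (1 * c' i + q * c i) + p * (if i = 0 then 1 else 0) = 0" using k2 by (auto simp: p_def q_def)
        qed
        moreover have "x = (sm 1 (sm 1 x + sm q z) + sm p e) + (sm (- p) e + sm (- q) z)"
          by (simp add: algebra_simps)
        ultimately have "x = sm (- p) e + sm (- q) z" by (metis add_0)
        then show "\<exists>s t. x = sm s e + sm t z" by blast
      qed
      then show ?thesis by blast
    qed
  qed
  then have "{t. \<not> (\<exists>u. spans e u (stab E (\<lambda>x. \<beta> x + t * \<gamma> x)))} \<subseteq> {t. d t = 0}"
    by (auto simp: \<beta>t_def)
  then show ?thesis using fin finite_subset by blast
qed

section \<open>The block algebras\<close>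

text \<open>The inclusion of K^n as the coordinates from k on. Its transpose is the corresponding
  projection.\<close>

definition sh :: "nat \<Rightarrow> nat \<Rightarrow> 'a::field fm" where
  "sh k n = Fm (\<lambda>i j. if i = k + j \<and> j < n then 1 else 0)"

abbreviation sh' :: "nat \<Rightarrow> nat \<Rightarrow> 'a::field fm" where
  "sh' k n \<equiv> tpose (sh k n)"

lemma ent_sh: "ent (sh k n) i j = (if i = k + j \<and> j < n then 1 else 0)"
  unfolding sh_def by (subst ent_Fm[of _ "k + n" n]) (auto split: if_splits)

lemma M_sh: "sh k n \<in> M (k + n) n" by (auto simp: M_def ent_sh)
lemma M_sh': "sh' k n \<in> M n (k + n)" by (simp add: M_tpose M_sh)

lemma ent_sh'_times: "ent (sh' k n * x) i j = (if i < n then ent x (k + i) j else 0)"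
proof -
  have "ent (sh' k n * x) i j = (\<Sum>l<k+n. if l = k + i then (if i < n then ent x (k + i) j else 0) else 0)"
    unfolding ent_times[OF M_sh'] by (intro sum.cong) (auto simp: ent_sh)
  then show ?thesis by simp
qed

lemma sh_times_sh:
  "sh' k n * sh k n = idm n"
  "k + n \<le> l \<or> l + m \<le> k \<Longrightarrow> sh' k n * sh l m = 0"
  by (auto intro!: fm_eqI simp: ent_sh'_times ent_sh ent_idm)

lemma ent_sh_sh': "ent (sh k n * sh' k n) i j = (if i = j \<and> k \<le> i \<and> i < k + n then 1 else 0)"
proof -
  have "ent (sh k n * sh' k n) i j = (\<Sum>l<n. if l = i - k then (if i = j \<and> k \<le> i \<and> i < k + n then 1 else 0) else 0)"
    unfolding ent_times[OF M_sh] by (intro sum.cong) (auto simp: ent_sh)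
  also have "\<dots> = (if i = j \<and> k \<le> i \<and> i < k + n then 1 else 0)" by auto
  finally show ?thesis .
qed

lemma sh_zero: "sh 0 n = idm n" by (rule fm_eqI) (auto simp: ent_sh ent_idm)

lemma idm_sh_sum: "m \<le> n \<Longrightarrow> idm m + sh m (n - m) * sh' m (n - m) = idm n"
  by (rule fm_eqI) (auto simp: ent_sh_sh' ent_idm)

definition blk :: "nat \<Rightarrow> nat \<Rightarrow> 'a::field t5 \<Rightarrow> 'a fm" where
  "blk a b = (\<lambda>(A0, A1, B, W, V). A0 + sh a a * A0 * sh' a a + A1 * sh' a a +
     sh (2 * a) b * B * sh' (2 * a) b + sh a a * W * sh' (2 * a) b + V * sh' (2 * a) b)"

definition unblk :: "nat \<Rightarrow> nat \<Rightarrow> 'a::field fm \<Rightarrow> 'a t5" where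
  "unblk a b y = (idm a * y * idm a, idm a * y * sh a a, sh' (2 * a) b * y * sh (2 * a) b,
     sh' a a * y * sh (2 * a) b, idm a * y * sh (2 * a) b)"

definition mul5 :: "'a::field t5 \<Rightarrow> 'a t5 \<Rightarrow> 'a t5" where
  "mul5 = (\<lambda>(A0, A1, B, W, V) (A0', A1', B', W', V').
     (A0 * A0', A0 * A1' + A1 * A0', B * B', A0 * W' + W * B', A0 * V' + A1 * W' + V * B'))"

definition tup_r :: "nat \<Rightarrow> nat \<Rightarrow> 'a::field t5 set" where
  "tup_r a b = {(A0, A1, B, W, V). A0 \<in> M a a \<and> A1 \<in> M a a \<and> B \<in> M b b \<and> W \<in> M a b \<and> V \<in> M a b}"

definition tup_q :: "nat \<Rightarrow> nat \<Rightarrow> 'a::field t5 set" where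
  "tup_q a b = {(A0, A1, B, W, V). A0 \<in> M a a \<and> A1 = 0 \<and> B \<in> M b b \<and> W \<in> M a b \<and> V \<in> M a b}"

lemma tup_q_r: "x \<in> tup_q a b \<Longrightarrow> x \<in> tup_r a b" by (auto simp: tup_q_def tup_r_def)

lemma sh_kill:
  "A \<in> M a n \<Longrightarrow> a \<le> k \<Longrightarrow> sh' k m * A = 0" "A \<in> M n a \<Longrightarrow> a \<le> k \<Longrightarrow> A * sh k m = 0"
proof -
  show 1: "sh' k m * A = 0" if "A \<in> M a n" "a \<le> k" for A :: "'a fm" and n
    using that by (intro fm_eqI) (auto simp: ent_sh'_times intro: M_D[OF that(1)])
  show "A * sh k m = 0" if "A \<in> M n a" "a \<le> k"
    using 1[of "tpose A" n] that by (metis M_tpose tpose_eq_0 tpose_times tpose_tpose)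
qed

lemma blk_simps:
  fixes A :: "'a::field fm"
  shows "A \<in> M a n \<Longrightarrow> sh' a a * A = 0" "A \<in> M a n \<Longrightarrow> sh' (2 * a) b * A = 0"
    "A \<in> M a n \<Longrightarrow> idm a * A = A"
    "A \<in> M n a \<Longrightarrow> A * sh a a = 0" "A \<in> M n a \<Longrightarrow> A * sh (2 * a) b = 0"
    "A \<in> M n a \<Longrightarrow> A * idm a = A" "A \<in> M n b \<Longrightarrow> A * idm b = A" "A \<in> M b n \<Longrightarrow> idm b * A = A"
  by (simp_all add: sh_kill idm_times times_idm)

lemma sh_rules:
  "sh' a a * sh a a = idm a" "sh' (2 * a) b * sh (2 * a) b = idm b"
  "sh' a a * sh (2 * a) b = 0" "sh' (2 * a) b * sh a a = 0"
  "idm a * sh a a = 0" "idm a * sh (2 * a) b = 0" "sh' a a * idm a = 0" "sh' (2 * a) b * idm a = 0"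
  by (simp_all add: sh_times_sh sh_kill[OF M_idm[OF le_refl le_refl]])

lemma unblk_blk:
  fixes x :: "'a::field t5"
  assumes "x \<in> tup_r a b" shows "unblk a b (blk a b x) = x"
proof -
  obtain A0 A1 B W V where x: "x = (A0, A1, B, W, V)" and m: "A0 \<in> M a a" "A1 \<in> M a a" "B \<in> M b b" "W \<in> M a b" "V \<in> M a b"
    using assms by (auto simp: tup_r_def)
  define s s1 r r1 where d: "s = (sh a a :: 'a fm)" "s1 = tpose s" "r = (sh (2 * a) b :: 'a fm)" "r1 = tpose r"
  have R: "s1 * s = idm a" "r1 * r = idm b" "s1 * r = 0" "r1 * s = 0" "idm a * s = 0" "idm a * r = 0"
    "s1 * idm a = 0" "r1 * idm a = 0" unfolding d by (fact sh_rules)+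
  have K: "A \<in> M a n \<Longrightarrow> s1 * A = 0" "A \<in> M a n \<Longrightarrow> r1 * A = 0" "A \<in> M a n \<Longrightarrow> idm a * A = A"
    "A \<in> M n a \<Longrightarrow> A * s = 0" "A \<in> M n a \<Longrightarrow> A * r = 0" "A \<in> M n a \<Longrightarrow> A * idm a = A"
    "A \<in> M n b \<Longrightarrow> A * idm b = A" "A \<in> M b n \<Longrightarrow> idm b * A = A" for A n
    unfolding d by (fact blk_simps)+
  note L = m(1,2,4,5)[THEN K(1)] m(1,2,4,5)[THEN K(2)] m(1,2,4,5)[THEN K(3)] m(1,2)[THEN K(4)]
    m(1,2)[THEN K(5)] m(1,2)[THEN K(6)] m(3,4,5)[THEN K(7)] m(3)[THEN K(8)]
  show ?thesis unfolding x unblk_def blk_def split_conv d[symmetric]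
    by (simp add: algebra_simps R R[THEN asc] L L[THEN asc])
qed

lemma blk_mult:
  fixes x :: "'a::field t5"
  assumes "x \<in> tup_r a b" "y \<in> tup_r a b" shows "blk a b x * blk a b y = blk a b (mul5 x y)"
proof -
  obtain A0 A1 B W V where x: "x = (A0, A1, B, W, V)" and m: "A0 \<in> M a a" "A1 \<in> M a a" "B \<in> M b b" "W \<in> M a b" "V \<in> M a b"
    using assms(1) by (auto simp: tup_r_def)
  obtain A0' A1' B' W' V' where y: "y = (A0', A1', B', W', V')" and m': "A0' \<in> M a a" "A1' \<in> M a a" "B' \<in> M b b" "W' \<in> M a b" "V' \<in> M a b"
    using assms(2) by (auto simp: tup_r_def)
  define s s1 r r1 where d: "s = (sh a a :: 'a fm)" "s1 = tpose s" "r = (sh (2 * a) b :: 'a fm)" "r1 = tpose r"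
  have R: "s1 * s = idm a" "r1 * r = idm b" "s1 * r = 0" "r1 * s = 0" "idm a * s = 0" "idm a * r = 0"
    "s1 * idm a = 0" "r1 * idm a = 0" unfolding d by (fact sh_rules)+
  have K: "A \<in> M a n \<Longrightarrow> s1 * A = 0" "A \<in> M a n \<Longrightarrow> r1 * A = 0" "A \<in> M a n \<Longrightarrow> idm a * A = A"
    "A \<in> M n a \<Longrightarrow> A * s = 0" "A \<in> M n a \<Longrightarrow> A * r = 0" "A \<in> M n a \<Longrightarrow> A * idm a = A"
    "A \<in> M n b \<Longrightarrow> A * idm b = A" "A \<in> M b n \<Longrightarrow> idm b * A = A" for A n
    unfolding d by (fact blk_simps)+
  note L = m'(1,2,4,5)[THEN K(1)] m'(1,2,4,5)[THEN K(2)] m'(1,2,4,5)[THEN K(3)] m(1,2)[THEN K(4)]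
    m(1,2)[THEN K(5)] m(1,2)[THEN K(6)] m(3,4,5)[THEN K(7)] m'(3)[THEN K(8)]
  show ?thesis unfolding x y mul5_def blk_def split_conv d[symmetric]
    by (simp add: algebra_simps R R[THEN asc] L L[THEN asc])
qed

lemma blk_add: "blk a b (x + y) = blk a b x + blk a b y"
  by (cases x, cases y) (simp add: blk_def algebra_simps)

lemma blk_smt: "blk a b (smt c x) = sm c (blk a b x)"
  by (cases x) (simp add: blk_def smt_def algebra_simps fm.scale_right_distrib)

lemma unblk_add: "unblk a b (x + y) = unblk a b x + unblk a b y"
  by (simp add: unblk_def algebra_simps)

lemma unblk_sm: "unblk a b (sm c x) = smt c (unblk a b x)"
  by (simp add: unblk_def smt_def)

lemma tup_add: "x \<in> tup_r a b \<Longrightarrow> y \<in> tup_r a b \<Longrightarrow> x + y \<in> tup_r a b"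
  "x \<in> tup_q a b \<Longrightarrow> y \<in> tup_q a b \<Longrightarrow> x + y \<in> tup_q a b"
  by (auto simp: tup_r_def tup_q_def M_add)
lemma tup_smt: "x \<in> tup_r a b \<Longrightarrow> smt c x \<in> tup_r a b" "x \<in> tup_q a b \<Longrightarrow> smt c x \<in> tup_q a b"
  by (auto simp: tup_r_def tup_q_def smt_def M_sm)
lemma tup_mul: "x \<in> tup_r a b \<Longrightarrow> y \<in> tup_r a b \<Longrightarrow> mul5 x y \<in> tup_r a b"
  "x \<in> tup_q a b \<Longrightarrow> y \<in> tup_q a b \<Longrightarrow> mul5 x y \<in> tup_q a b"
  by (auto simp: tup_r_def tup_q_def mul5_def M_closed)
lemma tup_one: "one5 a b \<in> tup_r a b" "one5 a b \<in> tup_q a b"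
  by (auto simp: tup_r_def tup_q_def one5_def M_idm)
lemma tup_zero: "0 \<in> tup_r a b" "0 \<in> tup_q a b"
  by (auto simp: tup_r_def tup_q_def zero_prod_def)
lemma mul5_one: "x \<in> tup_r a b \<Longrightarrow> mul5 (one5 a b) x = x" "x \<in> tup_r a b \<Longrightarrow> mul5 x (one5 a b) = x"
  by (auto simp: tup_r_def one5_def mul5_def M_iff)

lemma blk_one: "blk a b (one5 a b) = (idm (2 * a + b) :: 'a::field fm)"
proof -
  have 1: "(idm a :: 'a fm) + sh a a * sh' a a = idm (2 * a)" using idm_sh_sum[of a "2 * a"] by (simp add: mult_2)
  have 2: "(idm (2 * a) :: 'a fm) + sh (2 * a) b * sh' (2 * a) b = idm (2 * a + b)" using idm_sh_sum[of "2 * a" "2 * a + b"] by simp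
  have "sh a a * idm a = (sh a a :: 'a fm)" "sh (2 * a) b * idm b = (sh (2 * a) b :: 'a fm)"
    using times_idm[OF M_sh le_refl] by auto
  then show ?thesis unfolding blk_def one5_def using 1 2 by simp
qed

lemma blk_M: assumes "x \<in> tup_r a b" shows "blk a b x \<in> M (2 * a + b) (2 * a + b)"
  by (metis M_iff blk_mult blk_one mul5_one tup_one(1) assms)

text \<open>The algebra \<open>blk ` T\<close> for \<open>T = tup_r a b\<close> (resp. \<open>tup_q a b\<close>) has as its Lie algebra of commutators
  \<open>\<rr>(a, b)\<close> (resp. \<open>\<qq>(a, b)\<close>), its elements being the block matrices
  \<open>[A0, A1, V; 0, A0, W; 0, 0, B]\<close>.\<close>

definition pair5 :: "'a::field t5 \<Rightarrow> 'a t5 \<Rightarrow> 'a" where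
  "pair5 = (\<lambda>(C0, C1, D, S, T) (A0, A1, B, W, V).
     tr (C0 * A0) + tr (C1 * A1) + tr (D * B) + tr (S * W) + tr (T * V))"

definition sol :: "'a::field t5 set \<Rightarrow> 'a t5 \<Rightarrow> 'a t5 set" where
  "sol T G = {x \<in> T. \<forall>y \<in> T. pair5 G (mul5 x y) = pair5 G (mul5 y x)}"

lemma tr_rot: "tr (x * (y * z)) = tr (z * (x * y))"
  using tr_comm[of "x * y" z] by (simp add: mult.assoc)

text \<open>Cyclicity of the trace collects the coefficient of each block of the test element; these
  coefficients are the equations of \<open>rsol\<close>.\<close>

lemma pair5_comm:
  "pair5 (C0, C1, D, S, T) (mul5 (A0, A1, B, W, V) (A0', A1', B', W', V')) -
   pair5 (C0, C1, D, S, T) (mul5 (A0', A1', B', W', V') (A0, A1, B, W, V)) =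
   tr ((C0 * A0 - A0 * C0 + (C1 * A1 - A1 * C1) - (W * S + V * T)) * A0') +
   tr ((C1 * A0 - A0 * C1 - W * T) * A1') + tr ((S * W + T * V - (B * D - D * B)) * B') +
   tr ((S * A0 + T * A1 - B * S) * W') + tr ((T * A0 - B * T) * V')"
  unfolding mul5_def pair5_def split_conv
  using tr_rot[of C0 A0' A0] tr_rot[of C1 A0' A1] tr_rot[of C1 A1' A0] tr_rot[of D B' B]
    tr_rot[of S A0' W] tr_rot[of S W' B] tr_rot[of T A0' V] tr_rot[of T A1' W] tr_rot[of T V' B]
  by (simp add: algebra_simps tr_add tr_diff)

text \<open>Test elements with a single nonzero block separate the five coefficients, and the trace
  pairing is nondegenerate on each block.\<close>

lemma rsol_sol:
  assumes G: "G \<in> params a b" shows "rsol a b G = sol (tup_r a b) G"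
proof -
  obtain C0 C1 D S T where Ge: "G = (C0, C1, D, S, T)" and g: "C0 \<in> M a a" "C1 \<in> M a a" "D \<in> M b b" "S \<in> M b a" "T \<in> M b a"
    using G by (auto simp: params_def)
  have "(A0, A1, B, W, V) \<in> rsol a b G \<longleftrightarrow> (A0, A1, B, W, V) \<in> sol (tup_r a b) G" for A0 A1 B W V
  proof (cases "(A0, A1, B, W, V) \<in> tup_r a b")
    case True
    then have m: "A0 \<in> M a a" "A1 \<in> M a a" "B \<in> M b b" "W \<in> M a b" "V \<in> M a b" by (auto simp: tup_r_def)
    define E1 E2 E3 E4 E5 where E: "E1 = C0 * A0 - A0 * C0 + (C1 * A1 - A1 * C1) - (W * S + V * T)"
      "E2 = C1 * A0 - A0 * C1 - W * T" "E3 = S * W + T * V - (B * D - D * B)" "E4 = S * A0 + T * A1 - B * S"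
      "E5 = T * A0 - B * T"
    have ME: "E1 \<in> M a a" "E2 \<in> M a a" "E3 \<in> M b b" "E4 \<in> M b a" "E5 \<in> M b a"
      unfolding E using m g by - (assumption | rule M_closed)+
    have "(A0, A1, B, W, V) \<in> sol (tup_r a b) G \<longleftrightarrow> (\<forall>A0' A1' B' W' V'. (A0', A1', B', W', V') \<in> tup_r a b \<longrightarrow>
       tr (E1 * A0') + tr (E2 * A1') + tr (E3 * B') + tr (E4 * W') + tr (E5 * V') = 0)"
      unfolding sol_def Ge E pair5_comm[symmetric] using True by auto
    also have "\<dots> \<longleftrightarrow> E1 = 0 \<and> E2 = 0 \<and> E3 = 0 \<and> E4 = 0 \<and> E5 = 0"
    proof safe
      assume *: "\<forall>A0' A1' B' W' V'. (A0', A1', B', W', V') \<in> tup_r a b \<longrightarrow>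
       tr (E1 * A0') + tr (E2 * A1') + tr (E3 * B') + tr (E4 * W') + tr (E5 * V') = 0"
      show "E1 = 0" by (rule tr_nondeg[OF ME(1)]) (use *[rule_format, of _ 0 0 0 0] in \<open>auto simp: tup_r_def\<close>)
      show "E2 = 0" by (rule tr_nondeg[OF ME(2)]) (use *[rule_format, of 0 _ 0 0 0] in \<open>auto simp: tup_r_def\<close>)
      show "E3 = 0" by (rule tr_nondeg[OF ME(3)]) (use *[rule_format, of 0 0 _ 0 0] in \<open>auto simp: tup_r_def\<close>)
      show "E4 = 0" by (rule tr_nondeg[OF ME(4)]) (use *[rule_format, of 0 0 0 _ 0] in \<open>auto simp: tup_r_def\<close>)
      show "E5 = 0" by (rule tr_nondeg[OF ME(5)]) (use *[rule_format, of 0 0 0 0 _] in \<open>auto simp: tup_r_def\<close>)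
    qed auto
    also have "\<dots> \<longleftrightarrow> (A0, A1, B, W, V) \<in> rsol a b G"
      unfolding Ge rsol_def E using m by auto
    finally show ?thesis by blast
  qed (auto simp: rsol_def sol_def tup_r_def Ge)
  then show ?thesis by auto
qed

lemma qsol_sol:
  assumes G: "G \<in> params a b" shows "qsol a b G = sol (tup_q a b) G"
proof -
  obtain C0 C1 D S T where Ge: "G = (C0, C1, D, S, T)" and g: "C0 \<in> M a a" "C1 \<in> M a a" "D \<in> M b b" "S \<in> M b a" "T \<in> M b a"
    using G by (auto simp: params_def)
  have "(A0, A1, B, W, V) \<in> qsol a b G \<longleftrightarrow> (A0, A1, B, W, V) \<in> sol (tup_q a b) G" for A0 A1 B W V
  proof (cases "(A0, A1, B, W, V) \<in> tup_q a b")
    case True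
    then have m: "A0 \<in> M a a" "A1 = 0" "B \<in> M b b" "W \<in> M a b" "V \<in> M a b" by (auto simp: tup_q_def)
    define E1 E2 E3 E4 E5 where E: "E1 = C0 * A0 - A0 * C0 + (C1 * A1 - A1 * C1) - (W * S + V * T)"
      "E2 = C1 * A0 - A0 * C1 - W * T" "E3 = S * W + T * V - (B * D - D * B)" "E4 = S * A0 + T * A1 - B * S"
      "E5 = T * A0 - B * T"
    have ME: "E1 \<in> M a a" "E3 \<in> M b b" "E4 \<in> M b a" "E5 \<in> M b a"
      unfolding E m(2) using m(1,3-) g by (simp_all add: M_closed)
    have "(A0, A1, B, W, V) \<in> sol (tup_q a b) G \<longleftrightarrow> (\<forall>A0' A1' B' W' V'. (A0', A1', B', W', V') \<in> tup_q a b \<longrightarrow>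
       tr (E1 * A0') + tr (E2 * A1') + tr (E3 * B') + tr (E4 * W') + tr (E5 * V') = 0)"
      unfolding sol_def Ge E pair5_comm[symmetric] using True by auto
    also have "\<dots> \<longleftrightarrow> E1 = 0 \<and> E3 = 0 \<and> E4 = 0 \<and> E5 = 0"
    proof safe
      assume *: "\<forall>A0' A1' B' W' V'. (A0', A1', B', W', V') \<in> tup_q a b \<longrightarrow>
       tr (E1 * A0') + tr (E2 * A1') + tr (E3 * B') + tr (E4 * W') + tr (E5 * V') = 0"
      show "E1 = 0" by (rule tr_nondeg[OF ME(1)]) (use *[rule_format, of _ 0 0 0 0] in \<open>auto simp: tup_q_def\<close>)
      show "E3 = 0" by (rule tr_nondeg[OF ME(2)]) (use *[rule_format, of 0 0 _ 0 0] in \<open>auto simp: tup_q_def\<close>)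
      show "E4 = 0" by (rule tr_nondeg[OF ME(3)]) (use *[rule_format, of 0 0 0 _ 0] in \<open>auto simp: tup_q_def\<close>)
      show "E5 = 0" by (rule tr_nondeg[OF ME(4)]) (use *[rule_format, of 0 0 0 0 _] in \<open>auto simp: tup_q_def\<close>)
    qed (auto simp: tup_q_def)
    also have "\<dots> \<longleftrightarrow> (A0, A1, B, W, V) \<in> qsol a b G"
      unfolding Ge qsol_def E using m by auto
    finally show ?thesis by blast
  qed (auto simp: qsol_def sol_def tup_q_def Ge)
  then show ?thesis by auto
qed

definition fn5 :: "nat \<Rightarrow> nat \<Rightarrow> 'a::field t5 \<Rightarrow> 'a fm \<Rightarrow> 'a" where
  "fn5 a b G y = pair5 G (unblk a b y)"

lemma pair5_add: "pair5 G (x + y) = pair5 G x + pair5 G y"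
  by (cases G, cases x, cases y) (simp add: pair5_def algebra_simps tr_add)
lemma pair5_smt: "pair5 G (smt c x) = c * pair5 G x"
  by (cases G, cases x) (simp add: pair5_def smt_def algebra_simps tr_sm)
lemma pair5_lin: "pair5 (G + smt t G') x = pair5 G x + t * pair5 G' x"
  by (cases G, cases G', cases x) (simp add: pair5_def smt_def algebra_simps tr_add tr_sm)

lemma lf_fn5: "lf (fn5 a b G)"
  by (simp add: lf_def fn5_def unblk_add unblk_sm pair5_add pair5_smt)

lemma fn5_lin: "fn5 a b (G + smt t G') = (\<lambda>x. fn5 a b G x + t * fn5 a b G' x)"
  by (simp add: fun_eq_iff fn5_def pair5_lin)

definition subalg :: "nat \<Rightarrow> nat \<Rightarrow> 'a::field t5 set \<Rightarrow> bool" where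
  "subalg a b T \<longleftrightarrow> T \<subseteq> tup_r a b \<and> one5 a b \<in> T \<and> 0 \<in> T \<and> (\<forall>x \<in> T. \<forall>y \<in> T. x + y \<in> T \<and> mul5 x y \<in> T) \<and>
     (\<forall>c. \<forall>x \<in> T. smt c x \<in> T)"

lemma subalg_rq: "subalg a b (tup_r a b)" "subalg a b (tup_q a b)"
  by (auto simp: subalg_def tup_one tup_zero tup_add tup_mul tup_smt tup_q_r)

lemma blk_zero: "blk a b 0 = 0" by (simp add: blk_def zero_prod_def)

lemma subalg_blk:
  assumes "subalg a b T"
  shows "fm.subspace (blk a b ` T)" "blk a b ` T \<subseteq> M (2 * a + b) (2 * a + b)" "idm (2 * a + b) \<in> blk a b ` T"
    "x \<in> blk a b ` T \<Longrightarrow> y \<in> blk a b ` T \<Longrightarrow> x * y \<in> blk a b ` T"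
proof -
  show "fm.subspace (blk a b ` T)"
    using assms unfolding fm.subspace_def subalg_def
    by (auto simp: blk_add[symmetric] blk_smt[symmetric]) (metis blk_zero image_eqI)
  show "blk a b ` T \<subseteq> M (2 * a + b) (2 * a + b)" using assms blk_M unfolding subalg_def by blast
  show "idm (2 * a + b) \<in> blk a b ` T" using assms unfolding subalg_def by (auto simp: blk_one[symmetric])
  show "x * y \<in> blk a b ` T" if "x \<in> blk a b ` T" "y \<in> blk a b ` T"
    using that assms blk_mult unfolding subalg_def by (smt (verit) image_iff subsetD)
qed

lemma stab_blk:
  assumes "subalg a b T"
  shows "stab (blk a b ` T) (fn5 a b G) = blk a b ` sol T G"
proof -
  have T: "x \<in> tup_r a b" if "x \<in> T" for x using assms that by (auto simp: subalg_def)
  have *: "fn5 a b G (blk a b x * blk a b y) = pair5 G (mul5 x y)" if "x \<in> T" "y \<in> T" for x y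
    using that T by (simp add: fn5_def blk_mult unblk_blk tup_mul)
  have "blk a b x \<in> stab (blk a b ` T) (fn5 a b G) \<longleftrightarrow> x \<in> sol T G" if "x \<in> T" for x
    unfolding stab_def sol_def using that by (simp add: * del: split_paired_All)
  then show ?thesis unfolding stab_def sol_def by blast
qed

lemma rank_le_2_iff:
  fixes T :: "'a::field t5 set"
  assumes "subalg a b T"
  shows "rank_le_2 a b (sol T G) \<longleftrightarrow> (\<exists>u. spans (idm (2 * a + b)) u (stab (blk a b ` T) (fn5 a b G)))"
proof
  assume "rank_le_2 a b (sol T G)"
  then obtain u where u: "spanned_by (one5 a b) u (sol T G)" by (auto simp: rank_le_2_def)
  have "spans (idm (2 * a + b)) (blk a b u) (stab (blk a b ` T) (fn5 a b G))"
    unfolding spans_def stab_blk[OF assms]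
  proof
    fix y assume "y \<in> blk a b ` sol T G"
    then obtain x where "y = blk a b x" "x \<in> sol T G" by auto
    moreover from this u obtain s t where "x = smt s (one5 a b) + smt t u" unfolding spanned_by_def by blast
    ultimately have "y = sm s (idm (2 * a + b)) + sm t (blk a b u)" by (simp add: blk_add blk_smt blk_one)
    then show "\<exists>s t. y = sm s (idm (2 * a + b)) + sm t (blk a b u)" by blast
  qed
  then show "\<exists>u. spans (idm (2 * a + b)) u (stab (blk a b ` T) (fn5 a b G))" by blast
next
  assume "\<exists>u. spans (idm (2 * a + b)) u (stab (blk a b ` T) (fn5 a b G))"
  then obtain u where u: "spans (idm (2 * a + b)) u (stab (blk a b ` T) (fn5 a b G))" by auto
  have "spanned_by (one5 a b) (unblk a b u) (sol T G)"
    unfolding spanned_by_def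
  proof
    fix x assume x: "x \<in> sol T G"
    then have xr: "x \<in> tup_r a b" using assms by (auto simp: sol_def subalg_def)
    from x u obtain s t where "blk a b x = sm s (idm (2 * a + b)) + sm t u"
      unfolding spans_def stab_blk[OF assms] by blast
    then have "unblk a b (blk a b x) = smt s (unblk a b (idm (2 * a + b))) + smt t (unblk a b u)"
      by (simp add: unblk_add unblk_sm)
    moreover have "unblk a b (idm (2 * a + b)) = (one5 a b :: 'a t5)"
      by (metis blk_one unblk_blk tup_one(1))
    ultimately have "x = smt s (one5 a b) + smt t (unblk a b u)"
      by (simp only: unblk_blk[OF xr])
    then show "\<exists>s t. x = smt s (one5 a b) + smt t (unblk a b u)" by blast
  qed
  then show "rank_le_2 a b (sol T G)" unfolding rank_le_2_def by (rule exI)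
qed

lemma idm_nz: "0 < n \<Longrightarrow> idm n \<noteq> (0 :: 'a::field fm)"
  using ent_idm[of n 0 0, where 'a='a] by (metis ent_zero zero_neq_one)

lemma rank_le_2_generic:
  assumes "subalg a b T" "0 < a + b" "rank_le_2 a b (sol T G)"
  shows "finite {t. \<not> rank_le_2 a b (sol T (G + smt t G'))}"
  unfolding rank_le_2_iff[OF assms(1)] fn5_lin
  using assms(3) unfolding rank_le_2_iff[OF assms(1)]
proof (elim exE, intro stab_generic[OF subalg_blk(1-3)[OF assms(1)]] lf_fn5)
  show "idm (2 * a + b) \<noteq> 0" by (rule idm_nz) (use assms(2) in auto)
qed (use subalg_blk(2)[OF assms(1)] in \<open>auto simp: M_iff\<close>)

lemma functional_trace:
  fixes \<phi> :: "'a::field fm \<Rightarrow> 'a"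
  assumes "lf \<phi>"
  shows "\<exists>C \<in> M n m. \<forall>A \<in> M m n. \<phi> A = tr (C * A)"
proof -
  define C where "C = Fm (\<lambda>i j. if i < n \<and> j < m then \<phi> (el j i) else 0)"
  have C: "C \<in> M n m" unfolding C_def by (rule Fm_M) (auto split: if_splits)
  have eC: "ent C i j = (if i < n \<and> j < m then \<phi> (el j i) else 0)" for i j
    unfolding C_def by (subst ent_Fm[of _ n m]) (auto split: if_splits)
  have "\<phi> A = tr (C * A)" if A: "A \<in> M m n" for A
  proof -
    have "\<phi> A = (\<Sum>i<m. \<Sum>j<n. ent A i j * \<phi> (el i j))"
      by (subst fm_expand[OF A]) (simp add: lf_sum[OF assms] lf_sm[OF assms])
    also have "\<dots> = (\<Sum>j<n. \<Sum>i<m. ent C j i * ent A i j)"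
      by (subst sum.swap) (simp add: eC mult.commute)
    also have "\<dots> = tr (C * A)" by (simp add: tr_M[OF M_times[OF C A]] ent_times[OF C])
    finally show ?thesis .
  qed
  then show ?thesis using C by blast
qed

text \<open>Restricting a linear form to the five blocks and representing each restriction by a
  trace shows that the parameters exhaust all linear forms on the algebra.\<close>

lemma functional_pair5:
  assumes "lf \<beta>"
  shows "\<exists>G \<in> params a b. \<forall>x \<in> tup_r a b. \<beta> (blk a b x) = pair5 G x"
proof -
  let ?f0 = "\<lambda>A. \<beta> (blk a b (A, 0, 0, 0, 0))" and ?f1 = "\<lambda>A. \<beta> (blk a b (0, A, 0, 0, 0))"
    and ?f2 = "\<lambda>A. \<beta> (blk a b (0, 0, A, 0, 0))" and ?f3 = "\<lambda>A. \<beta> (blk a b (0, 0, 0, A, 0))"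
    and ?f4 = "\<lambda>A. \<beta> (blk a b (0, 0, 0, 0, A))"
  have "lf ?f0" "lf ?f1" "lf ?f2" "lf ?f3" "lf ?f4"
    unfolding lf_def
    by (auto simp: lf_add[OF assms, symmetric] lf_sm[OF assms, symmetric] blk_add[symmetric] blk_smt[symmetric] smt_def)
  note lfs = this
  obtain C0 where C0: "C0 \<in> M a a" "\<forall>A \<in> M a a. ?f0 A = tr (C0 * A)"
    using functional_trace[OF lfs(1), of a a] by blast
  obtain C1 where C1: "C1 \<in> M a a" "\<forall>A \<in> M a a. ?f1 A = tr (C1 * A)"
    using functional_trace[OF lfs(2), of a a] by blast
  obtain D where D: "D \<in> M b b" "\<forall>A \<in> M b b. ?f2 A = tr (D * A)"
    using functional_trace[OF lfs(3), of b b] by blast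
  obtain S where S: "S \<in> M b a" "\<forall>A \<in> M a b. ?f3 A = tr (S * A)"
    using functional_trace[OF lfs(4), of b a] by blast
  obtain T where T: "T \<in> M b a" "\<forall>A \<in> M a b. ?f4 A = tr (T * A)"
    using functional_trace[OF lfs(5), of b a] by blast
  note C = C0(1) C1(1) D(1) S(1) T(1) C0(2) C1(2) D(2) S(2) T(2)
  have "\<beta> (blk a b x) = pair5 (C0, C1, D, S, T) x" if x: "x \<in> tup_r a b" for x
  proof -
    obtain A0 A1 B W V where xe: "x = (A0, A1, B, W, V)" and m: "A0 \<in> M a a" "A1 \<in> M a a" "B \<in> M b b" "W \<in> M a b" "V \<in> M a b"
      using x by (auto simp: tup_r_def)
    have "x = (A0, 0, 0, 0, 0) + (0, A1, 0, 0, 0) + (0, 0, B, 0, 0) + (0, 0, 0, W, 0) + (0, 0, 0, 0, V)"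
      by (simp add: xe)
    then have "\<beta> (blk a b x) = ?f0 A0 + ?f1 A1 + ?f2 B + ?f3 W + ?f4 V"
      by (simp only: blk_add lf_add[OF assms])
    then show ?thesis using C(6-) m by (simp add: xe pair5_def)
  qed
  then show ?thesis using C(1-5) by (intro bexI[of _ "(C0, C1, D, S, T)"]) (auto simp: params_def)
qed

section \<open>Existence of split linear forms\<close>

text \<open>\<open>reg\<close> is what the index hypothesis provides: a form with stabiliser of
  dimension at most two. \<open>split\<close> is the target: a stabiliser spanned by the unit and an
  element with two distinct eigenvalues.\<close>

definition reg_r :: "nat \<Rightarrow> nat \<Rightarrow> 'a::field itself \<Rightarrow> bool" where
  "reg_r a b K \<longleftrightarrow> (\<exists>G \<in> params a b. rank_le_2 a b (rsol a b (G :: 'a t5)))"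
definition reg_q :: "nat \<Rightarrow> nat \<Rightarrow> 'a::field itself \<Rightarrow> bool" where
  "reg_q a b K \<longleftrightarrow> (\<exists>G \<in> params a b. rank_le_2 a b (qsol a b (G :: 'a t5)))"
definition split_r :: "nat \<Rightarrow> nat \<Rightarrow> 'a::field itself \<Rightarrow> bool" where
  "split_r a b K \<longleftrightarrow> (\<exists>G \<in> params a b. split a b (rsol a b (G :: 'a t5)))"
definition split_q :: "nat \<Rightarrow> nat \<Rightarrow> 'a::field itself \<Rightarrow> bool" where
  "split_q a b K \<longleftrightarrow> (\<exists>G \<in> params a b. split a b (qsol a b (G :: 'a t5)))"

lemma params_comb: "G \<in> params a b \<Longrightarrow> G' \<in> params a b \<Longrightarrow> G + smt t G' \<in> params a b"
  by (auto simp: params_def smt_def M_add M_sm)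

lemma rsol_generic:
  assumes "0 < a + b" "G \<in> params a b" "G' \<in> params a b" "rank_le_2 a b (rsol a b G)"
  shows "finite {t. \<not> rank_le_2 a b (rsol a b (G + smt t G'))}"
  using rank_le_2_generic[OF subalg_rq(1) assms(1), of G G'] assms(2-4) by (simp add: rsol_sol params_comb)

lemma qsol_generic:
  assumes "0 < a + b" "G \<in> params a b" "G' \<in> params a b" "rank_le_2 a b (qsol a b G)"
  shows "finite {t. \<not> rank_le_2 a b (qsol a b (G + smt t G'))}"
  using rank_le_2_generic[OF subalg_rq(2) assms(1), of G G'] assms(2-4) by (simp add: qsol_sol params_comb)

text \<open>The first m and the last n - m columns of an invertible matrix, together with the
  matching rows of its inverse.\<close>

lemma splitting_of_unit:
  fixes H h :: "'a::field fm"
  assumes H: "H \<in> M n n" "h \<in> M n n" "H * h = idm n" "h * H = idm n" and m: "m \<le> n"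
  shows "splitting n m (n - m) (H * idm m) (idm m * h) (H * sh m (n - m)) (sh' m (n - m) * h)"
proof
  have s: "sh m (n - m) \<in> M n (n - m)" "sh' m (n - m) \<in> M (n - m) n" 
    using M_sh[of m "n - m"] M_sh'[of m "n - m"] m by simp_all
  have i: "idm m \<in> M n m" "idm m \<in> M m n" using m by (simp_all add: M_idm)
  show "H * idm m \<in> M n m" "idm m * h \<in> M m n" "H * sh m (n - m) \<in> M n (n - m)" "sh' m (n - m) * h \<in> M (n - m) n"
    using H i s by (auto intro: M_closed)
  have hH: "h * (H * z) = z" if "z \<in> M n k" for z k
    using that by (simp add: mult.assoc[symmetric] H(4) idm_times)
  have k: "sh' m (n - m) * idm m = (0 :: 'a fm)" "idm m * sh m (n - m) = (0 :: 'a fm)" "idm m * idm m = (idm m :: 'a fm)"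
    by (rule sh_kill[OF M_idm[OF le_refl le_refl] le_refl] idm_times[OF M_idm[OF le_refl le_refl] le_refl])+
  show "idm m * h * (H * idm m) = idm m" "sh' m (n - m) * h * (H * sh m (n - m)) = idm (n - m)"
    "idm m * h * (H * sh m (n - m)) = 0" "sh' m (n - m) * h * (H * idm m) = 0"
    by (simp_all add: mult.assoc hH[OF i(1)] hH[OF s(1)] k sh_times_sh)
  have "H * idm m * (idm m * h) + H * sh m (n - m) * (sh' m (n - m) * h)
     = H * (idm m + sh m (n - m) * sh' m (n - m)) * h"
    using k(3)[THEN asc] by (simp add: algebra_simps)
  then show "H * idm m * (idm m * h) + H * sh m (n - m) * (sh' m (n - m) * h) = idm n"
    using H m by (simp add: idm_sh_sum times_idm)
qed

lemma splitting_std: "m \<le> n \<Longrightarrow> splitting n m (n - m) (idm m :: 'a::field fm) (idm m) (sh m (n - m)) (sh' m (n - m))"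
proof -
  assume m: "m \<le> n"
  have "idm n * idm m = (idm m :: 'a fm)" "idm m * idm n = (idm m :: 'a fm)"
    "idm n * sh m (n - m) = (sh m (n - m) :: 'a fm)" "sh' m (n - m) * idm n = (sh' m (n - m) :: 'a fm)"
    "idm n * idm n = (idm n :: 'a fm)"
    using m M_sh[of m "n - m"] M_sh'[of m "n - m"] by (auto intro!: idm_times times_idm M_idm)
  then show ?thesis using splitting_of_unit[OF _ _ _ _ m, of "idm n :: 'a fm" "idm n"] by (simp add: M_idm)
qed

text \<open>Padding P to a square matrix, the first a columns of \<open>P + t 1\<close> are
  \<open>P + t * idm a\<close>. Invertibility for almost all t therefore completes them to a
  splitting.\<close>

lemma generic_splitting_l:
  assumes "P \<in> M b a" "a \<le> b"
  shows "finite {t. \<not> (\<exists>P' N N'. splitting b a (b - a) (P + sm t (idm a)) P' N N')}"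
proof (rule finite_subset[OF _ invertible_generic[of P b]])
  show "P \<in> M b b" using assms by (auto intro: M_mono)
  show "{t. \<not> (\<exists>P' N N'. splitting b a (b - a) (P + sm t (idm a)) P' N N')}
    \<subseteq> {t. \<not> (\<exists>h\<in>M b b. (P + sm t (idm b)) * h = idm b \<and> h * (P + sm t (idm b)) = idm b)}"
  proof (rule Collect_mono, intro impI notI)
    fix t assume n: "\<not> (\<exists>P' N N'. splitting b a (b - a) (P + sm t (idm a)) P' N N')"
    assume "\<exists>h\<in>M b b. (P + sm t (idm b)) * h = idm b \<and> h * (P + sm t (idm b)) = idm b"
    then obtain h where h: "h \<in> M b b" "(P + sm t (idm b)) * h = idm b" "h * (P + sm t (idm b)) = idm b" by auto
    have "(P + sm t (idm b)) * idm a = P + sm t (idm a)"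
      using assms by (simp add: distrib_right times_idm idm_times[OF M_idm])
    then show False using splitting_of_unit[OF _ h assms(2)] n \<open>P \<in> M b b\<close> by (metis M_add M_sm M_idm le_refl)
  qed
qed

text \<open>Here T supplies the first b rows of an invertible square matrix, so it becomes the
  projection and not the inclusion.\<close>

lemma generic_splitting_r:
  assumes "T \<in> M b a" "b \<le> a"
  shows "finite {t. \<not> (\<exists>P N N'. splitting a b (a - b) P (T + sm t (idm b)) N N')}"
proof (rule finite_subset[OF _ invertible_generic[of T a]])
  show "T \<in> M a a" using assms by (auto intro: M_mono)
  show "{t. \<not> (\<exists>P N N'. splitting a b (a - b) P (T + sm t (idm b)) N N')}
    \<subseteq> {t. \<not> (\<exists>h\<in>M a a. (T + sm t (idm a)) * h = idm a \<and> h * (T + sm t (idm a)) = idm a)}"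
  proof (rule Collect_mono, intro impI notI)
    fix t assume n: "\<not> (\<exists>P N N'. splitting a b (a - b) P (T + sm t (idm b)) N N')"
    assume "\<exists>h\<in>M a a. (T + sm t (idm a)) * h = idm a \<and> h * (T + sm t (idm a)) = idm a"
    then obtain h where h: "h \<in> M a a" "(T + sm t (idm a)) * h = idm a" "h * (T + sm t (idm a)) = idm a" by auto
    have "idm b * (T + sm t (idm a)) = T + sm t (idm b)"
      using assms by (simp add: distrib_left idm_times times_idm[OF M_idm])
    then show False using splitting_of_unit[OF h(1) _ h(3,2) assms(2)] n \<open>T \<in> M a a\<close> by (metis M_add M_sm M_idm le_refl)
  qed
qed

context splitting
begin

lemma reg1:
  assumes "C \<in> M a a" "D \<in> M b b" "Q \<in> M b a" "rank_le_2 a b (qsol a b (C, C1, D, P, Q))"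
  shows "reg_r a c TYPE('a)"
proof -
  let ?G = "(C + P' * D * P, P' * Q, N' * D * N, N' * D * P, N' * Q)"
  have "rank_le_2 a c (rsol a c ?G)"
  proof (rule rank_le_2_image[OF lin5_maps(1) one_maps(1) assms(4)])
    show "rsol a c ?G \<subseteq> f1 ` qsol a b (C, C1, D, P, Q)"
      using g1_sol[OF assms(1-3)] by (metis image_eqI subsetI)
  qed
  moreover have "?G \<in> params a c" using assms M by (auto simp: params_def intro!: M_add intro: M_times)
  ultimately show ?thesis unfolding reg_r_def by blast
qed

text \<open>Every parameter of r(a, c) is the reduction of some parameter of q(a, b). The
  isomorphism of stabilisers therefore lifts splittings.\<close>

lemma split1: assumes "split_r a c TYPE('a)" shows "split_q a b TYPE('a)"
proof -
  obtain C0 C1 D S T where G: "C0 \<in> M a a" "C1 \<in> M a a" "D \<in> M c c" "S \<in> M c a" "T \<in> M c a"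
    and s: "split a c (rsol a c (C0, C1, D, S, T :: 'a fm))"
    using assms unfolding split_r_def params_def by auto
  \<comment> \<open>With these choices \<open>N' * D' * P = S\<close>,
    \<open>N' * D' * N = D\<close>, \<open>P' * D' * P = 0\<close>, \<open>P' * Q = C1\<close> and
    \<open>N' * Q = T\<close>, so the reduced parameter is the given one.\<close>
  define D' where "D' = N * S * P' + N * D * N'"
  define Q where "Q = P * C1 + N * T"
  have m: "D' \<in> M b b" "Q \<in> M b a" unfolding D'_def Q_def using G M by - (assumption | rule M_closed)+
  have i: "idm c * S = S" "S * idm a = S" "idm c * T = T" "idm a * C1 = C1" "idm c * D = D" "D * idm c = D"
    using G by (simp_all add: M_iff)
  have e: "(C0 + P' * D' * P, P' * Q, N' * D' * N, N' * D' * P, N' * Q) = (C0, C1, D, S, T)"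
    unfolding D'_def Q_def by (simp add: algebra_simps cancel i)
  have f: "f1 x \<in> rsol a c (C0, C1, D, S, T)" "g1 D' Q (f1 x) = x" if "x \<in> qsol a b (C0, 0, D', P, Q)" for x
    using f1_sol[OF G(1) m that] by (simp_all only: e)
  have g: "g1 D' Q y \<in> qsol a b (C0, 0, D', P, Q)" if "y \<in> rsol a c (C0, C1, D, S, T)" for y
    by (rule g1_sol(1)[OF G(1) m]) (use that in \<open>simp only: e\<close>)
  have "split a b (qsol a b (C0, 0, D', P, Q))"
  proof (rule split_pullback[OF lin5_maps(2) one_maps(4)[OF m(1)] s _ ev1])
    show "qsol a b (C0, 0, D', P, Q) = g1 D' Q ` rsol a c (C0, C1, D, S, T)"
      by (intro equalityI subsetI) (metis f image_eqI, use g in blast)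
  qed
  moreover have "(C0, 0, D', P, Q) \<in> params a b" using G m M by (auto simp: params_def)
  ultimately show ?thesis unfolding split_q_def by blast
qed

lemma reg2:
  assumes "C0 \<in> M a a" "C1 \<in> M a a" "D \<in> M b b" "S \<in> M b a" "rank_le_2 a b (rsol a b (C0, C1, D, S, P))"
  shows "reg_q a c TYPE('a)"
proof -
  let ?G = "(P' * D * P + C0 + (P' * S * C1 - C1 * (P' * S)), 0, N' * D * N, N' * D * P + N' * S * C1, N' * S)"
  have "rank_le_2 a c (qsol a c ?G)"
  proof (rule rank_le_2_image[OF lin5_maps(3) one_maps(2) assms(5)])
    show "qsol a c ?G \<subseteq> f2 C1 ` rsol a b (C0, C1, D, S, P)"
      using g2_sol[OF assms(1-4)] by (metis image_eqI subsetI)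
  qed
  moreover have "P' * D * P + C0 + (P' * S * C1 - C1 * (P' * S)) \<in> M a a" "N' * D * N \<in> M c c"
    "N' * D * P + N' * S * C1 \<in> M c a" "N' * S \<in> M c a"
    using assms(1-4) M by - (assumption | rule M_closed)+
  then have "?G \<in> params a c" by (auto simp: params_def)
  ultimately show ?thesis unfolding reg_q_def by blast
qed

lemma split2: assumes "split_q a c TYPE('a)" shows "split_r a b TYPE('a)"
proof -
  obtain C0 C1 D S T where G: "C0 \<in> M a a" "C1 \<in> M a a" "D \<in> M c c" "S \<in> M c a" "T \<in> M c a"
    and s: "split a c (qsol a c (C0, C1, D, S, T :: 'a fm))"
    using assms unfolding split_q_def params_def by auto
  \<comment> \<open>The lift has C1 = 0, which removes all correction terms of the reduction. The
    blocks \<open>N' * D' * P\<close>, \<open>N' * D' * N\<close> and \<open>N' * Q\<close> are then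
    S, D and T.\<close>
  define D' where "D' = N * S * P' + N * D * N'"
  define Q where "Q = N * T"
  have m: "D' \<in> M b b" "Q \<in> M b a" unfolding D'_def Q_def using G M by - (assumption | rule M_closed)+
  have i: "idm c * S = S" "S * idm a = S" "idm c * T = T" "idm c * D = D" "D * idm c = D"
    using G by (simp_all add: M_iff)
  have e: "(P' * D' * P + C0 + (P' * Q * 0 - 0 * (P' * Q)), C1, N' * D' * N, N' * D' * P + N' * Q * 0, N' * Q) = (C0, C1, D, S, T)"
    unfolding D'_def Q_def by (simp add: algebra_simps cancel i)
  have f: "f2 0 x \<in> qsol a c (C0, C1, D, S, T)" "g2 0 D' Q (f2 0 x) = x" if "x \<in> rsol a b (C0, 0, D', Q, P)" for x
    using f2_sol(1)[OF G(1) M_zero m that, where C'=C1] f2_sol(2)[OF G(1) M_zero m that] by (simp_all only: e)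
  have g: "g2 0 D' Q y \<in> rsol a b (C0, 0, D', Q, P)" if "y \<in> qsol a c (C0, C1, D, S, T)" for y
    by (rule g2_sol(1)[OF G(1) M_zero m, where C'=C1]) (use that in \<open>simp only: e\<close>)
  have "split a b (rsol a b (C0, 0, D', Q, P))"
  proof (rule split_pullback[OF lin5_maps(4) one_maps(5)[OF M_zero m] s _ ev2])
    show "rsol a b (C0, 0, D', Q, P) = g2 0 D' Q ` qsol a c (C0, C1, D, S, T)"
      by (intro equalityI subsetI) (metis f image_eqI, use g in blast)
  qed
  moreover have "(C0, 0, D', Q, P) \<in> params a b" using G m M by (auto simp: params_def)
  ultimately show ?thesis unfolding split_r_def by blast
qed

lemma reg3:
  assumes par: "C0 \<in> M b b" "C1 \<in> M b b" "D \<in> M a a" "S \<in> M a b"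
    and r: "rank_le_2 b a (rsol b a (C0, C1, D, S, P'))"
  shows "reg_r c a TYPE('a)"
proof -
  \<comment> \<open>P is a right inverse of P', so this Z satisfies \<open>S + P' * Z = 0\<close>
    and the first conjugation clears S.\<close>
  define Z where "Z = - (P * S)"
  have Z: "Z \<in> M b b" unfolding Z_def using par M by (auto intro!: M_uminus intro: M_times)
  have PZ: "S + P' * Z = 0" unfolding Z_def using par by (simp add: cancel idm_times)
  define C0' where "C0' = C0 + (C1 * Z - Z * C1)"
  have C0': "C0' \<in> M b b" unfolding C0'_def using par Z by - (assumption | rule M_closed)+
  have "rank_le_2 b a (rsol b a (C0', C1, D, 0, P'))"
  proof (rule rank_le_2_image[OF gauge_lin(1) gauge_one(1)[OF Z] r])
    show "rsol b a (C0', C1, D, 0, P') \<subseteq> gauge1 Z ` rsol b a (C0, C1, D, S, P')"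
    proof
      fix x assume "x \<in> rsol b a (C0', C1, D, 0, P')"
      from gauge1_sol[OF M_uminus[OF Z] this] have "gauge1 (- Z) x \<in> rsol b a (C0, C1, D, S, P')"
        using PZ by (simp add: C0'_def algebra_simps add_eq_0_iff2)
      then show "x \<in> gauge1 Z ` rsol b a (C0, C1, D, S, P')" by (metis gauge_inv(1) image_eqI)
    qed
  qed
  note r = this
  \<comment> \<open>Then \<open>(C1 - z * P') * P = 0\<close>, the second normalisation needed for
    the reduction.\<close>
  define z where "z = C1 * P"
  have z: "z \<in> M b a" unfolding z_def using par M by (auto intro: M_times)
  define C1' where "C1' = C1 - z * P'"
  have C1': "C1' \<in> M b b" "C1' * P = 0" unfolding C1'_def z_def using par M
    by (auto intro!: M_diff intro: M_times simp: algebra_simps cancel)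
  have "rank_le_2 b a (rsol b a (C0', C1', D, 0, P'))"
  proof (rule rank_le_2_image[OF gauge_lin(2) gauge_one(2)[OF z] r])
    show "rsol b a (C0', C1', D, 0, P') \<subseteq> gauge2 z ` rsol b a (C0', C1, D, 0, P')"
    proof
      fix x assume "x \<in> rsol b a (C0', C1', D, 0, P')"
      from gauge2_sol[OF M_uminus[OF z] this] have "gauge2 (- z) x \<in> rsol b a (C0', C1, D, 0, P')"
        by (simp add: C1'_def)
      then show "x \<in> gauge2 z ` rsol b a (C0', C1, D, 0, P')" by (metis gauge_inv(2) image_eqI)
    qed
  qed
  note r = this
  let ?G = "(N' * C0' * N, N' * C1' * N, D + P' * C0' * P, P' * C0' * N, P' * C1' * N)"
  have "rank_le_2 c a (rsol c a ?G)"
  proof (rule rank_le_2_image[OF lin5_maps(5) one_maps(3) r])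
    show "rsol c a ?G \<subseteq> f3 ` rsol b a (C0', C1', D, 0, P')"
      using g3_sol[OF C0' C1' par(3)] by (metis image_eqI subsetI)
  qed
  moreover have "N' * C0' * N \<in> M c c" "N' * C1' * N \<in> M c c" "D + P' * C0' * P \<in> M a a"
    "P' * C0' * N \<in> M a c" "P' * C1' * N \<in> M a c"
    using par C0' C1'(1) M by - (assumption | rule M_closed)+
  then have "?G \<in> params c a" by (auto simp: params_def)
  ultimately show ?thesis unfolding reg_r_def by blast
qed

lemma split3: assumes "split_r c a TYPE('a)" shows "split_r b a TYPE('a)"
proof -
  obtain C0 C1 D S T where G: "C0 \<in> M c c" "C1 \<in> M c c" "D \<in> M a a" "S \<in> M a c" "T \<in> M a c"
    and s: "split c a (rsol c a (C0, C1, D, S, T :: 'a fm))"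
    using assms unfolding split_r_def params_def by auto
  \<comment> \<open>The prescribed C0, S and C1, T are placed into the N and P blocks. The P columns
    of C1' vanish, so the lifted parameter is already normalised.\<close>
  define C0' where "C0' = P * S * N' + N * C0 * N'"
  define C1' where "C1' = P * T * N' + N * C1 * N'"
  have m: "C0' \<in> M b b" "C1' \<in> M b b" unfolding C0'_def C1'_def using G M by - (assumption | rule M_closed)+
  have z: "C1' * P = 0" by (simp add: C1'_def algebra_simps cancel)
  have i: "idm a * S = S" "S * idm c = S" "idm a * T = T" "T * idm c = T" "idm c * C0 = C0" "C0 * idm c = C0"
    "idm c * C1 = C1" "C1 * idm c = C1"
    using G by (simp_all add: M_iff)
  have e: "(N' * C0' * N, N' * C1' * N, D + P' * C0' * P, P' * C0' * N, P' * C1' * N) = (C0, C1, D, S, T)"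
    unfolding C0'_def C1'_def by (simp add: algebra_simps cancel i)
  have f: "f3 x \<in> rsol c a (C0, C1, D, S, T)" "g3 C0' C1' (f3 x) = x" if "x \<in> rsol b a (C0', C1', D, 0, P')" for x
    using f3_sol[OF m z G(3) that] by (simp_all only: e)
  have g: "g3 C0' C1' y \<in> rsol b a (C0', C1', D, 0, P')" if "y \<in> rsol c a (C0, C1, D, S, T)" for y
    by (rule g3_sol(1)[OF m z G(3)]) (use that in \<open>simp only: e\<close>)
  have "split b a (rsol b a (C0', C1', D, 0, P'))"
  proof (rule split_pullback[OF lin5_maps(6) one_maps(6)[OF m z] s _ ev3])
    show "rsol b a (C0', C1', D, 0, P') = g3 C0' C1' ` rsol c a (C0, C1, D, S, T)"
      by (intro equalityI subsetI) (metis f image_eqI, use g in blast)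
  qed
  moreover have "(C0', C1', D, 0, P') \<in> params b a" using G m M by (auto simp: params_def)
  ultimately show ?thesis unfolding split_r_def by blast
qed

end

lemma infinite_good:
  assumes "finite {t :: 'a::field_char_0. \<not> X t}" "finite {t. \<not> Y t}"
  shows "\<exists>t. X t \<and> Y t"
  using ex_new_if_finite[OF infinite_UNIV_char_0 finite_UnI[OF assms]] by auto

text \<open>A small stabiliser and the injectivity of \<open>P + t * idm a\<close> each fail for
  finitely many t only, so one t serves both and the reduction applies there.\<close>

lemma step_q:
  assumes "a \<le> b" "0 < a" "reg_q a b TYPE('a::field_char_0)"
  shows "reg_r a (b - a) TYPE('a)"
proof -
  obtain C C1 D P Q where G: "C \<in> M a a" "C1 \<in> M a a" "D \<in> M b b" "P \<in> M b a" "Q \<in> M b a"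
    and r: "rank_le_2 a b (qsol a b (C, C1, D, P, Q :: 'a fm))"
    using assms(3) unfolding reg_q_def params_def by auto
  have "finite {t. \<not> rank_le_2 a b (qsol a b ((C, C1, D, P, Q) + smt t (0, 0, 0, idm a, 0)))}"
    by (rule qsol_generic[OF _ _ _ r]) (use assms G in \<open>auto simp: params_def M_idm\<close>)
  from infinite_good[OF this generic_splitting_l[OF G(4) assms(1)]] obtain t P' N N' where
    t: "rank_le_2 a b (qsol a b (C, C1, D, P + sm t (idm a), Q))"
      "splitting b a (b - a) (P + sm t (idm a)) P' N N'"
    by (auto simp: smt_def)
  show ?thesis by (rule splitting.reg1[OF t(2) G(1,3,5) t(1)])
qed

lemma step_r:
  assumes "a \<le> b" "0 < a" "reg_r a b TYPE('a::field_char_0)"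
  shows "reg_q a (b - a) TYPE('a)"
proof -
  obtain C0 C1 D S T where G: "C0 \<in> M a a" "C1 \<in> M a a" "D \<in> M b b" "S \<in> M b a" "T \<in> M b a"
    and r: "rank_le_2 a b (rsol a b (C0, C1, D, S, T :: 'a fm))"
    using assms(3) unfolding reg_r_def params_def by auto
  have "finite {t. \<not> rank_le_2 a b (rsol a b ((C0, C1, D, S, T) + smt t (0, 0, 0, 0, idm a)))}"
    by (rule rsol_generic[OF _ _ _ r]) (use assms G in \<open>auto simp: params_def M_idm\<close>)
  from infinite_good[OF this generic_splitting_l[OF G(5) assms(1)]] obtain t P' N N' where
    t: "rank_le_2 a b (rsol a b (C0, C1, D, S, T + sm t (idm a)))"
      "splitting b a (b - a) (T + sm t (idm a)) P' N N'"
    by (auto simp: smt_def)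
  show ?thesis by (rule splitting.reg2[OF t(2) G(1-4) t(1)])
qed

lemma step_r':
  assumes "b \<le> a" "0 < b" "reg_r a b TYPE('a::field_char_0)"
  shows "reg_r (a - b) b TYPE('a)"
proof -
  obtain C0 C1 D S T where G: "C0 \<in> M a a" "C1 \<in> M a a" "D \<in> M b b" "S \<in> M b a" "T \<in> M b a"
    and r: "rank_le_2 a b (rsol a b (C0, C1, D, S, T :: 'a fm))"
    using assms(3) unfolding reg_r_def params_def by auto
  have "finite {t. \<not> rank_le_2 a b (rsol a b ((C0, C1, D, S, T) + smt t (0, 0, 0, 0, idm b)))}"
    by (rule rsol_generic[OF _ _ _ r]) (use assms G in \<open>auto simp: params_def M_idm\<close>)
  from infinite_good[OF this generic_splitting_r[OF G(5) assms(1)]] obtain t P N N' where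
    t: "rank_le_2 a b (rsol a b (C0, C1, D, S, T + sm t (idm b)))"
      "splitting a b (a - b) P (T + sm t (idm b)) N N'"
    by (auto simp: smt_def)
  show ?thesis by (rule splitting.reg3[OF t(2) G(1-4) t(1)])
qed

lemma params_swap: "(C, C1, D, P, Q) \<in> params a b \<Longrightarrow> (tpose D, 0, tpose C, tpose P, tpose Q) \<in> params b a"
  by (auto simp: params_def M_tpose)

lemma qsol_swap:
  "qsol b a (tpose D, C1', tpose C, tpose P, tpose Q) = swap5 ` qsol a b (C, C1, D, P, Q)"
proof -
  have "x \<in> swap5 ` qsol a b (C, C1, D, P, Q)" if "x \<in> qsol b a (tpose D, C1', tpose C, tpose P, tpose Q)" for x
    using swap5_sol[OF that, of C1] swap5_swap5[OF that] by (metis image_eqI tpose_tpose)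
  then show ?thesis using swap5_sol by blast
qed

lemma reg_q_swap: assumes "reg_q a b TYPE('a::field)" shows "reg_q b a TYPE('a)"
proof -
  obtain C C1 D P Q where G: "(C, C1, D, P, Q) \<in> params a b" and r: "rank_le_2 a b (qsol a b (C, C1, D, P, Q :: 'a fm))"
    using assms unfolding reg_q_def by auto
  have "rank_le_2 b a (qsol b a (tpose D, 0, tpose C, tpose P, tpose Q))"
    unfolding qsol_swap[of b a D 0 C P Q C1] by (rule rank_le_2_image[OF swap5_lin swap5_one r subset_refl])
  then show ?thesis using params_swap[OF G] unfolding reg_q_def by blast
qed

lemma split_q_swap: assumes "split_q a b TYPE('a::field)" shows "split_q b a TYPE('a)"
proof -
  obtain C C1 D P Q where G: "(C, C1, D, P, Q) \<in> params a b" and r: "split a b (qsol a b (C, C1, D, P, Q :: 'a fm))"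
    using assms unfolding split_q_def by auto
  have "split b a (qsol b a (tpose D, 0, tpose C, tpose P, tpose Q))"
    by (rule split_pullback[OF swap5_lin swap5_one r qsol_swap swap5_ev])
  then show ?thesis using params_swap[OF G] unfolding split_q_def by blast
qed

lemma M_0: "(x \<in> M 0 n) = (x = (0 :: 'a::field fm))" "(x \<in> M n 0) = (x = (0 :: 'a::field fm))"
  by (auto simp: M_def intro!: fm_eqI)

text \<open>For a = 0 both algebras are gl(b), and the stabiliser is the centraliser of D.\<close>

lemma sol_gl:
  "rsol 0 b (C0, C1, D, S, T) = {(0, 0, B, 0, 0) | B. B \<in> M b b \<and> B * D = D * B}"
  "qsol 0 b (C0, C1, D, S, T) = {(0, 0, B, 0, 0) | B. B \<in> M b b \<and> B * D = D * B}"
  if "(C0, C1, D, S, T) \<in> params 0 b"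
  using that by (auto simp: rsol_def qsol_def params_def M_0)

lemma qsol_rsol_gl: "G \<in> params 0 b \<Longrightarrow> qsol 0 b G = rsol 0 b G"
  by (cases G) (simp add: sol_gl)

lemma reg_q_gl: "reg_q 0 b K \<longleftrightarrow> reg_r 0 b K"
  unfolding reg_q_def reg_r_def by (rule bex_cong[OF refl]) (simp add: qsol_rsol_gl)

lemma split_q_gl: "split_q 0 b K \<longleftrightarrow> split_r 0 b K"
  unfolding split_q_def split_r_def by (rule bex_cong[OF refl]) (simp add: qsol_rsol_gl)

lemma times_el: assumes "x \<in> M m n" shows "ent (x * el p q) i j = (if j = q then ent x i p else 0)"
proof -
  have "ent (x * el p q) i j = (\<Sum>k<n. if k = p then (if j = q then ent x i p else 0) else 0)"
    unfolding ent_times[OF assms] by (intro sum.cong) (auto simp: ent_el)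
  then show ?thesis using M_D[OF assms, of i p] by auto
qed

lemma el_times: "ent (el p q * x) i j = (if i = p then ent x q j else 0)"
proof -
  have "ent (el p q * x) i j = (\<Sum>k<Suc q. if k = q then (if i = p then ent x q j else 0) else 0)"
    unfolding ent_times[OF M_el[OF lessI lessI]] by (intro sum.cong) (auto simp: ent_el)
  then show ?thesis by simp
qed

lemma el_mult: "el p q * el r s = (if q = r then el p s else 0)"
  by (rule fm_eqI) (auto simp: el_times ent_el)

text \<open>diag(0, 1) commutes only with diagonal matrices, that is with the span of 1 and itself,
  and its eigenvalues are 0 and 1.\<close>

lemma split_gl_2: "split_r 0 2 TYPE('a::field)"
proof -
  let ?d = "el 1 1 :: 'a fm"
  let ?G = "(0, 0, ?d, 0, 0) :: 'a t5"
  have G: "?G \<in> params 0 2" by (auto simp: params_def M_el)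
  have "split 0 2 (rsol 0 2 ?G)" unfolding split_def sol_gl(1)[OF G]
  proof (rule bexI[of _ ?G], intro conjI exI)
    show "spanned_by (one5 0 2) ?G {(0, 0, B, 0, 0) | B. B \<in> M 2 2 \<and> B * ?d = ?d * B}"
      unfolding spanned_by_def
    proof
      fix x :: "'a t5" assume "x \<in> {(0, 0, B, 0, 0) | B. B \<in> M 2 2 \<and> B * ?d = ?d * B}"
      then obtain B where B: "x = (0, 0, B, 0, 0)" "B \<in> M 2 2" "B * ?d = ?d * B" by auto
      have e: "(if j = 1 then ent B i 1 else 0) = (if i = 1 then ent B 1 j else 0)" for i j
        using arg_cong[OF B(3), of "\<lambda>z. ent z i j"] by (simp only: times_el[OF B(2)] el_times)
      have "B = sm (ent B 0 0) (idm 2) + sm (ent B 1 1 - ent B 0 0) ?d"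
      proof (rule fm_eqI)
        fix i j
        show "ent B i j = ent (sm (ent B 0 0) (idm 2) + sm (ent B 1 1 - ent B 0 0) ?d) i j"
          using e[of 0 1] e[of 1 0] M_D[OF B(2), of i j]
          by (cases "i < 2 \<and> j < 2") (auto simp: ent_idm ent_el less_2_cases_iff)
      qed
      then have "x = smt (ent B 0 0) (one5 0 2) + smt (ent B 1 1 - ent B 0 0) ?G"
        using M_idm[of 0 0 0, where 'a='a] by (simp add: B(1) one5_def smt_def M_0)
      then show "\<exists>s t. x = smt s (one5 0 2) + smt t ?G" by blast
    qed
    show "(0 :: 'a) \<noteq> 1" by simp
    have m: "(el 0 0 :: 'a fm) \<in> M 1 1" "?d \<in> M 2 2" by (auto intro: M_el)
    have nz: "(el i i :: 'a fm) \<noteq> 0" for i by (metis ent_el ent_zero zero_neq_one)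
    have "el 0 0 * ?d = 0" "?d * ?d = ?d"
      by (simp_all add: el_mult)
    moreover have "el 0 0 * idm 2 = (el 0 0 :: 'a fm)" "?d * idm 2 = ?d"
      using times_idm[OF m(1)] times_idm[OF m(2)] by auto
    ultimately show "ev 0 2 ?G 0" "ev 0 2 ?G 1" unfolding ev_def split_conv using nz by fastforce+
  qed (use G in \<open>auto simp: params_def\<close>)
  then show ?thesis using G unfolding split_r_def by blast
qed

text \<open>A centraliser contains 1, C and C^2, and for size at least three these are linearly
  independent for generic C. Genericity is tested on a pencil through a diagonal matrix with three
  distinct eigenvalues.\<close>

lemma reg_gl_le_2: assumes "reg_r 0 b TYPE('a::field_char_0)" shows "b \<le> 2"
proof (rule ccontr)
  assume "\<not> b \<le> 2"
  then have b: "3 \<le> b" by simp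
  obtain G where G: "G \<in> params 0 b" and r: "rank_le_2 0 b (rsol 0 b (G :: 'a t5))"
    using assms unfolding reg_r_def by auto
  then obtain D where Ge: "G = (0, 0, D, 0, 0)" and D: "D \<in> M b b" by (auto simp: params_def M_0)
  \<comment> \<open>diag(0, 1, 2) in the upper corner, for which the vector v with entries 1, 1, 1
    is cyclic on the first three coordinates.\<close>
  define E :: "'a fm" where "E = el 1 1 + sm 2 (el 2 2)"
  have E: "E \<in> M b b" unfolding E_def using b by (auto intro!: M_add M_sm M_el)
  have bad1: "finite {t. \<not> rank_le_2 0 b (rsol 0 b (G + smt t (0, 0, E, 0, 0)))}"
    by (rule rsol_generic[OF _ G _ r]) (use b E in \<open>auto simp: params_def M_0\<close>)
  define v :: "'a fm" where "v = el 0 0 + el 1 0 + el 2 0"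
  \<comment> \<open>\<open>x s i\<close> and \<open>y s i\<close> are the entries of C v and C^2 v
    for C = E + s D. As v is 1 on the rows 0, 1, 2, the polynomial F is the 3 by 3 minor of v, C v,
    C^2 v on these rows; F(0) = 2.\<close>
  define x where "x = (\<lambda>s i. ent (E * v) i 0 + s * ent (D * v) i 0)"
  define y where "y = (\<lambda>s i. ent (E * (E * v)) i 0 + s * ent (E * (D * v) + D * (E * v)) i 0 + s * s * ent (D * (D * v)) i 0)"
  define F where "F = (\<lambda>s. (x s 1 - x s 0) * (y s 2 - y s 0) - (x s 2 - x s 0) * (y s 1 - y s 0))"
  have "polyfun F" unfolding F_def x_def y_def
    by (intro polyfun_diff polyfun_mult polyfun_add polyfun_const polyfun_id)
  moreover have "F 0 \<noteq> 0"
  proof -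
    have v: "v \<in> M b 1" unfolding v_def using b by (auto intro!: M_add M_el)
    have ev: "ent (E * z) i j = (if i = 1 then ent z 1 j else 0) + 2 * (if i = 2 then ent z 2 j else 0)" for z i j
      by (simp add: E_def distrib_right el_times)
    show ?thesis by (simp add: F_def x_def y_def ev v_def ent_el)
  qed
  ultimately have bad2: "finite {s. F s = 0}" by (rule polyfun_finite)
  \<comment> \<open>With t = 1/s the perturbed D is \<open>inverse s\<close> times C, which has the
    same centraliser as C.\<close>
  have "finite (insert 0 ({s. F s = 0} \<union> inverse ` {t. \<not> rank_le_2 0 b (rsol 0 b (G + smt t (0, 0, E, 0, 0)))}))"
    using bad1 bad2 by simp
  from ex_new_if_finite[OF infinite_UNIV_char_0 this] obtain s where s: "s \<noteq> 0" "F s \<noteq> 0"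
    "rank_le_2 0 b (rsol 0 b (G + smt (inverse s) (0, 0, E, 0, 0)))"
    by (auto simp: image_iff) (metis inverse_inverse_eq)
  define C where "C = E + sm s D"
  have C: "C \<in> M b b" unfolding C_def using D E by (intro M_add M_sm)
  have Gt: "G + smt (inverse s) (0, 0, E, 0, 0) = (0, 0, sm (inverse s) C, 0, 0)"
    using s(1) by (simp add: Ge smt_def C_def algebra_simps fm.scale_right_distrib)
  have par: "(0, 0, sm (inverse s) C, 0, 0) \<in> params 0 b" using C by (auto simp: params_def M_sm M_0)
  obtain u where u: "spanned_by (one5 0 b) u {(0, 0, B, 0, 0) | B. B \<in> M b b \<and> B * sm (inverse s) C = sm (inverse s) C * B}"
    using s(3) unfolding Gt sol_gl(1)[OF par] rank_le_2_def by blast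
  have "idm b * C = C" "C * idm b = C" using C by (simp_all add: M_iff)
  then have inS: "(0, 0, C, 0, 0) \<in> {(0, 0, B, 0, 0) | B. B \<in> M b b \<and> B * sm (inverse s) C = sm (inverse s) C * B}"
      "(0, 0, C * C, 0, 0) \<in> {(0, 0, B, 0, 0) | B. B \<in> M b b \<and> B * sm (inverse s) C = sm (inverse s) C * B}"
    using C M_times[OF C C] by (auto simp: mult.assoc)
  obtain A0 A1 w W V where ue: "u = (A0, A1, w, W, V)" by (cases u)
  obtain s1 t1 s2 t2 where st: "C = sm s1 (idm b) + sm t1 w" "C * C = sm s2 (idm b) + sm t2 w"
    using u[unfolded spanned_by_def, rule_format, OF inS(1)] u[unfolded spanned_by_def, rule_format, OF inS(2)]
    unfolding ue one5_def smt_def by auto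
  \<comment> \<open>C and C^2 both lie in the span of 1 and w, so 1, C, C^2 satisfy a relation that
    involves C or C^2.\<close>
  have dep: "\<exists>p q r. (q \<noteq> 0 \<or> r \<noteq> 0) \<and> sm p (idm b) + sm q C + sm r (C * C) = 0"
  proof (cases "t1 = 0 \<and> t2 = 0")
    case True
    then have "sm (- s1) (idm b) + sm 1 C + sm 0 (C * C) = 0" using st(1) by simp
    then show ?thesis by (intro exI[of _ "- s1"] exI[of _ 1] exI[of _ 0]) simp
  next
    case False
    have "sm (- (t2 * s1 - t1 * s2)) (idm b) + sm t2 C + sm (- t1) (C * C) = 0"
      unfolding st(2) by (subst st(1)) (simp add: fm.scale_right_distrib algebra_simps fm.scale_left_diff_distrib)
    then show ?thesis using False by (intro exI[of _ "- (t2 * s1 - t1 * s2)"] exI[of _ t2] exI[of _ "- t1"]) auto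
  qed
  then obtain p q r where pqr: "q \<noteq> 0 \<or> r \<noteq> 0" "sm p (idm b) + sm q C + sm r (C * C) = 0" by blast
  have v: "v \<in> M b 1" unfolding v_def using b by (auto intro!: M_add M_el)
  have "(sm p (idm b) + sm q C + sm r (C * C)) * v = 0" by (simp add: pqr)
  then have "sm p v + sm q (C * v) + sm r (C * (C * v)) = 0" 
    using v by (simp add: distrib_right mult.assoc idm_times)
  then have "p * ent v i 0 + q * ent (C * v) i 0 + r * ent (C * (C * v)) i 0 = 0" for i
    by (metis ent_add ent_sm ent_zero)
  moreover have "ent (C * v) i 0 = x s i" "ent (C * (C * v)) i 0 = y s i" for i
    by (simp_all add: C_def x_def y_def algebra_simps)
  ultimately have row: "p * ent v i 0 + q * x s i + r * y s i = 0" for i by simp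
  have d: "q * (x s i - x s 0) = - r * (y s i - y s 0)" if "i \<in> {1, 2}" for i
  proof -
    have "q * (x s i - x s 0) + r * (y s i - y s 0) =
        (p * ent v i 0 + q * x s i + r * y s i) - (p * ent v 0 0 + q * x s 0 + r * y s 0)"
      using that by (auto simp: v_def ent_el algebra_simps)
    then show ?thesis by (simp add: row eq_neg_iff_add_eq_0)
  qed
  have d1: "q * (x s 1 - x s 0) = - r * (y s 1 - y s 0)" and d2: "q * (x s 2 - x s 0) = - r * (y s 2 - y s 0)"
    by (rule d, simp)+
  have "q * F s = (q * (x s 1 - x s 0)) * (y s 2 - y s 0) - (q * (x s 2 - x s 0)) * (y s 1 - y s 0)"
    by (simp add: F_def algebra_simps)
  also have "\<dots> = 0" unfolding d1 d2 by (simp add: algebra_simps)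
  finally have q: "q = 0" using s(2) by simp
  have "r * F s = (x s 1 - x s 0) * (r * (y s 2 - y s 0)) - (x s 2 - x s 0) * (r * (y s 1 - y s 0))"
    by (simp add: F_def algebra_simps)
  also have "r * (y s 1 - y s 0) = 0" using d1 q by simp
  also have "r * (y s 2 - y s 0) = 0" using d2 q by simp
  finally have "r * F s = 0" by simp
  then show False using s(2) pqr(1) q by simp
qed

text \<open>All (0, X) with X commuting with C1 stabilise. A span of the unit and one element leaves
  room for only one such direction, so the centraliser of C1 would consist of scalars. Then C1 is
  itself scalar and its centraliser is everything, a contradiction for a at least 2.\<close>

lemma not_reg_r_0: assumes "2 \<le> a" shows "\<not> reg_r a 0 TYPE('a::field)"
proof
  assume "reg_r a 0 TYPE('a)"
  then obtain G where G: "G \<in> params a 0" and r: "rank_le_2 a 0 (rsol a 0 (G :: 'a t5))"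
    unfolding reg_r_def by auto
  then obtain C0 C1 where Ge: "G = (C0, C1, 0, 0, 0)" and C: "C0 \<in> M a a" "C1 \<in> M a a" by (auto simp: params_def M_0)
  obtain u where u: "spanned_by (one5 a 0) u (rsol a 0 G)" using r by (auto simp: rank_le_2_def)
  have mem: "(0, X, 0, 0, 0) \<in> rsol a 0 G" if "X \<in> M a a" "C1 * X = X * C1" for X
    using that by (simp add: Ge rsol_def M_0)
  have one: "one5 a 0 = (idm a, 0, 0, 0, 0 :: 'a fm)" using M_idm[of 0 0 0, where 'a='a] by (simp add: one5_def M_0)
  have nz: "idm a \<noteq> (0 :: 'a fm)" using assms by (intro idm_nz) simp
  obtain U0 U1 U2 U3 U4 where ue: "u = (U0, U1, U2, U3, U4)" by (cases u)
  have dec: "\<exists>s t. 0 = sm s (idm a) + sm t U0 \<and> X = sm t U1" if "X \<in> M a a" "C1 * X = X * C1" for X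
    using u[unfolded spanned_by_def, rule_format, OF mem[OF that]] unfolding ue one smt_def by auto
  have i: "idm a \<in> M a a" "C1 * idm a = idm a * C1" using C by (auto simp: M_idm idm_times times_idm)
  from dec[OF i] obtain s t where st: "0 = sm s (idm a) + sm t U0" "idm a = sm t U1" by auto
  with nz have "t \<noteq> 0" by auto
  have scal: "\<exists>c. X = sm c (idm a)" if X: "X \<in> M a a" "C1 * X = X * C1" for X
  proof -
    from dec[OF X] obtain s' t' where "X = sm t' U1" by auto
    then have "X = sm (t' / t) (idm a)" unfolding st(2) using \<open>t \<noteq> 0\<close> by simp
    then show ?thesis by blast
  qed
  then obtain c where c: "C1 = sm c (idm a)" using C(2) by blast
  have e: "(el 0 0 :: 'a fm) \<in> M a a" using assms by (intro M_el) auto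
  then have "C1 * el 0 0 = el 0 0 * C1" unfolding c by (simp add: idm_times[OF e] times_idm[OF e])
  from scal[OF e this] obtain d where d: "(el 0 0 :: 'a fm) = sm d (idm a)" by auto
  from arg_cong[OF d, of "\<lambda>z. ent z 0 0"] arg_cong[OF d, of "\<lambda>z. ent z 1 1"] show False
    using assms by (simp add: ent_el ent_idm)
qed

text \<open>The Euclidean algorithm: generically \<open>\<qq>(a, b)\<close> reduces to \<open>\<rr>(a, b - a)\<close>, and \<open>\<rr>(a, b)\<close> to
  \<open>\<qq>(a, b - a)\<close> or \<open>\<rr>(a - b, b)\<close>, until one is left with a general linear algebra.\<close>

theorem split_forms:
  assumes "even a" "even b" "0 < a + b"
  shows "(reg_q a b TYPE('a::field_char_0) \<longrightarrow> split_q a b TYPE('a)) \<and> (reg_r a b TYPE('a) \<longrightarrow> split_r a b TYPE('a))"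
  using assms
proof (induction "a + b" arbitrary: a b rule: less_induct)
  case less
  \<comment> \<open>Here parity enters: a positive even size at most 2 is exactly 2.\<close>
  have gl: "reg_r 0 c TYPE('a) \<longrightarrow> split_r 0 c TYPE('a)" if "even c" "0 < c" for c
  proof
    assume "reg_r 0 c TYPE('a)"
    then have "c = 2" using reg_gl_le_2[of c] that by (metis dvd_imp_le le_antisym)
    then show "split_r 0 c TYPE('a)" using split_gl_2 by simp
  qed
  consider "a = 0" | "a > 0" "b = 0" | "0 < a" "0 < b" by blast
  then show ?case
  proof cases
    case 1
    then show ?thesis using gl[of b] less.prems by (simp add: reg_q_gl split_q_gl)
  next
    case 2
    have "2 \<le> a" using less.prems 2 by (metis dvd_imp_le)
    then have "\<not> reg_r a 0 TYPE('a)" by (rule not_reg_r_0)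
    moreover have "reg_q a 0 TYPE('a) \<longrightarrow> split_q a 0 TYPE('a)"
      using gl[of a] less.prems 2 reg_q_swap[of a 0, where 'a='a] split_q_swap[of 0 a, where 'a='a]
      by (simp add: reg_q_gl split_q_gl)
    ultimately show ?thesis using 2 by simp
  next
    case 3
    \<comment> \<open>Stated for any ordered pair with the same sum, so that the case a > b follows
      by transposition.\<close>
    have q: "reg_q m n TYPE('a) \<longrightarrow> split_q m n TYPE('a)"
      if "m + n = a + b" "m \<le> n" "0 < m" "even m" "even n" for m n
    proof
      assume "reg_q m n TYPE('a)"
      then have "reg_r m (n - m) TYPE('a)" using step_q that by blast
      then have "split_r m (n - m) TYPE('a)" using less.hyps[of m "n - m"] that by auto
      then show "split_q m n TYPE('a)" by (rule splitting.split1[OF splitting_std[OF that(2)]])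
    qed
    have "reg_q a b TYPE('a) \<longrightarrow> split_q a b TYPE('a)"
    proof (cases "a \<le> b")
      case True
      then show ?thesis using q[of a b] 3 less.prems by simp
    next
      case False
      then show ?thesis using q[of b a] 3 less.prems reg_q_swap[of a b, where 'a='a] split_q_swap[of b a, where 'a='a] by simp
    qed
    moreover have "reg_r a b TYPE('a) \<longrightarrow> split_r a b TYPE('a)"
    proof (cases "a \<le> b")
      case True
      show ?thesis
      proof
        assume "reg_r a b TYPE('a)"
        then have "reg_q a (b - a) TYPE('a)" using step_r True 3 by blast
        then have "split_q a (b - a) TYPE('a)" using less.hyps[of a "b - a"] True 3 less.prems by auto
        then show "split_r a b TYPE('a)" by (rule splitting.split2[OF splitting_std[OF True]])
      qed
    next
      case False
      show ?thesis
      proof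
        assume "reg_r a b TYPE('a)"
        then have "reg_r (a - b) b TYPE('a)" using step_r'[of b a, where 'a='a] False 3 by simp
        then have "split_r (a - b) b TYPE('a)" using less.hyps[of "a - b" b] False 3 less.prems by auto
        then show "split_r a b TYPE('a)" using splitting.split3[OF splitting_std[of b a]] False by auto
      qed
    qed
    ultimately show ?thesis by blast
  qed
qed

section \<open>Contact forms\<close>

text \<open>The partner index in a symplectic basis grouped into consecutive pairs; J below is the
  corresponding Gram matrix.\<close>

definition prt :: "nat \<Rightarrow> nat" where
  "prt i = (if even i then Suc i else i - 1)"

definition J :: "nat \<Rightarrow> nat \<Rightarrow> 'a::comm_ring_1" where
  "J i j = (if j = prt i then (if even i then 1 else - 1) else 0)"

lemma prt_prt [simp]: "prt (prt i) = i"
proof (cases "even i")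
  case False
  then obtain k where "i = Suc (2 * k)" by (metis oddE Suc_eq_plus1)
  then show ?thesis by (simp add: prt_def)
qed (simp add: prt_def)

lemma prt_less: "i < 2 * n \<Longrightarrow> prt i < 2 * n"
  unfolding prt_def by presburger

lemma even_prt: "even (prt i) \<longleftrightarrow> odd i"
  by (auto simp: prt_def)

lemma prt_neq: "prt i \<noteq> i"
  by (metis even_prt)

lemma prt_Suc: "prt (2 * n) = Suc (2 * n)" "prt (Suc (2 * n)) = 2 * n"
  by (simp_all add: prt_def)

lemma J_anti: "J i j = - (J j i :: 'a::comm_ring_1)"
proof -
  have 1: "J i j = (0 :: 'a) \<and> J j i = (0 :: 'a)" if "j \<noteq> prt i"
  proof -
    have "i \<noteq> prt j" using that prt_prt[of j] by auto
    then show ?thesis using that by (simp add: J_def)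
  qed
  show ?thesis
  proof (cases "j = prt i")
    case True
    show ?thesis unfolding True by (simp add: J_def even_prt)
  qed (use 1 in simp)
qed

text \<open>The term of the permutation \<rho> in the unnormalised Pfaffian of J.\<close>

definition Jprod :: "nat \<Rightarrow> (nat \<Rightarrow> nat) \<Rightarrow> 'a::comm_ring_1" where
  "Jprod n \<rho> = of_int (sign \<rho>) * (\<Prod>i<n. J (\<rho> (2 * i)) (\<rho> (Suc (2 * i))))"

lemma permutes_permutation: "p permutes {..<n::nat} \<Longrightarrow> permutation p"
  by (auto simp: permutation_permutes)

lemma Jprod_swap_last:
  assumes "\<rho> permutes {..<2 * Suc n}"
  shows "Jprod (Suc n) (\<rho> \<circ> transpose (2 * n) (Suc (2 * n))) = Jprod (Suc n) \<rho>"
proof -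
  have "(\<Prod>i<n. J ((\<rho> \<circ> transpose (2 * n) (Suc (2 * n))) (2 * i)) ((\<rho> \<circ> transpose (2 * n) (Suc (2 * n))) (Suc (2 * i))))
    = (\<Prod>i<n. J (\<rho> (2 * i)) (\<rho> (Suc (2 * i))) :: 'a)"
    by (intro prod.cong) (auto simp: transpose_def)
  moreover have "sign (\<rho> \<circ> transpose (2 * n) (Suc (2 * n))) = - sign \<rho>"
    by (subst sign_compose) (auto simp: permutes_permutation[OF assms] permutation_swap_id sign_swap_id)
  ultimately show ?thesis unfolding Jprod_def
    by (simp add: J_anti[of "\<rho> (Suc (2 * n))"])
qed

lemma Jprod_swap_pairs:
  assumes "\<rho> permutes {..<2 * Suc n}" "k < n"
  defines "\<kappa> \<equiv> transpose (2 * k) (2 * n) \<circ> transpose (Suc (2 * k)) (Suc (2 * n))"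
  shows "Jprod (Suc n) (\<rho> \<circ> \<kappa>) = Jprod (Suc n) \<rho>"
proof -
  have ne: "2 * i \<noteq> Suc (2 * j)" "Suc (2 * j) \<noteq> 2 * i" for i j :: nat by presburger+
  have 1: "\<kappa> (2 * i) = 2 * transpose k n i" "\<kappa> (Suc (2 * i)) = Suc (2 * transpose k n i)" for i
    using assms(2) by (auto simp: \<kappa>_def transpose_def ne)
  have "(\<Prod>i<Suc n. J ((\<rho> \<circ> \<kappa>) (2 * i)) ((\<rho> \<circ> \<kappa>) (Suc (2 * i))))
    = (\<Prod>i<Suc n. J (\<rho> (2 * transpose k n i)) (\<rho> (Suc (2 * transpose k n i))) :: 'a)"
    by (simp only: comp_def 1)
  also have "\<dots> = (\<Prod>i<Suc n. J (\<rho> (2 * i)) (\<rho> (Suc (2 * i))))"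
  proof -
    have "transpose k n permutes {..<Suc n}" by (rule permutes_swap_id) (use assms(2) in auto)
    from prod.permute[OF this, of "\<lambda>i. J (\<rho> (2 * i)) (\<rho> (Suc (2 * i))) :: 'a"]
    show ?thesis by (simp only: comp_def)
  qed
  finally have 2: "(\<Prod>i<Suc n. J ((\<rho> \<circ> \<kappa>) (2 * i)) ((\<rho> \<circ> \<kappa>) (Suc (2 * i))))
    = (\<Prod>i<Suc n. J (\<rho> (2 * i)) (\<rho> (Suc (2 * i))) :: 'a)" .
  have "permutation \<kappa>" unfolding \<kappa>_def by (intro permutation_compose permutation_swap_id)
  moreover have "sign \<kappa> = 1" unfolding \<kappa>_def using assms(2)
    by (subst sign_compose) (auto simp: permutation_swap_id sign_swap_id)
  ultimately have "sign (\<rho> \<circ> \<kappa>) = sign \<rho>"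
    by (simp add: sign_compose permutes_permutation[OF assms(1)])
  then show ?thesis unfolding Jprod_def 2 by simp
qed

text \<open>Exchanging two pairs, or the two entries of a pair, does not change a term: in the
  second case the sign and the antisymmetry of J compensate. The pair containing the last index can
  thus be moved to the end and put in order, which leaves a permutation of two points fewer.\<close>

lemma Jprod_1:
  assumes "\<rho> permutes {..<2 * n}" "Jprod n \<rho> \<noteq> (0 :: 'a::idom)"
  shows "Jprod n \<rho> = (1 :: 'a)"
  using assms
proof (induction n arbitrary: \<rho>)
  case 0
  then have "\<rho> = id" by simp
  then show ?case by (simp add: Jprod_def)
next
  case (Suc n)
  have fix_last: "Jprod (Suc n) \<rho> = (1 :: 'a)"
    if \<rho>: "\<rho> permutes {..<2 * Suc n}" "\<rho> (Suc (2 * n)) = Suc (2 * n)" "Jprod (Suc n) \<rho> \<noteq> (0 :: 'a)" for \<rho>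
  proof -
    have nz: "J (\<rho> (2 * n)) (Suc (2 * n)) \<noteq> (0 :: 'a)" using \<rho> by (auto simp: Jprod_def)
    then have "prt (\<rho> (2 * n)) = Suc (2 * n)" by (auto simp: J_def split: if_splits)
    then have "\<rho> (2 * n) = prt (Suc (2 * n))" by (metis prt_prt)
    then have 0: "\<rho> (2 * n) = 2 * n" by (simp add: prt_def)
    then have "J (\<rho> (2 * n)) (\<rho> (Suc (2 * n))) = (1 :: 'a)" using \<rho>(2) by (simp add: J_def prt_def)
    then have e: "Jprod (Suc n) \<rho> = (Jprod n \<rho> :: 'a)" by (simp add: Jprod_def)
    have "\<rho> permutes {..<2 * n}"
    proof (rule permutes_superset[OF \<rho>(1)])
      fix x assume "x \<in> {..<2 * Suc n} - {..<2 * n}"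
      then have "x = 2 * n \<or> x = Suc (2 * n)" by auto
      then show "\<rho> x = x" using 0 \<rho>(2) by auto
    qed
    from Suc.IH[OF this] show ?thesis using \<rho>(3) e by simp
  qed
  have last_pair: "Jprod (Suc n) \<rho> = (1 :: 'a)"
    if \<rho>: "\<rho> permutes {..<2 * Suc n}" "\<rho> (2 * n) = Suc (2 * n) \<or> \<rho> (Suc (2 * n)) = Suc (2 * n)"
      "Jprod (Suc n) \<rho> \<noteq> (0 :: 'a)" for \<rho>
    using \<rho>(2)
  proof
    assume *: "\<rho> (2 * n) = Suc (2 * n)"
    let ?t = "transpose (2 * n) (Suc (2 * n))"
    have "\<rho> \<circ> ?t permutes {..<2 * Suc n}"
      by (rule permutes_compose[OF permutes_swap_id \<rho>(1)]) auto
    from fix_last[OF this] show ?thesis using * \<rho>(3) Jprod_swap_last[OF \<rho>(1), where 'a='a] by simp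
  qed (use fix_last \<rho> in blast)
  have "Suc (2 * n) \<in> \<rho> ` {..<2 * Suc n}" unfolding permutes_image[OF Suc.prems(1)] by simp
  then obtain m where m: "m < 2 * Suc n" "\<rho> m = Suc (2 * n)" by auto
  show ?case
  proof (cases "m div 2 = n")
    case True
    then have "m = 2 * n \<or> m = Suc (2 * n)" by auto
    then show ?thesis using last_pair Suc.prems m by blast
  next
    case False
    define k where "k = m div 2"
    have k: "k < n" using False m by (auto simp: k_def)
    have mk: "m = 2 * k \<or> m = Suc (2 * k)" by (auto simp: k_def)
    let ?\<kappa> = "transpose (2 * k) (2 * n) \<circ> transpose (Suc (2 * k)) (Suc (2 * n))"
    have "?\<kappa> permutes {..<2 * Suc n}" using k by (intro permutes_compose permutes_swap_id) auto
    then have p: "\<rho> \<circ> ?\<kappa> permutes {..<2 * Suc n}" by (rule permutes_compose[OF _ Suc.prems(1)])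
    have "?\<kappa> (2 * n) = 2 * k" "?\<kappa> (Suc (2 * n)) = Suc (2 * k)"
      using k by (auto simp: transpose_def)
    then have "(\<rho> \<circ> ?\<kappa>) (2 * n) = Suc (2 * n) \<or> (\<rho> \<circ> ?\<kappa>) (Suc (2 * n)) = Suc (2 * n)"
      using mk m(2) by auto
    note last = last_pair[OF p this]
    have e: "Jprod (Suc n) (\<rho> \<circ> ?\<kappa>) = (Jprod (Suc n) \<rho> :: 'a)" by (rule Jprod_swap_pairs[OF Suc.prems(1) k])
    show ?thesis using last Suc.prems(2) unfolding e by blast
  qed
qed

text \<open>All nonzero terms equal 1, so the sum counts permutations. The identity is among them,
  and the characteristic is zero.\<close>

lemma sum_Jprod: "(\<Sum>\<rho> | \<rho> permutes {..<2 * n}. Jprod n \<rho>) \<noteq> (0 :: 'a::field_char_0)"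
proof -
  have "(\<Sum>\<rho> | \<rho> permutes {..<2 * n}. Jprod n \<rho>) = (\<Sum>\<rho> | \<rho> permutes {..<2 * n} \<and> Jprod n \<rho> \<noteq> (0 :: 'a). (1 :: 'a))"
    by (rule sum.mono_neutral_cong_right) (auto simp: finite_permutations Jprod_1)
  also have "\<dots> = of_nat (card {\<rho>. \<rho> permutes {..<2 * n} \<and> Jprod n \<rho> \<noteq> (0 :: 'a)})" by simp
  finally have e: "(\<Sum>\<rho> | \<rho> permutes {..<2 * n}. Jprod n \<rho>) = (of_nat (card {\<rho>. \<rho> permutes {..<2 * n} \<and> Jprod n \<rho> \<noteq> (0 :: 'a)}) :: 'a)" .
  have "id \<in> {\<rho>. \<rho> permutes {..<2 * n} \<and> Jprod n \<rho> \<noteq> (0 :: 'a)}"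
    by (auto simp: permutes_id Jprod_def J_def prt_def)
  moreover have "finite {\<rho>. \<rho> permutes {..<2 * n} \<and> Jprod n \<rho> \<noteq> (0 :: 'a)}"
    using finite_permutations[of "{..<2 * n}"] by auto
  ultimately have "card {\<rho>. \<rho> permutes {..<2 * n} \<and> Jprod n \<rho> \<noteq> (0 :: 'a)} \<noteq> 0"
    unfolding card_eq_0_iff by blast
  then show ?thesis unfolding e by simp
qed

text \<open>The value of \<open>\<phi>\<^sup>n\<close> is, up to normalisation, the Pfaffian of the matrix \<open>\<phi> (u i) (u j)\<close>.\<close>

definition pf :: "('v \<Rightarrow> 'v \<Rightarrow> 'a::field_char_0) \<Rightarrow> nat \<Rightarrow> (nat \<Rightarrow> 'v) \<Rightarrow> 'a" where
  "pf \<phi> n u = (\<Sum>\<sigma> | \<sigma> permutes {..<2 * n}.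
     of_int (sign \<sigma>) * (\<Prod>i<n. \<phi> (u (\<sigma> (2 * i))) (u (\<sigma> (Suc (2 * i))))))"

lemma wedge_power_pf:
  "wedge_power 2 (\<lambda>u. \<phi> (u 0) (u 1)) n u = pf \<phi> n u / 2 ^ n"
proof (induction n arbitrary: u)
  case 0
  then show ?case by (simp add: pf_def)
next
  case (Suc n)
  let ?S = "{\<sigma>. \<sigma> permutes {..<2 + 2 * n}}" and ?T = "{\<tau>. \<tau> permutes {..<2 * n}}"
  define F where "F = (\<lambda>\<rho>. of_int (sign \<rho>) * (\<Prod>i<Suc n. \<phi> (u (\<rho> (2 * i))) (u (\<rho> (Suc (2 * i))))))"
  \<comment> \<open>h moves a permutation of the last 2n arguments past the two arguments consumed
    by the first factor.\<close>
  define h where "h = (\<lambda>\<tau>. map_permutation {..<2 * n} (\<lambda>i. i + 2) \<tau>)"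
  have h: "h \<tau> permutes {..<2 + 2 * n}" "sign (h \<tau>) = sign \<tau>" "h \<tau> 0 = 0" "h \<tau> 1 = 1"
    "\<And>i. i < 2 * n \<Longrightarrow> h \<tau> (2 + i) = 2 + \<tau> i" if \<tau>: "\<tau> permutes {..<2 * n}" for \<tau>
  proof -
    have inj: "inj_on (\<lambda>i::nat. i + 2) {..<2 * n}" by (auto simp: inj_on_def)
    have "bij_betw (\<lambda>i::nat. i + 2) {..<2 * n} {2..<2 + 2 * n}"
      by (rule bij_betwI[of _ _ _ "\<lambda>i. i - 2"]) auto
    then have p: "h \<tau> permutes {2..<2 + 2 * n}" unfolding h_def by (rule map_permutation_permutes[OF _ \<tau>])
    then show "h \<tau> permutes {..<2 + 2 * n}" by (rule permutes_subset) auto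
    show "sign (h \<tau>) = sign \<tau>" unfolding h_def by (rule sign_map_permutation[OF inj \<tau>]) simp
    show "h \<tau> 0 = 0" "h \<tau> 1 = 1" using permutes_not_in[OF p] by auto
    show "h \<tau> (2 + i) = 2 + \<tau> i" if "i < 2 * n" for i
      using map_permutation_apply[OF inj, of i \<tau>] that by (simp add: h_def add.commute)
  qed
  have "wedge_power 2 (\<lambda>u. \<phi> (u 0) (u 1)) (Suc n) u = (\<Sum>\<sigma>\<in>?S. of_int (sign \<sigma>) * \<phi> (u (\<sigma> 0)) (u (\<sigma> 1)) *
      (pf \<phi> n (\<lambda>i. u (\<sigma> (2 + i))) / 2 ^ n)) / (fact 2 * fact (2 * n))"
    by (simp only: wedge_power.simps wedge_def Suc.IH)
  also have "(\<Sum>\<sigma>\<in>?S. of_int (sign \<sigma>) * \<phi> (u (\<sigma> 0)) (u (\<sigma> 1)) * (pf \<phi> n (\<lambda>i. u (\<sigma> (2 + i))) / 2 ^ n))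
     = (\<Sum>\<sigma>\<in>?S. (\<Sum>\<tau>\<in>?T. F (\<sigma> \<circ> h \<tau>)) / 2 ^ n)"
  proof (intro sum.cong refl)
    fix \<sigma> assume "\<sigma> \<in> ?S"
    then have \<sigma>: "permutation \<sigma>" by (auto intro: permutes_permutation)
    have "of_int (sign \<sigma>) * \<phi> (u (\<sigma> 0)) (u (\<sigma> 1)) * pf \<phi> n (\<lambda>i. u (\<sigma> (2 + i))) = (\<Sum>\<tau>\<in>?T. F (\<sigma> \<circ> h \<tau>))"
      unfolding pf_def sum_distrib_left
    proof (intro sum.cong refl)
      fix \<tau> assume "\<tau> \<in> ?T"
      then have \<tau>: "\<tau> permutes {..<2 * n}" by simp
      have s: "sign (\<sigma> \<circ> h \<tau>) = sign \<sigma> * sign \<tau>"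
        using sign_compose[OF \<sigma> permutes_permutation[OF h(1)[OF \<tau>]]] h(2)[OF \<tau>] by simp
      have "(\<Prod>i<Suc n. \<phi> (u ((\<sigma> \<circ> h \<tau>) (2 * i))) (u ((\<sigma> \<circ> h \<tau>) (Suc (2 * i)))))
        = \<phi> (u (\<sigma> 0)) (u (\<sigma> 1)) * (\<Prod>i<n. \<phi> (u (\<sigma> (h \<tau> (2 + 2 * i)))) (u (\<sigma> (h \<tau> (2 + Suc (2 * i))))))"
        unfolding prod.lessThan_Suc_shift using h(3,4)[OF \<tau>] by simp
      also have "\<dots> = \<phi> (u (\<sigma> 0)) (u (\<sigma> 1)) * (\<Prod>i<n. \<phi> (u (\<sigma> (2 + \<tau> (2 * i)))) (u (\<sigma> (2 + \<tau> (Suc (2 * i))))))"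
      proof -
        have "(\<Prod>i<n. \<phi> (u (\<sigma> (h \<tau> (2 + 2 * i)))) (u (\<sigma> (h \<tau> (2 + Suc (2 * i))))))
          = (\<Prod>i<n. \<phi> (u (\<sigma> (2 + \<tau> (2 * i)))) (u (\<sigma> (2 + \<tau> (Suc (2 * i))))))"
        proof (intro prod.cong refl)
          fix i assume "i \<in> {..<n}"
          then have "2 * i < 2 * n" "Suc (2 * i) < 2 * n" by auto
          then show "\<phi> (u (\<sigma> (h \<tau> (2 + 2 * i)))) (u (\<sigma> (h \<tau> (2 + Suc (2 * i)))))
            = \<phi> (u (\<sigma> (2 + \<tau> (2 * i)))) (u (\<sigma> (2 + \<tau> (Suc (2 * i)))))"
            by (simp only: h(5)[OF \<tau>])
        qed
        then show ?thesis by simp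
      qed
      finally show "of_int (sign \<sigma>) * \<phi> (u (\<sigma> 0)) (u (\<sigma> 1)) * (of_int (sign \<tau>) *
          (\<Prod>i<n. \<phi> (u (\<sigma> (2 + \<tau> (2 * i)))) (u (\<sigma> (2 + \<tau> (Suc (2 * i))))))) = F (\<sigma> \<circ> h \<tau>)"
        unfolding F_def s by simp
    qed
    then show "of_int (sign \<sigma>) * \<phi> (u (\<sigma> 0)) (u (\<sigma> 1)) * (pf \<phi> n (\<lambda>i. u (\<sigma> (2 + i))) / 2 ^ n) = (\<Sum>\<tau>\<in>?T. F (\<sigma> \<circ> h \<tau>)) / 2 ^ n"
      by (metis times_divide_eq_right)
  qed
  also have "(\<Sum>\<sigma>\<in>?S. (\<Sum>\<tau>\<in>?T. F (\<sigma> \<circ> h \<tau>)) / 2 ^ n) = (\<Sum>\<sigma>\<in>?S. \<Sum>\<tau>\<in>?T. F (\<sigma> \<circ> h \<tau>)) / 2 ^ n"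
    by (simp only: sum_divide_distrib)
  \<comment> \<open>For fixed \<tau>, composition with \<open>h \<tau>\<close> permutes the index
    set of \<sigma>, so every \<tau> contributes the same Pfaffian.\<close>
  also have "(\<Sum>\<sigma>\<in>?S. \<Sum>\<tau>\<in>?T. F (\<sigma> \<circ> h \<tau>)) = (\<Sum>\<tau>\<in>?T. \<Sum>\<sigma>\<in>?S. F (\<sigma> \<circ> h \<tau>))" by (rule sum.swap)
  also have "\<dots> = (\<Sum>\<tau>\<in>?T. sum F ?S)"
  proof (rule sum.cong[OF refl])
    fix \<tau> assume "\<tau> \<in> ?T"
    then have "h \<tau> permutes {..<2 + 2 * n}" using h(1) by simp
    from sum_permutations_compose_right[OF this, of F] show "(\<Sum>\<sigma>\<in>?S. F (\<sigma> \<circ> h \<tau>)) = sum F ?S" by simp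
  qed
  also have "\<dots> = fact (2 * n) * sum F ?S"
    by (simp add: card_permutations[of "{..<2 * n}" "2 * n"])
  also have "sum F ?S = pf \<phi> (Suc n) u" by (simp add: pf_def F_def)
  finally show ?case by (simp add: fact_numeral)
qed

lemma pf_permute:
  fixes \<phi> :: "'v \<Rightarrow> 'v \<Rightarrow> 'a::field_char_0"
  assumes "\<sigma> permutes {..<2 * n}"
  shows "pf \<phi> n (\<lambda>i. u (\<sigma> i)) = of_int (sign \<sigma>) * pf \<phi> n u"
proof -
  have "pf \<phi> n u = (\<Sum>\<tau> | \<tau> permutes {..<2 * n}. of_int (sign (\<sigma> \<circ> \<tau>)) * (\<Prod>i<n. \<phi> (u (\<sigma> (\<tau> (2 * i)))) (u (\<sigma> (\<tau> (Suc (2 * i)))))))"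
    unfolding pf_def
    by (subst setum_permutations_compose_left[OF assms]) simp
  also have "\<dots> = (\<Sum>\<tau> | \<tau> permutes {..<2 * n}. of_int (sign \<sigma>) * (of_int (sign \<tau>) * (\<Prod>i<n. \<phi> (u (\<sigma> (\<tau> (2 * i)))) (u (\<sigma> (\<tau> (Suc (2 * i))))))))"
    by (intro sum.cong refl) (auto simp: sign_compose permutes_permutation[OF assms] permutes_permutation)
  also have "\<dots> = of_int (sign \<sigma>) * pf \<phi> n (\<lambda>i. u (\<sigma> i))" by (simp add: pf_def sum_distrib_left)
  finally have "of_int (sign \<sigma>) * pf \<phi> n u = (of_int (sign \<sigma> * sign \<sigma>) :: 'a) * pf \<phi> n (\<lambda>i. u (\<sigma> i))"
    by (simp only: of_int_mult mult.assoc)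
  then show ?thesis by simp
qed

text \<open>\<alpha> kills all but the last vector, so only permutations fixing the last index
  survive. These all contribute equally, because the Pfaffian changes by the sign that is already
  present.\<close>

lemma wedge_contact:
  fixes \<alpha> :: "'v \<Rightarrow> 'b::field_char_0"
  assumes \<alpha>: "\<And>i. i < 2 * n \<Longrightarrow> \<alpha> (w i) = 0"
  shows "wedge (2 * n) 1 (wedge_power 2 (\<lambda>u. \<phi> (u 0) (u 1)) n) (\<lambda>u. \<alpha> (u 0)) w
    = pf \<phi> n w / 2 ^ n * \<alpha> (w (2 * n))"
proof -
  let ?g = "\<lambda>\<sigma>. of_int (sign \<sigma>) * (pf \<phi> n (\<lambda>i. w (\<sigma> i)) / 2 ^ n) * \<alpha> (w (\<sigma> (2 * n)))"
  have "(\<Sum>\<sigma> | \<sigma> permutes {..<2 * n + 1}. ?g \<sigma>) = (\<Sum>\<sigma> | \<sigma> permutes {..<2 * n}. ?g \<sigma>)"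
  proof (rule sum.mono_neutral_right)
    show "\<forall>\<sigma>\<in>{\<sigma>. \<sigma> permutes {..<2 * n + 1}} - {\<sigma>. \<sigma> permutes {..<2 * n}}. ?g \<sigma> = 0"
    proof
      fix \<sigma> assume s: "\<sigma> \<in> {\<sigma>. \<sigma> permutes {..<2 * n + 1}} - {\<sigma>. \<sigma> permutes {..<2 * n}}"
      have "\<sigma> (2 * n) \<noteq> 2 * n"
      proof
        assume e: "\<sigma> (2 * n) = 2 * n"
        have "\<sigma> permutes {..<2 * n}"
          by (rule permutes_superset[of _ "{..<2 * n + 1}"]) (use s e in \<open>auto simp: less_Suc_eq\<close>)
        then show False using s by simp
      qed
      moreover have "\<sigma> (2 * n) < 2 * n + 1" using s permutes_in_image[of \<sigma> "{..<2 * n + 1}" "2 * n"] by auto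
      ultimately have "\<alpha> (w (\<sigma> (2 * n))) = 0" by (intro \<alpha>) auto
      then show "?g \<sigma> = 0" by simp
    qed
  qed (auto simp: finite_permutations intro: permutes_subset)
  also have "\<dots> = (\<Sum>\<sigma> | \<sigma> permutes {..<2 * n}. pf \<phi> n w / 2 ^ n * \<alpha> (w (2 * n)))"
  proof (intro sum.cong refl)
    fix \<sigma> assume "\<sigma> \<in> {\<sigma>. \<sigma> permutes {..<2 * n}}"
    then have s: "\<sigma> permutes {..<2 * n}" by simp
    have gen: "x * (x * p / d) * c = (x * x) * (p / d * c)" for x p d c :: 'b by simp
    have e: "of_int (sign \<sigma>) * of_int (sign \<sigma>) = (1 :: 'b)" unfolding of_int_mult[symmetric] by simp
    have "\<sigma> (2 * n) = 2 * n" using permutes_not_in[OF s] by simp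
    then show "?g \<sigma> = pf \<phi> n w / 2 ^ n * \<alpha> (w (2 * n))"
      by (simp only: pf_permute[OF s, where u=w and \<phi>=\<phi>] gen e mult_1)
  qed
  also have "\<dots> = fact (2 * n) * (pf \<phi> n w / 2 ^ n * \<alpha> (w (2 * n)))"
    by (simp add: card_permutations[of "{..<2 * n}" "2 * n"])
  finally show ?thesis unfolding wedge_def wedge_power_pf by simp
qed

lemma pf_symplectic:
  fixes \<phi> :: "'v \<Rightarrow> 'v \<Rightarrow> 'a::field_char_0"
  assumes "\<And>i j. i < 2 * n \<Longrightarrow> j < 2 * n \<Longrightarrow> \<phi> (w i) (w j) = c * J i j" "c \<noteq> 0"
  shows "pf \<phi> n w \<noteq> 0"
proof -
  have "pf \<phi> n w = (\<Sum>\<sigma> | \<sigma> permutes {..<2 * n}. c ^ n * Jprod n \<sigma>)"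
    unfolding pf_def
  proof (intro sum.cong refl)
    fix \<sigma> assume "\<sigma> \<in> {\<sigma>. \<sigma> permutes {..<2 * n}}"
    then have "\<sigma> i < 2 * n" if "i < 2 * n" for i using permutes_in_image[of \<sigma> "{..<2 * n}" i] that by auto
    then have "(\<Prod>i<n. \<phi> (w (\<sigma> (2 * i))) (w (\<sigma> (Suc (2 * i))))) = (\<Prod>i<n. c * J (\<sigma> (2 * i)) (\<sigma> (Suc (2 * i))))"
      by (intro prod.cong refl assms(1)) auto
    then show "of_int (sign \<sigma>) * (\<Prod>i<n. \<phi> (w (\<sigma> (2 * i))) (w (\<sigma> (Suc (2 * i))))) = c ^ n * Jprod n \<sigma>"
      by (simp add: prod.distrib Jprod_def)
  qed
  also have "\<dots> = c ^ n * (\<Sum>\<sigma> | \<sigma> permutes {..<2 * n}. Jprod n \<sigma>)" by (simp add: sum_distrib_left)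
  finally show ?thesis using sum_Jprod[of n, where 'a='a] assms(2) by simp
qed

definition symp_family :: "'v set \<Rightarrow> ('v \<Rightarrow> 'v \<Rightarrow> 'a::comm_ring_1) \<Rightarrow> nat \<Rightarrow> (nat \<Rightarrow> 'v) \<Rightarrow> bool" where
  "symp_family V \<omega> n v \<longleftrightarrow> (\<forall>i<2 * n. v i \<in> V) \<and> (\<forall>i<2 * n. \<forall>j<2 * n. \<omega> (v i) (v j) = J i j)"

text \<open>A symplectic family of maximal length exists, since linear independence bounds the
  length. By maximality its orthogonal complement is isotropic, hence equal to the radical K s, and
  V is the sum of K s and the span of the family.\<close>

lemma (in vector_space) symplectic_basis:
  assumes two: "(2 :: 'a) \<noteq> 0" and V: "subspace V" "V \<subseteq> span B" "finite B"
    and add: "\<And>x y z. x \<in> V \<Longrightarrow> y \<in> V \<Longrightarrow> z \<in> V \<Longrightarrow> \<omega> (x + y) z = \<omega> x z + \<omega> y z"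
    and sc: "\<And>c x z. x \<in> V \<Longrightarrow> z \<in> V \<Longrightarrow> \<omega> (scale c x) z = c * \<omega> x z"
    and anti: "\<And>x y. x \<in> V \<Longrightarrow> y \<in> V \<Longrightarrow> \<omega> x y = - \<omega> y x"
    and s: "s \<in> V" "s \<noteq> 0" "\<And>x. x \<in> V \<Longrightarrow> (\<forall>y \<in> V. \<omega> x y = 0) \<longleftrightarrow> (\<exists>c. x = scale c s)"
  shows "\<exists>n v. symp_family V \<omega> n v \<and> dim V = 2 * n + 1"
proof -
  have zero: "\<omega> 0 z = 0" if "z \<in> V" for z using sc[of 0 z 0] V(1) that by (simp add: subspace_0)
  have V_sum: "(\<Sum>i<m. scale (c i) (v i)) \<in> V" if "\<And>i. i < m \<Longrightarrow> v i \<in> V" for c v and m :: nat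
    using that by (intro subspace_sum subspace_scale V(1)) auto
  have w_sum: "\<omega> (\<Sum>i<m. scale (c i) (v i)) z = (\<Sum>i<m. c i * \<omega> (v i) z)"
    if "\<And>i. i < m \<Longrightarrow> v i \<in> V" "z \<in> V" for c v z and m :: nat
    using that
  proof (induction m)
    case (Suc m)
    then show ?case using V_sum[of m v c] by (simp add: add sc subspace_scale[OF V(1)])
  qed (simp add: zero)
  have pair: "\<omega> (\<Sum>i<2*n. scale (c i) (v i)) (v k) = c (prt k) * J (prt k) k"
    if "symp_family V \<omega> n v" "k < 2 * n" for n v c k
  proof -
    have "\<omega> (\<Sum>i<2*n. scale (c i) (v i)) (v k) = (\<Sum>i<2*n. c i * J i k)"
      using that by (subst w_sum) (auto simp: symp_family_def intro!: sum.cong)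
    also have "\<dots> = (\<Sum>i<2*n. if i = prt k then c (prt k) * J (prt k) k else 0)"
      by (intro sum.cong refl) (auto simp: J_def)
    finally show ?thesis using prt_less[OF that(2)] by simp
  qed
  have fam_indep: "c j = 0"
    if "symp_family V \<omega> n v" "(\<Sum>i<2*n. scale (c i) (v i)) + scale d s = 0" "j < 2 * n" for n v c d j
  proof -
    let ?x = "\<Sum>i<2*n. scale (c i) (v i)"
    have vV: "\<And>i. i < 2 * n \<Longrightarrow> v i \<in> V" using that(1) by (simp add: symp_family_def)
    have "\<omega> (scale d s) (v (prt j)) = 0" 
      using s(3)[OF subspace_scale[OF V(1) s(1)], of d] vV[OF prt_less[OF that(3)]] by blast
    moreover have "\<omega> (?x + scale d s) (v (prt j)) = \<omega> ?x (v (prt j)) + \<omega> (scale d s) (v (prt j))"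
      by (rule add[OF V_sum[OF vV] subspace_scale[OF V(1) s(1)] vV[OF prt_less[OF that(3)]]])
    ultimately have "\<omega> ?x (v (prt j)) = 0" using that(2) zero vV prt_less[OF that(3)] by simp
    then have "c j * J j (prt j) = 0" using pair[OF that(1) prt_less[OF that(3)], of c] by simp
    then show "c j = 0" by (simp add: J_def split: if_splits)
  qed
  have indep: "independent (insert s (v ` {..<2*n})) \<and> card (insert s (v ` {..<2*n})) = 2 * n + 1"
    if sy: "symp_family V \<omega> n v" for n v
  proof -
    have inj: "inj_on v {..<2*n}"
    proof (rule inj_onI)
      fix i j assume ij: "i \<in> {..<2*n}" "j \<in> {..<2*n}" "v i = v j"
      then have l: "i < 2 * n" "j < 2 * n" by simp_all
      have "\<omega> (v i) (v (prt i)) = J i (prt i)" "\<omega> (v j) (v (prt i)) = J j (prt i)"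
        using sy l prt_less[OF l(1)] unfolding symp_family_def by blast+
      then have "J i (prt i) = (J j (prt i) :: 'a)" using ij by simp
      moreover have "J i (prt i) \<noteq> (0 :: 'a)" by (simp add: J_def)
      ultimately have "prt i = prt j" by (auto simp: J_def split: if_splits)
      then show "i = j" by (metis prt_prt)
    qed
    have sv: "s \<notin> v ` {..<2*n}"
    proof
      assume "s \<in> v ` {..<2*n}"
      then obtain i where i: "i < 2*n" "s = v i" by auto
      have "(\<Sum>j<2*n. scale (if j = i then 1 else 0) (v j)) = (\<Sum>j<2*n. if j = i then v i else 0)"
        by (intro sum.cong) auto
      then have "(\<Sum>j<2*n. scale (if j = i then 1 else 0) (v j)) + scale (- 1) s = 0" using i by simp
      from fam_indep[OF sy this i(1)] show False by simp
    qed
    have "independent (insert s (v ` {..<2*n}))"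
    proof (rule independent_if_scalars_zero)
      fix f x assume f: "(\<Sum>x\<in>insert s (v ` {..<2*n}). scale (f x) x) = 0" and x: "x \<in> insert s (v ` {..<2*n})"
      have e: "(\<Sum>i<2*n. scale (f (v i)) (v i)) + scale (f s) s = 0"
        using f sv by (simp add: sum.reindex[OF inj] add.commute)
      then have 0: "f (v i) = 0" if "i < 2*n" for i using fam_indep[OF sy _ that, of "\<lambda>i. f (v i)" "f s"] by blast
      then have "scale (f s) s = 0" using e by simp
      then show "f x = 0" using 0 x s(2) by auto
    qed simp
    then show ?thesis using sv inj by (simp add: card_image)
  qed
  have bound: "n \<le> card B" if "symp_family V \<omega> n v" for n v
  proof -
    have "insert s (v ` {..<2*n}) \<subseteq> span B" using that s(1) V(2) by (auto simp: symp_family_def)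
    from independent_span_bound[OF V(3) _ this] indep[OF that] show ?thesis by auto
  qed
  have "symp_family V \<omega> 0 v" for v by (simp add: symp_family_def)
  then have ex: "\<exists>n. \<exists>v. symp_family V \<omega> n v" by blast
  define n where "n = (GREATEST n. \<exists>v. symp_family V \<omega> n v)"
  obtain v where sy: "symp_family V \<omega> n v"
    using GreatestI_ex_nat[OF ex, of "card B"] bound unfolding n_def by blast
  have max: "\<not> symp_family V \<omega> (Suc n) v" for v
    using Greatest_le_nat[of "\<lambda>n. \<exists>v. symp_family V \<omega> n v" "Suc n" "card B"] bound unfolding n_def[symmetric] by fastforce
  have vV: "\<And>i. i < 2 * n \<Longrightarrow> v i \<in> V" using sy by (simp add: symp_family_def)
  \<comment> \<open>Projection to the orthogonal complement of the family. The factor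
    \<open>J i (prt i)\<close> is the sign that inverts the Gram matrix.\<close>
  define pr where "pr = (\<lambda>x. x - (\<Sum>i<2*n. scale (J i (prt i) * \<omega> x (v (prt i))) (v i)))"
  have prV: "pr x \<in> V" if "x \<in> V" for x unfolding pr_def
    using that vV by (intro subspace_diff V(1) V_sum) auto
  have diff: "\<omega> (x - y) z = \<omega> x z - \<omega> y z" if "x \<in> V" "y \<in> V" "z \<in> V" for x y z
  proof -
    have "\<omega> ((x - y) + y) z = \<omega> (x - y) z + \<omega> y z" by (rule add[OF subspace_diff[OF V(1) that(1,2)] that(2,3)])
    then show ?thesis by (simp only: diff_add_cancel eq_diff_eq)
  qed
  have pr_orth: "\<omega> (pr x) (v k) = 0" if "x \<in> V" "k < 2 * n" for x k
  proof -
    have "\<omega> (pr x) (v k) = \<omega> x (v k) - J (prt k) k * \<omega> x (v k) * J (prt k) k"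
      unfolding pr_def by (subst diff[OF that(1) V_sum[OF vV] vV[OF that(2)]]) (simp_all add: pair[OF sy that(2)])
    also have "J (prt k) k * \<omega> x (v k) * J (prt k) k = \<omega> x (v k)"
      by (simp add: J_def)
    finally show ?thesis by simp
  qed
  \<comment> \<open>If two projected vectors paired nontrivially, they would extend the family by
    one more normalised pair.\<close>
  have pr_pr: "\<omega> (pr x) (pr y) = 0" if xy: "x \<in> V" "y \<in> V" for x y
  proof (rule ccontr)
    assume nz: "\<omega> (pr x) (pr y) \<noteq> 0"
    define c where "c = inverse (\<omega> (pr x) (pr y))"
    define v' where "v' = (\<lambda>i. if i < 2 * n then v i else if i = 2 * n then scale c (pr x) else pr y)"
    have v'V: "v' i \<in> V" for i 
      using vV[of i] prV[OF xy(1)] prV[OF xy(2)] subspace_scale[OF V(1)] by (simp add: v'_def)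
    have self: "\<omega> z z = 0" if "z \<in> V" for z
    proof -
      have "\<omega> z z + \<omega> z z = 0" using anti[OF that that] eq_neg_iff_add_eq_0 by blast
      then have "2 * \<omega> z z = 0" by (simp only: mult_2)
      then show ?thesis using two unfolding mult_eq_0_iff by blast
    qed
    have orth: "\<omega> (v' i) (v k) = 0" "\<omega> (v k) (v' i) = 0" if "2 * n \<le> i" "k < 2 * n" for i k
    proof -
      show 1: "\<omega> (v' i) (v k) = 0"
      proof (cases "i = 2 * n")
        case True
        then have "v' i = scale c (pr x)" by (simp add: v'_def)
        then show ?thesis by (simp only: sc[OF prV[OF xy(1)] vV[OF that(2)]] pr_orth[OF xy(1) that(2)] mult_zero_right)
      next
        case False
        then have "v' i = pr y" using that(1) by (simp add: v'_def)
        then show ?thesis by (simp only: pr_orth[OF xy(2) that(2)])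
      qed
      show "\<omega> (v k) (v' i) = 0" unfolding anti[OF vV[OF that(2)] v'V[of i]] 1 by simp
    qed
    have 01: "\<omega> (v' (2 * n)) (v' (Suc (2 * n))) = 1" 
    proof -
      have "v' (2 * n) = scale c (pr x)" "v' (Suc (2 * n)) = pr y" by (simp_all add: v'_def)
      then show ?thesis using left_inverse[OF nz] by (simp only: sc[OF prV[OF xy(1)] prV[OF xy(2)]] c_def)
    qed
    have "\<omega> (v' i) (v' j) = J i j" if ij: "i < 2 * Suc n" "j < 2 * Suc n" for i j
    proof -
      have c: "i < 2 * n \<or> i = 2 * n \<or> i = Suc (2 * n)" "j < 2 * n \<or> j = 2 * n \<or> j = Suc (2 * n)"
        using ij by (simp_all add: less_Suc_eq)
      have J0: "J i k = (0 :: 'a)" "J k i = (0 :: 'a)" if "i < 2 * n" "2 * n \<le> k" for i k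
      proof -
        show 1: "J i k = (0 :: 'a)" using prt_less[OF that(1)] that(2) by (auto simp: J_def)
        show "J k i = (0 :: 'a)" using J_anti[of k i, where 'a='a] 1 by simp
      qed
      have vv: "v' k = v k" if "k < 2 * n" for k using that by (simp add: v'_def)
      have 10: "\<omega> (v' (Suc (2 * n))) (v' (2 * n)) = - 1"
        unfolding anti[OF v'V[of "Suc (2 * n)"] v'V[of "2 * n"]] 01 ..
      have JJ: "J (2 * n) (Suc (2 * n)) = (1 :: 'a)" "J (Suc (2 * n)) (2 * n) = (- 1 :: 'a)" "J k k = (0 :: 'a)" for k
        using prt_neq[of k] by (simp_all add: J_def prt_Suc)
      consider "i < 2 * n" "j < 2 * n" | "i < 2 * n" "2 * n \<le> j" | "2 * n \<le> i" "j < 2 * n" 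
        | "i = j" | "i = 2 * n" "j = Suc (2 * n)" | "i = Suc (2 * n)" "j = 2 * n"
        using c by (elim disjE) simp_all
      then show ?thesis
      proof cases
        case 1 then show ?thesis using sy by (simp add: vv symp_family_def)
      next
        case 2 then show ?thesis using orth(2)[OF 2(2,1)] J0(1)[OF 2] by (simp only: vv)
      next
        case 3 then show ?thesis using orth(1)[OF 3] J0(2)[OF 3(2,1)] by (simp only: vv)
      next
        case 4 show ?thesis unfolding 4 JJ(3) by (rule self[OF v'V])
      next
        case 5 show ?thesis unfolding 5 JJ(1) by (rule 01)
      next
        case 6 show ?thesis unfolding 6 JJ(2) by (rule 10)
      qed
    qed
    then have "symp_family V \<omega> (Suc n) v'" using v'V by (simp add: symp_family_def)
    then show False using max by blast
  qed
  have V_span: "V \<subseteq> span (insert s (v ` {..<2*n}))"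
  proof
    fix x assume x: "x \<in> V"
    \<comment> \<open>Every y is its projection plus a combination of the family; pr x is orthogonal
      to both parts, so it lies in the radical.\<close>
    have "\<omega> (pr x) y = 0" if y: "y \<in> V" for y
    proof -
      let ?q = "\<Sum>i<2*n. scale (J i (prt i) * \<omega> y (v (prt i))) (v i)"
      have "\<omega> y (pr x) = \<omega> (pr y) (pr x) + \<omega> ?q (pr x)"
        using add[of "pr y" ?q "pr x"] prV x y V_sum[of "2*n" v] vV by (simp add: pr_def)
      also have "\<omega> ?q (pr x) = (\<Sum>i<2*n. J i (prt i) * \<omega> y (v (prt i)) * \<omega> (v i) (pr x))"
        using w_sum vV prV[OF x] by simp
      also have "\<dots> = 0"
      proof (intro sum.neutral ballI)
        fix i assume "i \<in> {..<2*n}"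
        then have i: "i < 2 * n" by simp
        show "J i (prt i) * \<omega> y (v (prt i)) * \<omega> (v i) (pr x) = 0"
          unfolding anti[OF vV[OF i] prV[OF x]] using pr_orth[OF x i] by simp
      qed
      finally have "\<omega> y (pr x) = 0" using pr_pr x y by simp
      then show ?thesis using anti[OF prV[OF x] y] by simp
    qed
    then obtain c where "pr x = scale c s" using s(3)[OF prV[OF x]] by blast
    then have "x = scale c s + (\<Sum>i<2*n. scale (J i (prt i) * \<omega> x (v (prt i))) (v i))"
      by (simp add: pr_def diff_eq_eq)
    moreover have "\<dots> \<in> span (insert s (v ` {..<2*n}))"
      by (intro span_add span_scale span_sum span_base) auto
    ultimately show "x \<in> span (insert s (v ` {..<2*n}))" by simp
  qed
  have "dim V = card (insert s (v ` {..<2*n}))"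
    by (rule dim_unique[OF _ V_span _ refl]) (use s(1) vV indep[OF sy] in auto)
  then show ?thesis using sy indep[OF sy] by auto
qed

section \<open>From split forms to contact and strongly quasi-reductive algebras\<close>

text \<open>A linear projection of all matrices to the algebra extends forms given only on the
  algebra, and gives a linear criterion for membership.\<close>

lemma blk_projection:
  assumes "T = tup_r a b \<or> T = tup_q a b"
  shows "\<exists>pj. (\<forall>x y. pj (x + y) = pj x + pj y) \<and> (\<forall>c x. pj (sm c x) = sm c (pj x)) \<and>
    (\<forall>y. pj y \<in> blk a b ` T) \<and> (\<forall>x \<in> blk a b ` T. pj x = (x :: 'a::field fm))"
proof -
  define k :: "'a t5 \<Rightarrow> 'a t5" where
    "k = (if T = tup_r a b then (\<lambda>x. x) else (\<lambda>(A0, A1, B, W, V). (A0, 0, B, W, V)))"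
  have k: "k (x + y) = k x + k y" "k (smt c x) = smt c (k x)" for x y c
    by (auto simp: k_def smt_def split: prod.splits)
  have m: "unblk a b y \<in> tup_r a b" for y :: "'a fm"
  proof -
    have i: "idm a * (idm a * z) = idm a * z" "idm a * idm a = (idm a :: 'a fm)" for z :: "'a fm"
      by (simp_all add: idm_times[OF M_idm[OF le_refl le_refl]] mult.assoc[symmetric])
    have s: "idm a * sh' a a = (sh' a a :: 'a fm)" "sh a a * idm a = (sh a a :: 'a fm)"
       "idm b * sh' (2 * a) b = (sh' (2 * a) b :: 'a fm)" "sh (2 * a) b * idm b = (sh (2 * a) b :: 'a fm)"
      by (rule idm_times[OF M_sh' le_refl] times_idm[OF M_sh le_refl])+
    show ?thesis unfolding unblk_def tup_r_def
      by (simp add: M_iff mult.assoc i s) (simp add: mult.assoc[symmetric] i s)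
  qed
  have "k (unblk a b y) \<in> T" for y using m[of y] assms
    by (auto simp: k_def tup_r_def tup_q_def split: prod.splits)
  moreover have "k x = x" if "x \<in> T" for x using that assms by (auto simp: k_def tup_q_def split: prod.splits)
  moreover have "T \<subseteq> tup_r a b" using assms tup_q_r by blast
  ultimately show ?thesis
    by (intro exI[of _ "\<lambda>y. blk a b (k (unblk a b y))"])
      (auto simp: unblk_add unblk_sm blk_add blk_smt k unblk_blk subset_iff simp del: split_paired_All)
qed

text \<open>\<open>split_forms\<close> provides a form with stabiliser spanned by 1 and an element U
  with two eigenvalues. Since the stabiliser is a subalgebra, U satisfies a quadratic equation with
  these eigenvalues as roots, and its spectral idempotent spans the same space with 1.\<close>

lemma split_idempotent:
  fixes \<beta> :: "'a::field_char_0 fm \<Rightarrow> 'a"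
  assumes T: "T = tup_r a b \<or> T = tup_q a b" and ev: "even a" "even b" "0 < a + b"
    and n: "n = 2 * a + b" and E: "E = blk a b ` T"
    and \<beta>: "lf \<beta>" "spans (idm n) u (stab E \<beta>)"
  shows "\<exists>\<beta>' w. lf \<beta>' \<and> w \<in> stab E \<beta>' \<and> w * w = w \<and> w \<noteq> 0 \<and> w \<noteq> idm n \<and> spans (idm n) w (stab E \<beta>')"
proof -
  have sa: "subalg a b T" using T subalg_rq by blast
  have Tr: "T \<subseteq> tup_r a b" using sa by (simp add: subalg_def)
  obtain G where G: "G \<in> params a b" "\<And>x. x \<in> tup_r a b \<Longrightarrow> \<beta> (blk a b x) = pair5 G x"
    using functional_pair5[OF \<beta>(1), of a b] by blast
  have "\<beta> y = fn5 a b G y" if yE: "y \<in> E" for y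
  proof -
    obtain x where x: "x \<in> T" "y = blk a b x" using yE unfolding E by blast
    then have "x \<in> tup_r a b" using Tr by blast
    then show ?thesis unfolding x(2) fn5_def by (simp only: G(2) unblk_blk)
  qed
  then have "stab E \<beta> = stab E (fn5 a b G)" using subalg_blk(4)[OF sa] unfolding stab_def E by auto
  then have r: "rank_le_2 a b (sol T G)" unfolding rank_le_2_iff[OF sa] using \<beta>(2) n E by auto
  have "\<exists>G'. split a b (sol T G')"
    using T
  proof
    assume Te: "T = tup_r a b"
    have "rank_le_2 a b (rsol a b G)" using r unfolding rsol_sol[OF G(1)] Te .
    then have "reg_r a b TYPE('a)" using G(1) unfolding reg_r_def by blast
    then have "split_r a b TYPE('a)" using split_forms[OF ev] by blast
    then obtain G' :: "'a t5" where "G' \<in> params a b" "split a b (rsol a b G')" unfolding split_r_def by blast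
    then have "split a b (sol T G')" by (simp only: rsol_sol Te)
    then show ?thesis by (rule exI)
  next
    assume Te: "T = tup_q a b"
    have "rank_le_2 a b (qsol a b G)" using r unfolding qsol_sol[OF G(1)] Te .
    then have "reg_q a b TYPE('a)" using G(1) unfolding reg_q_def by blast
    then have "split_q a b TYPE('a)" using split_forms[OF ev] by blast
    then obtain G' :: "'a t5" where "G' \<in> params a b" "split a b (qsol a b G')" unfolding split_q_def by blast
    then have "split a b (sol T G')" by (simp only: qsol_sol Te)
    then show ?thesis by (rule exI)
  qed
  then obtain G' where G': "split a b (sol T G')" by (rule exE)
  then obtain x c d where x: "x \<in> sol T G'" "spanned_by (one5 a b) x (sol T G')" "c \<noteq> d" "ev a b x c" "ev a b x d"
    unfolding split_def by blast
  define \<beta>' where "\<beta>' = fn5 a b G'"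
  have lf: "lf \<beta>'" unfolding \<beta>'_def by (rule lf_fn5)
  define U where "U = blk a b x"
  have st: "stab E \<beta>' = blk a b ` sol T G'" unfolding E \<beta>'_def by (rule stab_blk[OF sa])
  have sp: "spans (idm n) U (stab E \<beta>')" unfolding spans_def st U_def
  proof
    fix y assume "y \<in> blk a b ` sol T G'"
    then obtain z where z: "y = blk a b z" "z \<in> sol T G'" by blast
    then obtain s t where "z = smt s (one5 a b) + smt t x" using x(2) unfolding spanned_by_def by blast
    then have "y = sm s (idm n) + sm t (blk a b x)" by (simp add: z(1) blk_add blk_smt blk_one n)
    then show "\<exists>s t. y = sm s (idm n) + sm t (blk a b x)" by blast
  qed
  have Est: "stab E \<beta>' \<subseteq> E" by (auto simp: stab_def)
  have Emul: "y * z \<in> E" if "y \<in> E" "z \<in> E" for y z using subalg_blk(4)[OF sa] that unfolding E by blast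
  have EM: "idm n * y = y \<and> y * idm n = y" if "y \<in> E" for y
    using subalg_blk(2)[OF sa] that unfolding E n by (auto simp: M_iff)
  have Esub: "fm.subspace E" unfolding E by (rule subalg_blk(1)[OF sa])
  have oneE: "idm n \<in> E" unfolding E n by (rule subalg_blk(3)[OF sa])
  have one_st: "idm n \<in> stab E \<beta>'" using oneE EM by (auto simp: stab_def)
  have Us: "U \<in> stab E \<beta>'" unfolding st U_def using x(1) by blast
  \<comment> \<open>Moving one factor U at a time across y: each move uses that U stabilises and
    that E is closed under products.\<close>
  have "U * U \<in> stab E \<beta>'"
  proof -
    have UE: "U \<in> E" using Us Est by blast
    have "\<beta>' (U * U * y) = \<beta>' (y * (U * U))" if y: "y \<in> E" for y
    proof -
      have "\<beta>' (U * (U * y)) = \<beta>' (U * y * U)" using Us Emul[OF UE y] unfolding stab_def by blast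
      also have "\<dots> = \<beta>' (U * (y * U))" by (simp add: mult.assoc)
      also have "\<dots> = \<beta>' (y * U * U)" using Us Emul[OF y UE] unfolding stab_def by blast
      finally show ?thesis by (simp add: mult.assoc)
    qed
    then show ?thesis using Emul[OF UE UE] by (simp add: stab_def)
  qed
  then obtain p q where pq: "U * U = sm p (idm n) + sm q U" using sp unfolding spans_def by blast
  have xT: "x \<in> tup_r a b" using x(1) Tr by (auto simp: sol_def)
  obtain A0 A1 B W V where xe: "x = (A0, A1, B, W, V)" and m: "A0 \<in> M a a" "A1 \<in> M a a" "B \<in> M b b" "W \<in> M a b" "V \<in> M a b"
    using xT by (auto simp: tup_r_def)
  have "blk a b (mul5 x x) = blk a b (smt p (one5 a b) + smt q x)"
    using pq unfolding U_def blk_mult[OF xT xT] by (simp add: blk_add blk_smt blk_one n)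
  then have "unblk a b (blk a b (mul5 x x)) = unblk a b (blk a b (smt p (one5 a b) + smt q x))" by (rule arg_cong)
  then have "mul5 x x = smt p (one5 a b) + smt q x"
    by (simp only: unblk_blk[OF tup_mul(1)[OF xT xT]] unblk_blk[OF tup_add(1)[OF tup_smt(1)[OF tup_one(1)] tup_smt(1)[OF xT]]])
  then have sq: "A0 * A0 = sm p (idm a) + sm q A0" "B * B = sm p (idm b) + sm q B"
    by (auto simp: xe mul5_def one5_def smt_def)
  \<comment> \<open>An eigenvector of a diagonal block satisfies the quadratic relation of that
    block, so every eigenvalue is a root.\<close>
  have root: "k * k = p + q * k" if k: "ev a b x k" for k
  proof -
    have key: "k * k = p + q * k" if "v \<noteq> 0" "sm (k * k) v = sm p v + sm (q * k) v" for v :: "'a fm"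
    proof -
      have "sm (k * k - (p + q * k)) v = 0"
        using that(2) by (simp add: fm.scale_left_diff_distrib fm.scale_left_distrib)
      then show ?thesis using that(1) by (simp add: fm.scale_eq_0_iff)
    qed
    from k consider v where "v \<noteq> 0" "idm a * v = v" "A0 * v = sm k v" | v where "v \<noteq> 0" "v * idm b = v" "v * B = sm k v"
      unfolding ev_def xe by auto
    then show ?thesis
    proof cases
      case 1
      have "A0 * A0 * v = sm (k * k) v" using 1 by (simp add: mult.assoc)
      then have "sm (k * k) v = sm p v + sm (q * k) v" unfolding sq using 1 by (simp add: distrib_right mult.commute)
      then show ?thesis using key 1(1) by blast
    next
      case 2
      have "v * (B * B) = sm (k * k) v" using 2 by (simp add: mult.assoc[symmetric])
      then have "sm (k * k) v = sm p v + sm (q * k) v" unfolding sq using 2 by (simp add: distrib_left mult.commute)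
      then show ?thesis using key 2(1) by blast
    qed
  qed
  have "(c - d) * (c + d - q) = 0" using root[OF x(4)] root[OF x(5)] by (simp add: algebra_simps)
  then have q: "q = c + d" using x(3) by auto
  have p: "p = - (c * d)" using root[OF x(4)] q by (simp add: algebra_simps eq_neg_iff_add_eq_0)
  have iE: "idm n * U = U" "U * idm n = U" "idm n * idm n = (idm n :: 'a fm)" using EM[of U] EM[OF oneE] Us Est by auto
  \<comment> \<open>The roots are c and d, so (U - c)(U - d) = 0 and this w is the projection onto
    the d-eigenspace.\<close>
  define w where "w = sm (1 / (d - c)) (U - sm c (idm n))"
  have dc: "d - c \<noteq> 0" using x(3) by simp
  have "(U - sm c (idm n)) * (U - sm c (idm n)) = sm (d - c) (U - sm c (idm n))"
    using pq by (simp add: algebra_simps iE fm.scale_right_diff_distrib fm.scale_left_diff_distrib fm.scale_left_distrib p q)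
  then have ww: "w * w = w" unfolding w_def using dc by simp
  have U: "U = sm c (idm n) + sm (d - c) w" unfolding w_def using dc by simp
  \<comment> \<open>A scalar matrix has only one eigenvalue; this excludes w = 0 and w = 1.\<close>
  have nscal: "U \<noteq> sm k (idm n)" for k
  proof
    assume "U = sm k (idm n)"
    then have "blk a b x = blk a b (smt k (one5 a b))" by (simp only: blk_smt blk_one n U_def)
    then have "unblk a b (blk a b x) = unblk a b (blk a b (smt k (one5 a b)))" by (rule arg_cong)
    then have "x = smt k (one5 a b)"
      by (simp only: unblk_blk[OF xT] unblk_blk[OF tup_smt(1)[OF tup_one(1)]])
    have "smt k (one5 a b) = (sm k (idm a), sm k 0, sm k (idm b), sm k 0, sm k (0 :: 'a fm))"
      by (simp only: one5_def smt_def split_conv)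
    with \<open>x = smt k (one5 a b)\<close> have t: "(A0, A1, B, W, V) = (sm k (idm a), sm k 0, sm k (idm b), sm k 0, sm k 0)"
      unfolding xe by (rule trans)
    have A: "A0 = sm k (idm a)" using arg_cong[OF t, of fst] by (simp only: fst_conv)
    have A': "B = sm k (idm b)" using arg_cong[OF t, of "\<lambda>x. fst (snd (snd x))"] by (simp only: fst_conv snd_conv)
    have "j = k" if "ev a b x j" for j
    proof -
      from that consider v where "v \<noteq> 0" "idm a * v = v" "A0 * v = sm j v" | v where "v \<noteq> 0" "v * idm b = v" "v * B = sm j v"
        unfolding ev_def xe by auto
      then show ?thesis
      proof cases
        case 1
        have "sm k v = sm j v" using 1(3) by (simp only: A sm_times 1(2))
        then have "k = j \<or> v = 0" by (rule fm.scale_cancel_right[THEN iffD1])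
        then show ?thesis using 1(1) by simp
      next
        case 2
        have "sm k v = sm j v" using 2(3) by (simp only: A' times_sm 2(2))
        then have "k = j \<or> v = 0" by (rule fm.scale_cancel_right[THEN iffD1])
        then show ?thesis using 2(1) by simp
      qed
    qed
    from this[OF x(4)] this[OF x(5)] x(3) show False by simp
  qed
  have "w \<noteq> 0" using nscal[of c] U by auto
  moreover have "w \<noteq> idm n" using nscal[of d] U by (auto simp: fm.scale_left_distrib[symmetric])
  moreover have "w = sm (1 / (d - c)) U + sm (- c / (d - c)) (idm n)"
    unfolding w_def by (simp add: fm.scale_right_diff_distrib)
  then have "w \<in> stab E \<beta>'" using stab_lin[OF Esub lf Us one_st, of "1 / (d - c)" "- c / (d - c)"] by (simp only:)
  moreover have "spans (idm n) w (stab E \<beta>')" unfolding spans_def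
  proof
    fix y assume "y \<in> stab E \<beta>'"
    then obtain s t where "y = sm s (idm n) + sm t U" using sp unfolding spans_def by blast
    then have "y = sm (s + t * c) (idm n) + sm (t * (d - c)) w"
      by (subst (asm) U) (simp add: fm.scale_right_distrib fm.scale_left_distrib algebra_simps)
    then show "\<exists>s t. y = sm s (idm n) + sm t w" by blast
  qed
  ultimately show ?thesis using lf ww by blast
qed

lemma tr_idm: "tr (idm n) = (of_nat n :: 'a::field)"
  unfolding tr_M[OF M_idm[OF le_refl le_refl]] by (simp add: ent_idm)

lemma dual_vector:
  assumes "w \<noteq> (0 :: 'a::field fm)"
  obtains l where "lf l" "l w = 1"
proof -
  obtain i j where "ent w i j \<noteq> 0" using assms by (metis ent_zero fm_eqI)
  then show ?thesis by (intro that[of "\<lambda>x. ent x i j / ent w i j"]) (auto simp: lf_def field_simps)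
qed

text \<open>Adding a form that annihilates commutators with w keeps w in the stabiliser and can
  change the value at w. Genericity keeps the stabiliser two-dimensional, and a multiple of the
  trace, which affects no stabiliser, makes the form vanish on 1.\<close>

lemma contact_form_exists:
  fixes \<beta> :: "'a::field_char_0 fm \<Rightarrow> 'a"
  assumes E: "fm.subspace E" "E \<subseteq> M n n" "idm n \<in> E" "\<And>x y. x \<in> E \<Longrightarrow> y \<in> E \<Longrightarrow> x * y \<in> E" and n: "0 < n"
    and \<beta>: "lf \<beta>" and w: "w \<in> stab E \<beta>" "w * w = w" "w \<noteq> 0" "w \<noteq> idm n" and sp: "spans (idm n) w (stab E \<beta>)"
  shows "\<exists>\<gamma>. lf \<gamma> \<and> \<gamma> (idm n) = 0 \<and> \<gamma> w \<noteq> 0 \<and> w \<in> stab E \<gamma> \<and> spans (idm n) w (stab E \<gamma>)"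
proof -
  let ?e = "idm n :: 'a fm"
  have wE: "w \<in> E" using w(1) by (simp add: stab_def)
  have i: "?e * x = x \<and> x * ?e = x" if "x \<in> E" for x using that E(2) by (auto simp: M_iff)
  define w' where "w' = ?e - w"
  have w': "w' \<noteq> 0" "w' * w' = w'" "w * w' = 0" "w' * w = 0" "w' \<in> E"
    using w(2,4) i[OF wE] i[OF E(3)] E(1,3) wE by (auto simp: w'_def algebra_simps fm.subspace_diff)
  obtain l where l: "lf l" "l w = 1" using dual_vector[OF w(3)] by blast
  obtain l' where l': "lf l'" "l' w' = 1" using dual_vector[OF w'(1)] by blast
  \<comment> \<open>Supported on the two diagonal Peirce blocks of w, hence symmetric in products
    with w. The normalisation gives \<sigma>(w) = 1 and \<sigma>(1) = 1 - 1 = 0.\<close>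
  define \<sigma> where "\<sigma> = (\<lambda>x. l (w * x * w) - l' (w' * x * w'))"
  have \<sigma>: "lf \<sigma>" using l(1) l'(1) unfolding \<sigma>_def lf_def by (simp add: algebra_simps)
  have wc: "w * (w * x) = w * x" "w' * (w * x) = 0" for x using w(2) w'(4) by (simp_all add: mult.assoc[symmetric])
  have \<sigma>w: "\<sigma> (w * x) = \<sigma> (x * w)" for x
    unfolding \<sigma>_def by (simp add: mult.assoc w(2) w'(3) wc)
  have "\<sigma> w = 1" "\<sigma> ?e = 0"
    using i[OF wE] i[OF w'(5)] by (simp_all add: \<sigma>_def w(2) w'(2,3,4) wc l(2) l'(2) lf_zero[OF l'(1)])
  have nz: "?e \<noteq> 0" by (rule idm_nz[OF n])
  have fin: "finite {t. \<not> (\<exists>u. spans ?e u (stab E (\<lambda>x. \<beta> x + t * \<sigma> x)))}"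
    by (rule stab_generic[OF E(1,2,3) i nz \<beta> \<sigma> sp])
  define c where "c = \<beta> w - \<beta> ?e / of_nat n * tr w"
  obtain t where t: "t \<noteq> - c" "\<exists>u. spans ?e u (stab E (\<lambda>x. \<beta> x + t * \<sigma> x))"
    using infinite_good[OF _ fin, of "\<lambda>t. t \<noteq> - c"] by auto
  \<comment> \<open>The trace of the unit is n, so this multiple of the trace gives \<gamma>(1) = 0;
    the value at w is t + c, nonzero by the choice of t.\<close>
  define \<gamma> where "\<gamma> = (\<lambda>x. \<beta> x + t * \<sigma> x - \<beta> ?e / of_nat n * tr x)"
  have lf: "lf \<gamma>" using \<beta> \<sigma> unfolding \<gamma>_def lf_def by (simp add: algebra_simps tr_add tr_sm add_divide_distrib)
  have st: "stab E \<gamma> = stab E (\<lambda>x. \<beta> x + t * \<sigma> x)"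
  proof -
    have "\<gamma> (x * y) = \<gamma> (y * x) \<longleftrightarrow> \<beta> (x * y) + t * \<sigma> (x * y) = \<beta> (y * x) + t * \<sigma> (y * x)" for x y
      unfolding \<gamma>_def using tr_comm[of x y] by simp
    then show ?thesis unfolding stab_def by blast
  qed
  have "\<gamma> ?e = 0" using n \<open>\<sigma> ?e = 0\<close> by (simp add: \<gamma>_def tr_idm)
  moreover have "\<gamma> w \<noteq> 0" using t(1) \<open>\<sigma> w = 1\<close> by (simp add: \<gamma>_def c_def add_eq_0_iff algebra_simps)
  moreover have ws: "w \<in> stab E \<gamma>" unfolding st using w(1) \<sigma>w by (auto simp: stab_def)
  moreover have "spans ?e w (stab E \<gamma>)"
  proof -
    obtain u where u: "spans ?e u (stab E \<gamma>)" using t(2) st by auto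
    from u ws obtain s r where sr: "w = sm s ?e + sm r u" unfolding spans_def by blast
    \<comment> \<open>Otherwise w would be a scalar idempotent, that is 0 or 1.\<close>
    have r: "r \<noteq> 0"
    proof
      assume "r = 0"
      then have "w = sm s ?e" using sr by simp
      then have "sm (s * s) ?e = sm s ?e" using w(2) i[OF E(3)] by simp
      then have "s * s = s" using nz by (simp add: fm.scale_cancel_right)
      then have "s = 0 \<or> s = 1" by simp
      then show False using \<open>w = sm s ?e\<close> w(3,4) by auto
    qed
    have u': "u = sm (1 / r) w - sm (s / r) ?e" unfolding sr using r by (simp add: fm.scale_right_distrib)
    show ?thesis unfolding spans_def
    proof
      fix y assume "y \<in> stab E \<gamma>"
      then obtain p q where "y = sm p ?e + sm q u" using u unfolding spans_def by blast
      then have "y = sm (p - q * s / r) ?e + sm (q / r) w"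
        unfolding u' by (simp add: fm.scale_right_diff_distrib fm.scale_left_diff_distrib)
      then show "\<exists>s t. y = sm s ?e + sm t w" by blast
    qed
  qed
  ultimately show ?thesis using lf by blast
qed

text \<open>If \<alpha> is nonzero on the radical K s of its differential, then the kernel of
  \<alpha> is a symplectic complement of K s. Evaluating the top form on a symplectic basis of the
  kernel followed by s gives a nonzero Pfaffian times \<alpha>(s).\<close>

lemma contactI:
  fixes L :: "('k::field_char_0, 'v::ab_group_add) lie_algebra"
  assumes vs: "vector_space (lie_scale L)"
    and V: "module.subspace (lie_scale L) (lie_carrier L)" "lie_carrier L \<subseteq> module.span (lie_scale L) B" "finite B"
    and \<alpha>: "\<alpha> \<in> lie_dual L"
    and add: "\<And>x y z. x \<in> lie_carrier L \<Longrightarrow> y \<in> lie_carrier L \<Longrightarrow> z \<in> lie_carrier L \<Longrightarrow>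
      \<alpha> (lie_bracket L (x + y) z) = \<alpha> (lie_bracket L x z) + \<alpha> (lie_bracket L y z)"
    and sc: "\<And>c x z. x \<in> lie_carrier L \<Longrightarrow> z \<in> lie_carrier L \<Longrightarrow>
      \<alpha> (lie_bracket L (lie_scale L c x) z) = c * \<alpha> (lie_bracket L x z)"
    and anti: "\<And>x y. x \<in> lie_carrier L \<Longrightarrow> y \<in> lie_carrier L \<Longrightarrow> \<alpha> (lie_bracket L x y) = - \<alpha> (lie_bracket L y x)"
    and s: "s \<in> lie_carrier L" "\<alpha> s \<noteq> 0" "\<And>x. x \<in> lie_stabiliser L \<alpha> \<longleftrightarrow> (\<exists>c. x = lie_scale L c s)"
  shows "contact L"
proof -
  interpret vector_space "lie_scale L" by (rule vs)
  let ?V = "lie_carrier L"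
  define \<omega> where "\<omega> = (\<lambda>x y. \<alpha> (lie_bracket L x y))"
  have \<alpha>_add: "\<alpha> (x + y) = \<alpha> x + \<alpha> y" if "x \<in> ?V" "y \<in> ?V" for x y using \<alpha> that by (auto simp: lie_dual_def)
  have \<alpha>_sc: "\<alpha> (lie_scale L c x) = c * \<alpha> x" if "x \<in> ?V" for c x using \<alpha> that by (auto simp: lie_dual_def)
  have "s \<noteq> 0" using \<alpha>_sc[OF s(1), of 0] s(2) by auto
  have rad: "(\<forall>y \<in> ?V. \<omega> x y = 0) \<longleftrightarrow> (\<exists>c. x = lie_scale L c s)" if "x \<in> ?V" for x
    using s(3)[of x] that by (auto simp: lie_stabiliser_def \<omega>_def)
  have "\<exists>n v. symp_family ?V \<omega> n v \<and> dim ?V = 2 * n + 1"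
  proof (rule symplectic_basis[OF _ V])
    show "(2 :: 'k) \<noteq> 0" by simp
    show "(\<forall>y \<in> ?V. \<omega> x y = 0) \<longleftrightarrow> (\<exists>c. x = lie_scale L c s)" if "x \<in> ?V" for x by (rule rad[OF that])
    show "\<omega> (x + y) z = \<omega> x z + \<omega> y z" if "x \<in> ?V" "y \<in> ?V" "z \<in> ?V" for x y z
      unfolding \<omega>_def by (rule add[OF that])
    show "\<omega> (lie_scale L c x) z = c * \<omega> x z" if "x \<in> ?V" "z \<in> ?V" for c x z
      unfolding \<omega>_def by (rule sc[OF that])
    show "\<omega> x y = - \<omega> y x" if "x \<in> ?V" "y \<in> ?V" for x y
      unfolding \<omega>_def by (rule anti[OF that])
  qed (fact s(1) \<open>s \<noteq> 0\<close>)+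
  then obtain n v where v: "symp_family ?V \<omega> n v" "dim ?V = 2 * n + 1" by blast
  \<comment> \<open>Multiples of s move the symplectic basis into the kernel of \<alpha> without
    changing any pairing; the vector with index 2n is s.\<close>
  define w where "w = (\<lambda>i. if i < 2 * n then v i + lie_scale L (- \<alpha> (v i) / \<alpha> s) s else s)"
  have sV: "lie_scale L c s \<in> ?V" for c using s(1) V(1) by (simp add: subspace_scale)
  have vV: "v i \<in> ?V" if "i < 2 * n" for i using v(1) that by (simp add: symp_family_def)
  have wi: "w k = v k + lie_scale L (- \<alpha> (v k) / \<alpha> s) s" if "k < 2 * n" for k using that by (simp add: w_def)
  have wV: "w i \<in> ?V" for i
  proof (cases "i < 2 * n")
    case True
    then show ?thesis unfolding wi[OF True] by (rule subspace_add[OF V(1) vV sV])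
  qed (use s(1) in \<open>simp add: w_def\<close>)
  have s0: "\<omega> (lie_scale L c s) y = 0" "\<omega> y (lie_scale L c s) = 0" if "y \<in> ?V" for c y
  proof -
    show 1: "\<omega> (lie_scale L c s) y = 0" using rad[OF sV[of c]] that by blast
    have "\<omega> y (lie_scale L c s) = - \<omega> (lie_scale L c s) y" unfolding \<omega>_def by (rule anti[OF that sV])
    then show "\<omega> y (lie_scale L c s) = 0" unfolding 1 by simp
  qed
  have \<omega>_add: "\<omega> (x + y) z = \<omega> x z + \<omega> y z" if "x \<in> ?V" "y \<in> ?V" "z \<in> ?V" for x y z
    unfolding \<omega>_def by (rule add[OF that])
  have \<omega>_add': "\<omega> z (x + y) = \<omega> z x + \<omega> z y" if "x \<in> ?V" "y \<in> ?V" "z \<in> ?V" for x y z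
  proof -
    have "\<omega> z (x + y) = - \<omega> (x + y) z" unfolding \<omega>_def by (rule anti[OF that(3) subspace_add[OF V(1) that(1,2)]])
    also have "\<dots> = - \<omega> x z + - \<omega> y z" unfolding \<omega>_add[OF that] by simp
    also have "- \<omega> x z = \<omega> z x" unfolding \<omega>_def by (rule anti[OF that(3,1), symmetric])
    also have "- \<omega> y z = \<omega> z y" unfolding \<omega>_def by (rule anti[OF that(3,2), symmetric])
    finally show ?thesis .
  qed
  have ww: "- \<omega> (w i) (w j) = - 1 * J i j" if ij: "i < 2 * n" "j < 2 * n" for i j
  proof -
    have "\<omega> (w i) (w j) = \<omega> (v i) (w j)"
      unfolding wi[OF ij(1)] \<omega>_add[OF vV[OF ij(1)] sV wV] s0(1)[OF wV] by simp
    also have "\<dots> = \<omega> (v i) (v j)"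
      unfolding wi[OF ij(2)] \<omega>_add'[OF vV[OF ij(2)] sV vV[OF ij(1)]] s0(2)[OF vV[OF ij(1)]] by simp
    also have "\<dots> = J i j" using v(1) ij by (simp add: symp_family_def)
    finally show ?thesis by simp
  qed
  have \<alpha>w: "\<alpha> (w i) = 0" if "i < 2 * n" for i
    unfolding wi[OF that] \<alpha>_add[OF vV[OF that] sV] \<alpha>_sc[OF s(1)] using s(2) by simp
  have d: "lie_d L \<alpha> = (\<lambda>u. (\<lambda>x y. - \<omega> x y) (u 0) (u 1))" by (simp add: lie_d_def \<omega>_def)
  have "pf (\<lambda>x y. - \<omega> x y) n w \<noteq> 0" 
    by (rule pf_symplectic[where c = "- 1"]) (use ww in simp_all)
  then have "wedge (2 * n) 1 (wedge_power 2 (lie_d L \<alpha>) n) (\<lambda>u. \<alpha> (u 0)) w \<noteq> 0"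
    unfolding d using wedge_contact[of n \<alpha> w "\<lambda>x y. - \<omega> x y", OF \<alpha>w] s(2) by (simp add: w_def)
  then show ?thesis unfolding contact_def using v(2) \<alpha> wV by blast
qed

lemma vector_space_Lie: "vector_space (lie_scale (Lie G))"
  by unfold_locales (auto simp: Lie_def fun_eq_iff algebra_simps)

text \<open>Common argument for both groups. \<Phi> presents the Lie algebra as E modulo scalars,
  and \<rho> sends a group element to a matrix that induces its adjoint action. Forms pass between
  the Lie algebra and E, and elements of a coadjoint stabiliser are sent into the associative
  stabiliser, the span of 1 and w; there \<open>red\<close> excludes nontrivial unipotents.\<close>

lemma quasi_reductive_contact:
  fixes G :: "('g, 'k::field_char_0) alg_group" and \<Phi> :: "'k fm \<Rightarrow> ('g \<Rightarrow> 'k) \<Rightarrow> 'k"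
  assumes T: "T = tup_r a b \<or> T = tup_q a b" and ev: "even a" "even b" "0 < a + b"
    and n: "n = 2 * a + b" and E: "E = blk a b ` T"
    and \<Phi>_add: "\<And>x y. x \<in> E \<Longrightarrow> y \<in> E \<Longrightarrow> \<Phi> (x + y) = \<Phi> x + \<Phi> y"
    and \<Phi>_sm: "\<And>c x. x \<in> E \<Longrightarrow> \<Phi> (sm c x) = (\<lambda>f. c * \<Phi> x f)"
    and \<Phi>_onto: "\<Phi> ` E = point_derivations G"
    and \<Phi>_ker: "\<And>x. x \<in> E \<Longrightarrow> \<Phi> x = 0 \<longleftrightarrow> (\<exists>c. x = sm c (idm n))"
    and \<Phi>_bracket: "\<And>x y. x \<in> E \<Longrightarrow> y \<in> E \<Longrightarrow> lie_bracket (Lie G) (\<Phi> x) (\<Phi> y) = \<Phi> (x * y - y * x)"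
    and Ad: "\<And>g. g \<in> carrier G \<Longrightarrow> \<rho> g \<in> E \<and> (\<exists>r' \<in> E. r' * \<rho> g = idm n \<and> (\<forall>x \<in> E. Ad G g (\<Phi> x) = \<Phi> (\<rho> g * x * r')))"
    and red: "\<And>w H u. w \<in> E \<Longrightarrow> w * w = w \<Longrightarrow> w \<noteq> 0 \<Longrightarrow> w \<noteq> idm n \<Longrightarrow> H \<subseteq> carrier G \<Longrightarrow> \<one>\<^bsub>G\<^esub> \<in> H \<Longrightarrow>
      (\<And>x y. x \<in> H \<Longrightarrow> y \<in> H \<Longrightarrow> x \<otimes>\<^bsub>G\<^esub> y \<in> H) \<Longrightarrow>
      (\<And>g. g \<in> H \<Longrightarrow> \<exists>s t. \<rho> g = sm s (idm n) + sm t w) \<Longrightarrow> u \<in> H \<Longrightarrow> unipotent (alg_subgroup G H) u \<Longrightarrow> u = \<one>\<^bsub>G\<^esub>"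
    and index: "lie_index (Lie G) = 1"
  shows "strongly_quasi_reductive G \<and> contact (Lie G)"
proof -
  let ?e = "idm n :: 'k fm" and ?L = "Lie G"
  interpret LV: vector_space "lie_scale (Lie G)" by (rule vector_space_Lie)
  have sa: "subalg a b T" using T subalg_rq by blast
  have Emul: "y * z \<in> E" if "y \<in> E" "z \<in> E" for y z using subalg_blk(4)[OF sa] that unfolding E by blast
  have EMn: "E \<subseteq> M n n" using subalg_blk(2)[OF sa] unfolding E n .
  have EM: "?e * y = y \<and> y * ?e = y" if "y \<in> E" for y using EMn that by (auto simp: M_iff)
  have Esub: "fm.subspace E" unfolding E by (rule subalg_blk(1)[OF sa])
  have oneE: "?e \<in> E" unfolding E n by (rule subalg_blk(3)[OF sa])
  have Ecl: "x + y \<in> E" "sm c x \<in> E" "x - y \<in> E" if "x \<in> E" "y \<in> E" for x y c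
    using that Esub by (auto simp: fm.subspace_add fm.subspace_scale fm.subspace_diff)
  have car: "lie_carrier ?L = \<Phi> ` E" by (simp add: Lie_def \<Phi>_onto)
  have scl: "lie_scale ?L c (\<Phi> x) = \<Phi> (sm c x)" if "x \<in> E" for c x by (simp add: Lie_def \<Phi>_sm[OF that])
  have \<Phi>_diff: "\<Phi> (x - y) = \<Phi> x - \<Phi> y" if "x \<in> E" "y \<in> E" for x y
    using \<Phi>_add[OF Ecl(3)[OF that] that(2)] by simp
  have \<Phi>_eq: "\<exists>c. x = y + sm c ?e" if "x \<in> E" "y \<in> E" "\<Phi> x = \<Phi> y" for x y
    using \<Phi>_ker[OF Ecl(3)[OF that(1,2)]] \<Phi>_diff[OF that(1,2)] that(3) by (simp add: diff_eq_eq add.commute)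
  have stab_\<Phi>: "lie_stabiliser ?L \<gamma> = \<Phi> ` stab E \<beta>"
    if \<beta>: "lf \<beta>" "\<And>x. x \<in> E \<Longrightarrow> \<gamma> (\<Phi> x) = \<beta> x" for \<gamma> \<beta>
  proof -
    have "\<gamma> (lie_bracket ?L (\<Phi> x) (\<Phi> y)) = 0 \<longleftrightarrow> \<beta> (x * y) = \<beta> (y * x)" if "x \<in> E" "y \<in> E" for x y
      using that Emul Ecl by (simp add: \<Phi>_bracket \<beta>(2) lf_diff[OF \<beta>(1)])
    then show ?thesis unfolding lie_stabiliser_def car stab_def by auto
  qed
  have dual0: "(\<lambda>_. 0) \<in> lie_dual ?L" by (simp add: lie_dual_def)
  have "lie_index ?L \<in> (\<lambda>\<gamma>. lie_dim ?L (lie_stabiliser ?L \<gamma>)) ` lie_dual ?L"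
    unfolding lie_index_def by (rule Inf_nat_def1) (use dual0 in blast)
  then obtain \<gamma>0 where \<gamma>0: "\<gamma>0 \<in> lie_dual ?L" "lie_dim ?L (lie_stabiliser ?L \<gamma>0) = 1" using index by auto
  obtain pj where pj: "\<And>x y. pj (x + y) = pj x + pj y" "\<And>c x. pj (sm c x) = sm c (pj x)" "\<And>y. pj y \<in> E" 
    "\<And>x. x \<in> E \<Longrightarrow> pj x = x" using blk_projection[OF T] unfolding E by blast
  \<comment> \<open>The form realising the index, pulled back to E and extended to all matrices by
    the projection.\<close>
  define \<beta>0 where "\<beta>0 = (\<lambda>x. \<gamma>0 (\<Phi> (pj x)))"
  have \<gamma>0_add: "\<gamma>0 (\<Phi> x + \<Phi> y) = \<gamma>0 (\<Phi> x) + \<gamma>0 (\<Phi> y)" if "x \<in> E" "y \<in> E" for x y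
    using \<gamma>0(1) that car unfolding lie_dual_def by blast
  have \<gamma>0_sc: "\<gamma>0 (lie_scale ?L c (\<Phi> x)) = c * \<gamma>0 (\<Phi> x)" if "x \<in> E" for c x
    using \<gamma>0(1) that car unfolding lie_dual_def by blast
  have \<beta>0: "lf \<beta>0" unfolding lf_def \<beta>0_def
    using pj(3) by (auto simp: pj(1,2) \<Phi>_add \<gamma>0_add scl[symmetric] \<gamma>0_sc)
  have st0: "lie_stabiliser ?L \<gamma>0 = \<Phi> ` stab E \<beta>0" by (rule stab_\<Phi>[OF \<beta>0]) (simp add: \<beta>0_def pj(4))
  obtain B where B: "B \<subseteq> lie_stabiliser ?L \<gamma>0" "lie_stabiliser ?L \<gamma>0 \<subseteq> LV.span B" "card B = 1"
    using LV.basis_exists[of "lie_stabiliser ?L \<gamma>0"] \<gamma>0(2) by metis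
  then obtain \<delta> where \<delta>: "B = {\<delta>}" by (auto simp: card_1_singleton_iff)
  then obtain x1 where x1: "x1 \<in> stab E \<beta>0" "\<delta> = \<Phi> x1" using B(1) st0 by auto
  then have x1E: "x1 \<in> E" by (simp add: stab_def)
  \<comment> \<open>The stabiliser of \<gamma>0 is a line, so its preimage under \<Phi> is spanned
    by a lift x1 and the kernel, the scalars.\<close>
  have "spans ?e x1 (stab E \<beta>0)" unfolding spans_def
  proof
    fix x assume x: "x \<in> stab E \<beta>0"
    then have xE: "x \<in> E" by (simp add: stab_def)
    have "\<Phi> x \<in> LV.span {\<delta>}" using x st0 B(2) \<delta> by blast
    then obtain c where "\<Phi> x = lie_scale ?L c (\<Phi> x1)" by (auto simp: LV.span_singleton x1(2))
    then have "\<Phi> x = \<Phi> (sm c x1)" by (simp add: scl[OF x1E])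
    from \<Phi>_eq[OF xE Ecl(2)[OF x1E x1E] this] obtain d where "x = sm c x1 + sm d ?e" by blast
    then have "x = sm d ?e + sm c x1" by (simp add: add.commute)
    then show "\<exists>s t. x = sm s ?e + sm t x1" by blast
  qed
  from split_idempotent[OF T ev n E \<beta>0 this] obtain \<beta>1 w where
    w: "lf \<beta>1" "w \<in> stab E \<beta>1" "w * w = w" "w \<noteq> 0" "w \<noteq> ?e" "spans ?e w (stab E \<beta>1)" by blast
  have "0 < n" using ev(3) n by auto
  from contact_form_exists[OF Esub EMn oneE Emul this w(1-6)] obtain \<beta> where
    \<beta>: "lf \<beta>" "\<beta> ?e = 0" "\<beta> w \<noteq> 0" "w \<in> stab E \<beta>" "spans ?e w (stab E \<beta>)" by blast
  have wE: "w \<in> E" using w(2) by (simp add: stab_def)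
  \<comment> \<open>The choice of preimage does not matter: preimages differ by scalars, on which
    \<beta> vanishes.\<close>
  define \<gamma> where "\<gamma> = (\<lambda>\<delta>. \<beta> (SOME x. x \<in> E \<and> \<Phi> x = \<delta>))"
  have \<gamma>: "\<gamma> (\<Phi> x) = \<beta> x" if xE: "x \<in> E" for x
  proof -
    define y where "y = (SOME y. y \<in> E \<and> \<Phi> y = \<Phi> x)"
    have y: "y \<in> E \<and> \<Phi> y = \<Phi> x" unfolding y_def by (rule someI[of _ x]) (use xE in simp)
    obtain c where "y = x + sm c ?e" using \<Phi>_eq[OF conjunct1[OF y] xE conjunct2[OF y]] by blast
    then have "\<beta> y = \<beta> x" by (simp add: lf_add[OF \<beta>(1)] lf_sm[OF \<beta>(1)] \<beta>(2))
    then show ?thesis by (simp add: \<gamma>_def y_def)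
  qed
  have dual: "\<gamma> \<in> lie_dual ?L"
    unfolding lie_dual_def car
    by (auto simp: \<Phi>_add[symmetric] scl \<gamma> Ecl lf_add[OF \<beta>(1)] lf_sm[OF \<beta>(1)])
  have st: "lie_stabiliser ?L \<gamma> = \<Phi> ` stab E \<beta>" by (rule stab_\<Phi>[OF \<beta>(1) \<gamma>])
  have \<Phi>1: "\<Phi> (sm s ?e) = 0" for s using \<Phi>_ker[OF Ecl(2)[OF oneE oneE]] by blast
  have rad: "x \<in> lie_stabiliser ?L \<gamma> \<longleftrightarrow> (\<exists>c. x = lie_scale ?L c (\<Phi> w))" for x
  proof
    assume "x \<in> lie_stabiliser ?L \<gamma>"
    then obtain y where y: "x = \<Phi> y" "y \<in> stab E \<beta>" unfolding st by blast
    then obtain s t where "y = sm s ?e + sm t w" using \<beta>(5) unfolding spans_def by blast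
    then have "x = lie_scale ?L t (\<Phi> w)"
      using y(1) \<Phi>_add[OF Ecl(2)[OF oneE oneE] Ecl(2)[OF wE wE], of s t] by (simp add: \<Phi>1 scl[OF wE])
    then show "\<exists>c. x = lie_scale ?L c (\<Phi> w)" by blast
  next
    assume "\<exists>c. x = lie_scale ?L c (\<Phi> w)"
    then obtain c where "x = \<Phi> (sm c w)" using scl[OF wE] by auto
    moreover have "sm c w \<in> stab E \<beta>" using stab_lin[OF Esub \<beta>(1) \<beta>(4) \<beta>(4), of c 0] by simp
    ultimately show "x \<in> lie_stabiliser ?L \<gamma>" unfolding st by blast
  qed
  have "strongly_quasi_reductive G"
    unfolding strongly_quasi_reductive_def
  proof (rule bexI[OF _ dual])
    let ?H = "coadjoint_stabiliser G \<gamma>"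
    have H: "\<exists>s t. \<rho> g = sm s ?e + sm t w" if g: "g \<in> ?H" for g
    proof -
      have gG: "g \<in> carrier G" and inv: "\<And>x. x \<in> E \<Longrightarrow> \<gamma> (Ad G g (\<Phi> x)) = \<gamma> (\<Phi> x)"
        using g car unfolding coadjoint_stabiliser_def by auto
      obtain r' where r: "\<rho> g \<in> E" "r' \<in> E" "r' * \<rho> g = ?e" "\<And>x. x \<in> E \<Longrightarrow> Ad G g (\<Phi> x) = \<Phi> (\<rho> g * x * r')"
        using Ad[OF gG] by blast
      \<comment> \<open>Invariance is tested at \<open>y * \<rho> g\<close>, so that conjugation by
        \<open>\<rho> g\<close> turns it into \<open>\<rho> g * y\<close>.\<close>
      have "\<beta> (\<rho> g * y) = \<beta> (y * \<rho> g)" if y: "y \<in> E" for y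
      proof -
        have yr: "y * \<rho> g \<in> E" using Emul y r(1) by blast
        have "\<gamma> (\<Phi> (\<rho> g * (y * \<rho> g) * r')) = \<gamma> (\<Phi> (y * \<rho> g))" using inv[OF yr] r(4)[OF yr] by simp
        moreover have "\<rho> g * (y * \<rho> g) * r' \<in> E" using Emul yr r(1,2) by blast
        ultimately have e: "\<beta> (\<rho> g * (y * \<rho> g) * r') = \<beta> (y * \<rho> g)" using \<gamma> yr by simp
        \<comment> \<open>In finite size a left inverse is a right inverse; this is taken from
          square matrices.\<close>
        have rr: "\<rho> g * r' = ?e"
        proof -
          obtain h where "h \<in> M n n" "\<rho> g * h = ?e"
          proof -
            have c: "to_mat n n r' \<in> carrier_mat n n" "to_mat n n (\<rho> g) \<in> carrier_mat n n" by auto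
            have m: "of_mat (to_mat n n r') = r'" "of_mat (to_mat n n (\<rho> g)) = \<rho> g"
              using r(1,2) EMn by (auto intro: of_mat_to_mat)
            have "to_mat n n r' * to_mat n n (\<rho> g) = 1\<^sub>m n"
              by (rule of_mat_inj[of _ n n]) (use r(3) in \<open>simp_all add: of_mat_times[OF c] m of_mat_one mult_carrier_mat[OF c]\<close>)
            then have "to_mat n n (\<rho> g) * to_mat n n r' = 1\<^sub>m n" by (rule mat_mult_left_right_inverse[OF c])
            then have "\<rho> g * r' = ?e" using of_mat_times[OF c(2,1)] m by (simp add: of_mat_one)
            then show ?thesis using that r(2) EMn by blast
          qed
          moreover have "r' = h"
            by (rule fm_inv_unique[OF _ \<open>h \<in> M n n\<close> r(3) \<open>\<rho> g * h = ?e\<close>]) (use r(2) EMn in blast)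
          ultimately show ?thesis by simp
        qed
        have "\<rho> g * (y * \<rho> g) * r' = \<rho> g * y" using EM[OF Emul[OF r(1) y]] rr by (simp add: mult.assoc)
        then show ?thesis using e by simp
      qed
      then have "\<rho> g \<in> stab E \<beta>" using r(1) by (simp add: stab_def)
      then show ?thesis using \<beta>(5) unfolding spans_def by blast
    qed
    show "reductive (alg_subgroup G ?H)"
      unfolding reductive_def
    proof (intro allI impI, elim conjE)
      fix U assume U: "U \<lhd> alg_subgroup G ?H" "\<forall>u\<in>U. unipotent (alg_subgroup G ?H) u"
      have sub: "subgroup U (alg_subgroup G ?H)" using U(1) by (simp add: normal_def)
      have UH: "U \<subseteq> ?H" using subgroup.subset[OF sub] by (simp add: alg_subgroup_def)
      have 1: "\<one>\<^bsub>G\<^esub> \<in> U" using subgroup.one_closed[OF sub] by (simp add: alg_subgroup_def)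
      have HG: "?H \<subseteq> carrier G" by (auto simp: coadjoint_stabiliser_def)
      have "u = \<one>\<^bsub>G\<^esub>" if uU: "u \<in> U" for u
      proof (rule red[OF wE w(3-5) HG subsetD[OF UH 1]])
        have "group (alg_subgroup G ?H)" using U(1) by (simp add: normal_def)
        then interpret H: group "alg_subgroup G ?H" .
        show "x \<otimes>\<^bsub>G\<^esub> y \<in> ?H" if "x \<in> ?H" "y \<in> ?H" for x y using H.m_closed[of x y] that by (simp add: alg_subgroup_def)
        show "\<exists>s t. \<rho> g = sm s ?e + sm t w" if "g \<in> ?H" for g by (rule H[OF that])
        show "u \<in> ?H" by (rule subsetD[OF UH uU])
        show "unipotent (alg_subgroup G ?H) u" by (rule bspec[OF U(2) uU])
      qed
      note all = this
      have eq: "\<one>\<^bsub>alg_subgroup G ?H\<^esub> = \<one>\<^bsub>G\<^esub>" by (simp add: alg_subgroup_def)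
      show "U = {\<one>\<^bsub>alg_subgroup G ?H\<^esub>}" unfolding eq
      proof (rule equalityI; rule subsetI)
        show "u \<in> {\<one>\<^bsub>G\<^esub>}" if uU: "u \<in> U" for u using all[OF uU] by (simp only: singleton_iff)
        show "u \<in> U" if u1: "u \<in> {\<one>\<^bsub>G\<^esub>}" for u using 1 singletonD[OF u1] by (simp only:)
      qed
    qed
  qed
  moreover have "contact ?L"
  proof (rule contactI[OF vector_space_Lie _ _ _ dual, of _ "\<Phi> w"])
    show "LV.subspace (lie_carrier ?L)"
      unfolding LV.subspace_def car
    proof (intro conjI ballI allI)
      show "0 \<in> \<Phi> ` E" using imageI[OF fm.subspace_0[OF Esub], of \<Phi>] \<Phi>1[of 0] by simp
    qed (auto simp: \<Phi>_add[symmetric] scl Ecl)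
    have fs: "\<Phi> x \<in> LV.span (\<Phi> ` pj ` (\<lambda>(i, j). el i j) ` ({..<n} \<times> {..<n}))" if x: "x \<in> E" for x
    proof -
      have s: "\<Phi> (pj (\<Sum>i\<in>A. f i)) = (\<Sum>i\<in>A. \<Phi> (pj (f i)))" if "finite A" for A :: "nat set" and f
        using that
      proof induction
        case empty
        have "pj 0 = 0" using pj(2)[of 0 0] by simp
        then show ?case using \<Phi>1[of 0] by simp
      qed (simp add: pj(1) \<Phi>_add pj(3))
      have "x = (\<Sum>i<n. \<Sum>j<n. sm (ent x i j) (el i j))" using fm_expand x EMn by blast
      then have "\<Phi> x = \<Phi> (pj (\<Sum>i<n. \<Sum>j<n. sm (ent x i j) (el i j)))" using pj(4)[OF x] by simp
      also have "\<dots> = (\<Sum>i<n. \<Sum>j<n. lie_scale ?L (ent x i j) (\<Phi> (pj (el i j))))"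
        by (simp add: s pj(2) scl[OF pj(3)])
      also have "\<dots> \<in> LV.span (\<Phi> ` pj ` (\<lambda>(i, j). el i j) ` ({..<n} \<times> {..<n}))"
        by (intro LV.span_sum LV.span_scale LV.span_base) auto
      finally show ?thesis .
    qed
    then show "lie_carrier ?L \<subseteq> LV.span (\<Phi> ` pj ` (\<lambda>(i, j). el i j) ` ({..<n} \<times> {..<n}))" unfolding car by blast
    show "finite (\<Phi> ` pj ` (\<lambda>(i, j). el i j) ` ({..<n} \<times> {..<n}))" by simp
    show "\<gamma> (lie_bracket ?L (x + y) z) = \<gamma> (lie_bracket ?L x z) + \<gamma> (lie_bracket ?L y z)"
      if "x \<in> lie_carrier ?L" "y \<in> lie_carrier ?L" "z \<in> lie_carrier ?L" for x y z
      using that unfolding car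
      by (auto simp: \<Phi>_add[symmetric] \<Phi>_bracket Ecl Emul \<gamma> lf_diff[OF \<beta>(1)] lf_add[OF \<beta>(1)] distrib_left distrib_right)
    show "\<gamma> (lie_bracket ?L (lie_scale ?L c x) z) = c * \<gamma> (lie_bracket ?L x z)"
      if "x \<in> lie_carrier ?L" "z \<in> lie_carrier ?L" for c x z
      using that unfolding car
      by (auto simp: scl \<Phi>_bracket Ecl Emul \<gamma> lf_diff[OF \<beta>(1)] lf_sm[OF \<beta>(1)] algebra_simps)
    show "\<gamma> (lie_bracket ?L x y) = - \<gamma> (lie_bracket ?L y x)"
      if "x \<in> lie_carrier ?L" "y \<in> lie_carrier ?L" for x y
      using that unfolding car
      by (auto simp: \<Phi>_bracket Ecl Emul \<gamma> lf_diff[OF \<beta>(1)])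
    show "\<Phi> w \<in> lie_carrier ?L" unfolding car using wE by blast
    show "\<gamma> (\<Phi> w) \<noteq> 0" using \<beta>(3) \<gamma>[OF wE] by simp
    show "x \<in> lie_stabiliser ?L \<gamma> \<longleftrightarrow> (\<exists>c. x = lie_scale ?L c (\<Phi> w))" for x by (rule rad)
  qed
  ultimately show ?thesis by blast
qed

section \<open>Function algebras and matrix-valued functions with entries in them\<close>

locale function_algebra =
  fixes S :: "'x set" and P :: "('x \<Rightarrow> 'k::field) \<Rightarrow> bool"
  assumes const: "P (\<lambda>x. c)"
    and add: "P f \<Longrightarrow> P g \<Longrightarrow> P (\<lambda>x. f x + g x)"
    and mult: "P f \<Longrightarrow> P g \<Longrightarrow> P (\<lambda>x. f x * g x)"
    and cong: "(\<And>x. x \<in> S \<Longrightarrow> f x = g x) \<Longrightarrow> P f \<Longrightarrow> P g"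
begin

lemma uminus: "P f \<Longrightarrow> P (\<lambda>x. - f x)"
  using mult[OF const[of "- 1"], of f] by simp

lemma diff: "P f \<Longrightarrow> P g \<Longrightarrow> P (\<lambda>x. f x - g x)"
  using add[of f, OF _ uminus[of g]] by simp

lemma sum: "(\<And>i. i \<in> A \<Longrightarrow> P (f i)) \<Longrightarrow> P (\<lambda>x. \<Sum>i\<in>A. f i x)"
  by (induction A rule: infinite_finite_induct) (auto intro: const add)

lemma prod: "(\<And>i. i \<in> A \<Longrightarrow> P (f i)) \<Longrightarrow> P (\<lambda>x. \<Prod>i\<in>A. f i x)"
  by (induction A rule: infinite_finite_induct) (auto intro: const mult)

lemma power: "P f \<Longrightarrow> P (\<lambda>x. f x ^ k)"
  by (induction k) (auto intro: const mult)

lemma det: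
  assumes "\<And>x. x \<in> S \<Longrightarrow> Y x \<in> carrier_mat m m" "\<And>i j. i < m \<Longrightarrow> j < m \<Longrightarrow> P (\<lambda>x. Y x $$ (i, j))"
  shows "P (\<lambda>x. det (Y x))"
proof (rule cong)
  show "P (\<lambda>x. \<Sum>p\<in>{p. p permutes {0..<m}}. signof p * (\<Prod>i\<in>{0..<m}. Y x $$ (i, p i)))"
    by (rule sum, rule mult, rule const, rule prod, rule assms(2)) (auto simp: permutes_in_image dest: permutes_in_image)
qed (simp add: det_def'[OF assms(1)])

text \<open>The common bound N makes the entries of a product sums of fixed length, so matrix
  expressions stay in the algebra. The locale serves regular functions, invariants, and functions of
  t differentiable at 0.\<close>

definition matP :: "('x \<Rightarrow> 'k fm) \<Rightarrow> bool" where
  "matP Y \<longleftrightarrow> (\<exists>N. \<forall>x \<in> S. Y x \<in> M N N) \<and> (\<forall>i j. P (\<lambda>x. ent (Y x) i j))"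

lemma matP_I: "(\<And>x. x \<in> S \<Longrightarrow> Y x \<in> M m n) \<Longrightarrow> (\<And>i j. P (\<lambda>x. ent (Y x) i j)) \<Longrightarrow> matP Y"
  unfolding matP_def by (metis M_mono max.cobounded1 max.cobounded2)

lemma matP_ent: "matP Y \<Longrightarrow> P (\<lambda>x. ent (Y x) i j)" by (simp add: matP_def)

lemma matP_const: "matP (\<lambda>x. c)"
  using ex_M[of c] const by (auto simp: matP_def)

lemma matP_add: assumes "matP X" "matP Y" shows "matP (\<lambda>x. X x + Y x)"
proof -
  obtain N N' where "\<forall>x\<in>S. X x \<in> M N N" "\<forall>x\<in>S. Y x \<in> M N' N'" using assms by (auto simp: matP_def)
  then have "X x + Y x \<in> M (max N N') (max N N')" if "x \<in> S" for x
    using that by (intro M_add) (auto intro: M_mono)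
  then show ?thesis using assms by (intro matP_I) (auto simp: matP_def intro: add)
qed

lemma matP_uminus: "matP X \<Longrightarrow> matP (\<lambda>x. - X x)"
  unfolding matP_def using M_uminus by (fastforce intro: uminus)

lemma matP_diff: "matP X \<Longrightarrow> matP Y \<Longrightarrow> matP (\<lambda>x. X x - Y x)"
  using matP_add[of X, OF _ matP_uminus[of Y]] by simp

lemma matP_sm: "P f \<Longrightarrow> matP X \<Longrightarrow> matP (\<lambda>x. sm (f x) (X x))"
  unfolding matP_def using M_sm by (fastforce intro: mult)

lemma matP_tpose: "matP X \<Longrightarrow> matP (\<lambda>x. tpose (X x))"
  by (auto simp: matP_def M_tpose)

lemma matP_times: assumes "matP X" "matP Y" shows "matP (\<lambda>x. X x * Y x)"
proof -
  obtain N N' where N: "\<forall>x\<in>S. X x \<in> M N N" "\<forall>x\<in>S. Y x \<in> M N' N'" using assms by (auto simp: matP_def)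
  show ?thesis
  proof (rule matP_I)
    show "X x * Y x \<in> M N N'" if "x \<in> S" for x using N that by (blast intro: M_times)
    show "P (\<lambda>x. ent (X x * Y x) i j)" for i j
    proof (rule cong)
      show "P (\<lambda>x. \<Sum>k<N. ent (X x) i k * ent (Y x) k j)" by (intro sum mult matP_ent assms)
    qed (use N in \<open>auto simp: ent_times\<close>)
  qed
qed

lemma matP_cong: "(\<And>x. x \<in> S \<Longrightarrow> X x = Y x) \<Longrightarrow> matP X \<Longrightarrow> matP Y"
  unfolding matP_def by (metis (mono_tags, lifting) cong)

lemma matP_of_mat:
  assumes "\<And>x. x \<in> S \<Longrightarrow> Y x \<in> carrier_mat m n" "\<And>i j. i < m \<Longrightarrow> j < n \<Longrightarrow> P (\<lambda>x. Y x $$ (i, j))"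
  shows "matP (\<lambda>x. of_mat (Y x))"
proof (rule matP_I)
  show "P (\<lambda>x. ent (of_mat (Y x)) i j)" for i j
  proof (rule cong)
    show "P (\<lambda>x. if i < m \<and> j < n then Y x $$ (i, j) else 0)"
      by (cases "i < m \<and> j < n") (auto intro: const assms(2))
    show "(if i < m \<and> j < n then Y x $$ (i, j) else 0) = ent (of_mat (Y x)) i j" if "x \<in> S" for x
      using assms(1)[OF that] by (auto simp: ent_of_mat)
  qed
qed (use assms(1) M_of_mat in blast)

lemma matP_mat_inv:
  assumes Y: "\<And>x. x \<in> S \<Longrightarrow> Y x \<in> carrier_mat m m" and P: "\<And>i j. i < m \<Longrightarrow> j < m \<Longrightarrow> P (\<lambda>x. Y x $$ (i, j))"
    and d: "P (\<lambda>x. inverse (det (Y x)))"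
  shows "matP (\<lambda>x. of_mat (mat_inv (Y x)))"
proof (rule matP_of_mat)
  show "mat_inv (Y x) \<in> carrier_mat m m" if "x \<in> S" for x by (rule mat_inv_carrier[OF Y[OF that]])
  fix i j assume ij: "i < m" "j < m"
  have dl: "P (\<lambda>x. det (mat_delete (Y x) j i))"
  proof (rule det)
    show "mat_delete (Y x) j i \<in> carrier_mat (m - 1) (m - 1)" if "x \<in> S" for x using Y[OF that] by (simp add: mat_delete_def)
    fix k l assume kl: "k < m - 1" "l < m - 1"
    show "P (\<lambda>x. mat_delete (Y x) j i $$ (k, l))"
    proof (rule cong)
      show "P (\<lambda>x. Y x $$ (if k < j then k else Suc k, if l < i then l else Suc l))" by (rule P) (use kl in auto)
      show "Y x $$ (if k < j then k else Suc k, if l < i then l else Suc l) = mat_delete (Y x) j i $$ (k, l)" if "x \<in> S" for x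
        using Y[OF that] kl by (simp add: mat_delete_def)
    qed
  qed
  show "P (\<lambda>x. mat_inv (Y x) $$ (i, j))"
  proof (rule cong)
    show "P (\<lambda>x. inverse (det (Y x)) * ((- 1) ^ (j + i) * det (mat_delete (Y x) j i)))" by (intro mult d const dl)
    show "inverse (det (Y x)) * ((- 1) ^ (j + i) * det (mat_delete (Y x) j i)) = mat_inv (Y x) $$ (i, j)" if "x \<in> S" for x
      using Y[OF that] ij by (simp add: mat_inv_def adj_mat_def cofactor_def)
  qed
qed

lemma matP_blk:
  assumes "matP A0" "matP A1" "matP B" "matP W" "matP V"
  shows "matP (\<lambda>x. blk a b (A0 x, A1 x, B x, W x, V x))"
  unfolding blk_def prod.case by (intro matP_add matP_times matP_const assms)

lemma det_to_mat: "matP Y \<Longrightarrow> P (\<lambda>x. det (to_mat m m (Y x)))"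
  by (rule det) (auto intro: matP_ent)

end

definition reg :: "'g set \<Rightarrow> ('g \<Rightarrow> 'k::field) set \<Rightarrow> ('g \<Rightarrow> 'k) \<Rightarrow> bool" where
  "reg S F f \<longleftrightarrow> zero_outside S f \<in> generated_algebra S F"

lemma zero_outside_arith:
  "zero_outside S (\<lambda>x. f x + g x) = zero_outside S f + zero_outside S (g :: _ \<Rightarrow> 'k::field)"
  "zero_outside S (\<lambda>x. f x * g x) = zero_outside S f * zero_outside S g"
  "zero_outside S (\<lambda>x. c * f x) = (\<lambda>x. c * zero_outside S f x)"
  by (auto simp: zero_outside_def fun_eq_iff)

lemma zero_outside_cong: "(\<And>x. x \<in> S \<Longrightarrow> f x = g x) \<Longrightarrow> zero_outside S f = zero_outside S g"
  by (auto simp: zero_outside_def)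

lemma zero_outside_in [simp]: "x \<in> S \<Longrightarrow> zero_outside S f x = f x"
  by (simp add: zero_outside_def)

lemma zero_outside_idem [simp]: "zero_outside S (zero_outside S f) = zero_outside S f"
  by (auto simp: zero_outside_def)

interpretation reg: function_algebra S "reg S F" for S F
proof
  show "reg S F (\<lambda>x. c)" for c by (simp add: reg_def generated_algebra.const)
  show "reg S F (\<lambda>x. f x + g x)" "reg S F (\<lambda>x. f x * g x)" if "reg S F f" "reg S F g" for f g
    using that by (simp_all add: reg_def zero_outside_arith generated_algebra.add generated_algebra.mult)
  show "reg S F g" if "\<And>x. x \<in> S \<Longrightarrow> f x = g x" "reg S F f" for f g
    using that zero_outside_cong[of S f g] by (simp add: reg_def)
qed

lemma reg_gen: "f \<in> F \<Longrightarrow> reg S F f"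
  by (simp add: reg_def generated_algebra.gen)

lemma generated_algebra_outside: "f \<in> generated_algebra S F \<Longrightarrow> zero_outside S f = f"
proof (induction rule: generated_algebra.induct)
  case (add f g) then show ?case using zero_outside_arith(1)[of S f g] by (simp add: plus_fun_def)
next
  case (mult f g) then show ?case using zero_outside_arith(2)[of S f g] by (simp add: times_fun_def)
qed auto

lemma generated_algebra_mono:
  assumes "\<And>f. f \<in> F \<Longrightarrow> reg S F' f"
  shows "generated_algebra S F \<subseteq> generated_algebra S F'"
proof
  fix f assume "f \<in> generated_algebra S F"
  then show "f \<in> generated_algebra S F'"
  proof induction
    case (add f g) show ?case by (rule generated_algebra.add[OF add.IH])
  next
    case (mult f g) show ?case by (rule generated_algebra.mult[OF mult.IH])
  qed (use assms in \<open>auto simp: reg_def intro: generated_algebra.const\<close>)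
qed

section \<open>Rational curves and their derivatives at 0\<close>

definition ev0 :: "('k::field \<Rightarrow> bool) \<Rightarrow> bool" where
  "ev0 Q \<longleftrightarrow> (\<exists>q. poly q 0 = 1 \<and> (\<forall>t. poly q t \<noteq> 0 \<longrightarrow> Q t))"

text \<open>The function \<open>\<phi>\<close> is a rational function, regular at \<open>0\<close> with derivative \<open>d\<close> there, away from a finite set.\<close>

definition has_der :: "('k::field_char_0 \<Rightarrow> 'k) \<Rightarrow> 'k \<Rightarrow> bool" where
  "has_der \<phi> d \<longleftrightarrow> (\<exists>p q. poly q 0 = 1 \<and> poly (pderiv p) 0 = d + poly p 0 * poly (pderiv q) 0 \<and>
     (\<forall>t. poly q t \<noteq> 0 \<longrightarrow> \<phi> t * poly q t = poly p t))"

text \<open>\<open>ev0\<close> expresses validity on a Zariski neighbourhood of 0; neighbourhoods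
  intersect by multiplying the polynomials that define them.\<close>

lemma ev0_conj: "ev0 Q \<Longrightarrow> ev0 R \<Longrightarrow> ev0 (\<lambda>t. Q t \<and> R t)"
  unfolding ev0_def
proof (elim exE conjE)
  fix q r :: "'a poly" assume "poly q 0 = 1" "poly r 0 = 1" "\<forall>t. poly q t \<noteq> 0 \<longrightarrow> Q t" "\<forall>t. poly r t \<noteq> 0 \<longrightarrow> R t"
  then show "\<exists>q. poly q 0 = 1 \<and> (\<forall>t. poly q t \<noteq> 0 \<longrightarrow> Q t \<and> R t)" by (intro exI[of _ "q * r"]) auto
qed

lemma ev0_mono: "ev0 Q \<Longrightarrow> (\<And>t. Q t \<Longrightarrow> R t) \<Longrightarrow> ev0 R"
  unfolding ev0_def by blast

lemma ev0_at: "ev0 Q \<Longrightarrow> Q 0" unfolding ev0_def by (metis zero_neq_one)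

lemma has_der_const: "has_der (\<lambda>t. c) 0"
  unfolding has_der_def by (rule exI[of _ "[:c:]"], rule exI[of _ 1]) auto

lemma has_der_id: "has_der (\<lambda>t. t) 1"
  unfolding has_der_def by (rule exI[of _ "[:0, 1:]"], rule exI[of _ 1]) (auto simp: pderiv_pCons)

lemma has_der_arith:
  assumes "has_der \<phi> d" "has_der \<psi> e"
  shows "has_der (\<lambda>t. \<phi> t + \<psi> t) (d + e)" "has_der (\<lambda>t. \<phi> t * \<psi> t) (\<phi> 0 * e + d * \<psi> 0)"
proof -
  obtain p q where 1: "poly q 0 = 1" "poly (pderiv p) 0 = d + poly p 0 * poly (pderiv q) 0"
     "\<And>t. poly q t \<noteq> 0 \<Longrightarrow> \<phi> t * poly q t = poly p t" using assms(1) unfolding has_der_def by blast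
  obtain r s where 2: "poly s 0 = 1" "poly (pderiv r) 0 = e + poly r 0 * poly (pderiv s) 0"
     "\<And>t. poly s t \<noteq> 0 \<Longrightarrow> \<psi> t * poly s t = poly r t" using assms(2) unfolding has_der_def by blast
  have 0: "\<phi> 0 = poly p 0" "\<psi> 0 = poly r 0" using 1(1) 1(3)[of 0] 2(1) 2(3)[of 0] by auto
  have v: "\<phi> t * poly (q * s) t = poly p t * poly s t" "\<psi> t * poly (q * s) t = poly r t * poly q t"
    "\<phi> t * \<psi> t * poly (q * s) t = poly p t * poly r t" if "poly (q * s) t \<noteq> 0" for t
  proof -
    have "poly q t \<noteq> 0" "poly s t \<noteq> 0" using that by auto
    from 1(3)[OF this(1)] 2(3)[OF this(2)] have "poly p t = \<phi> t * poly q t" "poly r t = \<psi> t * poly s t" by auto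
    then show "\<phi> t * poly (q * s) t = poly p t * poly s t" "\<psi> t * poly (q * s) t = poly r t * poly q t"
      "\<phi> t * \<psi> t * poly (q * s) t = poly p t * poly r t" by (simp_all only: poly_mult mult_ac)
  qed
  show "has_der (\<lambda>t. \<phi> t + \<psi> t) (d + e)" unfolding has_der_def
  proof (rule exI[of _ "p * s + r * q"], rule exI[of _ "q * s"], intro conjI allI impI)
    show "(\<phi> t + \<psi> t) * poly (q * s) t = poly (p * s + r * q) t" if "poly (q * s) t \<noteq> 0" for t
      using v(1,2)[OF that] by (simp only: distrib_right poly_add poly_mult)
  qed (simp_all add: pderiv_mult pderiv_add 1(1,2) 2(1,2) algebra_simps)
  show "has_der (\<lambda>t. \<phi> t * \<psi> t) (\<phi> 0 * e + d * \<psi> 0)" unfolding has_der_def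
  proof (rule exI[of _ "p * r"], rule exI[of _ "q * s"], intro conjI allI impI)
    show "\<phi> t * \<psi> t * poly (q * s) t = poly (p * r) t" if "poly (q * s) t \<noteq> 0" for t
      using v(3)[OF that] by (simp only: poly_mult)
  qed (simp_all add: pderiv_mult 0 1(1,2) 2(1,2) algebra_simps)
qed

lemma has_der_cong:
  assumes "has_der \<phi> d" "ev0 (\<lambda>t. \<phi> t = \<psi> t)" shows "has_der \<psi> d"
proof -
  obtain p q where 1: "poly q 0 = 1" "poly (pderiv p) 0 = d + poly p 0 * poly (pderiv q) 0"
     "\<And>t. poly q t \<noteq> 0 \<Longrightarrow> \<phi> t * poly q t = poly p t" using assms(1) unfolding has_der_def by blast
  obtain r where r: "poly r 0 = 1" "\<And>t. poly r t \<noteq> 0 \<Longrightarrow> \<phi> t = \<psi> t" using assms(2) unfolding ev0_def by blast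
  show ?thesis unfolding has_der_def
  proof (rule exI[of _ "p * r"], rule exI[of _ "q * r"], intro conjI allI impI)
    show "\<psi> t * poly (q * r) t = poly (p * r) t" if "poly (q * r) t \<noteq> 0" for t
      using 1(3)[of t] r(2)[of t] that by (simp add: mult.assoc[symmetric])
  qed (simp_all add: pderiv_mult 1(1,2) r(1) algebra_simps)
qed

lemma has_der_inverse:
  assumes "has_der \<phi> d" "\<phi> 0 = 1"
  shows "has_der (\<lambda>t. inverse (\<phi> t)) (- d)" "ev0 (\<lambda>t. \<phi> t \<noteq> 0)"
proof -
  obtain p q where 1: "poly q 0 = 1" "poly (pderiv p) 0 = d + poly p 0 * poly (pderiv q) 0"
     "\<And>t. poly q t \<noteq> 0 \<Longrightarrow> \<phi> t * poly q t = poly p t" using assms(1) unfolding has_der_def by blast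
  have p0: "poly p 0 = 1" using 1(1) 1(3)[of 0] assms(2) by simp
  have nz: "\<phi> t \<noteq> 0" if "poly q t \<noteq> 0" "poly p t \<noteq> 0" for t using 1(3)[OF that(1)] that(2) by auto
  show "has_der (\<lambda>t. inverse (\<phi> t)) (- d)" unfolding has_der_def
  proof (rule exI[of _ "q * q"], rule exI[of _ "p * q"], intro conjI allI impI)
    fix t assume "poly (p * q) t \<noteq> 0"
    then have q: "poly q t \<noteq> 0" and "poly p t \<noteq> 0" by auto
    with nz have "\<phi> t \<noteq> 0" by blast
    then show "inverse (\<phi> t) * poly (p * q) t = poly (q * q) t"
      unfolding poly_mult 1(3)[OF q, symmetric] by simp
  qed (simp_all add: pderiv_mult 1(1,2) p0)
  show "ev0 (\<lambda>t. \<phi> t \<noteq> 0)" unfolding ev0_def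
    by (rule exI[of _ "p * q"]) (use nz p0 1(1) in auto)
qed

text \<open>Two fraction representations agree where the denominators do not vanish. Multiplied by
  the denominators, their difference is zero everywhere, hence the zero polynomial, and
  differentiating at 0 compares the two derivatives.\<close>

lemma has_der_unique:
  assumes "has_der \<phi> d" "has_der \<phi> e" shows "d = e"
proof -
  obtain p q where 1: "poly q 0 = 1" "poly (pderiv p) 0 = d + poly p 0 * poly (pderiv q) 0"
     "\<And>t. poly q t \<noteq> 0 \<Longrightarrow> \<phi> t * poly q t = poly p t" using assms(1) unfolding has_der_def by blast
  obtain r s where 2: "poly s 0 = 1" "poly (pderiv r) 0 = e + poly r 0 * poly (pderiv s) 0"
     "\<And>t. poly s t \<noteq> 0 \<Longrightarrow> \<phi> t * poly s t = poly r t" using assms(2) unfolding has_der_def by blast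
  have "poly ((p * s - r * q) * (q * s)) t = 0" for t
  proof (cases "poly q t = 0 \<or> poly s t = 0")
    case False
    then have "poly p t = \<phi> t * poly q t" "poly r t = \<phi> t * poly s t" using 1(3)[of t] 2(3)[of t] by auto
    then have "poly p t * poly s t = poly r t * poly q t" by (simp only: mult_ac)
    then show ?thesis by simp
  qed auto
  then have "\<forall>t. poly ((p * s - r * q) * (q * s)) t = 0" by (rule allI)
  then have "(p * s - r * q) * (q * s) = 0" by (rule iffD1[OF poly_all_0_iff_0])
  moreover have "q \<noteq> 0" "s \<noteq> 0" using 1(1) 2(1) by auto
  ultimately have e: "p * s = r * q" by simp
  have e0: "poly p 0 = poly r 0" using arg_cong[OF e, of "\<lambda>p. poly p 0"] by (simp add: 1(1) 2(1))
  have "poly (pderiv (p * s)) 0 = poly (pderiv (r * q)) 0" unfolding e ..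
  then show ?thesis by (simp add: pderiv_mult 1(1,2) 2(1,2) e0)
qed

definition differentiable0 :: "('k::field_char_0 \<Rightarrow> 'k) \<Rightarrow> bool" where
  "differentiable0 \<phi> \<longleftrightarrow> (\<exists>d. has_der \<phi> d)"

interpretation d0: function_algebra UNIV differentiable0
proof
  show "differentiable0 g" if "\<And>x. x \<in> UNIV \<Longrightarrow> f x = g x" "differentiable0 f" for f g
  proof -
    have "f = g" using that(1) by auto
    then show ?thesis using that(2) by simp
  qed
qed (auto simp: differentiable0_def intro: has_der_const has_der_arith)

text \<open>By Cramer's rule the inverse has polynomial entries divided by a determinant that equals
  1 at 0. Near 0 it coincides with Z.\<close>

lemma differentiable0_inverse_matrix:
  assumes Y: "d0.matP Y" "\<And>t. Y t \<in> M n n" "Y 0 = idm n" and Z: "ev0 (\<lambda>t. Z t \<in> M n n \<and> Z t * Y t = idm n)"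
  shows "differentiable0 (\<lambda>t. ent (Z t) i j)"
proof -
  let ?D = "\<lambda>t. det (to_mat n n (Y t))"
  have D0: "?D 0 = 1"
  proof -
    have "to_mat n n (Y 0) = 1\<^sub>m n" unfolding Y(3) of_mat_one[symmetric] by (rule to_mat_of_mat) simp
    then show ?thesis by simp
  qed
  obtain d where d: "has_der ?D d" using d0.det_to_mat[OF Y(1), of n] unfolding differentiable0_def by blast
  have "d0.matP (\<lambda>t. of_mat (mat_inv (to_mat n n (Y t))))"
    by (rule d0.matP_mat_inv[where m = n])
       (use has_der_inverse(1)[OF d D0] in \<open>auto simp: differentiable0_def intro: d0.matP_ent[OF Y(1), unfolded differentiable0_def]\<close>)
  from d0.matP_ent[OF this] obtain e where e: "has_der (\<lambda>t. ent (of_mat (mat_inv (to_mat n n (Y t)))) i j) e"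
    unfolding differentiable0_def by blast
  have "of_mat (mat_inv (to_mat n n (Y t))) = Z t" if "?D t \<noteq> 0" "Z t \<in> M n n" "Z t * Y t = idm n" for t
  proof (rule fm_inv_unique[symmetric])
    show "of_mat (mat_inv (to_mat n n (Y t))) \<in> M n n" by (intro M_of_mat mat_inv_carrier) simp
    show "Y t * of_mat (mat_inv (to_mat n n (Y t))) = idm n"
      using mat_inv(1)[OF _ that(1)] of_mat_to_mat[OF Y(2)] by simp
  qed (use that in auto)
  then have "ev0 (\<lambda>t. ent (of_mat (mat_inv (to_mat n n (Y t)))) i j = ent (Z t) i j)"
    using ev0_conj[OF has_der_inverse(2)[OF d D0] Z] by (elim ev0_mono) auto
  from has_der_cong[OF e this] show ?thesis unfolding differentiable0_def by blast
qed

text \<open>The projection \<open>pj\<close> is a fixed linear combination of entries, so it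
  commutes with \<Lambda> applied entrywise. It fixes every value of F, hence fixes X. This places
  tangent matrices in the algebra.\<close>

lemma linear_functional_in_subspace:
  fixes F :: "'g \<Rightarrow> 'k::field fm" and \<Lambda> :: "('g \<Rightarrow> 'k) \<Rightarrow> 'k"
  assumes pj: "\<And>x y. pj (x + y) = pj x + pj y" "\<And>c x. pj (sm c x) = sm c (pj x)" "\<And>y. pj y \<in> E" "\<And>x. x \<in> E \<Longrightarrow> pj x = x"
    and C: "\<And>f g. f \<in> C \<Longrightarrow> g \<in> C \<Longrightarrow> (\<lambda>y. f y + g y) \<in> C" "\<And>c f. f \<in> C \<Longrightarrow> (\<lambda>y. c * f y) \<in> C"
    and \<Lambda>: "\<And>f g. f \<in> C \<Longrightarrow> g \<in> C \<Longrightarrow> \<Lambda> (\<lambda>y. f y + g y) = \<Lambda> f + \<Lambda> g" "\<And>c f. f \<in> C \<Longrightarrow> \<Lambda> (\<lambda>y. c * f y) = c * \<Lambda> f"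
    and F: "\<And>y. F y \<in> E" "\<And>y. F y \<in> M n n" "\<And>i j. (\<lambda>y. ent (F y) i j) \<in> C"
    and X: "X \<in> M n n" "\<And>i j. ent X i j = \<Lambda> (\<lambda>y. ent (F y) i j)"
  shows "X \<in> E"
proof -
  let ?I = "{..<n} \<times> {..<n}"
  have pjs: "pj (\<Sum>a\<in>A. f a) = (\<Sum>a\<in>A. pj (f a))" if "finite A" for A :: "(nat \<times> nat) set" and f
    using that
  proof induction
    case empty show ?case using pj(2)[of 0 0] by simp
  qed (simp add: pj(1))
  have pje: "ent (pj Y) i j = (\<Sum>a\<in>?I. ent (pj (el (fst a) (snd a))) i j * ent Y (fst a) (snd a))" if "Y \<in> M n n" for Y i j
  proof -
    have "Y = (\<Sum>a\<in>?I. sm (ent Y (fst a) (snd a)) (el (fst a) (snd a)))"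
      using fm_expand[OF that] by (simp add: sum.cartesian_product case_prod_beta)
    then have "pj Y = pj (\<Sum>a\<in>?I. sm (ent Y (fst a) (snd a)) (el (fst a) (snd a)))" by simp
    also have "\<dots> = (\<Sum>a\<in>?I. sm (ent Y (fst a) (snd a)) (pj (el (fst a) (snd a))))" by (simp add: pjs pj(2))
    finally show ?thesis by (simp add: ent_sum mult.commute)
  qed
  have \<Lambda>s: "(\<lambda>y. \<Sum>a\<in>A. c a * f a y) \<in> C \<and> \<Lambda> (\<lambda>y. \<Sum>a\<in>A. c a * f a y) = (\<Sum>a\<in>A. c a * \<Lambda> (f a))"
    if "finite A" "\<And>a. f a \<in> C" for A :: "(nat \<times> nat) set" and c f
    using that(1)
  proof induction
    case empty
    show ?case using C(2)[OF that(2), of 0] \<Lambda>(2)[OF that(2), of 0] by simp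
  next
    case (insert a A)
    then show ?case using C(1)[OF C(2)[OF that(2)] conjunct1[OF insert.IH]] \<Lambda>(1)[OF C(2)[OF that(2)] conjunct1[OF insert.IH]]
      by (simp add: \<Lambda>(2)[OF that(2)])
  qed
  have "pj X = X"
  proof (rule fm_eqI)
    fix i j
    have "ent X i j = \<Lambda> (\<lambda>y. ent (pj (F y)) i j)" by (simp add: X(2) pj(4)[OF F(1)])
    also have "\<dots> = \<Lambda> (\<lambda>y. \<Sum>a\<in>?I. ent (pj (el (fst a) (snd a))) i j * ent (F y) (fst a) (snd a))"
      by (simp only: pje[OF F(2)])
    also have "\<dots> = (\<Sum>a\<in>?I. ent (pj (el (fst a) (snd a))) i j * ent X (fst a) (snd a))"
      using conjunct2[OF \<Lambda>s[of ?I "\<lambda>a y. ent (F y) (fst a) (snd a)"]] F(3) by (simp add: X(2))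
    also have "\<dots> = ent (pj X) i j" by (rule pje[OF X(1), symmetric])
    finally show "ent (pj X) i j = ent X i j" ..
  qed
  then show ?thesis using pj(3)[of X] by simp
qed

lemma point_derivations_add: "\<delta> \<in> point_derivations G \<Longrightarrow> \<epsilon> \<in> point_derivations G \<Longrightarrow> (\<lambda>f. \<delta> f + \<epsilon> f) \<in> point_derivations G"
  unfolding point_derivations_def by (simp add: algebra_simps)

lemma point_derivations_scale: "\<delta> \<in> point_derivations G \<Longrightarrow> (\<lambda>f. c * \<delta> f) \<in> point_derivations G"
  unfolding point_derivations_def by (simp add: algebra_simps)

section \<open>The Lie algebra of a linear group in matrix coordinates\<close>

locale lin_group =
  fixes G :: "('g, 'k::field_char_0) alg_group" (structure) and \<iota> \<iota>' :: "'g \<Rightarrow> 'k fm" and n :: nat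
  assumes one_closed: "\<one> \<in> carrier G"
    and m_closed: "\<And>x y. x \<in> carrier G \<Longrightarrow> y \<in> carrier G \<Longrightarrow> x \<otimes> y \<in> carrier G"
    and \<iota>_mult: "\<And>x y. x \<in> carrier G \<Longrightarrow> y \<in> carrier G \<Longrightarrow> \<iota> (x \<otimes> y) = \<iota> x * \<iota> y"
    and \<iota>_one: "\<iota> \<one> = idm n"
    and \<iota>_M: "\<And>x. x \<in> carrier G \<Longrightarrow> \<iota> x \<in> M n n"
    and \<iota>'_M: "\<And>x. x \<in> carrier G \<Longrightarrow> \<iota>' x \<in> M n n"
    and \<iota>_\<iota>': "\<And>x. x \<in> carrier G \<Longrightarrow> \<iota> x * \<iota>' x = idm n"
    and \<iota>'_\<iota>: "\<And>x. x \<in> carrier G \<Longrightarrow> \<iota>' x * \<iota> x = idm n"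
    and \<iota>_inj: "inj_on \<iota> (carrier G)"
    and \<iota>_inv_ex: "\<And>x. x \<in> carrier G \<Longrightarrow> \<exists>y \<in> carrier G. \<iota> y = \<iota>' x"
    and coord: "coord_ring G = generated_algebra (carrier G)
      ({\<lambda>x. ent (\<iota> x) i j | i j. True} \<union> {\<lambda>x. ent (\<iota>' x) i j | i j. True})"
begin

abbreviation "S \<equiv> carrier G"
abbreviation "K \<equiv> coord_ring G"
abbreviation zo :: "('g \<Rightarrow> 'k) \<Rightarrow> 'g \<Rightarrow> 'k" where "zo \<equiv> zero_outside (carrier G)"
abbreviation "Der \<equiv> point_derivations G"

lemma group_G: "group G"
proof (rule groupI)
  show "x \<otimes> y \<otimes> z = x \<otimes> (y \<otimes> z)" if "x \<in> S" "y \<in> S" "z \<in> S" for x y z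
    by (rule inj_onD[OF \<iota>_inj]) (use that in \<open>simp_all add: \<iota>_mult m_closed mult.assoc\<close>)
  show "\<one> \<otimes> x = x" if "x \<in> S" for x
    by (rule inj_onD[OF \<iota>_inj]) (use that in \<open>simp_all add: \<iota>_mult m_closed one_closed \<iota>_one idm_times[OF \<iota>_M]\<close>)
  show "\<exists>y\<in>S. y \<otimes> x = \<one>" if x: "x \<in> S" for x
  proof -
    obtain y where y: "y \<in> S" "\<iota> y = \<iota>' x" using \<iota>_inv_ex[OF x] by blast
    have "y \<otimes> x = \<one>"
      by (rule inj_onD[OF \<iota>_inj]) (use x y in \<open>simp_all add: \<iota>_mult m_closed one_closed \<iota>_one \<iota>'_\<iota>\<close>)
    then show ?thesis using y by blast
  qed
qed (simp_all add: one_closed m_closed)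

sublocale group G by (rule group_G)

lemma \<iota>_inv: "x \<in> S \<Longrightarrow> \<iota> (inv x) = \<iota>' x"
  by (rule fm_inv_unique[of _ n _ "\<iota> x"]) (simp_all add: \<iota>_M \<iota>'_M \<iota>_\<iota>' \<iota>_mult[symmetric] \<iota>_one)

lemma \<iota>'_inv: "x \<in> S \<Longrightarrow> \<iota>' (inv x) = \<iota> x"
  by (metis \<iota>_inv inv_closed inv_inv)

lemma \<iota>'_mult: "x \<in> S \<Longrightarrow> y \<in> S \<Longrightarrow> \<iota>' (x \<otimes> y) = \<iota>' y * \<iota>' x"
  by (simp add: \<iota>_inv[symmetric] inv_mult_group \<iota>_mult)

lemma \<iota>'_one: "\<iota>' \<one> = idm n"
  using \<iota>_inv[OF one_closed] by (simp add: \<iota>_one)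

lemma K_reg: "(\<lambda>f. zo f \<in> K) = reg S ({\<lambda>x. ent (\<iota> x) i j | i j. True} \<union> {\<lambda>x. ent (\<iota>' x) i j | i j. True})"
  by (simp add: fun_eq_iff reg_def coord)

sublocale K: function_algebra S "\<lambda>f. zo f \<in> K"
  unfolding K_reg by (rule reg.function_algebra_axioms)

lemma zo_K: "f \<in> K \<Longrightarrow> zo f = f"
  by (simp add: coord generated_algebra_outside)

lemma K_ops:
  assumes "f \<in> K" "g \<in> K"
  shows "f + g = zo (\<lambda>x. f x + g x)" "(\<lambda>x. f x + g x) = zo (\<lambda>x. f x + g x)"
    "f * g = zo (\<lambda>x. f x * g x)" "(\<lambda>x. f x * g x) = zo (\<lambda>x. f x * g x)" "(\<lambda>x. c * f x) = zo (\<lambda>x. c * f x)"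
proof -
  show "f + g = zo (\<lambda>x. f x + g x)" "(\<lambda>x. f x + g x) = zo (\<lambda>x. f x + g x)"
    unfolding zero_outside_arith(1) zo_K[OF assms(1)] zo_K[OF assms(2)] by (simp_all only: plus_fun_def)
  show "f * g = zo (\<lambda>x. f x * g x)" "(\<lambda>x. f x * g x) = zo (\<lambda>x. f x * g x)"
    unfolding zero_outside_arith(2) zo_K[OF assms(1)] zo_K[OF assms(2)] by (simp_all only: times_fun_def)
  show "(\<lambda>x. c * f x) = zo (\<lambda>x. c * f x)" unfolding zero_outside_arith(3) zo_K[OF assms(1)] ..
qed

lemma K_closed:
  assumes "f \<in> K" "g \<in> K"
  shows "zo (\<lambda>x. f x + g x) \<in> K" "zo (\<lambda>x. f x * g x) \<in> K" "zo (\<lambda>x. c * f x) \<in> K"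
    "f + g \<in> K" "(\<lambda>x. f x + g x) \<in> K" "f * g \<in> K" "(\<lambda>x. f x * g x) \<in> K" "(\<lambda>x. c * f x) \<in> K"
proof -
  have fg: "zo f \<in> K" "zo g \<in> K" using assms by (simp_all only: zo_K)
  show 1: "zo (\<lambda>x. f x + g x) \<in> K" by (rule K.add[OF fg])
  show 2: "zo (\<lambda>x. f x * g x) \<in> K" by (rule K.mult[OF fg])
  show 3: "zo (\<lambda>x. c * f x) \<in> K" by (rule K.mult[OF K.const fg(1)])
  show "f + g \<in> K" "(\<lambda>x. f x + g x) \<in> K" "f * g \<in> K" "(\<lambda>x. f x * g x) \<in> K" "(\<lambda>x. c * f x) \<in> K"
    by (subst K_ops(1)[OF assms], rule 1, subst K_ops(2)[OF assms], rule 1, subst K_ops(3)[OF assms], rule 2,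
        subst K_ops(4)[OF assms], rule 2, subst K_ops(5)[OF assms], rule 3)
qed

lemma matP_\<iota>: "K.matP \<iota>" "K.matP \<iota>'"
  by (rule K.matP_I[OF \<iota>_M], assumption, subst coord, rule generated_algebra.gen, blast,
      rule K.matP_I[OF \<iota>'_M], assumption, subst coord, rule generated_algebra.gen, blast)

lemma K_induct [consumes 1, case_names const gen gen' add mult]:
  assumes "f \<in> K" "\<And>c. P (zo (\<lambda>x. c))" "\<And>i j. P (zo (\<lambda>x. ent (\<iota> x) i j))" "\<And>i j. P (zo (\<lambda>x. ent (\<iota>' x) i j))"
    "\<And>f g. f \<in> K \<Longrightarrow> g \<in> K \<Longrightarrow> P f \<Longrightarrow> P g \<Longrightarrow> P (zo (\<lambda>x. f x + g x))"
    "\<And>f g. f \<in> K \<Longrightarrow> g \<in> K \<Longrightarrow> P f \<Longrightarrow> P g \<Longrightarrow> P (zo (\<lambda>x. f x * g x))"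
  shows "P f"
proof -
  have "f \<in> K \<and> P f" using assms(1)[unfolded coord]
  proof induction
    case (const c) show ?case using assms(2) K.const by blast
  next
    case (gen f)
    then show ?case using assms(3,4) K.matP_ent[OF matP_\<iota>(1)] K.matP_ent[OF matP_\<iota>(2)] by auto
  next
    case (add f g)
    then have "f \<in> K" "g \<in> K" "P f" "P g" by blast+
    then show ?case using assms(5)[of f g] K_closed(1)[of f g] unfolding K_ops(1)[OF \<open>f \<in> K\<close> \<open>g \<in> K\<close>] by blast
  next
    case (mult f g)
    then have "f \<in> K" "g \<in> K" "P f" "P g" by blast+
    then show ?case using assms(6)[of f g] K_closed(2)[of f g] unfolding K_ops(3)[OF \<open>f \<in> K\<close> \<open>g \<in> K\<close>] by blast
  qed
  then show ?thesis ..
qed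

lemma K_subst:
  assumes T: "\<And>x. x \<in> S \<Longrightarrow> T x \<in> S" "K.matP (\<lambda>x. \<iota> (T x))" "K.matP (\<lambda>x. \<iota>' (T x))" and f: "f \<in> K"
  shows "zo (\<lambda>x. f (T x)) \<in> K"
  using f
proof (induction rule: K_induct)
  case (const c)
  show ?case by (rule K.cong[OF _ K.const[of c]]) (simp add: T)
next
  case (gen i j)
  show ?case by (rule K.cong[OF _ K.matP_ent[OF T(2), of i j]]) (simp add: T)
next
  case (gen' i j)
  show ?case by (rule K.cong[OF _ K.matP_ent[OF T(3), of i j]]) (simp add: T)
next
  case (add f g)
  show ?case by (rule K.cong[OF _ K.add[OF add.IH]]) (simp add: T)
next
  case (mult f g)
  show ?case by (rule K.cong[OF _ K.mult[OF mult.IH]]) (simp add: T)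
qed

lemma K_translate:
  assumes "x \<in> S" "z \<in> S" "f \<in> K" shows "zo (\<lambda>y. f (x \<otimes> y \<otimes> z)) \<in> K"
proof (rule K_subst[OF _ _ _ assms(3)])
  show "K.matP (\<lambda>y. \<iota> (x \<otimes> y \<otimes> z))"
    by (rule K.matP_cong[OF _ K.matP_times[OF K.matP_times[OF K.matP_const[of "\<iota> x"] matP_\<iota>(1)] K.matP_const[of "\<iota> z"]]])
       (simp add: assms \<iota>_mult)
  show "K.matP (\<lambda>y. \<iota>' (x \<otimes> y \<otimes> z))"
    by (rule K.matP_cong[OF _ K.matP_times[OF K.matP_const[of "\<iota>' z"] K.matP_times[OF matP_\<iota>(2) K.matP_const[of "\<iota>' x"]]]])
       (simp add: assms \<iota>'_mult)
qed (simp add: assms)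

lemma K_left: assumes "x \<in> S" "f \<in> K" shows "zo (\<lambda>y. f (x \<otimes> y)) \<in> K"
  by (rule K.cong[OF _ K_translate[OF assms(1) one_closed assms(2)], unfolded zero_outside_idem]) (simp add: assms)

lemma der_add: "\<delta> \<in> Der \<Longrightarrow> zo f \<in> K \<Longrightarrow> zo g \<in> K \<Longrightarrow> \<delta> (zo (\<lambda>x. f x + g x)) = \<delta> (zo f) + \<delta> (zo g)"
  by (simp add: zero_outside_arith point_derivations_def)

lemma der_scale: "\<delta> \<in> Der \<Longrightarrow> zo f \<in> K \<Longrightarrow> \<delta> (zo (\<lambda>x. c * f x)) = c * \<delta> (zo f)"
  by (simp add: zero_outside_arith(3) point_derivations_def)

lemma der_mult: "\<delta> \<in> Der \<Longrightarrow> zo f \<in> K \<Longrightarrow> zo g \<in> K \<Longrightarrow> \<delta> (zo (\<lambda>x. f x * g x)) = f \<one> * \<delta> (zo g) + \<delta> (zo f) * g \<one>"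
  by (simp add: zero_outside_arith(2) point_derivations_def)

lemma der_const: assumes "\<delta> \<in> Der" shows "\<delta> (zo (\<lambda>x. c)) = 0"
proof -
  have "\<delta> (zo (\<lambda>x. 1)) = 0" using der_mult[OF assms K.const K.const, of 1 1] by simp
  then show ?thesis using der_scale[OF assms K.const, of c 1] by simp
qed

lemma der_sum:
  assumes "\<delta> \<in> Der" "\<And>i. i \<in> A \<Longrightarrow> zo (f i) \<in> K"
  shows "\<delta> (zo (\<lambda>x. \<Sum>i\<in>A. f i x)) = (\<Sum>i\<in>A. \<delta> (zo (f i)))"
  using assms(2)
proof (induction A rule: infinite_finite_induct)
  case (insert a A)
  then show ?case using der_add[OF assms(1), of "f a" "\<lambda>x. \<Sum>i\<in>A. f i x"] by (simp add: K.sum)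
qed (simp_all add: der_const[OF assms(1)])

lemma der_conjugate:
  assumes \<delta>: "\<delta> \<in> Der" and X: "K.matP X" "\<And>y. y \<in> S \<Longrightarrow> X y \<in> M n n"
    and D: "D \<in> M n n" "\<And>i j. \<delta> (zo (\<lambda>y. ent (X y) i j)) = ent D i j"
  shows "\<delta> (zo (\<lambda>y. ent (P * X y * Q) i j)) = ent (P * D * Q) i j"
proof -
  obtain N where N: "P \<in> M N N" using ex_M by blast
  have e: "ent (P * Y * Q) i j = (\<Sum>k<N. \<Sum>l<n. (ent P i k * ent Q l j) * ent Y k l)" if "Y \<in> M n n" for Y
    using that by (simp add: mult.assoc ent_times[OF N] ent_times[OF that] sum_distrib_left mult_ac)
  have k: "zo (\<lambda>y. (ent P i k * ent Q l j) * ent (X y) k l) \<in> K" for k l by (intro K.mult K.const K.matP_ent X)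
  have "\<delta> (zo (\<lambda>y. ent (P * X y * Q) i j)) = \<delta> (zo (\<lambda>y. \<Sum>k<N. \<Sum>l<n. (ent P i k * ent Q l j) * ent (X y) k l))"
    by (rule arg_cong[of _ _ \<delta>], rule zero_outside_cong, rule e, rule X)
  also have "\<dots> = (\<Sum>k<N. \<Sum>l<n. (ent P i k * ent Q l j) * ent D k l)"
    by (simp only: der_sum[OF \<delta>] K.sum k der_scale[OF \<delta> K.matP_ent[OF X(1)]] D(2))
  finally show ?thesis by (simp add: e[OF D(1)])
qed

text \<open>The velocity of the representation \<iota> along \<delta>: the matrix that corresponds
  to a tangent vector at the identity.\<close>

definition Dm :: "(('g \<Rightarrow> 'k) \<Rightarrow> 'k) \<Rightarrow> 'k fm" where
  "Dm \<delta> = Fm (\<lambda>i j. \<delta> (zo (\<lambda>x. ent (\<iota> x) i j)))"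

lemma der_outside:
  assumes "\<delta> \<in> Der" "\<And>y. y \<in> S \<Longrightarrow> X y \<in> M n n" "\<delta> (zo (\<lambda>x. ent (X x) i j)) \<noteq> 0" shows "i < n \<and> j < n"
proof (rule ccontr)
  assume "\<not> (i < n \<and> j < n)"
  then have "zo (\<lambda>x. ent (X x) i j) = zo (\<lambda>x. 0)" by (intro zero_outside_cong) (metis M_D assms(2))
  then show False using assms(1,3) der_const by metis
qed

lemma Dm_M: assumes "\<delta> \<in> Der" shows "Dm \<delta> \<in> M n n"
  unfolding Dm_def by (rule Fm_M, erule der_outside[OF assms \<iota>_M, rotated])

lemma ent_Dm: assumes "\<delta> \<in> Der" shows "ent (Dm \<delta>) i j = \<delta> (zo (\<lambda>x. ent (\<iota> x) i j))"
  unfolding Dm_def by (subst ent_Fm[of _ n n]) (erule der_outside[OF assms \<iota>_M, rotated], simp_all)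

text \<open>The Leibniz rule applied to the entries of
  \<open>\<iota> x * \<iota>' x = idm n\<close>.\<close>

lemma der_\<iota>': assumes \<delta>: "\<delta> \<in> Der" shows "\<delta> (zo (\<lambda>x. ent (\<iota>' x) i j)) = ent (- Dm \<delta>) i j"
proof -
  define D' where "D' = Fm (\<lambda>i j. \<delta> (zo (\<lambda>x. ent (\<iota>' x) i j)))"
  have M': "D' \<in> M n n" unfolding D'_def by (rule Fm_M, erule der_outside[OF \<delta> \<iota>'_M, rotated])
  have e': "ent D' i j = \<delta> (zo (\<lambda>x. ent (\<iota>' x) i j))" for i j
    unfolding D'_def by (subst ent_Fm[of _ n n]) (erule der_outside[OF \<delta> \<iota>'_M, rotated], simp_all)
  have "D' + Dm \<delta> = 0"
  proof (rule fm_eqI)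
    fix i j
    have "zo (\<lambda>x. \<Sum>k<n. ent (\<iota> x) i k * ent (\<iota>' x) k j) = zo (\<lambda>x. ent (idm n) i j)"
      by (rule zero_outside_cong) (simp add: \<iota>_\<iota>'[symmetric] ent_times[OF \<iota>_M])
    then have "0 = \<delta> (zo (\<lambda>x. \<Sum>k<n. ent (\<iota> x) i k * ent (\<iota>' x) k j))" by (simp only: der_const[OF \<delta>])
    also have "\<dots> = (\<Sum>k<n. ent (idm n) i k * ent D' k j + ent (Dm \<delta>) i k * ent (idm n) k j)"
      by (simp add: der_sum[OF \<delta>] der_mult[OF \<delta>] K.mult K.matP_ent[OF matP_\<iota>(1)] K.matP_ent[OF matP_\<iota>(2)]
          \<iota>_one \<iota>'_one e' ent_Dm[OF \<delta>])
    also have "\<dots> = ent (idm n * D' + Dm \<delta> * idm n) i j"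
      by (simp add: ent_times[OF M_idm[OF le_refl le_refl]] ent_times[OF Dm_M[OF \<delta>]] sum.distrib)
    finally show "ent (D' + Dm \<delta>) i j = ent 0 i j" using M' Dm_M[OF \<delta>] by (simp add: M_iff)
  qed
  then have "D' = - Dm \<delta>" by (rule add_eq_0_iff[THEN iffD1, of "Dm \<delta>" D', unfolded add.commute[of "Dm \<delta>"]])
  then show ?thesis using e' by simp
qed

text \<open>The coordinate ring is generated by the entries of \<iota> and \<iota>', and on the
  latter a derivation is minus its matrix.\<close>

lemma der_eqI:
  assumes "\<delta> \<in> Der" "\<epsilon> \<in> Der" "Dm \<delta> = Dm \<epsilon>" shows "\<delta> = \<epsilon>"
proof
  fix f
  show "\<delta> f = \<epsilon> f"
  proof (cases "f \<in> K")
    case True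
    then show ?thesis
    proof (induction rule: K_induct)
      case (const c) show ?case using assms(1,2) by (simp add: der_const)
    next
      case (gen i j) show ?case using assms by (simp add: ent_Dm[symmetric])
    next
      case (gen' i j) show ?case using assms by (simp add: der_\<iota>')
    next
      case (add f g) then show ?case using assms(1,2) by (simp add: der_add zo_K)
    next
      case (mult f g) then show ?case using assms(1,2) by (simp add: der_mult zo_K)
    qed
  next
    case False
    then show ?thesis using assms(1,2) by (simp add: point_derivations_def)
  qed
qed

lemma Dm_add: "\<delta> \<in> Der \<Longrightarrow> \<epsilon> \<in> Der \<Longrightarrow> Dm (\<lambda>f. \<delta> f + \<epsilon> f) = Dm \<delta> + Dm \<epsilon>"
  by (rule fm_eqI) (simp add: ent_Dm point_derivations_add)

lemma Dm_scale: "\<delta> \<in> Der \<Longrightarrow> Dm (\<lambda>f. c * \<delta> f) = sm c (Dm \<delta>)"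
  by (rule fm_eqI) (simp add: ent_Dm point_derivations_scale)

lemma right_slice_zo: "x \<in> S \<Longrightarrow> right_slice G (zo f) x = zo (\<lambda>y. f (x \<otimes> y))"
  unfolding right_slice_def by (rule zero_outside_cong) simp

lemma right_slice_K: "x \<in> S \<Longrightarrow> f \<in> K \<Longrightarrow> right_slice G f x \<in> K"
  unfolding right_slice_def by (rule K_left)

abbreviation "L \<equiv> left_invariant_field G"

text \<open>Left translation multiplies \<iota> from the left, so the left invariant field acts on
  \<iota> by right multiplication with \<open>Dm \<delta>\<close>.\<close>

lemma L_\<iota>: assumes \<delta>: "\<delta> \<in> Der"
  shows "L \<delta> (zo (\<lambda>x. ent (\<iota> x) i j)) = zo (\<lambda>x. ent (\<iota> x * Dm \<delta>) i j)"
    "L \<delta> (zo (\<lambda>x. ent (\<iota>' x) i j)) = zo (\<lambda>x. - ent (Dm \<delta> * \<iota>' x) i j)"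
proof -
  have 1: "\<delta> (zo (\<lambda>y. ent (\<iota> (x \<otimes> y)) i j)) = ent (\<iota> x * Dm \<delta>) i j" if x: "x \<in> S" for x
  proof -
    have "zo (\<lambda>y. ent (\<iota> (x \<otimes> y)) i j) = zo (\<lambda>y. ent (\<iota> x * \<iota> y * idm n) i j)"
      by (rule zero_outside_cong) (simp add: \<iota>_mult x times_idm[OF M_times[OF \<iota>_M \<iota>_M]])
    then show ?thesis
      using der_conjugate[OF \<delta> matP_\<iota>(1) \<iota>_M Dm_M[OF \<delta>] ent_Dm[OF \<delta>, symmetric], of "\<iota> x" "idm n"] x
      by (simp add: times_idm[OF M_times[OF \<iota>_M Dm_M[OF \<delta>]]])
  qed
  have 2: "\<delta> (zo (\<lambda>y. ent (\<iota>' (x \<otimes> y)) i j)) = - ent (Dm \<delta> * \<iota>' x) i j" if x: "x \<in> S" for x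
  proof -
    have "zo (\<lambda>y. ent (\<iota>' (x \<otimes> y)) i j) = zo (\<lambda>y. ent (idm n * \<iota>' y * \<iota>' x) i j)"
      by (rule zero_outside_cong) (simp add: \<iota>'_mult x idm_times[OF \<iota>'_M])
    then show ?thesis
      using der_conjugate[OF \<delta> matP_\<iota>(2) \<iota>'_M M_uminus[OF Dm_M[OF \<delta>]] der_\<iota>'[OF \<delta>], of "idm n" "\<iota>' x"] x
      by (simp add: idm_times[OF Dm_M[OF \<delta>]])
  qed
  show "L \<delta> (zo (\<lambda>x. ent (\<iota> x) i j)) = zo (\<lambda>x. ent (\<iota> x * Dm \<delta>) i j)"
    "L \<delta> (zo (\<lambda>x. ent (\<iota>' x) i j)) = zo (\<lambda>x. - ent (Dm \<delta> * \<iota>' x) i j)"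
    unfolding left_invariant_field_def by (rule zero_outside_cong, simp add: right_slice_zo 1 2)+
qed

lemma L_arith:
  assumes "\<delta> \<in> Der" "f \<in> K" "g \<in> K"
  shows "L \<delta> (zo (\<lambda>x. f x + g x)) = zo (\<lambda>x. L \<delta> f x + L \<delta> g x)"
    "L \<delta> (zo (\<lambda>x. c * f x)) = zo (\<lambda>x. c * L \<delta> f x)"
    "L \<delta> (zo (\<lambda>x. f x * g x)) = zo (\<lambda>x. f x * L \<delta> g x + L \<delta> f x * g x)"
  unfolding left_invariant_field_def
  by (rule zero_outside_cong,
      simp add: right_slice_zo der_add[OF assms(1)] der_mult[OF assms(1)] der_scale[OF assms(1)] K_left assms,
      simp add: right_slice_def)+

lemma L_const: "\<delta> \<in> Der \<Longrightarrow> L \<delta> (zo (\<lambda>x. c)) = zo (\<lambda>x. 0)"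
  unfolding left_invariant_field_def by (rule zero_outside_cong) (simp add: right_slice_zo der_const)

lemma L_K: assumes "\<delta> \<in> Der" "f \<in> K" shows "L \<delta> f \<in> K"
  using assms(2)
proof (induction rule: K_induct)
  case (const c) show ?case by (simp add: L_const assms(1) K.const)
next
  case (gen i j) show ?case unfolding L_\<iota>[OF assms(1)] by (intro K.matP_ent K.matP_times K.matP_const matP_\<iota>)
next
  case (gen' i j) show ?case unfolding L_\<iota>[OF assms(1)] by (intro K.uminus K.matP_ent K.matP_times K.matP_const matP_\<iota>)
next
  case (add f g)
  then show ?case unfolding L_arith(1)[OF assms(1) add.hyps] by (intro K.add) (simp_all add: zo_K)
next
  case (mult f g)
  then show ?case unfolding L_arith(3)[OF assms(1) mult.hyps] by (intro K.add K.mult) (simp_all add: zo_K)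
qed

lemma L_one: "f \<in> K \<Longrightarrow> L \<delta> f \<one> = \<delta> f"
proof -
  assume f: "f \<in> K"
  have "right_slice G f \<one> = zo f" unfolding right_slice_def by (rule zero_outside_cong) simp
  then show ?thesis by (simp add: left_invariant_field_def zo_K f)
qed

text \<open>Applying \<delta> to the left invariant field of \<epsilon> on \<iota> gives
  \<open>Dm \<delta> * Dm \<epsilon>\<close>. The difference of the two orders is again a derivation
  because the second-order cross terms cancel.\<close>

lemma bracket:
  assumes \<delta>: "\<delta> \<in> Der" "\<epsilon> \<in> Der"
  shows "lie_bracket (Lie G) \<delta> \<epsilon> \<in> Der" "Dm (lie_bracket (Lie G) \<delta> \<epsilon>) = Dm \<delta> * Dm \<epsilon> - Dm \<epsilon> * Dm \<delta>"
proof -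
  let ?b = "lie_bracket (Lie G) \<delta> \<epsilon>"
  have b: "?b f = \<delta> (L \<epsilon> f) - \<epsilon> (L \<delta> f)" if "f \<in> K" for f using that by (simp add: Lie_def)
  have zL: "zo (L \<eta> f) \<in> K" "zo f \<in> K" "zo (L \<eta> f) = L \<eta> f" "zo f = f" if "f \<in> K" "\<eta> \<in> Der" for \<eta> f
    using that L_K by (simp_all add: zo_K)
  show bD: "?b \<in> Der"
    unfolding point_derivations_def mem_Collect_eq
  proof (intro conjI allI ballI impI)
    show "?b f = 0" if "f \<notin> K" for f using that by (simp add: Lie_def zero_outside_def)
    fix f g assume fg: "f \<in> K" "g \<in> K"
    show "?b (f + g) = ?b f + ?b g"
    proof -
      have *: "\<eta> (L \<theta> (zo (\<lambda>x. f x + g x))) = \<eta> (L \<theta> f) + \<eta> (L \<theta> g)" if "\<eta> \<in> Der" "\<theta> \<in> Der" for \<eta> \<theta>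
        unfolding L_arith(1)[OF that(2) fg] der_add[OF that(1) zL(1)[OF fg(1) that(2)] zL(1)[OF fg(2) that(2)]]
        by (simp only: zL(3)[OF fg(1) that(2)] zL(3)[OF fg(2) that(2)])
      show ?thesis unfolding K_ops(1)[OF fg] b[OF K_closed(1)[OF fg]] b[OF fg(1)] b[OF fg(2)] by (simp add: * \<delta>)
    qed
    show "?b (f * g) = f \<one> * ?b g + ?b f * g \<one>"
    proof -
      \<comment> \<open>The middle terms are symmetric in \<eta> and \<theta> and drop out of the
        bracket.\<close>
      have *: "\<eta> (L \<theta> (zo (\<lambda>x. f x * g x))) = f \<one> * \<eta> (L \<theta> g) + \<eta> f * \<theta> g + (\<theta> f * \<eta> g + \<eta> (L \<theta> f) * g \<one>)"
        if "\<eta> \<in> Der" "\<theta> \<in> Der" for \<eta> \<theta>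
      proof -
        note z = zL(1)[OF fg(1) that(2)] zL(1)[OF fg(2) that(2)] zL(2)[OF fg(1) that(2)] zL(2)[OF fg(2) that(2)]
        show ?thesis
          unfolding L_arith(3)[OF that(2) fg] der_add[OF that(1) K.mult[OF z(3,2)] K.mult[OF z(1,4)]]
            der_mult[OF that(1) z(3,2)] der_mult[OF that(1) z(1,4)]
          by (simp only: zL(3,4)[OF fg(1) that(2)] zL(3,4)[OF fg(2) that(2)] L_one[OF fg(1)] L_one[OF fg(2)])
      qed
      show ?thesis unfolding K_ops(3)[OF fg] b[OF K_closed(2)[OF fg]] b[OF fg(1)] b[OF fg(2)] by (simp add: * \<delta> algebra_simps)
    qed
  next
    fix c f assume fg: "f \<in> K"
    have *: "\<eta> (L \<theta> (zo (\<lambda>x. c * f x))) = c * \<eta> (L \<theta> f)" if "\<eta> \<in> Der" "\<theta> \<in> Der" for \<eta> \<theta>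
      unfolding L_arith(2)[OF that(2) fg fg] der_scale[OF that(1) zL(1)[OF fg that(2)]] by (simp only: zL(3)[OF fg that(2)])
    have "?b (zo (\<lambda>x. c * f x)) = c * ?b f"
      unfolding b[OF K_closed(3)[OF fg fg]] b[OF fg] by (simp add: * \<delta> right_diff_distrib)
    then show "?b (\<lambda>x. c * f x) = c * ?b f" using K_ops(5)[OF fg fg, of c] by simp
  qed
  show "Dm ?b = Dm \<delta> * Dm \<epsilon> - Dm \<epsilon> * Dm \<delta>"
  proof (rule fm_eqI)
    fix i j
    have *: "\<eta> (L \<theta> (zo (\<lambda>x. ent (\<iota> x) i j))) = ent (Dm \<eta> * Dm \<theta>) i j" if "\<eta> \<in> Der" "\<theta> \<in> Der" for \<eta> \<theta>
    proof -
      have "zo (\<lambda>y. ent (\<iota> y * Dm \<theta>) i j) = zo (\<lambda>y. ent (idm n * \<iota> y * Dm \<theta>) i j)"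
        by (rule zero_outside_cong) (simp add: idm_times[OF \<iota>_M])
      then show ?thesis unfolding L_\<iota>[OF that(2)]
        using der_conjugate[OF that(1) matP_\<iota>(1) \<iota>_M Dm_M ent_Dm[symmetric], OF _ that(1) that(1), of "idm n" "Dm \<theta>"]
        by (simp add: idm_times[OF Dm_M[OF that(1)]])
    qed
    show "ent (Dm ?b) i j = ent (Dm \<delta> * Dm \<epsilon> - Dm \<epsilon> * Dm \<delta>) i j"
      by (simp add: ent_Dm[OF bD] b K.matP_ent matP_\<iota> * \<delta>)
  qed
qed

lemma Ad_der:
  assumes x: "x \<in> S" and \<delta>: "\<delta> \<in> Der"
  shows "Ad G x \<delta> \<in> Der" "Dm (Ad G x \<delta>) = \<iota> x * Dm \<delta> * \<iota>' x"
proof -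
  let ?c = "\<lambda>y. x \<otimes> y \<otimes> inv x"
  have A: "Ad G x \<delta> f = \<delta> (zo (\<lambda>y. f (?c y)))" if "f \<in> K" for f using that by (simp add: Ad_def)
  have k: "zo (\<lambda>y. f (?c y)) \<in> K" if "f \<in> K" for f by (rule K_translate) (simp_all add: x that)
  have c1: "?c \<one> = \<one>" using x by simp
  show D: "Ad G x \<delta> \<in> Der"
    unfolding point_derivations_def mem_Collect_eq
  proof (intro conjI allI ballI impI)
    show "Ad G x \<delta> f = 0" if "f \<notin> K" for f using that by (simp add: Ad_def zero_outside_def)
    show "Ad G x \<delta> (f + g) = Ad G x \<delta> f + Ad G x \<delta> g" if "f \<in> K" "g \<in> K" for f g
    proof -
      have "f + g \<in> K" by (rule K_closed(4)[OF that])
      then show ?thesis using der_add[OF \<delta> k[OF that(1)] k[OF that(2)]] that by (simp add: A)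
    qed
    show "Ad G x \<delta> (\<lambda>x. c * f x) = c * Ad G x \<delta> f" if "f \<in> K" for c f
    proof -
      have "(\<lambda>x. c * f x) \<in> K" by (rule K_closed(8)[OF that that])
      then show ?thesis using der_scale[OF \<delta> k[OF that]] that by (simp add: A)
    qed
    show "Ad G x \<delta> (f * g) = f \<one> * Ad G x \<delta> g + Ad G x \<delta> f * g \<one>" if "f \<in> K" "g \<in> K" for f g
    proof -
      have "f * g \<in> K" by (rule K_closed(6)[OF that])
      then show ?thesis using der_mult[OF \<delta> k[OF that(1)] k[OF that(2)]] that by (simp add: A c1[simplified])
    qed
  qed
  show "Dm (Ad G x \<delta>) = \<iota> x * Dm \<delta> * \<iota>' x"
  proof (rule fm_eqI)
    fix i j
    have "zo (\<lambda>y. zo (\<lambda>x. ent (\<iota> x) i j) (?c y)) = zo (\<lambda>y. ent (\<iota> x * \<iota> y * \<iota>' x) i j)"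
      by (rule zero_outside_cong) (simp add: x \<iota>_mult \<iota>_inv)
    then show "ent (Dm (Ad G x \<delta>)) i j = ent (\<iota> x * Dm \<delta> * \<iota>' x) i j"
      using der_conjugate[OF \<delta> matP_\<iota>(1) \<iota>_M Dm_M[OF \<delta>] ent_Dm[OF \<delta>, symmetric], of "\<iota> x" "\<iota>' x"]
      by (simp add: ent_Dm[OF D] A K.matP_ent matP_\<iota>)
  qed
qed

text \<open>Differentiating regular functions along a rational curve through the identity gives a
  point derivation with the velocity of the curve as its matrix.\<close>

lemma der_exists:
  assumes Y: "\<And>t. Y t \<in> M n n" "Y 0 = idm n" "x \<in> M n n" "\<And>i j. has_der (\<lambda>t. ent (Y t) i j) (ent x i j)"
    and im: "ev0 (\<lambda>t. Y t \<in> \<iota> ` S)"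
  shows "\<exists>\<delta> \<in> Der. Dm \<delta> = x"
proof -
  \<comment> \<open>The curve need lie in the group only near 0; elsewhere the identity serves as a
    default value.\<close>
  define c where "c t = (if Y t \<in> \<iota> ` S then inv_into S \<iota> (Y t) else \<one>)" for t
  have cS: "c t \<in> S" for t by (auto simp: c_def inv_into_into)
  have c\<iota>: "\<iota> (c t) = Y t" if "Y t \<in> \<iota> ` S" for t using that by (simp add: c_def f_inv_into_f)
  have "\<iota> (c 0) = \<iota> \<one>" using c\<iota>[OF ev0_at[OF im]] Y(2) by (simp add: \<iota>_one)
  then have c0: "c 0 = \<one>" using inj_onD[OF \<iota>_inj _ cS one_closed] by blast
  have i1: "has_der (\<lambda>t. ent (\<iota> (c t)) i j) (ent x i j)" for i j
    by (rule has_der_cong[OF Y(4)]) (rule ev0_mono[OF im], simp add: c\<iota>)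
  have i2: "differentiable0 (\<lambda>t. ent (\<iota>' (c t)) i j)" for i j
  proof (rule differentiable0_inverse_matrix[where Y = Y and n = n])
    show "Y 0 = idm n" "\<And>t. Y t \<in> M n n" by (rule Y)+
    show "d0.matP Y" by (rule d0.matP_I[OF Y(1)]) (auto simp: differentiable0_def intro: Y(4))
    show "ev0 (\<lambda>t. \<iota>' (c t) \<in> M n n \<and> \<iota>' (c t) * Y t = idm n)"
      by (rule ev0_mono[OF im]) (use \<iota>'_M[OF cS] \<iota>'_\<iota>[OF cS] c\<iota> in metis)
  qed
  have ex: "differentiable0 (\<lambda>t. f (c t))" if "f \<in> K" for f
    using that
  proof (induction rule: K_induct)
    case (const a) show ?case by (simp add: cS d0.const)
  next
    case (gen i j) show ?case using i1 by (auto simp: cS differentiable0_def)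
  next
    case (gen' i j) show ?case using i2 by (simp add: cS)
  next
    case (add f g) then show ?case by (simp add: cS d0.add)
  next
    case (mult f g) then show ?case by (simp add: cS d0.mult)
  qed
  define \<delta> where "\<delta> f = (if f \<in> K then (THE d. has_der (\<lambda>t. f (c t)) d) else 0)" for f
  have \<delta>: "has_der (\<lambda>t. f (c t)) (\<delta> f)" if f: "f \<in> K" for f
  proof -
    obtain d where d: "has_der (\<lambda>t. f (c t)) d" using ex[OF f] by (auto simp: differentiable0_def)
    then have "(THE d. has_der (\<lambda>t. f (c t)) d) = d" by (rule the_equality) (rule has_der_unique[OF _ d])
    then show ?thesis using d f by (simp add: \<delta>_def)
  qed
  have \<delta>I: "\<delta> f = d" if "f \<in> K" "has_der (\<lambda>t. f (c t)) d" for f d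
    by (rule has_der_unique[OF \<delta>[OF that(1)] that(2)])
  have D: "\<delta> \<in> Der"
    unfolding point_derivations_def mem_Collect_eq
  proof (intro conjI allI ballI impI)
    show "\<delta> f = 0" if "f \<notin> K" for f using that by (simp add: \<delta>_def)
    show "\<delta> (f + g) = \<delta> f + \<delta> g" if "f \<in> K" "g \<in> K" for f g
    proof (rule \<delta>I)
      show "f + g \<in> K" by (rule K_closed(4)[OF that])
      show "has_der (\<lambda>t. (f + g) (c t)) (\<delta> f + \<delta> g)" using has_der_arith(1)[OF \<delta> \<delta>] that by simp
    qed
    show "\<delta> (\<lambda>x. a * f x) = a * \<delta> f" if "f \<in> K" for a f
    proof (rule \<delta>I)
      show "(\<lambda>x. a * f x) \<in> K" by (rule K_closed(8)[OF that that])
      show "has_der (\<lambda>t. a * f (c t)) (a * \<delta> f)" using has_der_arith(2)[OF has_der_const[of a] \<delta>] that by simp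
    qed
    show "\<delta> (f * g) = f \<one> * \<delta> g + \<delta> f * g \<one>" if "f \<in> K" "g \<in> K" for f g
    proof (rule \<delta>I)
      show "f * g \<in> K" by (rule K_closed(6)[OF that])
      show "has_der (\<lambda>t. (f * g) (c t)) (f \<one> * \<delta> g + \<delta> f * g \<one>)"
        using has_der_arith(2)[OF \<delta> \<delta>, of f g] that c0 by simp
    qed
  qed
  have "Dm \<delta> = x"
  proof (rule fm_eqI)
    fix i j
    show "ent (Dm \<delta>) i j = ent x i j" unfolding ent_Dm[OF D]
    proof (rule \<delta>I)
      show "zo (\<lambda>x. ent (\<iota> x) i j) \<in> K" by (intro K.matP_ent matP_\<iota>)
      show "has_der (\<lambda>t. zo (\<lambda>x. ent (\<iota> x) i j) (c t)) (ent x i j)" using i1 by (simp add: cS)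
    qed
  qed
  then show ?thesis using D by blast
qed

lemma Dm_subspace:
  assumes pj: "\<And>x y. pj (x + y) = pj x + pj y" "\<And>c x. pj (sm c x) = sm c (pj x)" "\<And>y. pj y \<in> E" "\<And>x. x \<in> E \<Longrightarrow> pj x = x"
    and E: "fm.subspace E" and \<iota>: "\<And>y. y \<in> S \<Longrightarrow> \<iota> y \<in> E" and \<delta>: "\<delta> \<in> Der"
  shows "Dm \<delta> \<in> E"
proof -
  let ?F = "\<lambda>y. if y \<in> S then \<iota> y else 0"
  have F: "(\<lambda>y. ent (?F y) i j) = zo (\<lambda>y. ent (\<iota> y) i j)" for i j by (auto simp: zero_outside_def)
  show ?thesis
  proof (rule linear_functional_in_subspace[of pj E K \<delta> ?F n])
    show "(\<lambda>y. f y + g y) \<in> K" "\<delta> (\<lambda>y. f y + g y) = \<delta> f + \<delta> g" if "f \<in> K" "g \<in> K" for f g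
      using der_add[OF \<delta>, of f g] that K_closed(5)[OF that] by (simp_all only: zo_K)
    show "(\<lambda>y. c * f y) \<in> K" "\<delta> (\<lambda>y. c * f y) = c * \<delta> f" if "f \<in> K" for c f
      using der_scale[OF \<delta>, of f c] that K_closed(8)[OF that that, of c] by (simp_all only: zo_K)
    show "?F y \<in> E" "?F y \<in> M n n" for y using \<iota> fm.subspace_0[OF E] \<iota>_M by auto
    show "(\<lambda>y. ent (?F y) i j) \<in> K" for i j unfolding F by (intro K.matP_ent matP_\<iota>)
    show "ent (Dm \<delta>) i j = \<delta> (\<lambda>y. ent (?F y) i j)" for i j unfolding F by (rule ent_Dm[OF \<delta>])
  qed (use pj Dm_M[OF \<delta>] in auto)
qed

end

text \<open>On f, translation by u minus the identity acts as c - 1. Nilpotency and the nonzero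
  value at the identity force c = 1.\<close>

lemma character_unipotent:
  fixes f :: "'g \<Rightarrow> 'k::field"
  assumes H: "\<one>\<^bsub>G\<^esub> \<in> H" "\<And>x y. x \<in> H \<Longrightarrow> y \<in> H \<Longrightarrow> x \<otimes>\<^bsub>G\<^esub> y \<in> H" "u \<in> H" and u: "unipotent (alg_subgroup G H) u"
    and f: "f \<in> coord_ring G" "\<And>x. x \<in> H \<Longrightarrow> f (x \<otimes>\<^bsub>G\<^esub> u) = c * f x" "f \<one>\<^bsub>G\<^esub> \<noteq> 0"
  shows "c = 1"
proof -
  let ?f = "zero_outside H f" and ?T = "\<lambda>h. zero_outside H (\<lambda>x. h (x \<otimes>\<^bsub>G\<^esub> u)) - h"
  obtain N where "(?T ^^ N) ?f = 0" using u f(1) by (force simp: unipotent_def alg_subgroup_def)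
  moreover have "(?T ^^ N) ?f = (\<lambda>x. (c - 1) ^ N * ?f x)"
  proof (induction N)
    case (Suc N)
    then show ?case using H(2)[OF _ H(3)] by (auto simp: fun_eq_iff zero_outside_def f(2) algebra_simps)
  qed simp
  ultimately have "(\<lambda>x. (c - 1) ^ N * ?f x) = 0" by simp
  from fun_cong[OF this, of "\<one>\<^bsub>G\<^esub>"] have "(c - 1) ^ N * f \<one>\<^bsub>G\<^esub> = 0" using H(1) by simp
  then show ?thesis using f(3) by simp
qed

section \<open>The quotient of a linear group by its scalar matrices\<close>

locale lin_group_scalars = lin_group +
  assumes n_pos: "0 < n" and scalars: "\<And>c. c \<noteq> 0 \<Longrightarrow> \<exists>z \<in> carrier G. \<iota> z = sm c (idm n)"
begin

definition Z :: "'a set" where "Z = {z \<in> S. \<exists>c. \<iota> z = sm c (idm n)}"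

abbreviation "Q \<equiv> alg_quotient G Z"
abbreviation "B \<equiv> coord_ring (alg_quotient G Z)"

lemma ZD: "z \<in> Z \<Longrightarrow> \<exists>c. c \<noteq> 0 \<and> \<iota> z = sm c (idm n)"
proof -
  assume z: "z \<in> Z"
  then obtain c where c: "\<iota> z = sm c (idm n)" "z \<in> S" by (auto simp: Z_def)
  have "c \<noteq> 0" using \<iota>_\<iota>'[OF c(2)] c(1) idm_nz[OF n_pos, where 'a='b] by auto
  then show ?thesis using c by blast
qed

lemma coset: assumes "x \<in> S" shows "Z #> x = {y \<in> S. \<exists>c. c \<noteq> 0 \<and> \<iota> y = sm c (\<iota> x)}"
proof (rule Set.set_eqI)
  fix y
  have "y \<in> Z #> x \<longleftrightarrow> (\<exists>z \<in> Z. y = z \<otimes> x)" by (auto simp: r_coset_def)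
  also have "\<dots> \<longleftrightarrow> y \<in> {y \<in> S. \<exists>c. c \<noteq> 0 \<and> \<iota> y = sm c (\<iota> x)}"
  proof
    assume "\<exists>z \<in> Z. y = z \<otimes> x"
    then obtain z where z: "z \<in> Z" "y = z \<otimes> x" by blast
    obtain c where c: "c \<noteq> 0" "\<iota> z = sm c (idm n)" using ZD[OF z(1)] by blast
    have zS: "z \<in> S" using z(1) by (simp add: Z_def)
    have "\<iota> y = sm c (\<iota> x)" using \<iota>_mult[OF zS assms] z(2) c(2) idm_times[OF \<iota>_M[OF assms]] by simp
    then show "y \<in> {y \<in> S. \<exists>c. c \<noteq> 0 \<and> \<iota> y = sm c (\<iota> x)}" using c(1) z(2) zS assms by auto
  next
    assume "y \<in> {y \<in> S. \<exists>c. c \<noteq> 0 \<and> \<iota> y = sm c (\<iota> x)}"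
    then obtain c where c: "c \<noteq> 0" "\<iota> y = sm c (\<iota> x)" and y: "y \<in> S" by blast
    obtain z where z: "z \<in> S" "\<iota> z = sm c (idm n)" using scalars[OF c(1)] by blast
    have "y = z \<otimes> x"
      by (rule inj_onD[OF \<iota>_inj]) (use z c assms y idm_times[OF \<iota>_M[OF assms]] in \<open>simp_all add: \<iota>_mult\<close>)
    then show "\<exists>z \<in> Z. y = z \<otimes> x" using z by (auto simp: Z_def)
  qed
  finally show "y \<in> Z #> x \<longleftrightarrow> y \<in> {y \<in> S. \<exists>c. c \<noteq> 0 \<and> \<iota> y = sm c (\<iota> x)}" .
qed

lemma \<iota>'_scale: assumes "x \<in> S" "y \<in> S" "c \<noteq> 0" "\<iota> y = sm c (\<iota> x)" shows "\<iota>' y = sm (inverse c) (\<iota>' x)"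
proof (rule fm_inv_unique[of _ n _ "\<iota> y"])
  show "\<iota> y * sm (inverse c) (\<iota>' x) = idm n" using assms by (simp add: \<iota>_\<iota>')
qed (use assms(1,2) in \<open>simp_all add: \<iota>'_M \<iota>'_\<iota> M_sm\<close>)

lemma Z_normal: "Z \<lhd> G"
proof (subst normal_inv_iff, intro conjI ballI)
  show "subgroup Z G"
  proof (rule subgroupI)
    show "Z \<subseteq> S" by (auto simp: Z_def)
    have "\<iota> \<one> = sm 1 (idm n)" by (simp add: \<iota>_one)
    then show "Z \<noteq> {}" unfolding Z_def using one_closed by blast
    show "x \<otimes> y \<in> Z" if "x \<in> Z" "y \<in> Z" for x y
      using that by (auto simp: Z_def \<iota>_mult idm_times[OF M_idm[OF le_refl le_refl]])
    fix z assume z: "z \<in> Z"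
    then have zS: "z \<in> S" by (simp add: Z_def)
    obtain c where c: "c \<noteq> 0" "\<iota> z = sm c (\<iota> \<one>)" using ZD[OF z] by (auto simp: \<iota>_one)
    from \<iota>'_scale[OF one_closed zS c] have "\<iota> (inv z) = sm (inverse c) (idm n)" by (simp add: \<iota>_inv zS \<iota>'_one)
    then show "inv z \<in> Z" using zS by (auto simp: Z_def)
  qed
  fix x z assume x: "x \<in> S" and z: "z \<in> Z"
  then have zS: "z \<in> S" by (simp add: Z_def)
  obtain c where c: "\<iota> z = sm c (idm n)" using ZD[OF z] by auto
  have "\<iota> (x \<otimes> z \<otimes> inv x) = sm c (idm n)"
    using x zS by (simp add: \<iota>_mult c \<iota>_inv times_idm[OF \<iota>_M] \<iota>_\<iota>')
  then show "x \<otimes> z \<otimes> inv x \<in> Z" using x zS by (auto simp: Z_def)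
qed

sublocale Z: normal Z G by (rule Z_normal)

lemma Q_simps [simp]:
  "carrier Q = rcosets Z" "\<one>\<^bsub>Q\<^esub> = Z" "monoid.mult Q = (<#>)"
  by (simp_all add: alg_quotient_def FactGroup_def)

lemma Q_carrierI: "x \<in> S \<Longrightarrow> Z #> x \<in> rcosets Z" by (auto simp: RCOSETS_def)

lemma Q_carrierE: assumes "C \<in> rcosets Z" obtains x where "x \<in> S" "C = Z #> x"
  using assms unfolding RCOSETS_def by blast

lemma Q_one: "Z #> \<one> = Z" by (rule coset_mult_one[OF Z.subset])

lemma Q_mult: "x \<in> S \<Longrightarrow> y \<in> S \<Longrightarrow> (Z #> x) <#> (Z #> y) = Z #> (x \<otimes> y)" by (rule Z.rcos_sum)

lemma Q_inv: assumes "x \<in> S" shows "inv\<^bsub>Q\<^esub> (Z #> x) = Z #> (inv x)"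
proof -
  interpret F: group "G Mod Z" by (rule Z.factorgroup_is_group)
  have "inv\<^bsub>Q\<^esub> (Z #> x) = inv\<^bsub>G Mod Z\<^esub> (Z #> x)" by (simp add: m_inv_def FactGroup_def)
  also have "\<dots> = Z #> (inv x)"
  proof (rule F.inv_equality)
    show "(Z #> inv x) \<otimes>\<^bsub>G Mod Z\<^esub> (Z #> x) = \<one>\<^bsub>G Mod Z\<^esub>" unfolding FactGroup_def using assms Q_mult[of "inv x" x] Q_one by simp
    show "Z #> x \<in> carrier (G Mod Z)" "Z #> inv x \<in> carrier (G Mod Z)" using assms Q_carrierI by (simp_all add: FactGroup_def)
  qed
  finally show ?thesis .
qed

lemma coset_eq: assumes "x \<in> S" "y \<in> S" shows "Z #> x = Z #> y \<longleftrightarrow> (\<exists>c. c \<noteq> 0 \<and> \<iota> y = sm c (\<iota> x))"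
proof
  assume "Z #> x = Z #> y"
  moreover have "y \<in> Z #> y" unfolding coset[OF assms(2)] using assms(2) by (auto intro!: exI[of _ 1])
  ultimately show "\<exists>c. c \<noteq> 0 \<and> \<iota> y = sm c (\<iota> x)" unfolding coset[OF assms(1)] by blast
next
  assume "\<exists>c. c \<noteq> 0 \<and> \<iota> y = sm c (\<iota> x)"
  then have "y \<in> Z #> x" unfolding coset[OF assms(1)] using assms(2) by blast
  then show "Z #> x = Z #> y" by (rule repr_independence[OF _ assms(1) Z.subgroup_axioms])
qed

definition rep :: "'a set \<Rightarrow> 'a" where "rep C = (SOME x. x \<in> S \<and> C = Z #> x)"

lemma rep: assumes "C \<in> rcosets Z" shows "rep C \<in> S" "Z #> rep C = C"
proof -
  have "\<exists>x. x \<in> S \<and> C = Z #> x" using assms by (auto elim: Q_carrierE)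
  from someI_ex[OF this] show "rep C \<in> S" "Z #> rep C = C" by (simp_all add: rep_def)
qed

text \<open>\<open>pb\<close> and \<open>psh\<close> below are the mutually inverse isomorphisms
  between the coordinate ring of the quotient and the ring \<open>Inv\<close> of functions invariant
  under scalars.\<close>

definition pb :: "('a set \<Rightarrow> 'b) \<Rightarrow> 'a \<Rightarrow> 'b" where "pb f = zo (\<lambda>x. f (Z #> x))"

definition Inv :: "('a \<Rightarrow> 'b) set" where
  "Inv = {F \<in> K. \<forall>x \<in> S. \<forall>y \<in> S. \<forall>c. c \<noteq> 0 \<longrightarrow> \<iota> y = sm c (\<iota> x) \<longrightarrow> F y = F x}"

definition psh :: "('a \<Rightarrow> 'b) \<Rightarrow> 'a set \<Rightarrow> 'b" where "psh F = zero_outside (rcosets Z) (\<lambda>C. F (rep C))"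

lemma B_iff: "f \<in> B \<longleftrightarrow> (\<forall>C. C \<notin> rcosets Z \<longrightarrow> f C = 0) \<and> pb f \<in> K"
  by (simp add: alg_quotient_def pb_def FactGroup_def)

lemma pb_at: "x \<in> S \<Longrightarrow> pb f x = f (Z #> x)" by (simp add: pb_def)

lemma pb_Inv: assumes "f \<in> B" shows "pb f \<in> Inv"
  unfolding Inv_def
proof (intro CollectI conjI ballI allI impI)
  show "pb f \<in> K" using assms by (simp add: B_iff)
  show "pb f y = pb f x" if "x \<in> S" "y \<in> S" "c \<noteq> 0" "\<iota> y = sm c (\<iota> x)" for x y c
  proof -
    have "Z #> x = Z #> y" using coset_eq[OF that(1,2)] that(3,4) by blast
    then show ?thesis using that(1,2) by (simp add: pb_at)
  qed
qed

lemma Inv_K: "F \<in> Inv \<Longrightarrow> F \<in> K" by (simp add: Inv_def)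

lemma psh: assumes "F \<in> Inv" shows "psh F \<in> B" "pb (psh F) = F"
proof -
  have "pb (psh F) = zo F" unfolding pb_def
  proof (rule zero_outside_cong)
    fix x assume x: "x \<in> S"
    note r = rep[OF Q_carrierI[OF x]]
    obtain c where "c \<noteq> 0" "\<iota> (rep (Z #> x)) = sm c (\<iota> x)" using coset_eq[OF x r(1)] r(2) by auto
    then have "F (rep (Z #> x)) = F x" using assms x r(1) by (auto simp: Inv_def)
    then show "psh F (Z #> x) = F x" by (simp add: psh_def Q_carrierI[OF x])
  qed
  then show 1: "pb (psh F) = F" by (simp add: zo_K Inv_K assms)
  show "psh F \<in> B" unfolding B_iff 1 using Inv_K[OF assms] by (simp add: psh_def zero_outside_def)
qed

lemma psh_pb: assumes "f \<in> B" shows "psh (pb f) = f"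
proof
  fix C
  show "psh (pb f) C = f C"
  proof (cases "C \<in> rcosets Z")
    case True
    then show ?thesis by (simp add: psh_def pb_at rep)
  qed (use assms in \<open>simp_all add: psh_def zero_outside_def B_iff\<close>)
qed

sublocale Inv: function_algebra S "\<lambda>f. zo f \<in> Inv"
proof
  show "zo (\<lambda>x. c) \<in> Inv" for c by (simp add: Inv_def K.const)
  show "zo (\<lambda>x. f x + g x) \<in> Inv" "zo (\<lambda>x. f x * g x) \<in> Inv" if "zo f \<in> Inv" "zo g \<in> Inv" for f g
    using that by (auto simp: Inv_def intro: K.add K.mult)
  show "zo g \<in> Inv" if "\<And>x. x \<in> S \<Longrightarrow> f x = g x" "zo f \<in> Inv" for f g
    using that(2) zero_outside_cong[of S f g, OF that(1)] by simp
qed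

lemma zo_Inv: "f \<in> Inv \<Longrightarrow> zo f = f" by (simp add: Inv_K zo_K)

lemma Inv_closed: assumes "F \<in> Inv" "H \<in> Inv" shows "F + H \<in> Inv" "(\<lambda>x. c * F x) \<in> Inv" "F * H \<in> Inv"
proof -
  have z: "zo F \<in> Inv" "zo H \<in> Inv" using assms by (simp_all only: zo_Inv)
  note k = Inv_K[OF assms(1)] Inv_K[OF assms(2)]
  show "F + H \<in> Inv" by (subst K_ops(1)[OF k], rule Inv.add[OF z])
  show "(\<lambda>x. c * F x) \<in> Inv" by (subst K_ops(5)[OF k], rule Inv.mult[OF Inv.const z(1)])
  show "F * H \<in> Inv" by (subst K_ops(3)[OF k], rule Inv.mult[OF z])
qed

lemma pb_arith: "pb (f + g) = pb f + pb g" "pb (\<lambda>x. c * f x) = (\<lambda>x. c * pb f x)" "pb (f * g) = pb f * pb g"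
  by (auto simp: pb_def zero_outside_def fun_eq_iff)

lemma psh_arith: "psh (f + g) = psh f + psh g" "psh (\<lambda>x. c * f x) = (\<lambda>x. c * psh f x)" "psh (f * g) = psh f * psh g"
  by (auto simp: psh_def zero_outside_def fun_eq_iff)

lemma B_closed: assumes "f \<in> B" "g \<in> B" shows "f + g \<in> B" "(\<lambda>x. c * f x) \<in> B" "f * g \<in> B"
  using assms K_closed(4,6,8)[of "pb f" "pb g"] unfolding B_iff pb_arith by auto

definition inv_der :: "(('a \<Rightarrow> 'b) \<Rightarrow> 'b) \<Rightarrow> bool" where
  "inv_der \<Delta> \<longleftrightarrow> (\<forall>F \<in> Inv. \<forall>H \<in> Inv. \<Delta> (F + H) = \<Delta> F + \<Delta> H \<and> \<Delta> (F * H) = F \<one> * \<Delta> H + \<Delta> F * H \<one>) \<and>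
     (\<forall>c. \<forall>F \<in> Inv. \<Delta> (\<lambda>x. c * F x) = c * \<Delta> F)"

lemma inv_der_rules:
  assumes "inv_der \<Delta>" "zo f \<in> Inv" "zo g \<in> Inv"
  shows "\<Delta> (zo (\<lambda>x. f x + g x)) = \<Delta> (zo f) + \<Delta> (zo g)"
    "\<Delta> (zo (\<lambda>x. f x * g x)) = f \<one> * \<Delta> (zo g) + \<Delta> (zo f) * g \<one>"
    "\<Delta> (zo (\<lambda>x. c * f x)) = c * \<Delta> (zo f)"
proof -
  have "\<Delta> (zo f + zo g) = \<Delta> (zo f) + \<Delta> (zo g)" "\<Delta> (zo f * zo g) = zo f \<one> * \<Delta> (zo g) + \<Delta> (zo f) * zo g \<one>"
    "\<Delta> (\<lambda>x. c * zo f x) = c * \<Delta> (zo f)" using assms unfolding inv_der_def by blast+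
  then show "\<Delta> (zo (\<lambda>x. f x + g x)) = \<Delta> (zo f) + \<Delta> (zo g)"
    "\<Delta> (zo (\<lambda>x. f x * g x)) = f \<one> * \<Delta> (zo g) + \<Delta> (zo f) * g \<one>"
    "\<Delta> (zo (\<lambda>x. c * f x)) = c * \<Delta> (zo f)"
    unfolding zero_outside_arith(1) zero_outside_arith(2)[of S f g] zero_outside_arith(3) by simp_all
qed

lemma inv_der_const: assumes "inv_der \<Delta>" shows "\<Delta> (zo (\<lambda>x. c)) = 0"
proof -
  have "\<Delta> (zo (\<lambda>x. 1)) = 0" using inv_der_rules(2)[OF assms Inv.const[of 1] Inv.const[of 1]] by simp
  then show ?thesis using inv_der_rules(3)[OF assms Inv.const[of 1] Inv.const[of 1], of c] by simp
qed

lemma inv_der_sum: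
  assumes "inv_der \<Delta>" "\<And>i. i \<in> A \<Longrightarrow> zo (f i) \<in> Inv"
  shows "\<Delta> (zo (\<lambda>x. \<Sum>i\<in>A. f i x)) = (\<Sum>i\<in>A. \<Delta> (zo (f i)))"
  using assms(2)
proof (induction A rule: infinite_finite_induct)
  case (insert a A)
  then show ?case using inv_der_rules(1)[OF assms(1), of "f a" "\<lambda>x. \<Sum>i\<in>A. f i x"] by (simp add: Inv.sum)
qed (simp_all add: inv_der_const[OF assms(1)])

text \<open>The entry (0, 0) of \<iota>' has degree -1 under scalars and value 1 at the identity, so
  it normalises the entries of \<iota> to degree zero. The functions \<beta> do the same for
  \<iota>'.\<close>

definition \<alpha> :: "nat \<Rightarrow> nat \<Rightarrow> 'a \<Rightarrow> 'b" where "\<alpha> i j = (\<lambda>x. ent (\<iota>' x) 0 0 * ent (\<iota> x) i j)"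
definition \<beta> :: "nat \<Rightarrow> nat \<Rightarrow> 'a \<Rightarrow> 'b" where "\<beta> i j = (\<lambda>x. ent (\<iota> x) 0 0 * ent (\<iota>' x) i j)"

lemma \<alpha>\<beta>_Inv: "zo (\<alpha> i j) \<in> Inv" "zo (\<beta> i j) \<in> Inv"
  unfolding Inv_def \<alpha>_def \<beta>_def using \<iota>'_scale by (auto intro!: K.mult K.matP_ent matP_\<iota>)

lemma \<alpha>\<beta>_one: "\<alpha> i j \<one> = ent (idm n) i j" "\<beta> i j \<one> = ent (idm n) i j"
  using n_pos by (simp_all add: \<alpha>_def \<beta>_def \<iota>_one \<iota>'_one ent_idm)

text \<open>The product of the matrices \<alpha> and \<beta> is \<alpha>(0, 0) times the unit.
  Differentiating its (0, 0) entry, with \<alpha>(0, 0) = \<beta>(0, 0), gives 2 x = x for x =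
  \<Delta> \<alpha>(0, 0), hence x = 0; the other entries follow.\<close>

lemma inv_der_\<beta>:
  assumes \<Delta>: "inv_der \<Delta>"
  shows "\<Delta> (zo (\<alpha> 0 0)) = 0" "\<Delta> (zo (\<beta> i j)) = - \<Delta> (zo (\<alpha> i j))"
proof -
  have 1: "\<Delta> (zo (\<beta> i j)) + \<Delta> (zo (\<alpha> i j)) = ent (idm n) i j * \<Delta> (zo (\<alpha> 0 0))" if ij: "i < n" "j < n" for i j
  proof -
    have "zo (\<lambda>x. \<Sum>k<n. \<alpha> i k x * \<beta> k j x) = zo (\<lambda>x. ent (idm n) i j * \<alpha> 0 0 x)"
      by (rule zero_outside_cong)
         (simp add: \<iota>_\<iota>'[symmetric] ent_times[OF \<iota>_M] \<alpha>_def \<beta>_def sum_distrib_left sum_distrib_right mult_ac)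
    then have "ent (idm n) i j * \<Delta> (zo (\<alpha> 0 0)) = \<Delta> (zo (\<lambda>x. \<Sum>k<n. \<alpha> i k x * \<beta> k j x))"
      by (simp add: inv_der_rules(3)[OF \<Delta> \<alpha>\<beta>_Inv(1) \<alpha>\<beta>_Inv(1)])
    also have "\<dots> = (\<Sum>k<n. ent (idm n) i k * \<Delta> (zo (\<beta> k j)) + \<Delta> (zo (\<alpha> i k)) * ent (idm n) k j)"
      by (simp add: inv_der_sum[OF \<Delta>] Inv.mult \<alpha>\<beta>_Inv inv_der_rules(2)[OF \<Delta> \<alpha>\<beta>_Inv] \<alpha>\<beta>_one)
    also have "\<dots> = (\<Sum>k<n. if k = i then \<Delta> (zo (\<beta> k j)) else 0) + (\<Sum>k<n. if k = j then \<Delta> (zo (\<alpha> i k)) else 0)"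
      unfolding sum.distrib[symmetric] by (rule sum.cong) (auto simp: ent_idm)
    also have "\<dots> = \<Delta> (zo (\<beta> i j)) + \<Delta> (zo (\<alpha> i j))" using ij by simp
    finally show ?thesis by simp
  qed
  have "\<beta> 0 0 = \<alpha> 0 0" by (simp add: \<alpha>_def \<beta>_def mult.commute)
  then show 0: "\<Delta> (zo (\<alpha> 0 0)) = 0" using 1[of 0 0] n_pos by (simp add: ent_idm)
  show "\<Delta> (zo (\<beta> i j)) = - \<Delta> (zo (\<alpha> i j))"
  proof (cases "i < n \<and> j < n")
    case True
    then show ?thesis using 1[of i j] 0 by (simp add: add_eq_0_iff)
  next
    case False
    then have "zo (\<alpha> i j) = zo (\<lambda>x. 0)" "zo (\<beta> i j) = zo (\<lambda>x. 0)"
      using M_D[OF \<iota>_M False] M_D[OF \<iota>'_M False] by (auto intro!: zero_outside_cong simp: \<alpha>_def \<beta>_def)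
    then show ?thesis by (simp add: inv_der_const[OF \<Delta>])
  qed
qed

text \<open>Every regular function, restricted to the multiples \<open>y \<cdot> ent (\<iota>' y) 0 0\<close> and multiplied with a
  power of \<open>\<mu> = \<alpha> 0 0\<close>, becomes a polynomial in the invariants \<open>\<alpha> i j\<close> and \<open>\<beta> i j\<close>.\<close>

lemma inv_der_eq:
  assumes \<Delta>: "inv_der \<Delta>1" "inv_der \<Delta>2" and eq: "\<And>i j. \<Delta>1 (zo (\<alpha> i j)) = \<Delta>2 (zo (\<alpha> i j))" and F: "F \<in> Inv"
  shows "\<Delta>1 F = \<Delta>2 F"
proof -
  let ?\<mu> = "\<alpha> 0 0" and ?m = "\<lambda>y. ent (\<iota>' y) 0 0"
  define A where "A f \<longleftrightarrow> zo f \<in> Inv \<and> \<Delta>1 (zo f) = \<Delta>2 (zo f)" for f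
  interpret A: function_algebra S A
  proof
    show "A (\<lambda>x. c)" for c by (simp add: A_def Inv.const inv_der_const \<Delta>)
    show "A (\<lambda>x. f x + g x)" "A (\<lambda>x. f x * g x)" if "A f" "A g" for f g
      using that by (simp_all add: A_def Inv.add Inv.mult inv_der_rules[OF \<Delta>(1)] inv_der_rules[OF \<Delta>(2)])
    show "A g" if "\<And>x. x \<in> S \<Longrightarrow> f x = g x" "A f" for f g
      using that(2) zero_outside_cong[of S f g, OF that(1)] by (simp add: A_def)
  qed
  have A\<alpha>: "A (\<alpha> i j)" "A (\<beta> i j)" for i j using eq by (simp_all add: A_def \<alpha>\<beta>_Inv inv_der_\<beta> \<Delta>)
  have "\<exists>N h. A h \<and> (\<forall>y \<in> S. \<forall>z \<in> S. ?m y \<noteq> 0 \<longrightarrow> \<iota> z = sm (?m y) (\<iota> y) \<longrightarrow> ?\<mu> y ^ N * f z = h y)" if "f \<in> K" for f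
    using that
  proof (induction rule: K_induct)
    case (const c)
    show ?case by (rule exI[of _ 0], rule exI[of _ "\<lambda>x. c"]) (simp add: A.const)
  next
    case (gen i j)
    show ?case by (rule exI[of _ 0], rule exI[of _ "\<alpha> i j"], rule conjI, rule A\<alpha>) (simp add: \<alpha>_def)
  next
    case (gen' i j)
    show ?case
    proof (rule exI[of _ 1], rule exI[of _ "\<beta> i j"], intro conjI A\<alpha> ballI impI)
      fix y z assume *: "y \<in> S" "z \<in> S" "?m y \<noteq> 0" "\<iota> z = sm (?m y) (\<iota> y)"
      from \<iota>'_scale[OF *] show "?\<mu> y ^ 1 * zo (\<lambda>x. ent (\<iota>' x) i j) z = \<beta> i j y" using * by (simp add: \<alpha>_def \<beta>_def)
    qed
  next
    case (add f g)
    then obtain N h N' h' where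
      1: "A h" "\<And>y z. y \<in> S \<Longrightarrow> z \<in> S \<Longrightarrow> ?m y \<noteq> 0 \<Longrightarrow> \<iota> z = sm (?m y) (\<iota> y) \<Longrightarrow> ?\<mu> y ^ N * f z = h y" and
      2: "A h'" "\<And>y z. y \<in> S \<Longrightarrow> z \<in> S \<Longrightarrow> ?m y \<noteq> 0 \<Longrightarrow> \<iota> z = sm (?m y) (\<iota> y) \<Longrightarrow> ?\<mu> y ^ N' * g z = h' y" by blast
    show ?case
    proof (rule exI[of _ "N + N'"], rule exI[of _ "\<lambda>y. ?\<mu> y ^ N' * h y + ?\<mu> y ^ N * h' y"], intro conjI ballI impI)
      show "A (\<lambda>y. ?\<mu> y ^ N' * h y + ?\<mu> y ^ N * h' y)" by (intro A.add A.mult A.power A\<alpha> 1 2)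
      fix y z assume *: "y \<in> S" "z \<in> S" "?m y \<noteq> 0" "\<iota> z = sm (?m y) (\<iota> y)"
      show "?\<mu> y ^ (N + N') * zo (\<lambda>x. f x + g x) z = ?\<mu> y ^ N' * h y + ?\<mu> y ^ N * h' y"
        unfolding 1(2)[OF *, symmetric] 2(2)[OF *, symmetric] using *(2) by (simp add: power_add algebra_simps)
    qed
  next
    case (mult f g)
    then obtain N h N' h' where
      1: "A h" "\<And>y z. y \<in> S \<Longrightarrow> z \<in> S \<Longrightarrow> ?m y \<noteq> 0 \<Longrightarrow> \<iota> z = sm (?m y) (\<iota> y) \<Longrightarrow> ?\<mu> y ^ N * f z = h y" and
      2: "A h'" "\<And>y z. y \<in> S \<Longrightarrow> z \<in> S \<Longrightarrow> ?m y \<noteq> 0 \<Longrightarrow> \<iota> z = sm (?m y) (\<iota> y) \<Longrightarrow> ?\<mu> y ^ N' * g z = h' y" by blast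
    show ?case
    proof (rule exI[of _ "N + N'"], rule exI[of _ "\<lambda>y. h y * h' y"], intro conjI ballI impI)
      show "A (\<lambda>y. h y * h' y)" by (intro A.mult 1 2)
      fix y z assume *: "y \<in> S" "z \<in> S" "?m y \<noteq> 0" "\<iota> z = sm (?m y) (\<iota> y)"
      show "?\<mu> y ^ (N + N') * zo (\<lambda>x. f x * g x) z = h y * h' y"
        unfolding 1(2)[OF *, symmetric] 2(2)[OF *, symmetric] using *(2) by (simp add: power_add mult_ac)
    qed
  qed
  from this[OF Inv_K[OF F]] obtain N h where
    h: "A h" "\<And>y z. y \<in> S \<Longrightarrow> z \<in> S \<Longrightarrow> ?m y \<noteq> 0 \<Longrightarrow> \<iota> z = sm (?m y) (\<iota> y) \<Longrightarrow> ?\<mu> y ^ N * F z = h y" by blast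
  \<comment> \<open>One more factor \<mu> makes the identity hold also at points where the
    normalising entry vanishes.\<close>
  have e: "zo (\<lambda>y. ?\<mu> y ^ Suc N * F y) = zo (\<lambda>y. ?\<mu> y * h y)"
  proof (rule zero_outside_cong)
    fix y assume y: "y \<in> S"
    show "?\<mu> y ^ Suc N * F y = ?\<mu> y * h y"
    proof (cases "?m y = 0")
      case False
      obtain z where z: "z \<in> S" "\<iota> z = sm (?m y) (idm n)" using scalars[OF False] by blast
      have zy: "\<iota> (z \<otimes> y) = sm (?m y) (\<iota> y)" using y z idm_times[OF \<iota>_M[OF y]] by (simp add: \<iota>_mult)
      have "F (z \<otimes> y) = F y" using F y z(1) zy False unfolding Inv_def by blast
      then show ?thesis using h(2)[OF y _ False zy] z(1) y by (simp add: mult.assoc)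
    qed (simp add: \<alpha>_def)
  qed
  \<comment> \<open>\<mu> has value 1 and derivative 0 at the identity, so multiplying by its powers
    does not change the derivative of F.\<close>
  have "\<Delta> (zo (\<lambda>y. ?\<mu> y ^ Suc N * F y)) = \<Delta> F" if d: "inv_der \<Delta>" for \<Delta>
  proof -
    have p: "\<Delta> (zo (\<lambda>y. ?\<mu> y ^ k)) = 0" for k
    proof (induction k)
      case (Suc k)
      then show ?case using inv_der_rules(2)[OF d \<alpha>\<beta>_Inv(1) Inv.power[OF \<alpha>\<beta>_Inv(1)], of 0 0 0 0 k] by (simp add: inv_der_\<beta>(1)[OF d])
    qed (simp add: inv_der_const[OF d])
    have FI: "zo F \<in> Inv" using F by (simp add: zo_Inv)
    have "?\<mu> \<one> = 1" using n_pos by (simp add: \<alpha>\<beta>_one ent_idm)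
    then show ?thesis using inv_der_rules(2)[OF d Inv.power[OF \<alpha>\<beta>_Inv(1)] FI, of 0 0 "Suc N"] p[of "Suc N"]
      by (simp add: zo_Inv[OF F])
  qed
  from this[OF \<Delta>(1)] this[OF \<Delta>(2)] show ?thesis
    using A.mult[OF A\<alpha>(1) h(1), of 0 0] unfolding e A_def by simp
qed

definition \<Psi> :: "(('a \<Rightarrow> 'b) \<Rightarrow> 'b) \<Rightarrow> ('a set \<Rightarrow> 'b) \<Rightarrow> 'b" where
  "\<Psi> \<delta> = zero_outside B (\<lambda>f. \<delta> (pb f))"

lemma Der_inv_der: "\<delta> \<in> Der \<Longrightarrow> inv_der \<delta>"
  unfolding inv_der_def point_derivations_def using Inv_K by blast

lemma \<Psi>_der: assumes "\<delta> \<in> Der" shows "\<Psi> \<delta> \<in> point_derivations Q"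
proof -
  note d = Der_inv_der[OF assms, unfolded inv_der_def]
  have 1: "pb f \<one> = f Z" for f using pb_at[OF one_closed, of f] by (simp add: Q_one)
  show ?thesis unfolding point_derivations_def mem_Collect_eq
  proof (intro conjI allI ballI impI)
    show "\<Psi> \<delta> f = 0" if "f \<notin> B" for f using that by (simp add: \<Psi>_def zero_outside_def)
    show "\<Psi> \<delta> (f + g) = \<Psi> \<delta> f + \<Psi> \<delta> g" if "f \<in> B" "g \<in> B" for f g
      using that B_closed(1)[OF that] d pb_Inv by (simp add: \<Psi>_def pb_arith)
    show "\<Psi> \<delta> (\<lambda>x. c * f x) = c * \<Psi> \<delta> f" if "f \<in> B" for c f
      using that B_closed(2)[OF that that, of c] d pb_Inv by (simp add: \<Psi>_def pb_arith)
    show "\<Psi> \<delta> (f * g) = f \<one>\<^bsub>Q\<^esub> * \<Psi> \<delta> g + \<Psi> \<delta> f * g \<one>\<^bsub>Q\<^esub>" if "f \<in> B" "g \<in> B" for f g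
      using that B_closed(3)[OF that] d pb_Inv by (simp add: \<Psi>_def pb_arith 1)
  qed
qed

lemma der_\<alpha>: assumes \<delta>: "\<delta> \<in> Der" shows "\<delta> (zo (\<alpha> i j)) = ent (Dm \<delta>) i j - ent (Dm \<delta>) 0 0 * ent (idm n) i j"
proof -
  have "\<delta> (zo (\<alpha> i j)) = ent (\<iota>' \<one>) 0 0 * \<delta> (zo (\<lambda>x. ent (\<iota> x) i j)) + \<delta> (zo (\<lambda>x. ent (\<iota>' x) 0 0)) * ent (\<iota> \<one>) i j"
    unfolding \<alpha>_def by (intro der_mult[OF \<delta>] K.matP_ent matP_\<iota>)
  then show ?thesis using n_pos by (simp add: der_\<iota>'[OF \<delta>] ent_Dm[OF \<delta>] \<iota>_one \<iota>'_one ent_idm)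
qed

text \<open>On \<alpha> the derivation gives its matrix minus the (0, 0) entry times the unit. This
  vanishes exactly for scalar matrices, and the functions \<alpha> determine a derivation of the
  invariants.\<close>

lemma \<Psi>_ker: assumes \<delta>: "\<delta> \<in> Der" shows "\<Psi> \<delta> = 0 \<longleftrightarrow> (\<exists>c. Dm \<delta> = sm c (idm n))"
proof
  assume 0: "\<Psi> \<delta> = 0"
  have "Dm \<delta> = sm (ent (Dm \<delta>) 0 0) (idm n)"
  proof (rule fm_eqI)
    fix i j
    have "\<Psi> \<delta> (psh (zo (\<alpha> i j))) = 0" by (simp add: 0)
    then have "\<delta> (zo (\<alpha> i j)) = 0" by (simp add: \<Psi>_def psh[OF \<alpha>\<beta>_Inv(1)])
    then show "ent (Dm \<delta>) i j = ent (sm (ent (Dm \<delta>) 0 0) (idm n)) i j" by (simp add: der_\<alpha>[OF \<delta>])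
  qed
  then show "\<exists>c. Dm \<delta> = sm c (idm n)" by blast
next
  assume "\<exists>c. Dm \<delta> = sm c (idm n)"
  then obtain c where c: "Dm \<delta> = sm c (idm n)" by blast
  have "\<delta> F = 0" if "F \<in> Inv" for F
    using inv_der_eq[OF Der_inv_der[OF \<delta>] _ _ that, of "\<lambda>_. 0"] n_pos
    by (simp add: inv_der_def der_\<alpha>[OF \<delta>] c ent_idm)
  then show "\<Psi> \<delta> = 0" using pb_Inv by (auto simp: \<Psi>_def zero_outside_def fun_eq_iff)
qed

text \<open>The values of a given derivation on the \<alpha> form a matrix in E, because the
  \<alpha> are the entries of an E-valued function. A tangent vector of G with this matrix agrees
  with the derivation on the \<alpha>, hence on all invariants.\<close>

lemma \<Psi>_onto:
  assumes pj: "\<And>x y. pj (x + y) = pj x + pj y" "\<And>c x. pj (sm c x) = sm c (pj x)" "\<And>y. pj y \<in> E" "\<And>x. x \<in> E \<Longrightarrow> pj x = x"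
    and E: "fm.subspace E" and \<iota>: "\<And>y. y \<in> S \<Longrightarrow> \<iota> y \<in> E" and ex: "\<And>x. x \<in> E \<Longrightarrow> \<exists>\<delta> \<in> Der. Dm \<delta> = x"
    and \<epsilon>: "\<epsilon> \<in> point_derivations Q"
  shows "\<exists>\<delta> \<in> Der. \<Psi> \<delta> = \<epsilon>"
proof -
  define \<Delta> where "\<Delta> F = \<epsilon> (psh F)" for F
  have 1: "psh F Z = F \<one>" if "F \<in> Inv" for F
    using psh(2)[OF that] pb_at[OF one_closed, of "psh F"] by (simp add: Q_one)
  have \<epsilon>r: "\<epsilon> (f + g) = \<epsilon> f + \<epsilon> g" "\<epsilon> (f * g) = f Z * \<epsilon> g + \<epsilon> f * g Z" "\<epsilon> (\<lambda>x. c * f x) = c * \<epsilon> f"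
    if "f \<in> B" "g \<in> B" for f g c using \<epsilon> that by (simp_all add: point_derivations_def)
  have \<Delta>: "inv_der \<Delta>"
    unfolding inv_der_def \<Delta>_def
  proof (intro conjI ballI allI)
    fix F H c assume F: "F \<in> Inv" and H: "H \<in> Inv"
    note r = \<epsilon>r[OF psh(1)[OF F] psh(1)[OF H]]
    show "\<epsilon> (psh (F + H)) = \<epsilon> (psh F) + \<epsilon> (psh H)" unfolding psh_arith by (rule r)
    show "\<epsilon> (psh (F * H)) = F \<one> * \<epsilon> (psh H) + \<epsilon> (psh F) * H \<one>" unfolding psh_arith r 1[OF F] 1[OF H] ..
  next
    fix c F assume F: "F \<in> Inv"
    show "\<epsilon> (psh (\<lambda>x. c * F x)) = c * \<epsilon> (psh F)" unfolding psh_arith by (rule \<epsilon>r(3)[OF psh(1)[OF F] psh(1)[OF F]])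
  qed
  define X where "X = Fm (\<lambda>i j. \<Delta> (zo (\<alpha> i j)))"
  have nz: "i < n \<and> j < n" if nz: "\<Delta> (zo (\<alpha> i j)) \<noteq> 0" for i j
  proof (rule ccontr)
    assume no: "\<not> (i < n \<and> j < n)"
    have "zo (\<alpha> i j) = zo (\<lambda>x. 0)" by (rule zero_outside_cong) (simp add: M_D[OF \<iota>_M no] \<alpha>_def)
    then show False using nz inv_der_const[OF \<Delta>, of 0] by simp
  qed
  have XM: "X \<in> M n n" and entX: "ent X i j = \<Delta> (zo (\<alpha> i j))" for i j
    unfolding X_def using Fm_M[of "\<lambda>i j. \<Delta> (zo (\<alpha> i j))" n n, OF nz] ent_Fm[of "\<lambda>i j. \<Delta> (zo (\<alpha> i j))" n n, OF nz] by simp_all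
  have XE: "X \<in> E"
  proof (rule linear_functional_in_subspace[of pj E Inv \<Delta> "\<lambda>y. if y \<in> S then sm (ent (\<iota>' y) 0 0) (\<iota> y) else 0" n, OF pj])
    show "(\<lambda>y. f y + g y) \<in> Inv" "\<Delta> (\<lambda>y. f y + g y) = \<Delta> f + \<Delta> g" if "f \<in> Inv" "g \<in> Inv" for f g
      using Inv_closed(1)[OF that] \<Delta> that by (simp_all add: inv_der_def plus_fun_def)
    show "(\<lambda>y. c * f y) \<in> Inv" "\<Delta> (\<lambda>y. c * f y) = c * \<Delta> f" if "f \<in> Inv" for c f
      using Inv_closed(2)[OF that that, of c] \<Delta> that by (simp_all add: inv_der_def)
    have e: "(\<lambda>y. ent (if y \<in> S then sm (ent (\<iota>' y) 0 0) (\<iota> y) else 0) i j) = zo (\<alpha> i j)" for i j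
      by (auto simp: \<alpha>_def zero_outside_def)
    show "(\<lambda>y. ent (if y \<in> S then sm (ent (\<iota>' y) 0 0) (\<iota> y) else 0) i j) \<in> Inv" for i j unfolding e by (rule \<alpha>\<beta>_Inv)
    show "ent X i j = \<Delta> (\<lambda>y. ent (if y \<in> S then sm (ent (\<iota>' y) 0 0) (\<iota> y) else 0) i j)" for i j unfolding e by (rule entX)
    fix y
    have "sm (ent (\<iota>' y) 0 0) (\<iota> y) \<in> E \<inter> M n n" if y: "y \<in> S"
      using fm.subspace_scale[OF E \<iota>[OF y]] M_sm[OF \<iota>_M[OF y]] by blast
    then have "(if y \<in> S then sm (ent (\<iota>' y) 0 0) (\<iota> y) else 0) \<in> E \<inter> M n n"
      using fm.subspace_0[OF E] by (cases "y \<in> S") simp_all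
    then show "(if y \<in> S then sm (ent (\<iota>' y) 0 0) (\<iota> y) else 0) \<in> E" "(if y \<in> S then sm (ent (\<iota>' y) 0 0) (\<iota> y) else 0) \<in> M n n"
      by blast+
  qed (assumption | rule XM)+
  from ex[OF XE] obtain \<delta> where \<delta>: "\<delta> \<in> Der" "Dm \<delta> = X" by blast
  \<comment> \<open>Thus the correction by the (0, 0) entry in \<open>der_\<alpha>\<close> vanishes
    for this lift.\<close>
  have "ent X 0 0 = 0" unfolding entX by (rule inv_der_\<beta>(1)[OF \<Delta>])
  then have "\<delta> (zo (\<alpha> i j)) = \<Delta> (zo (\<alpha> i j))" for i j
    unfolding der_\<alpha>[OF \<delta>(1)] \<delta>(2) entX[symmetric] by simp
  from inv_der_eq[OF Der_inv_der[OF \<delta>(1)] \<Delta> this] have \<delta>\<Delta>: "\<delta> F = \<Delta> F" if "F \<in> Inv" for F using that .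
  have "\<Psi> \<delta> f = \<epsilon> f" for f
  proof (cases "f \<in> B")
    case True
    then show ?thesis by (simp add: \<Psi>_def \<delta>\<Delta>[OF pb_Inv[OF True]] \<Delta>_def psh_pb)
  next
    case False
    then show ?thesis using \<epsilon> by (simp add: \<Psi>_def zero_outside_def point_derivations_def)
  qed
  then have "\<Psi> \<delta> = \<epsilon>" by (rule ext)
  then show ?thesis using \<delta>(1) by blast
qed

lemma \<Psi>_bracket:
  assumes \<delta>: "\<delta> \<in> Der" "\<epsilon> \<in> Der"
  shows "lie_bracket (Lie Q) (\<Psi> \<delta>) (\<Psi> \<epsilon>) = \<Psi> (lie_bracket (Lie G) \<delta> \<epsilon>)"
proof -
  have sl: "right_slice Q f (Z #> x) \<in> B \<and> pb (right_slice Q f (Z #> x)) = right_slice G (pb f) x" if f: "f \<in> B" and x: "x \<in> S" for f x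
  proof -
    have e: "pb (right_slice Q f (Z #> x)) = right_slice G (pb f) x"
      unfolding pb_def right_slice_def by (rule zero_outside_cong) (simp add: x Q_carrierI Q_mult)
    then show ?thesis using right_slice_K[OF x, of "pb f"] f unfolding B_iff
      by (simp add: right_slice_def zero_outside_def)
  qed
  have lf: "left_invariant_field Q (\<Psi> \<eta>) f \<in> B \<and> pb (left_invariant_field Q (\<Psi> \<eta>) f) = L \<eta> (pb f)" if f: "f \<in> B" and \<eta>: "\<eta> \<in> Der" for f \<eta>
  proof -
    have e: "pb (left_invariant_field Q (\<Psi> \<eta>) f) = L \<eta> (pb f)"
      by (subst pb_def, unfold left_invariant_field_def, rule zero_outside_cong) (use sl[OF f] in \<open>simp add: Q_carrierI \<Psi>_def\<close>)
    have "pb f \<in> K" using f by (simp add: B_iff)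
    then have "pb (left_invariant_field Q (\<Psi> \<eta>) f) \<in> K" unfolding e by (rule L_K[OF \<eta>])
    moreover have "\<forall>C. C \<notin> rcosets Z \<longrightarrow> left_invariant_field Q (\<Psi> \<eta>) f C = 0"
      by (simp add: left_invariant_field_def zero_outside_def)
    ultimately show ?thesis using e by (simp only: B_iff)
  qed
  show ?thesis
  proof
    fix f
    show "lie_bracket (Lie Q) (\<Psi> \<delta>) (\<Psi> \<epsilon>) f = \<Psi> (lie_bracket (Lie G) \<delta> \<epsilon>) f"
    proof (cases "f \<in> B")
      case True
      have "pb f \<in> K" using True by (simp add: B_iff)
      then show ?thesis using True lf[OF True \<delta>(1)] lf[OF True \<delta>(2)] by (simp add: Lie_def \<Psi>_def)
    next
      case False then show ?thesis by (simp add: Lie_def \<Psi>_def zero_outside_def)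
    qed
  qed
qed

lemma \<Psi>_Ad:
  assumes \<delta>: "\<delta> \<in> Der" and x: "x \<in> S"
  shows "Ad Q (Z #> x) (\<Psi> \<delta>) = \<Psi> (Ad G x \<delta>)"
proof
  fix f
  show "Ad Q (Z #> x) (\<Psi> \<delta>) f = \<Psi> (Ad G x \<delta>) f"
  proof (cases "f \<in> B")
    case True
    let ?h = "zero_outside (carrier Q) (\<lambda>y. f ((Z #> x) \<otimes>\<^bsub>Q\<^esub> y \<otimes>\<^bsub>Q\<^esub> inv\<^bsub>Q\<^esub> (Z #> x)))"
    have e: "pb ?h = zo (\<lambda>y. pb f (x \<otimes> y \<otimes> inv x))"
      unfolding pb_def by (rule zero_outside_cong) (simp add: x Q_carrierI Q_mult Q_inv)
    have k: "pb f \<in> K" using True by (simp add: B_iff)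
    then have hB: "?h \<in> B" using K_translate[of x "inv x" "pb f"] x unfolding B_iff e by (simp add: zero_outside_def)
    have "Ad Q (Z #> x) (\<Psi> \<delta>) f = \<delta> (pb ?h)"
      unfolding Ad_def \<Psi>_def zero_outside_in[OF True] by (rule zero_outside_in[OF hB])
    also have "\<dots> = \<Psi> (Ad G x \<delta>) f" unfolding e using True k by (simp add: \<Psi>_def Ad_def)
    finally show ?thesis .
  next
    case False then show ?thesis by (simp add: Ad_def \<Psi>_def zero_outside_def)
  qed
qed

end

section \<open>From block algebras to the Lie algebras of linear groups and their quotients\<close>

lemma nonzero_coordinate:
  fixes w :: "'k::field fm" assumes "w \<noteq> 0" shows "\<exists>c i j. c * ent w i j = 1"
proof -
  obtain i j where "ent w i j \<noteq> 0" using assms fm_eqI[of w 0] by fastforce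
  then show ?thesis by (intro exI[of _ "inverse (ent w i j)"] exI[of _ i] exI[of _ j]) simp
qed

lemma span_mult:
  fixes w :: "'k::field fm"
  assumes "w \<in> M n n" "w * w = w"
  shows "(sm s (idm n) + sm t w) * (sm s' (idm n) + sm t' w) = sm (s * s') (idm n) + sm (s * t' + t * s' + t * t') w"
    "w * (sm s (idm n) + sm t w) = sm (s + t) w" "(idm n - w) * (sm s (idm n) + sm t w) = sm s (idm n - w)"
proof -
  have 1: "idm n * w = w" "w * idm n = w" "idm n * idm n = (idm n :: 'k fm)"
    using assms(1) M_idm[of n n n, where 'a='k] by (auto simp: M_iff)
  show "(sm s (idm n) + sm t w) * (sm s' (idm n) + sm t' w) = sm (s * s') (idm n) + sm (s * t' + t * s' + t * t') w"
    by (simp add: distrib_left distrib_right 1 assms(2) fm.scale_right_distrib) (rule fm_eqI, simp add: algebra_simps)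
  show "w * (sm s (idm n) + sm t w) = sm (s + t) w"
    by (simp add: distrib_left 1 assms(2) fm.scale_left_distrib)
  show "(idm n - w) * (sm s (idm n) + sm t w) = sm s (idm n - w)"
    by (simp add: distrib_left left_diff_distrib 1 assms(2) fm.scale_right_diff_distrib)
qed

text \<open>For a group whose tangent space is a complement of the scalars in E: E modulo scalars is
  identified with the tangent space, and conjugation fixes scalars, so brackets and Ad are the
  matrix ones.\<close>

lemma (in lin_group) reductive_contact_direct:
  assumes T: "T = tup_r a b \<or> T = tup_q a b" and ev: "even a" "even b" "0 < a + b"
    and n: "n = 2 * a + b" and E: "E = blk a b ` T" and \<iota>E: "\<And>x. x \<in> S \<Longrightarrow> \<iota> x \<in> E"
    and dec: "\<And>x. x \<in> E \<Longrightarrow> \<exists>\<delta> \<in> Der. \<exists>c. Dm \<delta> = x + sm c (idm n)"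
    and one: "\<And>\<delta> c. \<delta> \<in> Der \<Longrightarrow> Dm \<delta> = sm c (idm n) \<Longrightarrow> c = 0"
    and index: "lie_index (Lie G) = 1"
  shows "strongly_quasi_reductive G \<and> contact (Lie G)"
proof -
  let ?e = "idm n :: 'k fm"
  have sa: "subalg a b T" using T subalg_rq by blast
  have EMn: "E \<subseteq> M n n" using subalg_blk(2)[OF sa] unfolding E n .
  have Esub: "fm.subspace E" unfolding E by (rule subalg_blk(1)[OF sa])
  obtain pj where pj: "\<And>x y. pj (x + y) = pj x + pj y" "\<And>c x. pj (sm c x) = sm c (pj x)" "\<And>y. pj y \<in> E"
    "\<And>x. x \<in> E \<Longrightarrow> pj x = x" using blk_projection[OF T] unfolding E by blast
  \<comment> \<open>The derivation whose matrix is x modulo scalars; it is unique because no nonzero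
    scalar is tangent.\<close>
  define \<Phi> where "\<Phi> x = (THE \<delta>. \<delta> \<in> Der \<and> (\<exists>c. Dm \<delta> = x + sm c ?e))" for x
  have ee: "?e * y = y" "y * ?e = y" if "y \<in> M n n" for y using that by (auto simp: M_iff)
  have uniq: "\<delta> = \<epsilon>" if d: "\<delta> \<in> Der" "\<epsilon> \<in> Der" "Dm \<delta> = x + sm c ?e" "Dm \<epsilon> = x + sm d ?e" for \<delta> \<epsilon> x c d
  proof -
    let ?\<eta> = "\<lambda>f. \<delta> f + (- 1) * \<epsilon> f"
    have "?\<eta> \<in> Der" by (intro point_derivations_add point_derivations_scale d)
    moreover have "Dm ?\<eta> = sm (c - d) ?e"
      unfolding Dm_add[OF d(1) point_derivations_scale[OF d(2)]] Dm_scale[OF d(2)] d(3,4) by (rule fm_eqI) (simp add: algebra_simps)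
    ultimately have "c - d = 0" by (rule one)
    then show ?thesis using der_eqI[OF d(1,2)] d(3,4) by simp
  qed
  have \<Phi>I: "\<Phi> x = \<delta>" if d: "\<delta> \<in> Der" "Dm \<delta> = x + sm c ?e" for x \<delta> c
    unfolding \<Phi>_def
  proof (rule the_equality)
    show "\<delta> \<in> Der \<and> (\<exists>c. Dm \<delta> = x + sm c ?e)" using d by blast
    show "\<epsilon> = \<delta>" if e: "\<epsilon> \<in> Der \<and> (\<exists>c. Dm \<epsilon> = x + sm c ?e)" for \<epsilon>
      using uniq[OF conjunct1[OF e] d(1) _ d(2)] conjunct2[OF e] by blast
  qed
  have \<Phi>: "\<Phi> x \<in> Der \<and> (\<exists>c. Dm (\<Phi> x) = x + sm c ?e)" if x: "x \<in> E" for x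
  proof -
    obtain \<delta> c where d: "\<delta> \<in> Der" "Dm \<delta> = x + sm c ?e" using dec[OF x] by blast
    show ?thesis unfolding \<Phi>I[OF d] using d by blast
  qed
  have DmE: "Dm \<delta> \<in> E" if "\<delta> \<in> Der" for \<delta> by (rule Dm_subspace[OF pj Esub \<iota>E that])
  have zD: "(\<lambda>_. 0) \<in> Der" "Dm (\<lambda>_. 0) = 0"
  proof -
    show 1: "(\<lambda>_. 0) \<in> Der" by (simp add: point_derivations_def)
    show "Dm (\<lambda>_. 0) = 0" by (rule fm_eqI) (simp add: ent_Dm[OF 1])
  qed
  show ?thesis
  proof (rule quasi_reductive_contact[OF T ev n E, where \<Phi> = \<Phi> and \<rho> = \<iota>])
    fix x y assume x: "x \<in> E" and y: "y \<in> E"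
    obtain c d where c: "Dm (\<Phi> x) = x + sm c ?e" and d: "Dm (\<Phi> y) = y + sm d ?e" using \<Phi>[OF x] \<Phi>[OF y] by blast
    note D = conjunct1[OF \<Phi>[OF x]] conjunct1[OF \<Phi>[OF y]]
    have "Dm (\<lambda>f. \<Phi> x f + \<Phi> y f) = (x + y) + sm (c + d) ?e"
      unfolding Dm_add[OF D] c d by (simp add: fm.scale_left_distrib algebra_simps)
    from \<Phi>I[OF point_derivations_add[OF D] this] show "\<Phi> (x + y) = \<Phi> x + \<Phi> y" by (simp add: plus_fun_def)
    have "Dm (lie_bracket (Lie G) (\<Phi> x) (\<Phi> y)) = (x * y - y * x) + sm 0 ?e"
      unfolding bracket(2)[OF D] c d using ee subsetD[OF EMn x] subsetD[OF EMn y] by (simp add: distrib_left distrib_right fm.scale_right_distrib mult.commute[of c d])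
    from \<Phi>I[OF bracket(1)[OF D] this] show "lie_bracket (Lie G) (\<Phi> x) (\<Phi> y) = \<Phi> (x * y - y * x)" by simp
  next
    fix c x assume x: "x \<in> E"
    obtain d where d: "Dm (\<Phi> x) = x + sm d ?e" using \<Phi>[OF x] by blast
    note D = conjunct1[OF \<Phi>[OF x]]
    have "Dm (\<lambda>f. c * \<Phi> x f) = sm c x + sm (c * d) ?e" unfolding Dm_scale[OF D] d by (simp add: fm.scale_right_distrib)
    from \<Phi>I[OF point_derivations_scale[OF D] this] show "\<Phi> (sm c x) = (\<lambda>f. c * \<Phi> x f)" .
  next
    show "\<Phi> ` E = Der"
    proof (intro equalityI subsetI)
      show "\<delta> \<in> Der" if d: "\<delta> \<in> \<Phi> ` E" for \<delta>
      proof -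
        obtain x where x: "x \<in> E" "\<delta> = \<Phi> x" using d by (rule imageE)
        show ?thesis using conjunct1[OF \<Phi>[OF x(1)]] by (simp only: x(2))
      qed
      show "\<delta> \<in> \<Phi> ` E" if d: "\<delta> \<in> Der" for \<delta>
      proof -
        have "\<Phi> (Dm \<delta>) = \<delta>" by (rule \<Phi>I[OF d, of _ 0]) simp
        then show ?thesis using imageI[OF DmE[OF d], of \<Phi>] by simp
      qed
    qed
  next
    fix x assume x: "x \<in> E"
    show "\<Phi> x = 0 \<longleftrightarrow> (\<exists>c. x = sm c ?e)"
    proof
      assume "\<Phi> x = 0"
      moreover obtain c where "Dm (\<Phi> x) = x + sm c ?e" using \<Phi>[OF x] by blast
      ultimately have "x + sm c ?e = 0" using zD(2) by (simp add: zero_fun_def)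
      then have "x = sm (- c) ?e" by (simp add: eq_neg_iff_add_eq_0)
      then show "\<exists>c. x = sm c ?e" by blast
    next
      assume "\<exists>c. x = sm c ?e"
      then obtain c where "x = sm c ?e" by blast
      then have "Dm (\<lambda>_. 0) = x + sm (- c) ?e" by (simp add: zD(2))
      from \<Phi>I[OF zD(1) this] show "\<Phi> x = 0" by (simp add: zero_fun_def)
    qed
  next
    fix g assume g: "g \<in> S"
    obtain g' where g': "g' \<in> S" "\<iota> g' = \<iota>' g" using \<iota>_inv_ex[OF g] by blast
    have r: "\<iota>' g \<in> E" using \<iota>E[OF g'(1)] g'(2) by simp
    show "\<iota> g \<in> E \<and> (\<exists>r'\<in>E. r' * \<iota> g = ?e \<and> (\<forall>x\<in>E. Ad G g (\<Phi> x) = \<Phi> (\<iota> g * x * r')))"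
    proof (intro conjI \<iota>E[OF g] bexI[OF _ r] \<iota>'_\<iota>[OF g] ballI)
      fix x assume x: "x \<in> E"
      obtain d where d: "Dm (\<Phi> x) = x + sm d ?e" using \<Phi>[OF x] by blast
      note D = conjunct1[OF \<Phi>[OF x]]
      have "Dm (Ad G g (\<Phi> x)) = \<iota> g * x * \<iota>' g + sm d ?e"
        unfolding Ad_der(2)[OF g D] d by (simp add: distrib_left distrib_right ee(2)[OF \<iota>_M[OF g]] \<iota>_\<iota>'[OF g])
      from \<Phi>I[OF Ad_der(1)[OF g D] this] show "Ad G g (\<Phi> x) = \<Phi> (\<iota> g * x * \<iota>' g)" ..
    qed
  next
    fix w H u assume w: "w \<in> E" "w * w = w" "w \<noteq> 0" "w \<noteq> ?e" and H: "H \<subseteq> S" "\<one> \<in> H" "\<And>x y. x \<in> H \<Longrightarrow> y \<in> H \<Longrightarrow> x \<otimes> y \<in> H"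
      and sp: "\<And>g. g \<in> H \<Longrightarrow> \<exists>s t. \<iota> g = sm s ?e + sm t w" and u: "u \<in> H" "unipotent (alg_subgroup G H) u"
    have wM: "w \<in> M n n" using w(1) EMn by blast
    note sm_rules = span_mult[OF wM w(2)]
    obtain s' t' where st': "\<iota> u = sm s' ?e + sm t' w" using sp[OF u(1)] by blast
    have one_sp: "\<iota> \<one> = sm 1 ?e + sm 0 w" by (simp add: \<iota>_one)
    \<comment> \<open>s + t w acts on w by s + t and on 1 - w by s. Both are characters given by
      regular functions, so they take the value 1 at a unipotent element.\<close>
    have char: "\<chi> s' t' = 1"
      if v: "\<And>s t. v * (sm s ?e + sm t w) = sm (\<chi> s t) v" "v \<noteq> 0" "\<chi> 1 0 = 1"
        "\<And>s t s' t'. \<chi> (s * s') (s * t' + t * s' + t * t') = \<chi> s t * \<chi> s' t'" for v and \<chi> :: "'k \<Rightarrow> 'k \<Rightarrow> 'k"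
    proof -
      obtain c i j where c: "c * ent v i j = 1" using nonzero_coordinate[OF v(2)] by blast
      define f where "f = zo (\<lambda>x. c * ent (v * \<iota> x) i j)"
      have f: "f x = \<chi> s t" if "x \<in> S" "\<iota> x = sm s ?e + sm t w" for x s t
        using that c by (simp add: f_def v(1) mult.left_commute)
      show ?thesis
      proof (rule character_unipotent[OF H(2,3) u])
        show "f \<in> K" unfolding f_def by (intro K.mult K.const K.matP_ent K.matP_times K.matP_const matP_\<iota>)
        show "f \<one> \<noteq> 0" using f[OF one_closed one_sp] v(3) by simp
        fix x assume x: "x \<in> H"
        obtain s t where st: "\<iota> x = sm s ?e + sm t w" using sp[OF x] by blast
        have xS: "x \<in> S" "u \<in> S" using x u(1) H(1) by auto
        have "f (x \<otimes> u) = \<chi> (s * s') (s * t' + t * s' + t * t')"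
          by (rule f) (simp_all only: m_closed xS \<iota>_mult st st' sm_rules(1))
        then show "f (x \<otimes> u) = \<chi> s' t' * f x" by (simp only: f[OF xS(1) st] v(4) mult.commute[of "\<chi> s t"])
      qed
    qed
    have "s' + t' = 1" by (rule char[OF sm_rules(2) w(3)]) (simp_all add: algebra_simps)
    moreover have "s' = 1" by (rule char[OF sm_rules(3)]) (use w(4) in simp_all)
    ultimately have "t' = 0" "s' = 1" by simp_all
    then have "\<iota> u = \<iota> \<one>" unfolding st' \<iota>_one by simp
    then show "u = \<one>" by (rule inj_onD[OF \<iota>_inj _ subsetD[OF H(1) u(1)] one_closed])
  qed (rule index)
qed

text \<open>Here the tangent space of G is all of E and \<Psi> divides out the scalars. An element s
  + t w counts only up to scalars, so the ratio (s + t)/s is the character that detects it.\<close>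

lemma (in lin_group_scalars) reductive_contact_quotient:
  assumes T: "T = tup_r a b \<or> T = tup_q a b" and ev: "even a" "even b" "0 < a + b"
    and n: "n = 2 * a + b" and E: "E = blk a b ` T" and \<iota>E: "\<And>x. x \<in> S \<Longrightarrow> \<iota> x \<in> E"
    and ex: "\<And>x. x \<in> E \<Longrightarrow> \<exists>\<delta> \<in> Der. Dm \<delta> = x"
    and index: "lie_index (Lie Q) = 1"
  shows "strongly_quasi_reductive Q \<and> contact (Lie Q)"
proof -
  let ?e = "idm n :: 'b fm"
  have sa: "subalg a b T" using T subalg_rq by blast
  have EMn: "E \<subseteq> M n n" using subalg_blk(2)[OF sa] unfolding E n .
  have Esub: "fm.subspace E" unfolding E by (rule subalg_blk(1)[OF sa])
  obtain pj where pj: "\<And>x y. pj (x + y) = pj x + pj y" "\<And>c x. pj (sm c x) = sm c (pj x)" "\<And>y. pj y \<in> E"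
    "\<And>x. x \<in> E \<Longrightarrow> pj x = x" using blk_projection[OF T] unfolding E by blast
  define dv where "dv x = (THE \<delta>. \<delta> \<in> Der \<and> Dm \<delta> = x)" for x
  have dvI: "dv x = \<delta>" if "\<delta> \<in> Der" "Dm \<delta> = x" for x \<delta>
    unfolding dv_def
  proof (rule the_equality)
    show "\<epsilon> = \<delta>" if e: "\<epsilon> \<in> Der \<and> Dm \<epsilon> = x" for \<epsilon>
      using der_eqI[OF conjunct1[OF e] \<open>\<delta> \<in> Der\<close>] \<open>Dm \<delta> = x\<close> e by simp
  qed (use that in blast)
  have dv: "dv x \<in> Der" "Dm (dv x) = x" if x: "x \<in> E" for x
  proof -
    obtain \<delta> where d: "\<delta> \<in> Der" "Dm \<delta> = x" using ex[OF x] by blast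
    show "dv x \<in> Der" "Dm (dv x) = x" using d dvI[OF d] by simp_all
  qed
  have DmE: "Dm \<delta> \<in> E" if "\<delta> \<in> Der" for \<delta> by (rule Dm_subspace[OF pj Esub \<iota>E that])
  define \<Phi> where "\<Phi> x = \<Psi> (dv x)" for x
  show ?thesis
  proof (rule quasi_reductive_contact[OF T ev n E, where \<Phi> = \<Phi> and \<rho> = "\<lambda>C. \<iota> (rep C)"])
    fix x y assume x: "x \<in> E" and y: "y \<in> E"
    note D = dv(1)[OF x] dv(1)[OF y]
    have "dv (x + y) = (\<lambda>f. dv x f + dv y f)"
      by (rule dvI[OF point_derivations_add[OF D]]) (simp add: Dm_add D dv x y)
    then show "\<Phi> (x + y) = \<Phi> x + \<Phi> y" by (auto simp: \<Phi>_def \<Psi>_def zero_outside_def fun_eq_iff)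
    have "dv (x * y - y * x) = lie_bracket (Lie G) (dv x) (dv y)"
      by (rule dvI[OF bracket(1)[OF D]]) (simp add: bracket(2)[OF D] dv x y)
    then show "lie_bracket (Lie Q) (\<Phi> x) (\<Phi> y) = \<Phi> (x * y - y * x)" by (simp add: \<Phi>_def \<Psi>_bracket[OF D])
  next
    fix c x assume x: "x \<in> E"
    have "dv (sm c x) = (\<lambda>f. c * dv x f)"
      by (rule dvI[OF point_derivations_scale[OF dv(1)[OF x]]]) (simp add: Dm_scale dv x)
    then show "\<Phi> (sm c x) = (\<lambda>f. c * \<Phi> x f)" by (auto simp: \<Phi>_def \<Psi>_def zero_outside_def fun_eq_iff)
  next
    show "\<Phi> ` E = point_derivations Q"
    proof (intro equalityI subsetI)
      show "\<delta> \<in> point_derivations Q" if d: "\<delta> \<in> \<Phi> ` E" for \<delta>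
      proof -
        obtain x where x: "x \<in> E" "\<delta> = \<Phi> x" using d by (rule imageE)
        show ?thesis using \<Psi>_der[OF dv(1)[OF x(1)]] by (simp only: x(2) \<Phi>_def)
      qed
      show "\<epsilon> \<in> \<Phi> ` E" if e: "\<epsilon> \<in> point_derivations Q" for \<epsilon>
      proof -
        obtain \<delta> where d: "\<delta> \<in> Der" "\<Psi> \<delta> = \<epsilon>" using \<Psi>_onto[OF pj Esub \<iota>E ex e] by blast
        have "\<Phi> (Dm \<delta>) = \<epsilon>" using dvI[OF d(1) refl] d(2) by (simp add: \<Phi>_def)
        then show ?thesis using imageI[OF DmE[OF d(1)], of \<Phi>] by simp
      qed
    qed
  next
    fix x assume x: "x \<in> E"
    show "\<Phi> x = 0 \<longleftrightarrow> (\<exists>c. x = sm c ?e)" using \<Psi>_ker[OF dv(1)[OF x]] by (simp add: \<Phi>_def dv(2)[OF x])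
  next
    fix C assume "C \<in> carrier Q"
    then have r: "rep C \<in> S" "Z #> rep C = C" by (simp_all add: rep)
    obtain g' where g': "g' \<in> S" "\<iota> g' = \<iota>' (rep C)" using \<iota>_inv_ex[OF r(1)] by blast
    have r': "\<iota>' (rep C) \<in> E" using \<iota>E[OF g'(1)] g'(2) by simp
    show "\<iota> (rep C) \<in> E \<and> (\<exists>r'\<in>E. r' * \<iota> (rep C) = ?e \<and> (\<forall>x\<in>E. Ad Q C (\<Phi> x) = \<Phi> (\<iota> (rep C) * x * r')))"
    proof (intro conjI \<iota>E[OF r(1)] bexI[OF _ r'] \<iota>'_\<iota>[OF r(1)] ballI)
      fix x assume x: "x \<in> E"
      have "Ad Q C (\<Phi> x) = \<Psi> (Ad G (rep C) (dv x))"
        using \<Psi>_Ad[OF dv(1)[OF x] r(1)] by (simp add: r(2) \<Phi>_def)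
      moreover have "dv (\<iota> (rep C) * x * \<iota>' (rep C)) = Ad G (rep C) (dv x)"
        by (rule dvI[OF Ad_der(1)[OF r(1) dv(1)[OF x]]]) (simp add: Ad_der(2)[OF r(1) dv(1)[OF x]] dv(2)[OF x])
      ultimately show "Ad Q C (\<Phi> x) = \<Phi> (\<iota> (rep C) * x * \<iota>' (rep C))" by (simp add: \<Phi>_def)
    qed
  next
    fix w H u assume w: "w \<in> E" "w * w = w" "w \<noteq> 0" "w \<noteq> ?e" and H: "H \<subseteq> carrier Q" "\<one>\<^bsub>Q\<^esub> \<in> H"
        "\<And>x y. x \<in> H \<Longrightarrow> y \<in> H \<Longrightarrow> x \<otimes>\<^bsub>Q\<^esub> y \<in> H"
      and sp: "\<And>C. C \<in> H \<Longrightarrow> \<exists>s t. \<iota> (rep C) = sm s ?e + sm t w" and u: "u \<in> H" "unipotent (alg_subgroup Q H) u"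
    have wM: "w \<in> M n n" using w(1) EMn by blast
    note sm_rules = span_mult[OF wM w(2)]
    have w'0: "?e - w \<noteq> 0" using w(4) by simp
    obtain c i j where c: "c * ent w i j = 1" using nonzero_coordinate[OF w(3)] by blast
    obtain c' i' j' where c': "c' * ent (?e - w) i' j' = 1" using nonzero_coordinate[OF w'0] by blast
    \<comment> \<open>The first factor gives s + t through \<iota> on w, the second 1/s through
      \<iota>' on 1 - w. The degrees cancel, so f descends to the quotient.\<close>
    define f where "f = (\<lambda>x. (c * ent (w * \<iota> x) i j) * (c' * ent ((?e - w) * \<iota>' x) i' j'))"
    have fI: "zo f \<in> Inv"
      unfolding Inv_def mem_Collect_eq
    proof (intro conjI ballI allI impI)
      show "zo f \<in> K" unfolding f_def by (intro K.mult K.const K.matP_ent K.matP_times K.matP_const matP_\<iota>)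
      fix x y d assume *: "x \<in> S" "y \<in> S" "d \<noteq> 0" "\<iota> y = sm d (\<iota> x)"
      show "zo f y = zo f x" using * \<iota>'_scale[OF *] by (simp add: f_def)
    qed
    have f: "s \<noteq> 0 \<and> f x = (s + t) * inverse s" if x: "x \<in> S" "\<iota> x = sm s ?e + sm t w" for x s t
    proof -
      have 1: "?e - w = sm s ((?e - w) * \<iota>' x)"
      proof -
        have "?e - w = (?e - w) * (\<iota> x * \<iota>' x)" using M_diff[OF M_idm[OF le_refl le_refl] wM] by (simp add: \<iota>_\<iota>'[OF x(1)] M_iff)
        also have "\<dots> = ((?e - w) * \<iota> x) * \<iota>' x" by (simp only: mult.assoc)
        also have "\<dots> = sm s ((?e - w) * \<iota>' x)" unfolding x(2) sm_rules(3) by (rule sm_times)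
        finally show ?thesis .
      qed
      then have s: "s \<noteq> 0" using w'0 by auto
      have "ent (?e - w) i' j' = s * ent ((?e - w) * \<iota>' x) i' j'" using arg_cong[OF 1, of "\<lambda>z. ent z i' j'"] by (simp only: ent_sm)
      then have "s * (c' * ent ((?e - w) * \<iota>' x) i' j') = 1" using c' by (simp only: mult.left_commute)
      then have "c' * ent ((?e - w) * \<iota>' x) i' j' = inverse s" using s by (simp add: field_simps)
      moreover have "c * ent (w * \<iota> x) i j = s + t" unfolding x(2) sm_rules(2) ent_sm using c by (simp add: mult.left_commute)
      ultimately show ?thesis using s by (simp add: f_def)
    qed
    have pf: "psh (zo f) (Z #> x) = f x" if "x \<in> S" for x
      using pb_at[OF that, of "psh (zo f)"] by (simp add: psh(2)[OF fI] that)
    have r: "rep C \<in> S" "Z #> rep C = C" if "C \<in> H" for C using that H(1) rep by auto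
    obtain s' t' where st': "\<iota> (rep u) = sm s' ?e + sm t' w" using sp[OF u(1)] by blast
    have "(s' + t') * inverse s' = 1"
    proof (rule character_unipotent[OF H(2,3) u, of "psh (zo f)"])
      show "psh (zo f) \<in> B" by (rule psh(1)[OF fI])
      have "f \<one> = (1 + 0) * inverse 1" using f[OF one_closed, of 1 0] by (simp add: \<iota>_one)
      then show "psh (zo f) \<one>\<^bsub>Q\<^esub> \<noteq> 0" using pf[OF one_closed] by (simp add: Q_one)
      fix C assume C: "C \<in> H"
      obtain s t where st: "\<iota> (rep C) = sm s ?e + sm t w" using sp[OF C] by blast
      have "\<iota> (rep C \<otimes> rep u) = sm (s * s') ?e + sm (s * t' + t * s' + t * t') w"
        by (simp only: \<iota>_mult r(1)[OF C] r(1)[OF u(1)] st st' sm_rules(1))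
      from f[OF m_closed[OF r(1)[OF C] r(1)[OF u(1)]] this]
      have "f (rep C \<otimes> rep u) = (s * s' + (s * t' + t * s' + t * t')) * inverse (s * s')" by blast
      also have "\<dots> = (s' + t') * inverse s' * f (rep C)"
        using f[OF r(1)[OF C] st] f[OF r(1)[OF u(1)] st'] by (simp add: field_simps)
      finally have "psh (zo f) (Z #> (rep C \<otimes> rep u)) = (s' + t') * inverse s' * psh (zo f) (Z #> rep C)"
        unfolding pf[OF r(1)[OF C]] pf[OF m_closed[OF r(1)[OF C] r(1)[OF u(1)]]] .
      moreover have "Z #> (rep C \<otimes> rep u) = C \<otimes>\<^bsub>Q\<^esub> u"
        using Q_mult[OF r(1)[OF C] r(1)[OF u(1)]] by (simp add: r(2)[OF C] r(2)[OF u(1)])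
      ultimately show "psh (zo f) (C \<otimes>\<^bsub>Q\<^esub> u) = (s' + t') * inverse s' * psh (zo f) C" by (simp add: r(2)[OF C])
    qed
    moreover have s': "s' \<noteq> 0" using f[OF r(1)[OF u(1)] st'] by blast
    ultimately have "t' = 0" by (simp add: field_simps)
    then have "\<exists>c. c \<noteq> 0 \<and> \<iota> (rep u) = sm c (\<iota> \<one>)" using st' s' by (auto simp: \<iota>_one)
    then have "Z #> \<one> = Z #> rep u" using coset_eq[OF one_closed r(1)[OF u(1)]] by blast
    then show "u = \<one>\<^bsub>Q\<^esub>" unfolding Q_one r(2)[OF u(1)] Q_simps ..
  qed (rule index)
qed

section \<open>The group R(a, b) as the unit group of block matrices\<close>

lemma mat_inv_dim [simp]: "dim_row (mat_inv A) = dim_row A" "dim_col (mat_inv A) = dim_col A"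
  by (simp_all add: mat_inv_def adj_mat_def)

lemma of_mat_arith:
  "dim_col A = dim_row B \<Longrightarrow> of_mat (A * B) = of_mat A * of_mat B"
  "dim_row A = dim_row C \<Longrightarrow> dim_col A = dim_col C \<Longrightarrow> of_mat (A + C) = of_mat A + of_mat C"
  "dim_row A = dim_row C \<Longrightarrow> dim_col A = dim_col C \<Longrightarrow> of_mat (A - C) = of_mat A - of_mat C"
  by (rule of_mat_times[of A "dim_row A" "dim_col A" B "dim_col B"], auto,
      rule of_mat_add[of A "dim_row A" "dim_col A"], auto, rule of_mat_minus[of A "dim_row A" "dim_col A"], auto)

lemma fm_left_inverse:
  fixes x y :: "'k::field fm"
  assumes "x \<in> M n n" "y \<in> M n n" "x * y = idm n" shows "y * x = idm n"
proof -
  have c: "to_mat n n x \<in> carrier_mat n n" "to_mat n n y \<in> carrier_mat n n" by auto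
  have m: "of_mat (to_mat n n x) = x" "of_mat (to_mat n n y) = y" using assms(1,2) by (auto intro: of_mat_to_mat)
  have "to_mat n n x * to_mat n n y = 1\<^sub>m n"
    by (rule of_mat_inj[of _ n n]) (simp_all add: of_mat_times[OF c] m of_mat_one assms(3) mult_carrier_mat[OF c])
  then have "to_mat n n y * to_mat n n x = 1\<^sub>m n" by (rule mat_mult_left_right_inverse[OF c])
  then show ?thesis using of_mat_times[OF c(2,1)] m by (simp add: of_mat_one)
qed

lemma det_mat_inv: assumes "A \<in> carrier_mat m m" "det A \<noteq> 0" shows "det (mat_inv A) * det A = 1"
proof -
  have c: "mat_inv A \<in> carrier_mat m m" by (rule mat_inv_carrier[OF assms(1)])
  have "mat_inv A * A = 1\<^sub>m m"
    by (rule of_mat_inj[of _ m m]) (use c assms(1) in \<open>simp_all add: of_mat_times[OF c assms(1)] mat_inv(2)[OF assms] of_mat_one\<close>)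
  then show ?thesis using det_mult[OF c assms(1)] by simp
qed

lemma det_to_mat_times: assumes "x \<in> M m m" "y \<in> M m m" shows "det (to_mat m m (x * y)) = det (to_mat m m x) * det (to_mat m m y)"
proof -
  have "to_mat m m (x * y) = to_mat m m x * to_mat m m y"
    by (rule of_mat_inj[of _ m m])
       (simp_all add: of_mat_times[of _ m m _ m] of_mat_to_mat assms M_times[OF assms] mult_carrier_mat[of _ m m _ m])
  then show ?thesis by (simp add: det_mult[of _ m])
qed

lemma to_mat_idm: "to_mat m m (idm m) = 1\<^sub>m m"
  unfolding of_mat_one[symmetric] by (rule to_mat_of_mat) simp

lemma (in function_algebra) entries_P:
  assumes "matP (\<lambda>x. of_mat (Y x))" "\<And>x. x \<in> S \<Longrightarrow> Y x \<in> carrier_mat m n" "f \<in> entries Y m n"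
  shows "P f"
proof -
  obtain i j where f: "f = (\<lambda>x. Y x $$ (i, j))" "i < m" "j < n" using assms(3) by (auto simp: entries_def)
  show ?thesis
  proof (rule cong)
    show "P (\<lambda>x. ent (of_mat (Y x)) i j)" by (rule matP_ent[OF assms(1)])
    show "ent (of_mat (Y x)) i j = f x" if "x \<in> S" for x using assms(2)[OF that] f(2,3) by (simp add: ent_of_mat f(1))
  qed
qed

lemma matP_entries:
  assumes "\<And>x. x \<in> S \<Longrightarrow> Y x \<in> carrier_mat m n" "entries Y m n \<subseteq> F"
  shows "reg.matP S F (\<lambda>x. of_mat (Y x))"
  by (rule reg.matP_of_mat[OF assms(1)], assumption, rule reg_gen, rule subsetD[OF assms(2)]) (auto simp: entries_def)

lemma sm_half: "sm (inverse 2) x + sm (inverse 2) x = (x :: 'k::field_char_0 fm)"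
  by (rule fm_eqI) (simp add: field_simps)

lemma sm_half_bracket:
  fixes A A' w w' :: "'k::field_char_0 fm"
  shows "sm (inverse 2) (A * w' - A' * w) + sm (inverse 2) ((A + A') * (w + w')) =
    A * w' + sm (inverse 2) (A * w) + sm (inverse 2) (A' * w')"
  unfolding distrib_left distrib_right by (rule fm_eqI) (simp add: field_simps)

text \<open>The homomorphism property on block tuples. The half commutator in the group law together
  with half the product of the sums yields the term A w' and the two separate halves, as in the
  exponential law.\<close>

lemma R_tuple_mult:
  fixes G Gi G2 K Ki Ki2 A w v A2 w2 v2 :: "'k::field_char_0 fm"
  assumes m: "G2 \<in> M a a" "Ki2 \<in> M b b" "w2 \<in> M a b" "K \<in> M b b" and i: "Gi * G = idm a" "K * Ki = idm b"
  shows "mul5 (G, A * G, Ki, w * Ki, (v + sm (inverse 2) (A * w)) * Ki)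
      (G2, A2 * G2, Ki2, w2 * Ki2, (v2 + sm (inverse 2) (A2 * w2)) * Ki2) =
    (G * G2, (A + G * A2 * Gi) * (G * G2), Ki * Ki2, (w + G * w2 * K) * (Ki * Ki2),
     (v + G * v2 * K + sm (inverse 2) (A * (G * w2 * K) - (G * A2 * Gi) * w) +
       sm (inverse 2) ((A + G * A2 * Gi) * (w + G * w2 * K))) * (Ki * Ki2))"
proof -
  have r1: "Gi * (G * z) = z" if "z \<in> M a q" for z q
    using idm_times[OF that le_refl] by (simp add: mult.assoc[symmetric] i)
  have r2: "K * (Ki * z) = z" if "z \<in> M b q" for z q
    using idm_times[OF that le_refl] by (simp add: mult.assoc[symmetric] i)
  note r = r1[OF m(1)] r2[OF m(2)] r1[OF M_times[OF m(3) m(2)]] r1[OF M_times[OF m(3) m(4)]]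
  have e: "v + G * v2 * K + sm (inverse 2) (A * (G * w2 * K) - (G * A2 * Gi) * w) +
       sm (inverse 2) ((A + G * A2 * Gi) * (w + G * w2 * K)) =
     v + G * v2 * K + (A * (G * w2 * K) + sm (inverse 2) (A * w) + sm (inverse 2) (G * A2 * Gi * (G * w2 * K)))"
    unfolding add.assoc[of "v + G * v2 * K"] sm_half_bracket ..
  show ?thesis unfolding mul5_def e
    by (simp add: distrib_left distrib_right mult.assoc r add_ac)
qed

text \<open>exp(A + w + v) is the unipotent block matrix with blocks A, w and v + A w / 2,
  multiplied by diag(g, g, k) with k the inverse transpose of h. Then the action of (g, h) on w
  becomes g w k^(-1), that is, conjugation.\<close>

definition \<iota>R :: "nat \<Rightarrow> nat \<Rightarrow> 'k mat \<times> 'k mat \<times> 'k mat \<times> 'k mat \<times> 'k mat \<Rightarrow> 'k::field_char_0 fm" where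
  "\<iota>R a b = (\<lambda>(g, h, A, w, v). blk a b (of_mat g, of_mat A * of_mat g, tpose (of_mat (mat_inv h)),
     of_mat w * tpose (of_mat (mat_inv h)),
     (of_mat v + sm (inverse 2) (of_mat A * of_mat w)) * tpose (of_mat (mat_inv h))))"

definition \<iota>R' :: "nat \<Rightarrow> nat \<Rightarrow> 'k mat \<times> 'k mat \<times> 'k mat \<times> 'k mat \<times> 'k mat \<Rightarrow> 'k::field_char_0 fm" where
  "\<iota>R' a b = (\<lambda>(g, h, A, w, v). blk a b (of_mat (mat_inv g), - (of_mat (mat_inv g) * of_mat A), tpose (of_mat h),
     - (of_mat (mat_inv g) * of_mat w),
     of_mat (mat_inv g) * (sm (inverse 2) (of_mat A * of_mat w) - of_mat v)))"

lemma R_carrier: "(g, h, A, w, v) \<in> carrier (R_group a b) \<longleftrightarrow> g \<in> carrier_mat a a \<and> h \<in> carrier_mat b b \<and>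
    det g \<noteq> 0 \<and> det h \<noteq> 0 \<and> A \<in> carrier_mat a a \<and> w \<in> carrier_mat a b \<and> v \<in> carrier_mat a b"
  by (simp add: R_group_def Let_def)

lemma R_tuple:
  assumes "(g, h, A, w, v) \<in> carrier (R_group a b)"
  shows "of_mat g \<in> M a a" "of_mat (mat_inv g) \<in> M a a" "tpose (of_mat h) \<in> M b b" "tpose (of_mat (mat_inv h)) \<in> M b b"
    "of_mat A \<in> M a a" "of_mat w \<in> M a b" "of_mat v \<in> M a b"
    "of_mat g * of_mat (mat_inv g) = idm a" "of_mat (mat_inv g) * of_mat g = idm a"
    "tpose (of_mat h) * tpose (of_mat (mat_inv h)) = idm b" "tpose (of_mat (mat_inv h)) * tpose (of_mat h) = idm b"
  using assms mat_inv[of g a] mat_inv[of h b]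
  by (simp_all add: R_carrier M_of_mat M_tpose mat_inv_carrier tpose_times[symmetric])

lemma \<iota>R_tup:
  assumes "(g, h, A, w, v) \<in> carrier (R_group a b)"
  shows "(of_mat g, of_mat A * of_mat g, tpose (of_mat (mat_inv h)), of_mat w * tpose (of_mat (mat_inv h)),
     (of_mat v + sm (inverse 2) (of_mat A * of_mat w)) * tpose (of_mat (mat_inv h))) \<in> tup_r a b"
    "(of_mat (mat_inv g), - (of_mat (mat_inv g) * of_mat A), tpose (of_mat h), - (of_mat (mat_inv g) * of_mat w),
     of_mat (mat_inv g) * (sm (inverse 2) (of_mat A * of_mat w) - of_mat v)) \<in> tup_r a b"
  unfolding tup_r_def mem_Collect_eq prod.case
  by (intro conjI; (rule M_times M_add M_diff M_sm M_uminus R_tuple[OF assms])+)+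

lemma \<iota>R_M: assumes "x \<in> carrier (R_group a b)" shows "\<iota>R a b x \<in> M (2 * a + b) (2 * a + b)" "\<iota>R' a b x \<in> M (2 * a + b) (2 * a + b)"
    "\<iota>R a b x \<in> blk a b ` tup_r a b"
proof -
  obtain g h A w v where x: "x = (g, h, A, w, v)" by (cases x)
  note t = \<iota>R_tup[OF assms[unfolded x]]
  show "\<iota>R a b x \<in> M (2 * a + b) (2 * a + b)" "\<iota>R' a b x \<in> M (2 * a + b) (2 * a + b)" "\<iota>R a b x \<in> blk a b ` tup_r a b"
    unfolding x \<iota>R_def \<iota>R'_def prod.case by (rule blk_M[OF t(1)], rule blk_M[OF t(2)], rule imageI[OF t(1)])
qed

lemma \<iota>R_inverse: assumes "x \<in> carrier (R_group a b)" shows "\<iota>R a b x * \<iota>R' a b x = idm (2 * a + b)"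
proof -
  obtain g h A w v where x: "x = (g, h, A, w, v)" by (cases x)
  note t = \<iota>R_tup[OF assms[unfolded x]] and f = R_tuple[OF assms[unfolded x]]
  have r1: "of_mat g * (of_mat (mat_inv g) * z) = z" if "z \<in> M a q" for z q
    using idm_times[OF that le_refl] by (simp add: mult.assoc[symmetric] f)
  have Aw: "of_mat A * of_mat w \<in> M a b" by (rule M_times[OF f(5,6)])
  have s: "sm (inverse 2) (of_mat A * of_mat w) - of_mat v - of_mat A * of_mat w + (of_mat v + sm (inverse 2) (of_mat A * of_mat w)) = 0"
    using sm_half[of "of_mat A * of_mat w"] by (simp add: algebra_simps)
  have 1: "\<iota>R a b x * \<iota>R' a b x = blk a b (one5 a b)"
    unfolding x \<iota>R_def \<iota>R'_def prod.case blk_mult[OF t]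
  proof (rule arg_cong[of _ _ "blk a b"], unfold mul5_def one5_def prod.case, intro arg_cong2[of _ _ _ _ Pair])
    show "of_mat g * - (of_mat (mat_inv g) * of_mat A) + of_mat A * of_mat g * of_mat (mat_inv g) = 0"
      by (simp add: mult.assoc f(8) r1[OF f(5)] times_idm[OF f(5)])
    show "of_mat g * - (of_mat (mat_inv g) * of_mat w) + of_mat w * tpose (of_mat (mat_inv h)) * tpose (of_mat h) = 0"
      by (simp add: mult.assoc f(11) r1[OF f(6)] times_idm[OF f(6)])
    show "of_mat g * (of_mat (mat_inv g) * (sm (inverse 2) (of_mat A * of_mat w) - of_mat v)) +
        of_mat A * of_mat g * - (of_mat (mat_inv g) * of_mat w) +
        (of_mat v + sm (inverse 2) (of_mat A * of_mat w)) * tpose (of_mat (mat_inv h)) * tpose (of_mat h) = 0"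
      using s by (simp add: mult.assoc f(11) r1[OF f(6)] r1[OF M_diff[OF M_sm[OF Aw] f(7)]] times_idm[OF M_add[OF f(7) M_sm[OF Aw]]])
  qed (rule f)+
  show ?thesis unfolding 1 by (rule blk_one)
qed

lemma \<iota>R_mult:
  assumes "x \<in> carrier (R_group a b)" "y \<in> carrier (R_group a b)"
  shows "x \<otimes>\<^bsub>R_group a b\<^esub> y \<in> carrier (R_group a b)" "\<iota>R a b (x \<otimes>\<^bsub>R_group a b\<^esub> y) = \<iota>R a b x * \<iota>R a b y"
proof -
  obtain g h A w v where x: "x = (g, h, A, w, v)" by (cases x)
  obtain g2 h2 A2 w2 v2 where y: "y = (g2, h2, A2, w2, v2)" by (cases y)
  note t = \<iota>R_tup(1)[OF assms(1)[unfolded x]] \<iota>R_tup(1)[OF assms(2)[unfolded y]]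
  note f = R_tuple[OF assms(1)[unfolded x]] and f2 = R_tuple[OF assms(2)[unfolded y]]
  note c = assms(1)[unfolded x R_carrier] and c2 = assms(2)[unfolded y R_carrier]
  define A'' where "A'' = g * A2 * mat_inv g"
  define w'' where "w'' = g * w2 * transpose_mat h"
  define v'' where "v'' = g * v2 * transpose_mat h"
  have xy: "x \<otimes>\<^bsub>R_group a b\<^esub> y = (g * g2, h * h2, A + A'', w + w'', v + v'' + inverse 2 \<cdot>\<^sub>m (A * w'' - A'' * w))"
    unfolding x y A''_def w''_def v''_def by (simp add: R_group_def Let_def)
  have c3: "A'' \<in> carrier_mat a a" "w'' \<in> carrier_mat a b" "v'' \<in> carrier_mat a b"
    using c c2 mat_inv_carrier[of g a] unfolding A''_def w''_def v''_def by auto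
  show cl: "x \<otimes>\<^bsub>R_group a b\<^esub> y \<in> carrier (R_group a b)"
    unfolding xy R_carrier using c c2 c3 by (auto simp: det_mult[of _ a] det_mult[of _ b])
  have d: "dim_row g = a" "dim_col g = a" "dim_row h = b" "dim_col h = b" "dim_row A = a" "dim_col A = a" "dim_row w = a" "dim_col w = b"
    "dim_row v = a" "dim_col v = b" "dim_row g2 = a" "dim_col g2 = a" "dim_row h2 = b" "dim_col h2 = b" "dim_row A2 = a" "dim_col A2 = a"
    "dim_row w2 = a" "dim_col w2 = b" "dim_row v2 = a" "dim_col v2 = b" "dim_row A'' = a" "dim_col A'' = a" "dim_row w'' = a" "dim_col w'' = b"
    "dim_row v'' = a" "dim_col v'' = b"
    using c c2 c3 by auto
  have e: "of_mat A'' = of_mat g * of_mat A2 * of_mat (mat_inv g)" "of_mat w'' = of_mat g * of_mat w2 * tpose (of_mat h)"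
    "of_mat v'' = of_mat g * of_mat v2 * tpose (of_mat h)"
    unfolding A''_def w''_def v''_def by (simp_all add: of_mat_arith d of_mat_tpose)
  have hh: "tpose (of_mat (mat_inv (h * h2))) = tpose (of_mat (mat_inv h)) * tpose (of_mat (mat_inv h2))"
  proof (rule fm_inv_unique[of _ b _ "tpose (of_mat (h * h2))"])
    have p: "tpose (of_mat (h * h2)) = tpose (of_mat h2) * tpose (of_mat h)" by (simp add: of_mat_arith d tpose_times)
    note q = R_tuple[OF cl[unfolded xy]]
    show "tpose (of_mat (mat_inv (h * h2))) \<in> M b b" "tpose (of_mat (mat_inv (h * h2))) * tpose (of_mat (h * h2)) = idm b" by (rule q)+
    show "tpose (of_mat (mat_inv h)) * tpose (of_mat (mat_inv h2)) \<in> M b b" by (rule M_times[OF f(4) f2(4)])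
    have "tpose (of_mat h) * (tpose (of_mat (mat_inv h)) * tpose (of_mat (mat_inv h2))) = tpose (of_mat (mat_inv h2))"
      using idm_times[OF f2(4) le_refl] by (simp add: mult.assoc[symmetric] f(10))
    then show "tpose (of_mat (h * h2)) * (tpose (of_mat (mat_inv h)) * tpose (of_mat (mat_inv h2))) = idm b"
      unfolding p by (simp add: mult.assoc f2(10))
  qed
  show "\<iota>R a b (x \<otimes>\<^bsub>R_group a b\<^esub> y) = \<iota>R a b x * \<iota>R a b y"
    unfolding xy unfolding x y \<iota>R_def prod.case blk_mult[OF t] R_tuple_mult[OF f2(1) f2(4) f2(6) f(3) f(9) f(10)]
    by (rule arg_cong[of _ _ "blk a b"]) (simp add: of_mat_arith of_mat_smult d hh e)
qed

lemma \<iota>R_inj: "inj_on (\<iota>R a b) (carrier (R_group a b))"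
proof (rule inj_onI)
  fix x y assume xS: "x \<in> carrier (R_group a b)" and yS: "y \<in> carrier (R_group a b)" and e: "\<iota>R a b x = \<iota>R a b y"
  obtain g h A w v where x: "x = (g, h, A, w, v)" by (cases x)
  obtain g2 h2 A2 w2 v2 where y: "y = (g2, h2, A2, w2, v2)" by (cases y)
  note t = \<iota>R_tup(1)[OF xS[unfolded x]] \<iota>R_tup(1)[OF yS[unfolded y]]
  note f = R_tuple[OF xS[unfolded x]] and f2 = R_tuple[OF yS[unfolded y]]
  note c = xS[unfolded x R_carrier] and c2 = yS[unfolded y R_carrier]
  have "(of_mat g, of_mat A * of_mat g, tpose (of_mat (mat_inv h)), of_mat w * tpose (of_mat (mat_inv h)),
     (of_mat v + sm (inverse 2) (of_mat A * of_mat w)) * tpose (of_mat (mat_inv h))) =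
    (of_mat g2, of_mat A2 * of_mat g2, tpose (of_mat (mat_inv h2)), of_mat w2 * tpose (of_mat (mat_inv h2)),
     (of_mat v2 + sm (inverse 2) (of_mat A2 * of_mat w2)) * tpose (of_mat (mat_inv h2)))" (is "?t = ?t2")
    using arg_cong[OF e, of "unblk a b"] unfolding x y \<iota>R_def prod.case unblk_blk[OF t(1)] unblk_blk[OF t(2)] .
  note I = this[unfolded prod.inject]
  note 1 = conjunct1[OF I] and 2 = conjunct1[OF conjunct2[OF I]] and 3 = conjunct1[OF conjunct2[OF conjunct2[OF I]]]
    and 4 = conjunct1[OF conjunct2[OF conjunct2[OF conjunct2[OF I]]]] and 5 = conjunct2[OF conjunct2[OF conjunct2[OF conjunct2[OF I]]]]
  have canc: "z = z2" if "z \<in> M a b" "z2 \<in> M a b" "z * tpose (of_mat (mat_inv h)) = z2 * tpose (of_mat (mat_inv h2))" for z z2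
  proof -
    have "z * (tpose (of_mat (mat_inv h)) * tpose (of_mat h)) = z2 * (tpose (of_mat (mat_inv h)) * tpose (of_mat h))"
      using that(3) by (simp only: mult.assoc[symmetric] 3[symmetric])
    then show ?thesis using that(1,2) by (simp add: f(11) times_idm)
  qed
  have A: "of_mat A = of_mat A2"
  proof -
    have "of_mat A * (of_mat g * of_mat (mat_inv g)) = of_mat A2 * (of_mat g * of_mat (mat_inv g))"
      using 2 by (simp only: mult.assoc[symmetric] 1[symmetric])
    then show ?thesis by (simp add: f(8) times_idm[OF f(5)] times_idm[OF f2(5)])
  qed
  have w: "of_mat w = of_mat w2" by (rule canc[OF f(6) f2(6) 4])
  have "of_mat v + sm (inverse 2) (of_mat A * of_mat w) = of_mat v2 + sm (inverse 2) (of_mat A2 * of_mat w2)"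
    by (rule canc[OF _ _ 5]) (intro M_add M_sm f f2 M_times[OF f(5,6)] M_times[OF f2(5,6)])+
  then have v: "of_mat v = of_mat v2" by (simp add: A w)
  have "tpose (of_mat h) = tpose (of_mat h2)"
    by (rule fm_inv_unique[OF f(3) f2(3) f(10)]) (simp only: 3 f2(11))
  from arg_cong[OF this, of tpose] have h: "of_mat h = of_mat h2" by simp
  have "g = g2" by (rule of_mat_inj[OF _ _ 1]) (use c c2 in auto)
  moreover have "h = h2" by (rule of_mat_inj[OF _ _ h]) (use c c2 in auto)
  moreover have "A = A2" by (rule of_mat_inj[OF _ _ A]) (use c c2 in auto)
  moreover have "w = w2" by (rule of_mat_inj[OF _ _ w]) (use c c2 in auto)
  moreover have "v = v2" by (rule of_mat_inj[OF _ _ v]) (use c c2 in auto)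
  ultimately show "x = y" by (simp only: x y)
qed

text \<open>The defining formula of \<open>\<iota>R\<close> is solved for g, h, A, w, v in turn.
  Hence every block matrix with invertible diagonal blocks comes from the group.\<close>

lemma \<iota>R_image:
  fixes A0 :: "'k::field_char_0 fm"
  assumes t: "(A0, A1, C, W, V) \<in> tup_r a b" and d: "det (to_mat a a A0) \<noteq> 0" "det (to_mat b b C) \<noteq> 0"
  shows "blk a b (A0, A1, C, W, V) \<in> \<iota>R a b ` carrier (R_group a b)"
proof -
  have m: "A0 \<in> M a a" "A1 \<in> M a a" "C \<in> M b b" "W \<in> M a b" "V \<in> M a b" using t by (simp_all add: tup_r_def)
  define g where "g = to_mat a a A0"
  define Ci where "Ci = of_mat (mat_inv (to_mat b b C))"
  define h where "h = transpose_mat (mat_inv (to_mat b b C))"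
  define A where "A = to_mat a a (A1 * of_mat (mat_inv g))"
  define w where "w = to_mat a b (W * Ci)"
  define v where "v = to_mat a b (V * Ci - sm (inverse 2) (A1 * of_mat (mat_inv g) * (W * Ci)))"
  have cc: "mat_inv (to_mat b b C) \<in> carrier_mat b b" by (rule mat_inv_carrier) simp
  have "det h \<noteq> 0" using det_mat_inv[of "to_mat b b C" b] d(2) cc by (auto simp: h_def det_transpose)
  then have S: "(g, h, A, w, v) \<in> carrier (R_group a b)" using d(1) cc by (simp add: R_carrier g_def h_def A_def w_def v_def)
  note f = R_tuple[OF S]
  have G: "of_mat g = A0" unfolding g_def by (rule of_mat_to_mat[OF m(1)])
  have CiM: "Ci \<in> M b b" unfolding Ci_def by (rule M_of_mat[OF cc])
  have Cc: "C * Ci = idm b" "Ci * C = idm b"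
    using mat_inv[of "to_mat b b C" b] d(2) of_mat_to_mat[OF m(3)] by (simp_all add: Ci_def)
  have "tpose (of_mat h) = Ci" by (simp add: h_def Ci_def of_mat_tpose)
  then have K: "tpose (of_mat (mat_inv h)) = C"
    using fm_inv_unique[OF f(4) m(3) f(11)] Cc(2) by simp
  have A: "of_mat A = A1 * of_mat (mat_inv g)" unfolding A_def by (rule of_mat_to_mat[OF M_times[OF m(2) f(2)]])
  have w: "of_mat w = W * Ci" unfolding w_def by (rule of_mat_to_mat[OF M_times[OF m(4) CiM]])
  have v: "of_mat v = V * Ci - sm (inverse 2) (of_mat A * of_mat w)" unfolding A w v_def
    by (rule of_mat_to_mat, rule M_diff[OF M_times[OF m(5) CiM] M_sm[OF M_times[OF M_times[OF m(2) f(2)] M_times[OF m(4) CiM]]]])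
  have "\<iota>R a b (g, h, A, w, v) = blk a b (A0, A1, C, W, V)"
    unfolding \<iota>R_def prod.case v K
    by (simp add: A w mult.assoc f(9) Cc(2) times_idm[OF m(2)] times_idm[OF m(4)] times_idm[OF m(5)], simp add: G)
  then show ?thesis using S by (metis imageI)
qed

lemma \<iota>R_unblk:
  assumes "(g, h, A, w, v) \<in> carrier (R_group a b)"
  shows "idm a * \<iota>R a b (g, h, A, w, v) * idm a = of_mat g"
    "idm a * \<iota>R a b (g, h, A, w, v) * sh a a = of_mat A * of_mat g"
    "sh' (2 * a) b * \<iota>R a b (g, h, A, w, v) * sh (2 * a) b = tpose (of_mat (mat_inv h))"
    "sh' a a * \<iota>R a b (g, h, A, w, v) * sh (2 * a) b = of_mat w * tpose (of_mat (mat_inv h))"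
    "idm a * \<iota>R a b (g, h, A, w, v) * sh (2 * a) b = (of_mat v + sm (inverse 2) (of_mat A * of_mat w)) * tpose (of_mat (mat_inv h))"
    "idm a * \<iota>R' a b (g, h, A, w, v) * idm a = of_mat (mat_inv g)"
    "sh' (2 * a) b * \<iota>R' a b (g, h, A, w, v) * sh (2 * a) b = tpose (of_mat h)"
  using unblk_blk[OF \<iota>R_tup(1)[OF assms]] unblk_blk[OF \<iota>R_tup(2)[OF assms]]
  unfolding unblk_def \<iota>R_def \<iota>R'_def prod.case prod.inject by blast+

text \<open>The two sets of generators are polynomials in each other: inverse matrices are adjugates
  times inverse determinants, and inverse determinants are determinants of inverse matrices.\<close>

lemma R_coord:
  "coord_ring (R_group a b :: (_, 'k::field_char_0) alg_group) = generated_algebra (carrier (R_group a b))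
     ({\<lambda>x. ent (\<iota>R a b x) i j | i j. True} \<union> {\<lambda>x. ent (\<iota>R' a b x) i j | i j. True})"
proof -
  let ?S = "carrier (R_group a b :: (_, 'k) alg_group)"
  let ?g = "\<lambda>(g, h, A, w, v). g :: 'k mat" and ?h = "\<lambda>(g, h, A, w, v). h :: 'k mat" and ?A = "\<lambda>(g, h, A, w, v). A :: 'k mat"
    and ?w = "\<lambda>(g, h, A, w, v). w :: 'k mat" and ?v = "\<lambda>(g, h, A, w, v). v :: 'k mat"
  let ?F1 = "entries ?g a a \<union> entries ?h b b \<union> {\<lambda>(g, h, A, w, v). inverse (det g), \<lambda>(g, h, A, w, v). inverse (det h)} \<union>
     entries ?A a a \<union> entries ?w a b \<union> entries ?v a b"
  let ?F2 = "{\<lambda>x. ent (\<iota>R a b x) i j | i j. True} \<union> {\<lambda>x. ent (\<iota>R' a b x) i j | i j. True}"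
  have 0: "coord_ring (R_group a b) = generated_algebra ?S ?F1" by (simp add: R_group_def Let_def)
  have S: "?g x \<in> carrier_mat a a" "?h x \<in> carrier_mat b b" "?A x \<in> carrier_mat a a" "?w x \<in> carrier_mat a b" "?v x \<in> carrier_mat a b"
    "det (?g x) \<noteq> 0" "det (?h x) \<noteq> 0" if "x \<in> ?S" for x using that by (cases x; simp add: R_carrier)+
  have e: "\<iota>R a b = (\<lambda>x. blk a b (of_mat (?g x), of_mat (?A x) * of_mat (?g x), tpose (of_mat (mat_inv (?h x))),
       of_mat (?w x) * tpose (of_mat (mat_inv (?h x))),
       (of_mat (?v x) + sm (inverse 2) (of_mat (?A x) * of_mat (?w x))) * tpose (of_mat (mat_inv (?h x)))))"
    "\<iota>R' a b = (\<lambda>x. blk a b (of_mat (mat_inv (?g x)), - (of_mat (mat_inv (?g x)) * of_mat (?A x)), tpose (of_mat (?h x)),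
       - (of_mat (mat_inv (?g x)) * of_mat (?w x)),
       of_mat (mat_inv (?g x)) * (sm (inverse 2) (of_mat (?A x) * of_mat (?w x)) - of_mat (?v x))))"
    unfolding \<iota>R_def \<iota>R'_def by (rule ext, simp only: case_prod_beta)+
  have "generated_algebra ?S ?F1 = generated_algebra ?S ?F2"
  proof (rule equalityI; rule generated_algebra_mono)
    fix f assume f: "f \<in> ?F1"
    have I: "reg.matP ?S ?F2 (\<iota>R a b)" "reg.matP ?S ?F2 (\<iota>R' a b)"
      by (rule reg.matP_I[OF \<iota>R_M(1)], assumption, rule reg_gen, blast, rule reg.matP_I[OF \<iota>R_M(2)], assumption, rule reg_gen, blast)
    have I': "reg.matP ?S ?F2 (\<lambda>x. p * \<iota>R a b x * q)" "reg.matP ?S ?F2 (\<lambda>x. p * \<iota>R' a b x * q)" for p q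
      by (intro reg.matP_times reg.matP_const I)+
    have g: "reg.matP ?S ?F2 (\<lambda>x. of_mat (?g x))"
      by (rule reg.matP_cong[OF _ I'(1)[of "idm a" "idm a"]]) (auto simp: \<iota>R_unblk)
    have gi: "reg.matP ?S ?F2 (\<lambda>x. of_mat (mat_inv (?g x)))"
      by (rule reg.matP_cong[OF _ I'(2)[of "idm a" "idm a"]]) (auto simp: \<iota>R_unblk)
    have k: "reg.matP ?S ?F2 (\<lambda>x. tpose (of_mat (?h x)))"
      by (rule reg.matP_cong[OF _ I'(2)[of "sh' (2 * a) b" "sh (2 * a) b"]]) (auto simp: \<iota>R_unblk)
    have ki: "reg.matP ?S ?F2 (\<lambda>x. tpose (of_mat (mat_inv (?h x))))"
      by (rule reg.matP_cong[OF _ I'(1)[of "sh' (2 * a) b" "sh (2 * a) b"]]) (auto simp: \<iota>R_unblk)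
    have h: "reg.matP ?S ?F2 (\<lambda>x. of_mat (?h x))" and hi: "reg.matP ?S ?F2 (\<lambda>x. of_mat (mat_inv (?h x)))"
      using reg.matP_tpose[OF k] reg.matP_tpose[OF ki] by simp_all
    have A: "reg.matP ?S ?F2 (\<lambda>x. of_mat (?A x))"
    proof (rule reg.matP_cong[OF _ reg.matP_times[OF I'(1)[of "idm a" "sh a a"] gi]])
      show "idm a * \<iota>R a b x * sh a a * of_mat (mat_inv (?g x)) = of_mat (?A x)" if "x \<in> ?S" for x
      proof -
        obtain g h A w v where x: "x = (g, h, A, w, v)" by (cases x)
        note xS = that[unfolded x]
        show ?thesis unfolding x prod.case \<iota>R_unblk[OF xS] by (simp add: mult.assoc R_tuple[OF xS] times_idm[OF R_tuple(5)[OF xS]])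
      qed
    qed
    have w: "reg.matP ?S ?F2 (\<lambda>x. of_mat (?w x))"
    proof (rule reg.matP_cong[OF _ reg.matP_times[OF I'(1)[of "sh' a a" "sh (2 * a) b"] k]])
      show "sh' a a * \<iota>R a b x * sh (2 * a) b * tpose (of_mat (?h x)) = of_mat (?w x)" if "x \<in> ?S" for x
      proof -
        obtain g h A w v where x: "x = (g, h, A, w, v)" by (cases x)
        note xS = that[unfolded x]
        show ?thesis unfolding x prod.case \<iota>R_unblk[OF xS] by (simp add: mult.assoc R_tuple[OF xS] times_idm[OF R_tuple(6)[OF xS]])
      qed
    qed
    have v: "reg.matP ?S ?F2 (\<lambda>x. of_mat (?v x))"
    proof (rule reg.matP_cong[OF _ reg.matP_diff[OF reg.matP_times[OF I'(1)[of "idm a" "sh (2 * a) b"] k]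
          reg.matP_sm[OF reg.const[of _ _ "inverse 2"] reg.matP_times[OF A w]]]])
      show "idm a * \<iota>R a b x * sh (2 * a) b * tpose (of_mat (?h x)) - sm (inverse 2) (of_mat (?A x) * of_mat (?w x)) = of_mat (?v x)"
        if "x \<in> ?S" for x
      proof -
        obtain g h A w v where x: "x = (g, h, A, w, v)" by (cases x)
        note xS = that[unfolded x]
        have vM: "of_mat v + sm (inverse 2) (of_mat A * of_mat w) \<in> M a b"
          by (intro M_add M_sm R_tuple[OF xS] M_times[OF R_tuple(5)[OF xS] R_tuple(6)[OF xS]])
        show ?thesis unfolding x prod.case \<iota>R_unblk[OF xS]
          by (simp only: mult.assoc R_tuple(11)[OF xS] times_idm[OF vM le_refl] add_diff_cancel_right')
      qed
    qed
    have dg: "reg ?S ?F2 (\<lambda>(g, h, A, w, v). inverse (det g))"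
    proof (rule reg.cong[OF _ reg.det_to_mat[OF gi, of a]])
      show "det (to_mat a a (of_mat (mat_inv (?g x)))) = (\<lambda>(g, h, A, w, v). inverse (det g)) x" if "x \<in> ?S" for x
        using det_mat_inv[OF S(1)[OF that] S(6)[OF that]] to_mat_of_mat[OF mat_inv_carrier[OF S(1)[OF that]]] S(6)[OF that]
        by (simp add: case_prod_beta field_simps)
    qed
    have dh: "reg ?S ?F2 (\<lambda>(g, h, A, w, v). inverse (det h))"
    proof (rule reg.cong[OF _ reg.det_to_mat[OF hi, of b]])
      show "det (to_mat b b (of_mat (mat_inv (?h x)))) = (\<lambda>(g, h, A, w, v). inverse (det h)) x" if "x \<in> ?S" for x
        using det_mat_inv[OF S(2)[OF that] S(7)[OF that]] to_mat_of_mat[OF mat_inv_carrier[OF S(2)[OF that]]] S(7)[OF that]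
        by (simp add: case_prod_beta field_simps)
    qed
    have en1: "f \<in> entries ?g a a \<Longrightarrow> reg ?S ?F2 f" by (rule reg.entries_P[OF g S(1)])
    have en2: "f \<in> entries ?h b b \<Longrightarrow> reg ?S ?F2 f" by (rule reg.entries_P[OF h S(2)])
    have en3: "f \<in> entries ?A a a \<Longrightarrow> reg ?S ?F2 f" by (rule reg.entries_P[OF A S(3)])
    have en4: "f \<in> entries ?w a b \<Longrightarrow> reg ?S ?F2 f" by (rule reg.entries_P[OF w S(4)])
    have en5: "f \<in> entries ?v a b \<Longrightarrow> reg ?S ?F2 f" by (rule reg.entries_P[OF v S(5)])
    from f show "reg ?S ?F2 f"
      by (elim UnE) (erule en1, erule en2, erule insertE, erule ssubst, rule dg, erule singletonE, erule ssubst, rule dh,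
        erule en3, erule en4, erule en5)
  next
    fix f :: "'k mat \<times> 'k mat \<times> 'k mat \<times> 'k mat \<times> 'k mat \<Rightarrow> 'k" assume f: "f \<in> ?F2"
    have g: "reg.matP ?S ?F1 (\<lambda>x. of_mat (?g x))" by (rule matP_entries[OF S(1)]) (assumption, blast)
    have h: "reg.matP ?S ?F1 (\<lambda>x. of_mat (?h x))" by (rule matP_entries[OF S(2)]) (assumption, blast)
    have A: "reg.matP ?S ?F1 (\<lambda>x. of_mat (?A x))" by (rule matP_entries[OF S(3)]) (assumption, blast)
    have w: "reg.matP ?S ?F1 (\<lambda>x. of_mat (?w x))" by (rule matP_entries[OF S(4)]) (assumption, blast)
    have v: "reg.matP ?S ?F1 (\<lambda>x. of_mat (?v x))" by (rule matP_entries[OF S(5)]) (assumption, blast)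
    have gi: "reg.matP ?S ?F1 (\<lambda>x. of_mat (mat_inv (?g x)))"
    proof (rule reg.matP_mat_inv[OF S(1)])
      show "reg ?S ?F1 (\<lambda>x. ?g x $$ (i, j))" if "i < a" "j < a" for i j
        by (rule reg_gen, rule UnI1, rule UnI1, rule UnI1, rule UnI1, rule UnI1) (use that in \<open>auto simp: entries_def\<close>)
      have r: "reg ?S ?F1 (\<lambda>(g, h, A, w, v). inverse (det g))" by (rule reg_gen) simp
      show "reg ?S ?F1 (\<lambda>x. inverse (det (?g x)))" by (rule reg.cong[OF _ r]) (simp add: case_prod_beta)
    qed
    have hi: "reg.matP ?S ?F1 (\<lambda>x. of_mat (mat_inv (?h x)))"
    proof (rule reg.matP_mat_inv[OF S(2)])
      show "reg ?S ?F1 (\<lambda>x. ?h x $$ (i, j))" if "i < b" "j < b" for i j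
        by (rule reg_gen, rule UnI1, rule UnI1, rule UnI1, rule UnI1, rule UnI2) (use that in \<open>auto simp: entries_def\<close>)
      have r: "reg ?S ?F1 (\<lambda>(g, h, A, w, v). inverse (det h))" by (rule reg_gen) simp
      show "reg ?S ?F1 (\<lambda>x. inverse (det (?h x)))" by (rule reg.cong[OF _ r]) (simp add: case_prod_beta)
    qed
    have "reg.matP ?S ?F1 (\<iota>R a b)" "reg.matP ?S ?F1 (\<iota>R' a b)"
      unfolding e
      by (intro reg.matP_blk reg.matP_times reg.matP_add reg.matP_diff reg.matP_uminus reg.matP_tpose reg.matP_sm reg.const g h A w v gi hi)+
    then show "reg ?S ?F1 f" using f by (auto intro: reg.matP_ent)
  qed
  then show ?thesis unfolding 0 .
qed

lemma R_one: "\<one>\<^bsub>R_group a b\<^esub> = (1\<^sub>m a, 1\<^sub>m b, 0\<^sub>m a a, 0\<^sub>m a b, 0\<^sub>m a b)"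
  by (simp add: R_group_def Let_def)

text \<open>As h enters through its inverse transpose, the pair (c, 1/c) becomes the scalar c on all
  blocks.\<close>

lemma torus_\<iota>R:
  fixes c :: "'k::field_char_0"
  assumes "c \<noteq> 0"
  shows "(c \<cdot>\<^sub>m 1\<^sub>m a, inverse c \<cdot>\<^sub>m 1\<^sub>m b, 0\<^sub>m a a, 0\<^sub>m a b, 0\<^sub>m a b) \<in> carrier (R_group a b)" (is "?z \<in> _")
    "\<iota>R a b (c \<cdot>\<^sub>m 1\<^sub>m a, inverse c \<cdot>\<^sub>m 1\<^sub>m b, 0\<^sub>m a a, 0\<^sub>m a b, 0\<^sub>m a b) = sm c (idm (2 * a + b))"
proof -
  show z: "?z \<in> carrier (R_group a b)" using assms by (simp add: R_carrier)
  have "tpose (of_mat (mat_inv (inverse c \<cdot>\<^sub>m 1\<^sub>m b))) = sm c (idm b)"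
  proof (rule fm_inv_unique[OF R_tuple(4)[OF z] M_sm[OF M_idm[OF le_refl le_refl]] R_tuple(11)[OF z]])
    show "tpose (of_mat (inverse c \<cdot>\<^sub>m 1\<^sub>m b)) * sm c (idm b) = idm b"
      using assms by (simp add: of_mat_smult of_mat_one tpose_sm idm_times[OF M_idm[OF le_refl le_refl]])
  qed
  then have "\<iota>R a b ?z = blk a b (smt c (one5 a b))"
    by (simp add: \<iota>R_def of_mat_smult of_mat_one of_mat_zero smt_def one5_def)
  then show "\<iota>R a b ?z = sm c (idm (2 * a + b))" by (simp add: blk_smt blk_one)
qed

lemma R_lin_group_scalars:
  assumes "0 < a + b"
  shows "lin_group_scalars (R_group a b) (\<iota>R a b) (\<iota>R' a b :: _ \<Rightarrow> 'k::field_char_0 fm) (2 * a + b)"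
proof
  let ?G = "R_group a b :: (_, 'k) alg_group"
  have one: "\<one>\<^bsub>?G\<^esub> = (1 \<cdot>\<^sub>m 1\<^sub>m a, inverse 1 \<cdot>\<^sub>m 1\<^sub>m b, 0\<^sub>m a a, 0\<^sub>m a b, 0\<^sub>m a b)"
    unfolding R_one by (auto intro: eq_matI)
  show "\<one>\<^bsub>?G\<^esub> \<in> carrier ?G" unfolding one by (rule torus_\<iota>R) simp
  show "\<iota>R a b \<one>\<^bsub>?G\<^esub> = idm (2 * a + b)" unfolding one torus_\<iota>R(2)[OF one_neq_zero] by simp
  show "x \<otimes>\<^bsub>?G\<^esub> y \<in> carrier ?G" "\<iota>R a b (x \<otimes>\<^bsub>?G\<^esub> y) = \<iota>R a b x * \<iota>R a b y" if "x \<in> carrier ?G" "y \<in> carrier ?G" for x y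
    by (rule \<iota>R_mult[OF that])+
  show "inj_on (\<iota>R a b) (carrier ?G)" by (rule \<iota>R_inj)
  show "\<exists>z \<in> carrier ?G. \<iota>R a b z = sm c (idm (2 * a + b))" if "c \<noteq> 0" for c
    using torus_\<iota>R[OF that] by blast
  fix x assume x: "x \<in> carrier ?G"
  show i: "\<iota>R a b x \<in> M (2 * a + b) (2 * a + b)" "\<iota>R' a b x \<in> M (2 * a + b) (2 * a + b)" "\<iota>R a b x * \<iota>R' a b x = idm (2 * a + b)"
    by (rule \<iota>R_M[OF x] \<iota>R_inverse[OF x])+
  show "\<iota>R' a b x * \<iota>R a b x = idm (2 * a + b)" by (rule fm_left_inverse[OF i])
  show "\<exists>y \<in> carrier ?G. \<iota>R a b y = \<iota>R' a b x"
  proof -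
    obtain g h A w v where xe: "x = (g, h, A, w, v)" by (cases x)
    note xS = x[unfolded xe]
    have c: "g \<in> carrier_mat a a" "det g \<noteq> 0" "h \<in> carrier_mat b b" "det h \<noteq> 0" using xS by (simp_all add: R_carrier)
    have "det (to_mat a a (of_mat (mat_inv g))) \<noteq> 0"
      using det_mat_inv[OF c(1,2)] by (auto simp: to_mat_of_mat[OF mat_inv_carrier[OF c(1)]])
    moreover have "det (to_mat b b (tpose (of_mat h))) \<noteq> 0"
      using c(3,4) by (simp add: of_mat_tpose[symmetric] to_mat_of_mat det_transpose)
    ultimately have "\<iota>R' a b x \<in> \<iota>R a b ` carrier ?G" unfolding xe \<iota>R'_def prod.case by (rule \<iota>R_image[OF \<iota>R_tup(2)[OF xS]])
    then show ?thesis by (elim imageE) metis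
  qed
qed (use assms R_coord in auto)

lemma has_der_line: "has_der (\<lambda>s. ent (e + sm s x) i j) (ent x i j)"
  using has_der_arith(1)[OF has_der_const[of "ent e i j"] has_der_arith(2)[OF has_der_id has_der_const[of "ent x i j"]]] by simp

lemma det_line:
  fixes X :: "'k::field_char_0 fm"
  assumes "X \<in> M m m"
  shows "\<exists>d. has_der (\<lambda>s. det (to_mat m m (idm m + sm s X))) d" "det (to_mat m m (idm m + sm 0 X)) = 1"
    "ev0 (\<lambda>s. det (to_mat m m (idm m + sm s X)) \<noteq> 0)"
proof -
  have "d0.matP (\<lambda>s. idm m + sm s X)"
    by (rule d0.matP_I[where m = m and n = m])
       (auto simp: differentiable0_def intro!: M_add M_sm M_idm assms simp del: ent_add intro: has_der_line)
  from d0.det_to_mat[OF this] show 1: "\<exists>d. has_der (\<lambda>s. det (to_mat m m (idm m + sm s X))) d" by (simp only: differentiable0_def)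
  show 2: "det (to_mat m m (idm m + sm 0 X)) = 1" by (simp add: to_mat_idm)
  show "ev0 (\<lambda>s. det (to_mat m m (idm m + sm s X)) \<noteq> 0)" 
  proof -
    obtain d where d: "has_der (\<lambda>s. det (to_mat m m (idm m + sm s X))) d" using 1 by blast
    show ?thesis by (rule has_der_inverse(2)[OF d 2])
  qed
qed

lemma blk_line:
  "idm (2 * a + b) + sm s (blk a b (A0, A1, C, W, V)) =
     blk a b (idm a + sm s A0, sm s A1, idm b + sm s C, sm s W, sm s (V :: 'k::field fm))"
  unfolding blk_one[symmetric] blk_smt[symmetric] blk_add[symmetric] by (simp add: one5_def smt_def)

lemma R_derivations:
  fixes x :: "'k::field_char_0 fm"
  assumes ab: "0 < a + b" and x: "x \<in> blk a b ` tup_r a b"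
  shows "\<exists>\<delta> \<in> point_derivations (R_group a b). lin_group.Dm (R_group a b) (\<iota>R a b) \<delta> = x"
proof -
  interpret R: lin_group_scalars "R_group a b" "\<iota>R a b" "\<iota>R' a b :: _ \<Rightarrow> 'k fm" "2 * a + b" by (rule R_lin_group_scalars[OF ab])
  obtain A0 A1 C W V where t: "(A0, A1, C, W, V) \<in> tup_r a b" "x = blk a b (A0, A1, C, W, V)" using x by auto
  then have m: "A0 \<in> M a a" "A1 \<in> M a a" "C \<in> M b b" "W \<in> M a b" "V \<in> M a b" by (simp_all add: tup_r_def)
  have xM: "x \<in> M (2 * a + b) (2 * a + b)" unfolding t(2) by (rule blk_M[OF t(1)])
  show ?thesis
  proof (rule R.der_exists[of "\<lambda>s. idm (2 * a + b) + sm s x"])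
    show "idm (2 * a + b) + sm s x \<in> M (2 * a + b) (2 * a + b)" for s by (intro M_add M_idm M_sm xM le_refl)
    show "has_der (\<lambda>s. ent (idm (2 * a + b) + sm s x) i j) (ent x i j)" for i j by (rule has_der_line)
    show "ev0 (\<lambda>s. idm (2 * a + b) + sm s x \<in> \<iota>R a b ` carrier (R_group a b))"
    proof (rule ev0_mono[OF ev0_conj[OF det_line(3)[OF m(1)] det_line(3)[OF m(3)]]])
      fix s assume d: "det (to_mat a a (idm a + sm s A0)) \<noteq> 0 \<and> det (to_mat b b (idm b + sm s C)) \<noteq> 0"
      have "(idm a + sm s A0, sm s A1, idm b + sm s C, sm s W, sm s V) \<in> tup_r a b"
        unfolding tup_r_def by (simp add: m M_add M_sm M_idm)
      from \<iota>R_image[OF this conjunct1[OF d] conjunct2[OF d]]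
      show "idm (2 * a + b) + sm s x \<in> \<iota>R a b ` carrier (R_group a b)" unfolding t(2) blk_line .
    qed
    show "idm (2 * a + b) + sm 0 x = idm (2 * a + b)" by simp
  qed (rule xM)
qed

lemma Rbar_quotient:
  assumes ab: "0 < a + b"
  shows "lin_group_scalars.Z (R_group a b) (\<iota>R a b :: _ \<Rightarrow> 'k::field_char_0 fm) (2 * a + b) = R_central_torus a b"
proof -
  interpret R: lin_group_scalars "R_group a b" "\<iota>R a b" "\<iota>R' a b :: _ \<Rightarrow> 'k fm" "2 * a + b" by (rule R_lin_group_scalars[OF ab])
  show ?thesis
  proof (intro equalityI subsetI)
    fix z assume z: "z \<in> R.Z"
    then have zS: "z \<in> carrier (R_group a b)" unfolding R.Z_def by blast
    obtain c where c: "c \<noteq> 0" "\<iota>R a b z = sm c (idm (2 * a + b))" using R.ZD[OF z] by blast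
    have "z = (c \<cdot>\<^sub>m 1\<^sub>m a, inverse c \<cdot>\<^sub>m 1\<^sub>m b, 0\<^sub>m a a, 0\<^sub>m a b, 0\<^sub>m a b)"
      by (rule inj_onD[OF \<iota>R_inj _ zS torus_\<iota>R(1)[OF c(1)]]) (simp only: c(2) torus_\<iota>R(2)[OF c(1)])
    then show "z \<in> R_central_torus a b" using c(1) unfolding R_central_torus_def by blast
  next
    fix z :: "'k mat \<times> 'k mat \<times> 'k mat \<times> 'k mat \<times> 'k mat" assume "z \<in> R_central_torus a b"
    then obtain c where c: "c \<noteq> 0" "z = (c \<cdot>\<^sub>m 1\<^sub>m a, inverse c \<cdot>\<^sub>m 1\<^sub>m b, 0\<^sub>m a a, 0\<^sub>m a b, 0\<^sub>m a b)"
      unfolding R_central_torus_def by blast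
    show "z \<in> R.Z" using torus_\<iota>R[OF c(1)] unfolding c(2) R.Z_def by blast
  qed
qed

lemma Rbar_reductive_contact:
  assumes ab: "0 < a + b" "even a" "even b" and index: "lie_index (Lie (Rbar a b :: 'k::field_char_0 Rbar_group)) = 1"
  shows "strongly_quasi_reductive (Rbar a b :: 'k Rbar_group) \<and> contact (Lie (Rbar a b :: 'k Rbar_group))"
proof -
  interpret R: lin_group_scalars "R_group a b" "\<iota>R a b" "\<iota>R' a b :: _ \<Rightarrow> 'k fm" "2 * a + b" by (rule R_lin_group_scalars[OF ab(1)])
  have e: "Rbar a b = alg_quotient (R_group a b) R.Z" unfolding Rbar_def Rbar_quotient[OF ab(1)] ..
  show ?thesis unfolding e
    by (rule R.reductive_contact_quotient[OF disjI1[OF refl] ab(2,3,1) refl refl \<iota>R_M(3) R_derivations[OF ab(1)] index[unfolded e]])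
qed

section \<open>The group of q(a, b) with its determinant condition\<close>

definition \<iota>Q :: "nat \<Rightarrow> nat \<Rightarrow> 'k mat \<times> 'k mat \<times> 'k mat \<times> 'k mat \<Rightarrow> 'k::field_char_0 fm" where
  "\<iota>Q a b = (\<lambda>(g, h, X, Y). blk a b (of_mat g, 0, of_mat h, of_mat X * of_mat h, of_mat Y * of_mat h))"

definition \<iota>Q' :: "nat \<Rightarrow> nat \<Rightarrow> 'k mat \<times> 'k mat \<times> 'k mat \<times> 'k mat \<Rightarrow> 'k::field_char_0 fm" where
  "\<iota>Q' a b = (\<lambda>(g, h, X, Y). blk a b (of_mat (mat_inv g), 0, of_mat (mat_inv h),
     - (of_mat (mat_inv g) * of_mat X), - (of_mat (mat_inv g) * of_mat Y)))"

lemma Q_carrier: "(g, h, X, Y) \<in> carrier (Qbar a b) \<longleftrightarrow> g \<in> carrier_mat a a \<and> h \<in> carrier_mat b b \<and>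
    det g * det h = 1 \<and> X \<in> carrier_mat a b \<and> Y \<in> carrier_mat a b"
  by (simp add: Qbar_def Let_def)

lemma Q_det: "(g, h, X, Y) \<in> carrier (Qbar a b) \<Longrightarrow> det g \<noteq> 0 \<and> det h \<noteq> 0"
  by (auto simp: Q_carrier)

lemma Q_tuple:
  assumes "(g, h, X, Y) \<in> carrier (Qbar a b)"
  shows "of_mat g \<in> M a a" "of_mat (mat_inv g) \<in> M a a" "of_mat h \<in> M b b" "of_mat (mat_inv h) \<in> M b b"
    "of_mat X \<in> M a b" "of_mat Y \<in> M a b"
    "of_mat g * of_mat (mat_inv g) = idm a" "of_mat (mat_inv g) * of_mat g = idm a"
    "of_mat h * of_mat (mat_inv h) = idm b" "of_mat (mat_inv h) * of_mat h = idm b"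
  using assms mat_inv[of g a] mat_inv[of h b] Q_det[OF assms]
  by (simp_all add: Q_carrier M_of_mat mat_inv_carrier)

lemma \<iota>Q_tup:
  assumes "(g, h, X, Y) \<in> carrier (Qbar a b)"
  shows "(of_mat g, 0, of_mat h, of_mat X * of_mat h, of_mat Y * of_mat h) \<in> tup_q a b"
    "(of_mat (mat_inv g), 0, of_mat (mat_inv h), - (of_mat (mat_inv g) * of_mat X), - (of_mat (mat_inv g) * of_mat Y)) \<in> tup_q a b"
  unfolding tup_q_def mem_Collect_eq prod.case
  by (intro conjI refl; (rule M_times M_uminus Q_tuple[OF assms])+)+

lemma \<iota>Q_M: assumes "x \<in> carrier (Qbar a b)"
  shows "\<iota>Q a b x \<in> M (2 * a + b) (2 * a + b)" "\<iota>Q' a b x \<in> M (2 * a + b) (2 * a + b)" "\<iota>Q a b x \<in> blk a b ` tup_q a b"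
proof -
  obtain g h X Y where x: "x = (g, h, X, Y)" by (cases x)
  note t = \<iota>Q_tup[OF assms[unfolded x]]
  show "\<iota>Q a b x \<in> M (2 * a + b) (2 * a + b)" "\<iota>Q' a b x \<in> M (2 * a + b) (2 * a + b)" "\<iota>Q a b x \<in> blk a b ` tup_q a b"
    unfolding x \<iota>Q_def \<iota>Q'_def prod.case by (rule blk_M[OF tup_q_r[OF t(1)]], rule blk_M[OF tup_q_r[OF t(2)]], rule imageI[OF t(1)])
qed

lemma \<iota>Q_inverse: assumes "x \<in> carrier (Qbar a b)" shows "\<iota>Q a b x * \<iota>Q' a b x = idm (2 * a + b)"
proof -
  obtain g h X Y where x: "x = (g, h, X, Y)" by (cases x)
  note t = \<iota>Q_tup[OF assms[unfolded x]] and f = Q_tuple[OF assms[unfolded x]]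
  have r1: "of_mat g * (of_mat (mat_inv g) * z) = z" if "z \<in> M a q" for z q
    using idm_times[OF that le_refl] by (simp add: mult.assoc[symmetric] f)
  have 1: "\<iota>Q a b x * \<iota>Q' a b x = blk a b (one5 a b)"
    unfolding x \<iota>Q_def \<iota>Q'_def prod.case blk_mult[OF tup_q_r[OF t(1)] tup_q_r[OF t(2)]] mul5_def one5_def
    by (simp add: mult.assoc f r1[OF f(5)] r1[OF f(6)] times_idm[OF f(5)] times_idm[OF f(6)])
  show ?thesis unfolding 1 by (rule blk_one)
qed

text \<open>exp(X, Y) times diag(g, g, h) has the blocks X h and Y h; the trailing h cancels the
  inverse of h in the action on the second factor.\<close>

lemma \<iota>Q_mult:
  assumes "x \<in> carrier (Qbar a b)" "y \<in> carrier (Qbar a b)"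
  shows "x \<otimes>\<^bsub>Qbar a b\<^esub> y \<in> carrier (Qbar a b)" "\<iota>Q a b (x \<otimes>\<^bsub>Qbar a b\<^esub> y) = \<iota>Q a b x * \<iota>Q a b y"
proof -
  obtain g h X Y where x: "x = (g, h, X, Y)" by (cases x)
  obtain g2 h2 X2 Y2 where y: "y = (g2, h2, X2, Y2)" by (cases y)
  note t = \<iota>Q_tup(1)[OF assms(1)[unfolded x]] \<iota>Q_tup(1)[OF assms(2)[unfolded y]]
  note f = Q_tuple[OF assms(1)[unfolded x]] and f2 = Q_tuple[OF assms(2)[unfolded y]]
  note c = assms(1)[unfolded x Q_carrier] and c2 = assms(2)[unfolded y Q_carrier]
  have xy: "x \<otimes>\<^bsub>Qbar a b\<^esub> y = (g * g2, h * h2, X + g * X2 * mat_inv h, Y + g * Y2 * mat_inv h)"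
    unfolding x y by (simp add: Qbar_def Let_def)
  have mi: "mat_inv h \<in> carrier_mat b b" using c by (simp add: mat_inv_carrier)
  have dd: "det (g * g2) * det (h * h2) = (det g * det h) * (det g2 * det h2)"
    using c c2 by (simp add: det_mult[of _ a] det_mult[of _ b] mult_ac)
  show "x \<otimes>\<^bsub>Qbar a b\<^esub> y \<in> carrier (Qbar a b)"
    unfolding xy Q_carrier dd using c c2 mi by auto
  have d: "dim_row g = a" "dim_col g = a" "dim_row h = b" "dim_col h = b" "dim_row X = a" "dim_col X = b"
    "dim_row Y = a" "dim_col Y = b" "dim_row g2 = a" "dim_col g2 = a" "dim_row h2 = b" "dim_col h2 = b"
    "dim_row X2 = a" "dim_col X2 = b" "dim_row Y2 = a" "dim_col Y2 = b"
    using c c2 by auto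
  have r: "of_mat (mat_inv h) * (of_mat h * of_mat h2) = of_mat h2"
    using idm_times[OF f2(3) le_refl] by (simp add: mult.assoc[symmetric] f)
  show "\<iota>Q a b (x \<otimes>\<^bsub>Qbar a b\<^esub> y) = \<iota>Q a b x * \<iota>Q a b y"
    unfolding xy unfolding x y \<iota>Q_def prod.case blk_mult[OF tup_q_r[OF t(1)] tup_q_r[OF t(2)]] mul5_def
    by (rule arg_cong[of _ _ "blk a b"]) (simp add: of_mat_arith d distrib_right mult.assoc r add_ac)
qed

lemma \<iota>Q_unblk:
  assumes "(g, h, X, Y) \<in> carrier (Qbar a b)"
  shows "idm a * \<iota>Q a b (g, h, X, Y) * idm a = of_mat g"
    "sh' (2 * a) b * \<iota>Q a b (g, h, X, Y) * sh (2 * a) b = of_mat h"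
    "sh' a a * \<iota>Q a b (g, h, X, Y) * sh (2 * a) b = of_mat X * of_mat h"
    "idm a * \<iota>Q a b (g, h, X, Y) * sh (2 * a) b = of_mat Y * of_mat h"
    "sh' (2 * a) b * \<iota>Q' a b (g, h, X, Y) * sh (2 * a) b = of_mat (mat_inv h)"
  using unblk_blk[OF tup_q_r[OF \<iota>Q_tup(1)[OF assms]]] unblk_blk[OF tup_q_r[OF \<iota>Q_tup(2)[OF assms]]]
  unfolding unblk_def \<iota>Q_def \<iota>Q'_def prod.case prod.inject by blast+

lemma \<iota>Q_inj: "inj_on (\<iota>Q a b) (carrier (Qbar a b))"
proof (rule inj_onI)
  fix x y assume xS: "x \<in> carrier (Qbar a b)" and yS: "y \<in> carrier (Qbar a b)" and e: "\<iota>Q a b x = \<iota>Q a b y"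
  obtain g h X Y where x: "x = (g, h, X, Y)" by (cases x)
  obtain g2 h2 X2 Y2 where y: "y = (g2, h2, X2, Y2)" by (cases y)
  note u = \<iota>Q_unblk[OF xS[unfolded x], folded x] and u2 = \<iota>Q_unblk[OF yS[unfolded y], folded y]
  note f = Q_tuple[OF xS[unfolded x]] and f2 = Q_tuple[OF yS[unfolded y]]
  note c = xS[unfolded x Q_carrier] and c2 = yS[unfolded y Q_carrier]
  have g: "of_mat g = of_mat g2" using u(1) u2(1) by (simp only: e)
  have h: "of_mat h = of_mat h2" using u(2) u2(2) by (simp only: e)
  have canc: "z = z2" if "z \<in> M a b" "z2 \<in> M a b" "z * of_mat h = z2 * of_mat h2" for z z2
  proof -
    have "z * (of_mat h * of_mat (mat_inv h)) = z2 * (of_mat h * of_mat (mat_inv h))"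
      using that(3) by (simp only: mult.assoc[symmetric] h[symmetric])
    then show ?thesis using that(1,2) by (simp add: f times_idm)
  qed
  have X: "of_mat X = of_mat X2" by (rule canc[OF f(5) f2(5)]) (use u(3) u2(3) in \<open>simp only: e\<close>)
  have Y: "of_mat Y = of_mat Y2" by (rule canc[OF f(6) f2(6)]) (use u(4) u2(4) in \<open>simp only: e\<close>)
  have "g = g2" by (rule of_mat_inj[OF _ _ g]) (use c c2 in auto)
  moreover have "h = h2" by (rule of_mat_inj[OF _ _ h]) (use c c2 in auto)
  moreover have "X = X2" by (rule of_mat_inj[OF _ _ X]) (use c c2 in auto)
  moreover have "Y = Y2" by (rule of_mat_inj[OF _ _ Y]) (use c c2 in auto)
  ultimately show "x = y" by (simp only: x y)
qed

lemma \<iota>Q_image: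
  fixes A0 :: "'k::field_char_0 fm"
  assumes t: "(A0, A1, C, W, V) \<in> tup_q a b" and d: "det (to_mat a a A0) * det (to_mat b b C) = 1"
  shows "blk a b (A0, A1, C, W, V) \<in> \<iota>Q a b ` carrier (Qbar a b)"
proof -
  have m: "A0 \<in> M a a" "A1 = 0" "C \<in> M b b" "W \<in> M a b" "V \<in> M a b" using t by (simp_all add: tup_q_def)
  define h where "h = to_mat b b C"
  let ?Ci = "of_mat (mat_inv h)"
  let ?x = "(to_mat a a A0, h, to_mat a b (W * ?Ci), to_mat a b (V * ?Ci))"
  have S: "?x \<in> carrier (Qbar a b)" using d by (simp add: Q_carrier h_def)
  note f = Q_tuple[OF S]
  have e: "of_mat (to_mat a a A0) = A0" "of_mat h = C" "of_mat (to_mat a b (W * ?Ci)) = W * ?Ci" "of_mat (to_mat a b (V * ?Ci)) = V * ?Ci"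
    unfolding h_def by (rule of_mat_to_mat; rule m M_times[OF _ f(4)[unfolded h_def]]; rule m)+
  have CC: "?Ci * C = idm b" using f(10) unfolding e(2) .
  have "\<iota>Q a b ?x = blk a b (A0, A1, C, W, V)"
    unfolding \<iota>Q_def prod.case e by (simp add: mult.assoc CC m(2) times_idm[OF m(4)] times_idm[OF m(5)])
  then show ?thesis using S by (metis imageI)
qed

text \<open>Since det g and det h are inverse to each other, both inverse determinants are already
  polynomials in the entries.\<close>

lemma Q_coord:
  "coord_ring (Qbar a b :: 'k::field_char_0 Qbar_group) = generated_algebra (carrier (Qbar a b))
     ({\<lambda>x. ent (\<iota>Q a b x) i j | i j. True} \<union> {\<lambda>x. ent (\<iota>Q' a b x) i j | i j. True})"
proof -
  let ?S = "carrier (Qbar a b :: 'k Qbar_group)"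
  let ?g = "\<lambda>(g, h, X, Y). g :: 'k mat" and ?h = "\<lambda>(g, h, X, Y). h :: 'k mat" and ?X = "\<lambda>(g, h, X, Y). X :: 'k mat"
    and ?Y = "\<lambda>(g, h, X, Y). Y :: 'k mat"
  let ?F1 = "entries ?g a a \<union> entries ?h b b \<union> entries ?X a b \<union> entries ?Y a b"
  let ?F2 = "{\<lambda>x. ent (\<iota>Q a b x) i j | i j. True} \<union> {\<lambda>x. ent (\<iota>Q' a b x) i j | i j. True}"
  have 0: "coord_ring (Qbar a b) = generated_algebra ?S ?F1" by (simp add: Qbar_def Let_def)
  have S: "?g x \<in> carrier_mat a a" "?h x \<in> carrier_mat b b" "?X x \<in> carrier_mat a b" "?Y x \<in> carrier_mat a b"
    "det (?g x) * det (?h x) = 1" if "x \<in> ?S" for x using that by (cases x; simp add: Q_carrier)+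
  have e: "\<iota>Q a b = (\<lambda>x. blk a b (of_mat (?g x), 0, of_mat (?h x), of_mat (?X x) * of_mat (?h x), of_mat (?Y x) * of_mat (?h x)))"
    "\<iota>Q' a b = (\<lambda>x. blk a b (of_mat (mat_inv (?g x)), 0, of_mat (mat_inv (?h x)),
       - (of_mat (mat_inv (?g x)) * of_mat (?X x)), - (of_mat (mat_inv (?g x)) * of_mat (?Y x))))"
    unfolding \<iota>Q_def \<iota>Q'_def by (rule ext, simp only: case_prod_beta)+
  have "generated_algebra ?S ?F1 = generated_algebra ?S ?F2"
  proof (rule equalityI; rule generated_algebra_mono)
    fix f assume f: "f \<in> ?F1"
    have I: "reg.matP ?S ?F2 (\<iota>Q a b)" "reg.matP ?S ?F2 (\<iota>Q' a b)"
      by (rule reg.matP_I[OF \<iota>Q_M(1)], assumption, rule reg_gen, blast, rule reg.matP_I[OF \<iota>Q_M(2)], assumption, rule reg_gen, blast)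
    have I': "reg.matP ?S ?F2 (\<lambda>x. p * \<iota>Q a b x * q)" "reg.matP ?S ?F2 (\<lambda>x. p * \<iota>Q' a b x * q)" for p q
      by (intro reg.matP_times reg.matP_const I)+
    have g: "reg.matP ?S ?F2 (\<lambda>x. of_mat (?g x))"
      by (rule reg.matP_cong[OF _ I'(1)[of "idm a" "idm a"]]) (auto simp: \<iota>Q_unblk)
    have h: "reg.matP ?S ?F2 (\<lambda>x. of_mat (?h x))"
      by (rule reg.matP_cong[OF _ I'(1)[of "sh' (2 * a) b" "sh (2 * a) b"]]) (auto simp: \<iota>Q_unblk)
    have hi: "reg.matP ?S ?F2 (\<lambda>x. of_mat (mat_inv (?h x)))"
      by (rule reg.matP_cong[OF _ I'(2)[of "sh' (2 * a) b" "sh (2 * a) b"]]) (auto simp: \<iota>Q_unblk)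
    have X: "reg.matP ?S ?F2 (\<lambda>x. of_mat (?X x))"
    proof (rule reg.matP_cong[OF _ reg.matP_times[OF I'(1)[of "sh' a a" "sh (2 * a) b"] hi]])
      show "sh' a a * \<iota>Q a b x * sh (2 * a) b * of_mat (mat_inv (?h x)) = of_mat (?X x)" if "x \<in> ?S" for x
      proof -
        obtain g h X Y where x: "x = (g, h, X, Y)" by (cases x)
        note xS = that[unfolded x]
        show ?thesis unfolding x prod.case \<iota>Q_unblk[OF xS] by (simp add: mult.assoc Q_tuple[OF xS] times_idm[OF Q_tuple(5)[OF xS]])
      qed
    qed
    have Y: "reg.matP ?S ?F2 (\<lambda>x. of_mat (?Y x))"
    proof (rule reg.matP_cong[OF _ reg.matP_times[OF I'(1)[of "idm a" "sh (2 * a) b"] hi]])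
      show "idm a * \<iota>Q a b x * sh (2 * a) b * of_mat (mat_inv (?h x)) = of_mat (?Y x)" if "x \<in> ?S" for x
      proof -
        obtain g h X Y where x: "x = (g, h, X, Y)" by (cases x)
        note xS = that[unfolded x]
        show ?thesis unfolding x prod.case \<iota>Q_unblk[OF xS] by (simp add: mult.assoc Q_tuple[OF xS] times_idm[OF Q_tuple(6)[OF xS]])
      qed
    qed
    have en1: "f \<in> entries ?g a a \<Longrightarrow> reg ?S ?F2 f" by (rule reg.entries_P[OF g S(1)])
    have en2: "f \<in> entries ?h b b \<Longrightarrow> reg ?S ?F2 f" by (rule reg.entries_P[OF h S(2)])
    have en3: "f \<in> entries ?X a b \<Longrightarrow> reg ?S ?F2 f" by (rule reg.entries_P[OF X S(3)])
    have en4: "f \<in> entries ?Y a b \<Longrightarrow> reg ?S ?F2 f" by (rule reg.entries_P[OF Y S(4)])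
    from f show "reg ?S ?F2 f" by (elim UnE) (erule en1, erule en2, erule en3, erule en4)
  next
    fix f :: "'k mat \<times> 'k mat \<times> 'k mat \<times> 'k mat \<Rightarrow> 'k" assume f: "f \<in> ?F2"
    have g: "reg.matP ?S ?F1 (\<lambda>x. of_mat (?g x))" by (rule matP_entries[OF S(1)]) (assumption, blast)
    have h: "reg.matP ?S ?F1 (\<lambda>x. of_mat (?h x))" by (rule matP_entries[OF S(2)]) (assumption, blast)
    have X: "reg.matP ?S ?F1 (\<lambda>x. of_mat (?X x))" by (rule matP_entries[OF S(3)]) (assumption, blast)
    have Y: "reg.matP ?S ?F1 (\<lambda>x. of_mat (?Y x))" by (rule matP_entries[OF S(4)]) (assumption, blast)
    have gr: "reg ?S ?F1 (\<lambda>x. ?g x $$ (i, j))" if "i < a" "j < a" for i j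
      by (rule reg_gen, rule UnI1, rule UnI1, rule UnI1) (use that in \<open>auto simp: entries_def\<close>)
    have hr: "reg ?S ?F1 (\<lambda>x. ?h x $$ (i, j))" if "i < b" "j < b" for i j
      by (rule reg_gen, rule UnI1, rule UnI1, rule UnI2) (use that in \<open>auto simp: entries_def\<close>)
    have gi: "reg.matP ?S ?F1 (\<lambda>x. of_mat (mat_inv (?g x)))"
    proof (rule reg.matP_mat_inv[OF S(1) gr])
      show "reg ?S ?F1 (\<lambda>x. inverse (det (?g x)))"
      proof (rule reg.cong[OF _ reg.det[OF S(2) hr]])
        show "det (?h x) = inverse (det (?g x))" if "x \<in> ?S" for x
          using inverse_unique[of "det (?g x)" "det (?h x)"] S(5)[OF that] by (simp only:)
      qed
    qed
    have hi: "reg.matP ?S ?F1 (\<lambda>x. of_mat (mat_inv (?h x)))"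
    proof (rule reg.matP_mat_inv[OF S(2) hr])
      show "reg ?S ?F1 (\<lambda>x. inverse (det (?h x)))"
      proof (rule reg.cong[OF _ reg.det[OF S(1) gr]])
        show "det (?g x) = inverse (det (?h x))" if "x \<in> ?S" for x
          using inverse_unique[of "det (?h x)" "det (?g x)"] S(5)[OF that] by (simp only: mult.commute)
      qed
    qed
    have "reg.matP ?S ?F1 (\<iota>Q a b)" "reg.matP ?S ?F1 (\<iota>Q' a b)"
      unfolding e by (intro reg.matP_blk reg.matP_const[of _ _ 0] reg.matP_times reg.matP_uminus g h X Y gi hi)+
    then show "reg ?S ?F1 f" using f by (auto intro: reg.matP_ent)
  qed
  then show ?thesis unfolding 0 .
qed

lemma Q_lin_group: "lin_group (Qbar a b) (\<iota>Q a b) (\<iota>Q' a b :: _ \<Rightarrow> 'k::field_char_0 fm) (2 * a + b)"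
proof
  let ?G = "Qbar a b :: 'k Qbar_group"
  have one: "\<one>\<^bsub>?G\<^esub> = (1\<^sub>m a, 1\<^sub>m b, 0\<^sub>m a b, 0\<^sub>m a b)" by (simp add: Qbar_def Let_def)
  show "\<one>\<^bsub>?G\<^esub> \<in> carrier ?G" unfolding one by (simp add: Q_carrier)
  show "\<iota>Q a b \<one>\<^bsub>?G\<^esub> = idm (2 * a + b)" unfolding one by (simp add: \<iota>Q_def of_mat_one of_mat_zero blk_one[symmetric] one5_def)
  show "x \<otimes>\<^bsub>?G\<^esub> y \<in> carrier ?G" "\<iota>Q a b (x \<otimes>\<^bsub>?G\<^esub> y) = \<iota>Q a b x * \<iota>Q a b y" if "x \<in> carrier ?G" "y \<in> carrier ?G" for x y
    by (rule \<iota>Q_mult[OF that])+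
  show "inj_on (\<iota>Q a b) (carrier ?G)" by (rule \<iota>Q_inj)
  fix x assume x: "x \<in> carrier ?G"
  show i: "\<iota>Q a b x \<in> M (2 * a + b) (2 * a + b)" "\<iota>Q' a b x \<in> M (2 * a + b) (2 * a + b)" "\<iota>Q a b x * \<iota>Q' a b x = idm (2 * a + b)"
    by (rule \<iota>Q_M[OF x] \<iota>Q_inverse[OF x])+
  show "\<iota>Q' a b x * \<iota>Q a b x = idm (2 * a + b)" by (rule fm_left_inverse[OF i])
  show "\<exists>y \<in> carrier ?G. \<iota>Q a b y = \<iota>Q' a b x"
  proof -
    obtain g h X Y where xe: "x = (g, h, X, Y)" by (cases x)
    note xS = x[unfolded xe]
    have c: "g \<in> carrier_mat a a" "h \<in> carrier_mat b b" "det g * det h = 1" "det g \<noteq> 0" "det h \<noteq> 0"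
      using xS Q_det[OF xS] by (simp_all add: Q_carrier)
    have "(det (mat_inv g) * det (mat_inv h)) * (det g * det h) = (det (mat_inv g) * det g) * (det (mat_inv h) * det h)"
      by (simp only: mult_ac)
    then have "det (to_mat a a (of_mat (mat_inv g))) * det (to_mat b b (of_mat (mat_inv h))) = 1"
      by (simp add: to_mat_of_mat[OF mat_inv_carrier] c det_mat_inv[of _ a] det_mat_inv[of _ b])
    then have "\<iota>Q' a b x \<in> \<iota>Q a b ` carrier ?G" unfolding xe \<iota>Q'_def prod.case by (rule \<iota>Q_image[OF \<iota>Q_tup(2)[OF xS]])
    then show ?thesis by (elim imageE) metis
  qed
qed (rule Q_coord)

text \<open>A derivation that acts on the matrix entries by a scalar acts on homogeneous polynomials by the degree (Euler).\<close>

lemma (in lin_group) der_scalar_det: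
  assumes \<delta>: "\<delta> \<in> Der" "Dm \<delta> = sm c (idm n)"
  shows "\<delta> (zo (\<lambda>x. det (to_mat m m (P * \<iota> x * R)))) = of_nat m * c * det (to_mat m m (P * idm n * R))"
proof -
  define F where "F i j x = ent (P * \<iota> x * R) i j" for i j x
  have FK: "zo (F i j) \<in> K" for i j unfolding F_def by (intro K.matP_ent K.matP_times K.matP_const matP_\<iota>)
  have dF: "\<delta> (zo (F i j)) = c * F i j \<one>" for i j
    using der_conjugate[OF \<delta>(1) matP_\<iota>(1) \<iota>_M Dm_M[OF \<delta>(1)] ent_Dm[OF \<delta>(1), symmetric], of P R i j]
    by (simp add: F_def[abs_def] \<delta>(2) \<iota>_one)
  have pr: "\<delta> (zo (\<lambda>x. \<Prod>i\<in>A. F i (p i) x)) = of_nat (card A) * c * (\<Prod>i\<in>A. F i (p i) \<one>)" if "finite A" for A p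
    using that
  proof induction
    case empty show ?case by (simp add: der_const[OF \<delta>(1)])
  next
    case (insert i A)
    then show ?case by (simp add: der_mult[OF \<delta>(1) FK K.prod[OF FK]] dF algebra_simps)
  qed
  have dt: "det (to_mat m m (P * \<iota> x * R)) = (\<Sum>p\<in>{p. p permutes {0..<m}}. signof p * (\<Prod>i\<in>{0..<m}. F i (p i) x))" for x
    unfolding det_def'[OF to_mat_carrier]
    by (intro sum.cong prod.cong arg_cong2[of _ _ _ _ "(*)"] refl) (auto simp: F_def permutes_in_image dest: permutes_in_image)
  have "\<delta> (zo (\<lambda>x. det (to_mat m m (P * \<iota> x * R)))) = (\<Sum>p\<in>{p. p permutes {0..<m}}. signof p * (of_nat m * c * (\<Prod>i\<in>{0..<m}. F i (p i) \<one>)))"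
    unfolding dt by (simp add: der_sum[OF \<delta>(1)] K.mult K.const K.prod FK der_scale[OF \<delta>(1) K.prod[OF FK]] pr)
  also have "\<dots> = of_nat m * c * det (to_mat m m (P * \<iota> \<one> * R))"
    unfolding dt by (simp add: sum_distrib_left mult_ac)
  finally show ?thesis by (simp add: \<iota>_one)
qed

text \<open>Differentiating det g * det h = 1 along the scalar c gives (a + b) c = 0, and a + b is
  nonzero in characteristic zero.\<close>

lemma Q_derivation_scalar:
  assumes ab: "0 < a + b" and \<delta>: "\<delta> \<in> point_derivations (Qbar a b)"
    and c: "lin_group.Dm (Qbar a b) (\<iota>Q a b :: _ \<Rightarrow> 'k::field_char_0 fm) \<delta> = sm c (idm (2 * a + b))"
  shows "c = 0"
proof -
  interpret Q: lin_group "Qbar a b" "\<iota>Q a b" "\<iota>Q' a b :: _ \<Rightarrow> 'k fm" "2 * a + b" by (rule Q_lin_group)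
  let ?d1 = "\<lambda>x. det (to_mat a a (idm a * \<iota>Q a b x * idm a))" and ?d2 = "\<lambda>x. det (to_mat b b (sh' (2 * a) b * \<iota>Q a b x * sh (2 * a) b))"
  have K: "Q.zo ?d1 \<in> Q.K" "Q.zo ?d2 \<in> Q.K" by (intro Q.K.det_to_mat Q.K.matP_times Q.K.matP_const Q.matP_\<iota>)+
  have u: "idm a * idm (2 * a + b) * idm a = (idm a :: 'k fm)" "sh' (2 * a) b * idm (2 * a + b) * sh (2 * a) b = (idm b :: 'k fm)"
    using unblk_blk[OF tup_one(1)[of a b], where 'a='k] unfolding blk_one unblk_def by (simp_all add: one5_def)
  have "Q.zo (\<lambda>x. ?d1 x * ?d2 x) = Q.zo (\<lambda>x. 1)"
  proof (rule zero_outside_cong)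
    fix x :: "'k mat \<times> 'k mat \<times> 'k mat \<times> 'k mat" assume x: "x \<in> carrier (Qbar a b)"
    obtain g h X Y where xe: "x = (g, h, X, Y)" by (cases x)
    show "?d1 x * ?d2 x = 1" using x unfolding xe by (simp add: \<iota>Q_unblk Q_carrier to_mat_of_mat)
  qed
  then have "0 = \<delta> (Q.zo (\<lambda>x. ?d1 x * ?d2 x))" by (simp only: Q.der_const[OF \<delta>])
  also have "\<dots> = of_nat (a + b) * c"
    unfolding Q.der_mult[OF \<delta> K] Q.der_scalar_det[OF \<delta> c] Q.\<iota>_one u by (simp add: to_mat_idm algebra_simps)
  finally have "of_nat (a + b) = (0 :: 'k) \<or> c = 0" by (simp only: eq_commute[of 0] mult_eq_0_iff)
  moreover have "of_nat (a + b) \<noteq> (0 :: 'k)" using ab by (simp only: of_nat_eq_0_iff)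
  ultimately show ?thesis by blast
qed

lemma has_der_sum:
  "finite A \<Longrightarrow> (\<And>i. i \<in> A \<Longrightarrow> has_der (\<phi> i) (d i)) \<Longrightarrow> has_der (\<lambda>t. \<Sum>i\<in>A. \<phi> i t) (\<Sum>i\<in>A. d i)"
  by (induction rule: finite_induct) (auto intro: has_der_const has_der_arith(1))

lemma has_der_times_idm:
  assumes X: "\<And>s. X s \<in> M n n" "X 0 = idm n" "X' \<in> M n n" "\<And>i j. has_der (\<lambda>s. ent (X s) i j) (ent X' i j)"
    and Y: "Y 0 = idm n" "Y' \<in> M n n" "\<And>i j. has_der (\<lambda>s. ent (Y s) i j) (ent Y' i j)"
  shows "has_der (\<lambda>s. ent (X s * Y s) i j) (ent (X' + Y') i j)"
proof -
  have "has_der (\<lambda>s. \<Sum>k<n. ent (X s) i k * ent (Y s) k j) (\<Sum>k<n. ent (X 0) i k * ent Y' k j + ent X' i k * ent (Y 0) k j)"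
    by (intro has_der_sum has_der_arith(2) X Y finite_lessThan)
  moreover have "(\<Sum>k<n. ent (X 0) i k * ent Y' k j + ent X' i k * ent (Y 0) k j) = ent (X 0 * Y' + X' * Y 0) i j"
    by (simp add: ent_times[OF X(1)] ent_times[OF X(3)] sum.distrib)
  moreover have "X 0 * Y' + X' * Y 0 = X' + Y'" using X(3) Y(2) by (simp add: X(2) Y(1) M_iff add.commute)
  ultimately show ?thesis by (simp add: ent_times[OF X(1)])
qed

lemma det_scale_corner:
  fixes \<sigma> :: "'k::field_char_0"
  assumes "0 < m" shows "det (to_mat m m (idm m + sm (\<sigma> - 1) (el 0 0))) = \<sigma>"
proof -
  have "to_mat m m (idm m + sm (\<sigma> - 1) (el 0 0)) = multrow_mat m 0 \<sigma>"
    by (rule eq_matI) (auto simp: ent_idm ent_el)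
  then show ?thesis using assms by (simp add: det_multrow_mat)
qed

text \<open>Points of the group near the identity are obtained from the line \<open>1 + s x\<close> by rescaling one
  diagonal entry so as to restore determinant one.\<close>

lemma Q_derivations_corner:
  assumes ab: "0 < a + b"
  shows "\<exists>P :: 'k::field_char_0 fm. \<forall>x \<in> blk a b ` tup_q a b.
    \<exists>d. \<exists>\<delta> \<in> point_derivations (Qbar a b). lin_group.Dm (Qbar a b) (\<iota>Q a b) \<delta> = x - sm d P"
proof -
  interpret Q: lin_group "Qbar a b" "\<iota>Q a b" "\<iota>Q' a b :: _ \<Rightarrow> 'k fm" "2 * a + b" by (rule Q_lin_group)
  \<comment> \<open>An elementary idempotent in a diagonal block of positive size; this is the entry
    that gets rescaled.\<close>
  define p :: "'k fm \<times> 'k fm \<times> 'k fm \<times> 'k fm \<times> 'k fm"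
    where "p = (if 0 < a then (el 0 0, 0, 0, 0, 0) else (0, 0, el 0 0, 0, 0))"
  have p: "p \<in> tup_q a b" using ab by (auto simp: p_def tup_q_def M_el)
  let ?n = "2 * a + b" and ?P = "blk a b p"
  have PM: "?P \<in> M ?n ?n" by (rule blk_M[OF tup_q_r[OF p]])
  show ?thesis
  proof (rule exI[of _ ?P], rule ballI)
    fix x :: "'k fm" assume "x \<in> blk a b ` tup_q a b"
    then obtain A0 A1 C W V where t: "(A0, A1, C, W, V) \<in> tup_q a b" "x = blk a b (A0, A1, C, W, V)" by auto
    then have m: "A0 \<in> M a a" "A1 = 0" "C \<in> M b b" "W \<in> M a b" "V \<in> M a b" by (simp_all add: tup_q_def)
    have xM: "x \<in> M ?n ?n" unfolding t(2) by (rule blk_M[OF tup_q_r[OF t(1)]])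
    \<comment> \<open>The value of det g * det h along the line. The rescaling factor is its
      inverse, so the derivative d of \<chi> at 0 becomes the coefficient of the correction.\<close>
    define \<chi> where "\<chi> s = det (to_mat a a (idm a + sm s A0)) * det (to_mat b b (idm b + sm s C))" for s
    obtain d1 d2 where "has_der (\<lambda>s. det (to_mat a a (idm a + sm s A0))) d1" "has_der (\<lambda>s. det (to_mat b b (idm b + sm s C))) d2"
      using det_line(1)[OF m(1)] det_line(1)[OF m(3)] by blast
    from has_der_arith(2)[OF this] obtain d where d: "has_der \<chi> d" unfolding \<chi>_def by blast
    have \<chi>0: "\<chi> 0 = 1" unfolding \<chi>_def det_line(2)[OF m(1)] det_line(2)[OF m(3)] by simp
    let ?X = "\<lambda>s. idm ?n + sm (inverse (\<chi> s) - 1) ?P" and ?Y = "\<lambda>s. idm ?n + sm s x"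
    have X: "?X s \<in> M ?n ?n" "?Y s \<in> M ?n ?n" for s by (intro M_add M_idm M_sm xM PM le_refl)+
    have "\<exists>\<delta> \<in> Q.Der. Q.Dm \<delta> = sm (- d) ?P + x"
    proof (rule Q.der_exists[of "\<lambda>s. ?X s * ?Y s"])
      show "?X s * ?Y s \<in> M ?n ?n" for s by (rule M_times[OF X])
      show "?X 0 * ?Y 0 = idm ?n" by (simp add: \<chi>0 idm_times[OF M_idm[OF le_refl le_refl]])
      show "sm (- d) ?P + x \<in> M ?n ?n" by (intro M_add M_sm PM xM)
      have hX: "has_der (\<lambda>s. ent (?X s) i j) (ent (sm (- d) ?P) i j)" for i j
      proof -
        have "has_der (\<lambda>s. ent (idm ?n) i j + (inverse (\<chi> s) + (- 1)) * ent ?P i j)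
           (0 + ((inverse (\<chi> 0) + (- 1)) * 0 + (- d + 0) * ent ?P i j))"
          by (intro has_der_arith(1) has_der_arith(2) has_der_const has_der_inverse(1)[OF d \<chi>0])
        then show ?thesis by simp
      qed
      show "has_der (\<lambda>s. ent (?X s * ?Y s) i j) (ent (sm (- d) ?P + x) i j)" for i j
      proof (rule has_der_times_idm[where n = ?n and X = ?X and Y = ?Y])
        show "?X 0 = idm ?n" "?Y 0 = idm ?n" by (simp_all add: \<chi>0)
      qed (rule X M_sm[OF PM] hX xM has_der_line)+
      show "ev0 (\<lambda>s. ?X s * ?Y s \<in> \<iota>Q a b ` carrier (Qbar a b))"
      proof (rule ev0_mono[OF has_der_inverse(2)[OF d \<chi>0]])
        fix s assume nz: "\<chi> s \<noteq> 0"
        define \<sigma> where "\<sigma> = inverse (\<chi> s)"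
        define D1 where "D1 = (if 0 < a then idm a + sm (\<sigma> - 1) (el 0 0) else (idm a :: 'k fm))"
        define D2 where "D2 = (if 0 < a then (idm b :: 'k fm) else idm b + sm (\<sigma> - 1) (el 0 0))"
        have D: "D1 \<in> M a a" "D2 \<in> M b b" using ab by (auto simp: D1_def D2_def intro!: M_add M_sm M_idm M_el)
        have dD: "det (to_mat a a D1) * det (to_mat b b D2) = \<sigma>"
          using ab by (cases "0 < a") (simp_all add: D1_def D2_def det_scale_corner to_mat_idm)
        have Xe: "?X s = blk a b (D1, 0, D2, 0, 0)"
        proof (cases "0 < a")
          case True
          show ?thesis unfolding \<sigma>_def[symmetric] p_def D1_def D2_def if_P[OF True] blk_line by simp
        next
          case False
          show ?thesis unfolding \<sigma>_def[symmetric] p_def D1_def D2_def if_not_P[OF False] blk_line by simp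
        qed
        have Ye: "?Y s = blk a b (idm a + sm s A0, 0, idm b + sm s C, sm s W, sm s V)"
          unfolding t(2) blk_line by (simp add: m(2))
        have tt: "(D1, 0, D2, 0, 0) \<in> tup_q a b" "(idm a + sm s A0, 0, idm b + sm s C, sm s W, sm s V) \<in> tup_q a b"
          by (auto simp: tup_q_def intro!: D M_add M_idm M_sm m)
        have "?X s * ?Y s = blk a b (D1 * (idm a + sm s A0), 0, D2 * (idm b + sm s C), D1 * sm s W, D1 * sm s V)"
          unfolding Xe Ye blk_mult[OF tup_q_r[OF tt(1)] tup_q_r[OF tt(2)]] by (simp add: mul5_def)
        also have "\<dots> \<in> \<iota>Q a b ` carrier (Qbar a b)"
        proof (rule \<iota>Q_image)
          show "(D1 * (idm a + sm s A0), 0, D2 * (idm b + sm s C), D1 * sm s W, D1 * sm s V) \<in> tup_q a b"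
            using tup_mul(2)[OF tt] by (simp add: mul5_def)
          have "det (to_mat a a (D1 * (idm a + sm s A0))) * det (to_mat b b (D2 * (idm b + sm s C))) =
              (det (to_mat a a D1) * det (to_mat b b D2)) * \<chi> s"
            using tt(2) by (simp add: det_to_mat_times D tup_q_def \<chi>_def)
          then show "det (to_mat a a (D1 * (idm a + sm s A0))) * det (to_mat b b (D2 * (idm b + sm s C))) = 1"
            unfolding dD \<sigma>_def using nz by simp
        qed
        finally show "?X s * ?Y s \<in> \<iota>Q a b ` carrier (Qbar a b)" .
      qed
    qed
    then obtain \<delta> where \<delta>: "\<delta> \<in> Q.Der" "Q.Dm \<delta> = sm (- d) ?P + x" by blast
    have "Q.Dm \<delta> = x - sm d ?P" unfolding \<delta>(2) by simp
    then show "\<exists>d. \<exists>\<delta> \<in> Q.Der. Q.Dm \<delta> = x - sm d ?P" using \<delta>(1) by blast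
  qed
qed

lemma Qbar_reductive_contact:
  assumes ab: "0 < a + b" "even a" "even b" and index: "lie_index (Lie (Qbar a b :: 'k::field_char_0 Qbar_group)) = 1"
  shows "strongly_quasi_reductive (Qbar a b :: 'k Qbar_group) \<and> contact (Lie (Qbar a b :: 'k Qbar_group))"
proof -
  interpret Q: lin_group "Qbar a b" "\<iota>Q a b" "\<iota>Q' a b :: _ \<Rightarrow> 'k fm" "2 * a + b" by (rule Q_lin_group)
  let ?e = "idm (2 * a + b) :: 'k fm"
  obtain P :: "'k fm" where P: "\<And>x. x \<in> blk a b ` tup_q a b \<Longrightarrow> \<exists>d. \<exists>\<delta> \<in> Q.Der. Q.Dm \<delta> = x - sm d P"
    using Q_derivations_corner[OF ab(1)] by blast
  have one: "c = 0" if "\<delta> \<in> Q.Der" "Q.Dm \<delta> = sm c ?e" for \<delta> c by (rule Q_derivation_scalar[OF ab(1) that])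
  \<comment> \<open>Taking x = 1: the unit is not tangent, so d1 is nonzero and P itself is tangent
    modulo scalars. Hence every x in the algebra is tangent modulo scalars.\<close>
  obtain d1 \<delta>1 where 1: "\<delta>1 \<in> Q.Der" "Q.Dm \<delta>1 = ?e - sm d1 P"
    using P[OF subalg_blk(3)[OF subalg_rq(2)]] by blast
  have d1: "d1 \<noteq> 0" using one[OF 1(1), of 1] 1(2) by auto
  have dec: "\<exists>\<delta> \<in> Q.Der. \<exists>c. Q.Dm \<delta> = x + sm c ?e" if x: "x \<in> blk a b ` tup_q a b" for x
  proof -
    obtain d \<delta> where 2: "\<delta> \<in> Q.Der" "Q.Dm \<delta> = x - sm d P" using P[OF x] by blast
    let ?\<eta> = "\<lambda>f. \<delta> f + (- (d / d1)) * \<delta>1 f"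
    have "?\<eta> \<in> Q.Der" by (rule point_derivations_add[OF 2(1) point_derivations_scale[OF 1(1)]])
    moreover have "Q.Dm ?\<eta> = x + sm (- (d / d1)) ?e"
      unfolding Q.Dm_add[OF 2(1) point_derivations_scale[OF 1(1)]] Q.Dm_scale[OF 1(1)] 1(2) 2(2)
      by (rule fm_eqI) (use d1 in \<open>simp add: field_simps\<close>)
    ultimately show ?thesis by blast
  qed
  show ?thesis
    by (rule Q.reductive_contact_direct[OF disjI2[OF refl] ab(2,3,1) refl refl \<iota>Q_M(3) dec one index])
qed

theorem theorem4p2:
  fixes a b :: nat
  assumes "a \<noteq> 0 \<or> b \<noteq> 0"
    and "even a" and "even b"
    and "lie_index (qbar a b :: 'k::{alg_closed_field, field_char_0} qbar_algebra) = 1"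
    and "lie_index (rbar a b :: 'k rbar_algebra) = 1"
  shows "strongly_quasi_reductive (Qbar a b :: 'k Qbar_group) \<and>
         strongly_quasi_reductive (Rbar a b :: 'k Rbar_group) \<and>
         contact (qbar a b :: 'k qbar_algebra) \<and>
         contact (rbar a b :: 'k rbar_algebra)"
  using Qbar_reductive_contact[of a b, where 'k='k] Rbar_reductive_contact[of a b, where 'k='k] assms
  unfolding qbar_def rbar_def by auto

end
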